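(* Let $\phi\in\mathbb{Q}(x)$ be a rational function of degree $2$ having a $2$-periodic critical point, and suppose that $\operatorname{Aut}(\phi)$ is trivial. (a) The field of definition of every $3$-periodic point of $\phi$ is a number field of absolute degree $6$. (b) The set of primes $p$ such that $\phi$ does not have a $3$-periodic point in $\mathbb{P}^1(\mathbb{Q}_p)$ has Dirichlet density greater than $72\%$.
   Context: A point $P\in\mathbb{P}^1(\overline{\mathbb{Q}})$ is $n$-periodic for $\phi$ if $\phi^n(P)=P$ with $n\ge1$ minimal ($\phi^n$ the $n$-fold composition). A critical point is a point where $\phi:\mathbb{P}^1\to\mathbb{P}^1$ ramifies. $\operatorname{Aut}(\phi)$ is the group of degree-one $\sigma\in\overline{\mathbb{Q}}(x)$ with $\sigma^{-1}\circ\phi\circ\sigma=\phi$. The field of definition of $P=a\in\overline{\mathbb{Q}}$ is $\mathbb{Q}(a)$, and of $\infty$ is $\mathbb{Q}$. $\mathbb{Q}_p$ denotes the field of $p$-adic numbers. *)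

theory Defs
  imports Complex_Main "HOL-Computational_Algebra.Computational_Algebra"
begin

text \<open>Points of the projective line over a field: None is the point at infinity.
 A rational function phi in Q(x) is given by a pair (f, g) of coprime rational
 polynomials, phi = f / g, g nonzero; its degree is max (deg f) (deg g).\<close>

definition rat_fun_deg :: "rat poly \<Rightarrow> rat poly \<Rightarrow> nat" where
  "rat_fun_deg f g = max (degree f) (degree g)"

definition is_rat_fun :: "rat poly \<Rightarrow> rat poly \<Rightarrow> bool" where
  "is_rat_fun f g \<longleftrightarrow> g \<noteq> 0 \<and> coprime f g"

definition rf_act :: "rat poly \<Rightarrow> rat poly \<Rightarrow> 'a::field_char_0 option \<Rightarrow> 'a option" where
  "rf_act f g P = (case P of
      None \<Rightarrow> (if degree g < degree f then None
               else Some (of_rat (coeff f (degree g)) / of_rat (lead_coeff g)))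
    | Some z \<Rightarrow> (if poly (map_poly of_rat g) z = 0 then None
               else Some (poly (map_poly of_rat f) z / poly (map_poly of_rat g) z)))"

text \<open>Fibre polynomial F - w G (resp. G for w = infinity) of the homogeneous representation;
 the ramification index of phi at P is the multiplicity of P as a root of the fibre form
 over phi(P) (for P = infinity: d minus the degree of the dehomogenised form).\<close>
definition fibre_poly :: "rat poly \<Rightarrow> rat poly \<Rightarrow> complex option \<Rightarrow> complex poly" where
  "fibre_poly f g w = (case w of
      None \<Rightarrow> map_poly of_rat g
    | Some c \<Rightarrow> map_poly of_rat f - smult c (map_poly of_rat g))"

definition ram_index :: "rat poly \<Rightarrow> rat poly \<Rightarrow> complex option \<Rightarrow> nat" where
  "ram_index f g P = (case P of
      Some z \<Rightarrow> order z (fibre_poly f g (rf_act f g P))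
    | None \<Rightarrow> rat_fun_deg f g - degree (fibre_poly f g (rf_act f g P)))"

definition critical_pt :: "rat poly \<Rightarrow> rat poly \<Rightarrow> complex option \<Rightarrow> bool" where
  "critical_pt f g P \<longleftrightarrow> ram_index f g P \<ge> 2"

definition alg_point :: "complex option \<Rightarrow> bool" where
  "alg_point P \<longleftrightarrow> (case P of None \<Rightarrow> True | Some z \<Rightarrow> algebraic z)"

definition periodic_pt :: "('p \<Rightarrow> 'p \<Rightarrow> bool) \<Rightarrow> ('p \<Rightarrow> 'p) \<Rightarrow> nat \<Rightarrow> 'p \<Rightarrow> bool" where
  "periodic_pt eq h n P \<longleftrightarrow> n \<ge> 1 \<and> eq ((h ^^ n) P) P \<and>
      (\<forall>m. 0 < m \<and> m < n \<longrightarrow> \<not> eq ((h ^^ m) P) P)"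

definition moebius_act :: "complex \<Rightarrow> complex \<Rightarrow> complex \<Rightarrow> complex \<Rightarrow> complex option \<Rightarrow> complex option" where
  "moebius_act a b c d P = (case P of
      None \<Rightarrow> (if c = 0 then None else Some (a / c))
    | Some z \<Rightarrow> (if c * z + d = 0 then None else Some ((a * z + b) / (c * z + d))))"

definition trivial_Aut :: "rat poly \<Rightarrow> rat poly \<Rightarrow> bool" where
  "trivial_Aut f g \<longleftrightarrow> (\<forall>a b c d. algebraic a \<and> algebraic b \<and> algebraic c \<and> algebraic d \<and>
      a * d - b * c \<noteq> 0 \<and>
      (moebius_act a b c d \<circ> rf_act f g = rf_act f g \<circ> moebius_act a b c d)
      \<longrightarrow> moebius_act a b c d = id)"

text \<open>Absolute degree [Q(a):Q] of the field of definition of a point of P^1(Qbar):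
 the degree of the minimal polynomial of a over Q; Q itself for infinity.\<close>
definition alg_degree :: "complex \<Rightarrow> nat" where
  "alg_degree a = (LEAST n. \<exists>q :: rat poly. q \<noteq> 0 \<and> degree q = n \<and> poly (map_poly of_rat q) a = 0)"

definition field_of_def_degree :: "complex option \<Rightarrow> nat" where
  "field_of_def_degree P = (case P of None \<Rightarrow> 1 | Some a \<Rightarrow> alg_degree a)"

definition padic_val :: "nat \<Rightarrow> rat \<Rightarrow> int" where
  "padic_val p q = int (multiplicity (int p) (fst (quotient_of q)))
                 - int (multiplicity (int p) (snd (quotient_of q)))"

definition padic_abs :: "nat \<Rightarrow> rat \<Rightarrow> real" where
  "padic_abs p q = (if q = 0 then 0 else real p powr (- real_of_int (padic_val p q)))"

definition padic_cauchy :: "nat \<Rightarrow> (nat \<Rightarrow> rat) \<Rightarrow> bool" where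
  "padic_cauchy p s \<longleftrightarrow> (\<forall>e>0. \<exists>N. \<forall>m\<ge>N. \<forall>n\<ge>N. padic_abs p (s m - s n) < e)"

definition padic_null :: "nat \<Rightarrow> (nat \<Rightarrow> rat) \<Rightarrow> bool" where
  "padic_null p s \<longleftrightarrow> (\<forall>e>0. \<exists>N. \<forall>n\<ge>N. padic_abs p (s n) < e)"

text \<open>Q_p = p-adic Cauchy sequences of rationals modulo null sequences.
 A point of P^1(Q_p) is None (infinity) or Some s with s Cauchy (a representative).\<close>
definition Qp_P1 :: "nat \<Rightarrow> (nat \<Rightarrow> rat) option \<Rightarrow> bool" where
  "Qp_P1 p P \<longleftrightarrow> (case P of None \<Rightarrow> True | Some s \<Rightarrow> padic_cauchy p s)"

definition Qp_P1_eq :: "nat \<Rightarrow> (nat \<Rightarrow> rat) option \<Rightarrow> (nat \<Rightarrow> rat) option \<Rightarrow> bool" where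
  "Qp_P1_eq p P Q = (case (P, Q) of
      (None, None) \<Rightarrow> True
    | (Some s, Some t) \<Rightarrow> padic_null p (\<lambda>n. s n - t n)
    | _ \<Rightarrow> False)"

definition rf_act_Qp :: "nat \<Rightarrow> rat poly \<Rightarrow> rat poly \<Rightarrow> (nat \<Rightarrow> rat) option \<Rightarrow> (nat \<Rightarrow> rat) option" where
  "rf_act_Qp p f g P = (case P of
      None \<Rightarrow> (if degree g < degree f then None
               else Some (\<lambda>n. coeff f (degree g) / lead_coeff g))
    | Some s \<Rightarrow> (if padic_null p (\<lambda>n. poly g (s n)) then None
               else Some (\<lambda>n. poly f (s n) / poly g (s n))))"

definition has_dirichlet_density :: "nat set \<Rightarrow> real \<Rightarrow> bool" where
  "has_dirichlet_density S \<delta> \<longleftrightarrow>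
     ((\<lambda>s. (\<Sum>p. if prime p \<and> p \<in> S then 1 / real p powr s else 0)
          / (\<Sum>p. if prime p then 1 / real p powr s else 0)) \<longlongrightarrow> \<delta>) (at_right 1)"

end

theory Submission
  imports Defs "HOL-Number_Theory.Number_Theory" "HOL-Library.Function_Algebras" "HOL-Library.Numeral_Type"
begin

text \<open>Rational coordinates bring the map to the form x \<mapsto> t / (x^2 + x), the critical 2-cycle being infinity, 0.
For a 3-cycle x, y, z the ratio w = (z - y) / (y - x) is a primitive cube root of unity and 3 x - w^2 + 1
is a cube root of w^2 (27 t - 3 + 3 w^2), an element of Q(w) that is not a cube by the case n = 3 of Fermat's theorem.
This gives the degree 6. At a prime p of good reduction there is a 3-periodic point over the p-adic numbers
iff this element k is a cube modulo a prime of Q(w) of degree 1 above p. The mean number of cube roots of an element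
mu is computed without zeta functions: norm-form values of Z[w, mu^(1/3)] in boxes are counted and compared with
their prime factorisations as in Mertens' theorem. Inclusion-exclusion for k and its conjugate gives a
density of at least 1 - 5/18 = 13/18.\<close>

text \<open>Why the mean is 1: a typical norm in a box of side X in rank n has logarithm about n ln
  X, and a prime p contributes card (J p) ln p / p to it, where \<open>J p\<close> indexes the
  linear forms modulo p whose vanishing makes p divide the norm (the primes of degree 1 above p). So
  the sum of these terms over p up to X^n is about n ln X. The kernels are counted asymptotically
  only for p up to X^(n (1 - delta)); larger primes are controlled by Chebyshev's estimate, at a
  cost proportional to delta. The argument is the same for Z, Z[w] and the sextic ring.

  Where 5/18 comes from: half of the primes split in Q(w), and if k and its conjugate are
  independent modulo cubes, both are noncubes for 4/9 of these, which leaves 1/2 * 5/9. Dependence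
  only lowers this proportion, so lower bounds for two of the means suffice.

  The normal form has to be rational. If the critical point on the 2-cycle were irrational, its
  conjugate would be the other critical point and lie on the only 2-cycle as well, and the map would
  commute with a rotation of order 3.\<close>

lemmas ring2 = power2_eq_square algebra_simps
lemmas ring3 = power3_eq_cube algebra_simps
lemmas ring23 = power3_eq_cube ring2

section \<open>Lattice points in boxes: sparse subgroups and kernels of linear forms modulo
  p\<close>

definition box :: "nat => ('i::finite => int) set" where
 "box X = {v. \<forall>i. 0 <= v i & v i < int X}"

lemma box_eq_PiE: "box X = (UNIV :: 'i::finite set) \<rightarrow>\<^sub>E {0..<int X}"
 by (auto simp: box_def PiE_def Pi_def)

lemma finite_box [simp, intro]: "finite (box X)"
 unfolding box_eq_PiE by (intro finite_PiE) auto

lemma card_box: "card (box X :: ('i::finite => int) set) = X ^ CARD('i)"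
 unfolding box_eq_PiE by (subst card_PiE) auto

text \<open>Pigeonhole on cells of side \<open>s\<close>: two points of \<open>G\<close> in one cell
  differ by an element of \<open>G\<close> with all coordinates below \<open>s\<close> in absolute
  value, so they coincide, and the box meets at most X div s + 1 cells in each direction.\<close>

lemma card_sparse_box:
 fixes G :: "('i::finite => int) set"
 assumes diff: "!!v w. v \<in> G ==> w \<in> G ==> v - w \<in> G"
  and sparse: "!!v. v \<in> G ==> v ~= 0 ==> \<exists>i. int s <= \<bar>v i\<bar>"
  and s: "s > 0"
 shows "card (G \<inter> box X) <= (X div s + 1) ^ CARD('i)"
proof -
 have "inj_on (%v i. v i div int s) (G \<inter> box X)"
 proof (rule inj_onI)
  fix v w assume v: "v \<in> G \<inter> box X" and w: "w \<in> G \<inter> box X"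
   and eq: "(%i. v i div int s) = (%i. w i div int s)"
  have "\<bar>(v - w) i\<bar> < int s" for i
  proof -
   have "v i div int s = w i div int s" using eq by meson
   moreover have "v i = int s * (v i div int s) + v i mod int s"
    "w i = int s * (w i div int s) + w i mod int s" by simp_all
   moreover have "0 <= v i mod int s" "v i mod int s < int s" "0 <= w i mod int s" "w i mod int s < int s"
    using s by auto
   ultimately show ?thesis unfolding fun_diff_def by (smt (verit))
  qed
  then have "v - w = 0" using sparse[OF diff, of v w] v w by (meson IntD1 not_le)
  then show "v = w" by simp
 qed
 moreover have "(%v i. v i div int s) ` (G \<inter> box X) \<subseteq> box (X div s + 1)"
 proof clarify
  fix v :: "'i => int" assume v: "v \<in> box X"
  show "(%i. v i div int s) \<in> box (X div s + 1)" unfolding box_def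
  proof safe
   fix i
   have vi: "0 <= v i" "v i <= int X" using v by (auto simp: box_def less_imp_le)
   show "0 <= v i div int s" using vi s by (simp add: pos_imp_zdiv_nonneg_iff)
   have "v i div int s <= int X div int s" using vi s by (intro zdiv_mono1) auto
   then show "v i div int s < int (X div s + 1)" by (simp add: zdiv_int)
  qed
 qed
 ultimately have "card (G \<inter> box X) <= card (box (X div s + 1) :: ('i => int) set)"
  by (intro card_inj_on_le) auto
 then show ?thesis by (simp add: card_box)
qed

text \<open>The cube is centred at 0 so that radii add under both sums and differences of
  vectors.\<close>

definition residues_upto :: "(('i::finite => int) => int) => nat => int => int set" where
 "residues_upto L p B = (%v. L v mod int p) ` {v. \<forall>i. \<bar>v i\<bar> <= B}"

lemma residues_upto_mono: "B <= B' ==> residues_upto L p B \<subseteq> residues_upto L p B'"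
 unfolding residues_upto_def by (intro image_mono) (auto intro: order_trans)

text \<open>A set of residues that is generated by the unit vectors either stops growing, and is then
 everything, or picks up a new disjoint translate of the image of the small cube.\<close>
lemma residues_upto_growth:
 fixes L :: "('i::finite => int) => int"
 assumes p: "p > 0" and s: "s > 0"
  and add: "!!v w. L (v - w) = L v - L w"
  and e: "!!i. \<bar>e i\<bar> <= 1" "L e = 1"
  and sparse: "!!v. int p dvd L v ==> v ~= 0 ==> \<exists>i. int s <= \<bar>v i\<bar>"
 shows "residues_upto L p (3 * int j * int s) = {0..<int p}
   \<or> j * s ^ CARD('i) <= card (residues_upto L p (3 * int j * int s))"
proof (induction j)
 case 0
 then show ?case by simp
next
 case (Suc j)
 define A where "A k = residues_upto L p (int k * int s)" for k
 have A3: "A (3 * k) = residues_upto L p (3 * int k * int s)" for k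
  by (simp add: A_def)
 have L0: "L 0 = 0" using add[of 0 0] by simp
 have addL: "L (v + w) = L v + L w" for v w
  using add[of v "- w"] add[of 0 w] L0 by (simp add: algebra_simps)
 have sub: "A k \<subseteq> {0..<int p}" for k using p by (auto simp: A_def residues_upto_def)
 have fin: "finite (A k)" for k using sub finite_subset by blast
 have mono: "A k \<subseteq> A l" if "k <= l" for k l
  unfolding A_def using that by (intro residues_upto_mono mult_right_mono) auto
 have mem: "x \<in> A k \<longleftrightarrow> (\<exists>v. (\<forall>i. \<bar>v i\<bar> <= int k * int s) & x = L v mod int p)" for x k
  by (auto simp: A_def residues_upto_def)
 have memD: "\<exists>v. (\<forall>i. \<bar>v i\<bar> <= int k * int s) & x = L v mod int p" if "x \<in> A k" for x k
  using that mem by simp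
 have memI: "L v mod int p \<in> A k" if "\<forall>i. \<bar>v i\<bar> <= int k * int s" for v k
  using that mem by auto
 have A1: "s ^ CARD('i) <= card (A 1)"
 proof -
  have "inj_on (%v. L v mod int p) (box s)"
  proof (rule inj_onI)
   fix v w assume vw: "v \<in> box s" "w \<in> box s" "L v mod int p = L w mod int p"
   then have "int p dvd L (v - w)" unfolding add by (simp add: mod_eq_dvd_iff)
   moreover have "\<bar>(v - w) i\<bar> < int s" for i
   proof -
    have "0 <= v i" "v i < int s" "0 <= w i" "w i < int s" using vw by (auto simp: box_def)
    then show ?thesis by simp
   qed
   ultimately have "v - w = 0" using sparse[of "v - w"] by (meson not_le)
   then show "v = w" by simp
  qed
  moreover have "(%v. L v mod int p) ` box s \<subseteq> A 1"
   by (auto simp: A_def residues_upto_def box_def abs_of_nonneg less_imp_le)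
  ultimately have "card (box s :: ('i => int) set) <= card (A 1)" using fin card_inj_on_le by blast
  then show ?thesis by (simp add: card_box)
 qed
 \<comment> \<open>\<open>e\<close> is a short vector of value 1; a set of residues containing 0 and
   closed under adding 1 is everything.\<close>
 have full: "A k = {0..<int p}" if closed: "\<forall>x\<in>A k. (x + 1) mod int p \<in> A k" for k
 proof -
  have 0: "0 \<in> A k" using L0 by (auto simp: mem intro!: exI[of _ 0])
  have "int m \<in> A k" if "m < p" for m using \<open>m < p\<close>
  proof (induction m)
   case 0 then show ?case using \<open>0 \<in> A k\<close> by simp
  next
   case (Suc m)
   then have "int m \<in> A k" by simp
   then have "(int m + 1) mod int p \<in> A k" using closed by blast
   moreover have "(int m + 1) mod int p = int m + 1"
    using Suc.prems by (intro mod_pos_pos_trivial) auto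
   ultimately have "int m + 1 \<in> A k" by metis
   then show ?case by (simp add: add.commute)
  qed
  then have "{0..<int p} \<subseteq> A k"
   by (auto simp: image_iff subset_iff) (metis nonneg_int_cases of_nat_less_iff)
  then show ?thesis using sub by blast
 qed
 show ?case
 proof (cases "A (3 * j) = {0..<int p}")
  case True
  then have "A (3 * Suc j) = {0..<int p}" using mono[of "3 * j" "3 * Suc j"] sub by force
  then show ?thesis unfolding A3 by simp
 next
  case False
  then have IH: "j * s ^ CARD('i) <= card (A (3 * j))" using Suc.IH by (simp add: A3)
  show ?thesis
  proof (cases "A (3 * j + 2) \<subseteq> A (3 * j + 1)")
   case True
   have "(x + 1) mod int p \<in> A (3 * j + 1)" if x: "x \<in> A (3 * j + 1)" for x
   proof -
    obtain v where v: "\<forall>i. \<bar>v i\<bar> <= int (3 * j + 1) * int s" "x = L v mod int p"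
     using memD[OF x] by blast
    have "(x + 1) mod int p = L (v + e) mod int p" by (simp add: v addL e mod_simps)
    moreover have "\<forall>i. \<bar>(v + e) i\<bar> <= int (3 * j + 2) * int s"
    proof
     fix i
     have "\<bar>v i + e i\<bar> <= int (3 * j + 1) * int s + 1" using v(1) e(1)[of i] abs_triangle_ineq[of "v i" "e i"] by (smt (verit))
     also have "... <= int (3 * j + 2) * int s" using s by (simp add: algebra_simps)
     finally show "\<bar>(v + e) i\<bar> <= int (3 * j + 2) * int s" by simp
    qed
    ultimately have "(x + 1) mod int p \<in> A (3 * j + 2)" using memI by metis
    then show ?thesis using True by blast
   qed
   then have "A (3 * j + 1) = {0..<int p}" using full by blast
   then have "A (3 * Suc j) = {0..<int p}" using mono[of "3 * j + 1" "3 * Suc j"] sub by force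
   then show ?thesis unfolding A3 by simp
  next
   case False
   then obtain g where g: "g \<in> A (3 * j + 2)" "g \<notin> A (3 * j + 1)" by blast
   \<comment> \<open>\<open>g\<close> is reached with radius 3 j + 2 but not with 3 j + 1 (in units
     of \<open>s\<close>). A common point of its translate and \<open>A (3 * j)\<close> would write
     \<open>g\<close> as the value of a vector of radius 3 j + 1. This is why one round costs three
     units of radius.\<close>
   define T where "T = (%x. (g + x) mod int p) ` A 1"
   have "inj_on (%x. (g + x) mod int p) (A 1)"
   proof (rule inj_onI)
    fix x y assume "x \<in> A 1" "y \<in> A 1" "(g + x) mod int p = (g + y) mod int p"
    then have "x mod int p = y mod int p" by (simp add: mod_eq_dvd_iff)
    moreover have "x \<in> {0..<int p}" "y \<in> {0..<int p}" using sub \<open>x \<in> A 1\<close> \<open>y \<in> A 1\<close> by blast+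
    ultimately show "x = y" by simp
   qed
   then have cT: "card T = card (A 1)" unfolding T_def by (rule card_image)
   obtain v where v: "\<forall>i. \<bar>v i\<bar> <= int (3 * j + 2) * int s" "g = L v mod int p" using memD[OF g(1)] by blast
   have "T \<subseteq> A (3 * j + 3)"
   proof
    fix y assume "y \<in> T"
    then obtain w where w: "\<forall>i. \<bar>w i\<bar> <= int 1 * int s" "y = (g + L w mod int p) mod int p"
     unfolding T_def using memD[of _ 1] by blast
    have "y = L (v + w) mod int p" by (simp add: v w addL mod_simps)
    moreover have "\<forall>i. \<bar>(v + w) i\<bar> <= int (3 * j + 3) * int s"
    proof
     fix i
     have "\<bar>v i + w i\<bar> <= int (3 * j + 2) * int s + int 1 * int s"
      using v(1) w(1) abs_triangle_ineq[of "v i" "w i"] by (meson add_mono order_trans)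
     then show "\<bar>(v + w) i\<bar> <= int (3 * j + 3) * int s" by (simp add: algebra_simps)
    qed
    ultimately show "y \<in> A (3 * j + 3)" using memI by metis
   qed
   moreover have "T \<inter> A (3 * j) = {}"
   proof (rule ccontr)
    assume "T \<inter> A (3 * j) ~= {}"
    then obtain y where y: "y \<in> T" "y \<in> A (3 * j)" by blast
    then obtain w where w: "\<forall>i. \<bar>w i\<bar> <= int 1 * int s" "y = (g + L w mod int p) mod int p"
     unfolding T_def using memD[of _ 1] by blast
    obtain u where u: "\<forall>i. \<bar>u i\<bar> <= int (3 * j) * int s" "y = L u mod int p" using memD[OF y(2)] by blast
    have "L u mod int p = (g + L w) mod int p" using u(2) w(2) by (simp add: mod_simps)
    then have "int p dvd L u - (g + L w)" by (simp add: mod_eq_dvd_iff)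
    then have "int p dvd g - L (u - w)" unfolding add by (smt (verit) dvd_minus_iff)
    then have "g mod int p = L (u - w) mod int p" by (simp add: mod_eq_dvd_iff)
    then have "g = L (u - w) mod int p" using v(2) by simp
    moreover have "\<forall>i. \<bar>(u - w) i\<bar> <= int (3 * j + 1) * int s"
    proof
     fix i
     have "\<bar>u i - w i\<bar> <= int (3 * j) * int s + int 1 * int s"
      using u(1) w(1) abs_triangle_ineq4[of "u i" "w i"] by (meson add_mono order_trans)
     then show "\<bar>(u - w) i\<bar> <= int (3 * j + 1) * int s" by (simp add: algebra_simps)
    qed
    ultimately show False using g(2) memI by metis
   qed
   moreover have "A (3 * j) \<subseteq> A (3 * j + 3)" by (rule mono) simp
   ultimately have "card T + card (A (3 * j)) <= card (A (3 * j + 3))"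
    using fin by (metis T_def card_Un_disjoint card_mono finite_imageI Un_least)
   then have "Suc j * s ^ CARD('i) <= card (A (3 * Suc j))"
    using IH A1 cT by (simp add: algebra_simps numeral_3_eq_3)
   then show ?thesis unfolding A3 by simp
  qed
 qed
qed

text \<open>Once j * s^n exceeds p, the second alternative of the growth lemma is impossible. A
  vector of radius 3 j s then represents any residue, and adding the constant vector
  \<open>u\<close> moves it into a box with corner 0.\<close>

lemma residue_covering:
 fixes L :: "('i::finite => int) => int"
 assumes p: "p > 0" and s: "s > 0"
  and add: "!!v w. L (v - w) = L v - L w"
  and e: "!!i. \<bar>e i\<bar> <= 1" "L e = 1"
  and sparse: "!!v. int p dvd L v ==> v ~= 0 ==> \<exists>i. int s <= \<bar>v i\<bar>"
  and j: "p < j * s ^ CARD('i)"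
 shows "\<exists>v\<in>box (6 * j * s + 1). int p dvd L v - c"
proof -
 define u :: "'i => int" where "u = (%_. 3 * int j * int s)"
 have "residues_upto L p (3 * int j * int s) \<subseteq> {0..<int p}"
  using p by (auto simp: residues_upto_def)
 then have "card (residues_upto L p (3 * int j * int s)) <= p"
  using card_mono[of "{0..<int p}"] by fastforce
 then have full: "residues_upto L p (3 * int j * int s) = {0..<int p}"
  using residues_upto_growth[OF p s add e sparse] j by (metis leD le_trans)
 have "(c - L u) mod int p \<in> {0..<int p}" using p by simp
 then obtain v where v: "\<forall>i. \<bar>v i\<bar> <= 3 * int j * int s" "(c - L u) mod int p = L v mod int p"
  unfolding full[symmetric] residues_upto_def by blast
 have L0: "L 0 = 0" using add[of 0 0] by simp
 have addL: "L (v + w) = L v + L w" for v w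
  using add[of v "- w"] add[of 0 w] L0 by (simp add: algebra_simps)
 have "int p dvd L (v + u) - c"
  using v(2) unfolding mod_eq_dvd_iff addL by (smt (verit) dvd_minus_iff)
 moreover have "v + u \<in> box (6 * j * s + 1)"
  unfolding box_def
 proof (safe)
  fix i
  have "\<bar>v i\<bar> <= 3 * (int j * int s)" using v(1) by (simp add: mult.assoc)
  then show "0 <= (v + u) i" "(v + u) i < int (6 * j * s + 1)"
   by (simp_all add: u_def mult.assoc abs_le_iff)
 qed
 ultimately show ?thesis by blast
qed

text \<open>A short representative \<open>\<tau> c\<close> of every residue makes the kernel tile
  space: (v, c) \<mapsto> v + \<tau> c is injective into a box enlarged by \<open>R\<close>, and
  every vector far enough from the lower faces is of this form with v in the box.\<close>

lemma card_kernel_box: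
 fixes L :: "('i::finite => int) => int"
 assumes p: "p > 0"
  and add: "!!v w. L (v - w) = L v - L w"
  and cover: "!!c. \<exists>v\<in>box R. int p dvd L v - c"
 shows "p * card {v \<in> box X. int p dvd L v} <= (X + R) ^ CARD('i)"
  and "(X - R) ^ CARD('i) <= p * card {v \<in> box X. int p dvd L v}"
proof -
 have L0: "L 0 = 0" using add[of 0 0] by simp
 have addL: "L (v + w) = L v + L w" for v w
  using add[of v "- w"] add[of 0 w] L0 by (simp add: algebra_simps)
 obtain \<tau> where \<tau>: "!!c. \<tau> c \<in> box R" "!!c. int p dvd L (\<tau> c) - c"
  using cover by metis
 define H where "H = {v \<in> box X. int p dvd L v}"
 have fH: "finite H" unfolding H_def by (rule finite_subset[OF _ finite_box[of X]]) auto
 have cH: "card (H \<times> {0..<int p}) = p * card H" by (simp add: card_cartesian_product)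
 have "inj_on (%(v, c). v + \<tau> c) (H \<times> {0..<int p})"
 proof (rule inj_onI, clarify)
  fix v c w d assume vw: "v \<in> H" "w \<in> H" "c \<in> {0..<int p}" "d \<in> {0..<int p}" and eq: "v + \<tau> c = w + \<tau> d"
  have "L v + L (\<tau> c) = L w + L (\<tau> d)" using eq addL by metis
  moreover have "int p dvd L v" "int p dvd L w" using vw by (auto simp: H_def)
  moreover have "L (\<tau> c) - L (\<tau> d) = L w - L v" using calculation(1) by simp
  then have "c - d = (L w - L v) - (L (\<tau> c) - c) + (L (\<tau> d) - d)" by simp
  ultimately have "int p dvd c - d" using \<tau>(2)[of c] \<tau>(2)[of d] by (metis dvd_add dvd_diff)
  then have "c mod int p = d mod int p" by (simp add: mod_eq_dvd_iff)
  then have "c = d" using vw by simp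
  then show "v = w & c = d" using eq by simp
 qed
 moreover have "(%(v, c). v + \<tau> c) ` (H \<times> {0..<int p}) \<subseteq> box (X + R)"
  using \<tau>(1) by (fastforce simp: H_def box_def intro: add_strict_mono)
 ultimately have "card (H \<times> {0..<int p}) <= card (box (X + R) :: ('i => int) set)"
  by (intro card_inj_on_le) auto
 then show "p * card {v \<in> box X. int p dvd L v} <= (X + R) ^ CARD('i)"
  unfolding cH H_def[symmetric] by (simp add: card_box)
 \<comment> \<open>Coordinates at least \<open>R\<close>, so that subtracting a representative does
   not leave the box.\<close>
 define M where "M = (UNIV :: 'i set) \<rightarrow>\<^sub>E {int R..<int X}"
 have cM: "card M = (X - R) ^ CARD('i)"
  unfolding M_def by (subst card_PiE) (auto simp: nat_diff_distrib')
 have "inj_on (%v. (v - \<tau> (L v mod int p), L v mod int p)) M"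
  by (rule inj_onI) auto
 moreover have "(%v. (v - \<tau> (L v mod int p), L v mod int p)) ` M \<subseteq> H \<times> {0..<int p}"
 proof clarify
  fix v assume v: "v \<in> M"
  let ?c = "L v mod int p"
  have "int p dvd L v - ?c" by simp
  then have "int p dvd (L v - ?c) - (L (\<tau> ?c) - ?c)" using \<tau>(2) dvd_diff by blast
  then have "int p dvd L (v - \<tau> ?c)" unfolding add by simp
  moreover have "v - \<tau> ?c \<in> box X" unfolding box_def
  proof safe
   fix i
   have "int R <= v i" "v i < int X" using v by (auto simp: M_def)
   moreover have "0 <= \<tau> ?c i" "\<tau> ?c i < int R" using \<tau>(1)[of ?c] by (auto simp: box_def)
   ultimately show "0 <= (v - \<tau> ?c) i" "(v - \<tau> ?c) i < int X" by simp_all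
  qed
  ultimately show "v - \<tau> ?c \<in> H & ?c \<in> {0..<int p}" using p by (simp add: H_def)
 qed
 ultimately have "card M <= card (H \<times> {0..<int p})"
  using fH by (intro card_inj_on_le) auto
 then show "(X - R) ^ CARD('i) <= p * card {v \<in> box X. int p dvd L v}"
  unfolding cH H_def[symmetric] cM .
qed

lemma card_fibre_bound:
 fixes i0 :: "'i::finite"
 assumes "!!v. v \<in> box X ==> card {a \<in> {0..<int X}. P (v(i0 := a))} <= m"
 shows "card {v \<in> box X. P v} <= m * X ^ (CARD('i) - 1)"
proof -
 define B where "B = (\<Pi>\<^sub>E i\<in>(UNIV :: 'i set). if i = i0 then {0} else {0..<int X})"
 have fB: "finite B" unfolding B_def by (intro finite_PiE) auto
 have cB: "card B = X ^ (CARD('i) - 1)"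
 proof -
  have "card B = (\<Prod>i\<in>(UNIV :: 'i set). if i = i0 then 1 else X)"
   unfolding B_def by (subst card_PiE) (auto intro!: prod.cong)
  also have "... = (\<Prod>i\<in>UNIV - {i0}. X)"
   by (subst prod.remove[of _ i0]) (auto intro!: prod.cong)
  finally show ?thesis by simp
 qed
 have ff: "finite {a \<in> {0..<int X}. Q a}" for Q by (rule finite_subset[of _ "{0..<int X}"]) auto
 define S where "S = (SIGMA v:B. {a \<in> {0..<int X}. P (v(i0 := a))})"
 have "inj_on (%v. (v(i0 := 0), v i0)) {v \<in> box X. P v}"
  by (rule inj_onI) (metis fun_upd_triv fun_upd_upd prod.inject)
 moreover have "(%v. (v(i0 := 0), v i0)) ` {v \<in> box X. P v} \<subseteq> S"
  by (auto simp: S_def B_def box_def)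
 moreover have "finite S" unfolding S_def by (intro finite_SigmaI fB ff)
 ultimately have "card {v \<in> box X. P v} <= card S" by (intro card_inj_on_le)
 also have "... = (\<Sum>v\<in>B. card {a \<in> {0..<int X}. P (v(i0 := a))})"
  unfolding S_def by (intro card_SigmaI fB ballI ff)
 also have "... <= (\<Sum>v\<in>B. m)"
 proof (rule sum_mono)
  fix v assume v: "v \<in> B"
  show "card {a \<in> {0..<int X}. P (v(i0 := a))} <= m"
  proof (cases "X = 0")
   case False
   have "v i \<in> (if i = i0 then {0} else {0..<int X})" for i
    using v unfolding B_def by (rule PiE_mem) simp
   then have "0 <= v i & v i < int X" for i using False by (cases "i = i0") (metis of_nat_0_less_iff order_refl singletonD neq0_conv, metis atLeastLessThan_iff)
   then have "v \<in> box X" by (simp add: box_def)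
   then show ?thesis by (rule assms)
  qed simp
 qed
 finally show ?thesis by (simp add: cB mult.commute)
qed

lemma card_congruent_le:
 assumes "q > 0"
 shows "card {a \<in> {0..<int X}. int q dvd a - c} <= X div q + 1"
proof -
 have "inj_on (%a. a div int q) {a \<in> {0..<int X}. int q dvd a - c}"
 proof (rule inj_onI, clarify)
  fix a b assume "int q dvd a - c" "int q dvd b - c" "a div int q = b div int q"
  then have "a mod int q = b mod int q" by (metis mod_eq_dvd_iff)
  then show "a = b" using \<open>a div int q = b div int q\<close> by (metis div_mult_mod_eq)
 qed
 moreover have "(%a. a div int q) ` {a \<in> {0..<int X}. int q dvd a - c} \<subseteq> {0..int (X div q)}"
  using assms by (auto simp: pos_imp_zdiv_nonneg_iff zdiv_int intro!: zdiv_mono1)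
 ultimately have "card {a \<in> {0..<int X}. int q dvd a - c} <= card {0..int (X div q)}"
  by (intro card_inj_on_le) auto
 then show ?thesis by (simp add: nat_add_distrib)
qed

text \<open>Given one solution a0, f(a) is (a - a0) g(a) modulo p^(d j + 1), with d the degree of f
  and g of degree d - 1. Since d j + 2 = (j + 1) + ((d - 1) j + 1), either p^(j + 1) divides a - a0
  or p^((d - 1) j + 1) divides g(a), and induction applies to g. No separability enters, so the
  bound also serves the ramified primes.\<close>

lemma card_poly_roots_mod_prime_power:
 fixes f :: "int poly" and p :: nat
 assumes p: "prime p" and "lead_coeff f = 1"
 shows "card {a \<in> {0..<int X}. int p ^ (degree f * j + 1) dvd poly f a}
   <= degree f * (X div p ^ (j + 1) + 1)"
 using assms(2)
proof (induction "degree f" arbitrary: f)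
 case 0
 then have "f = 1" by (metis degree_0_id lead_coeff_1 one_pCons)
 moreover have "~ int p dvd 1" using p not_prime_1 by (metis int_dvd_int_iff of_nat_1 nat_dvd_1_iff_1)
  ultimately show ?case by simp
next
 case (Suc n)
 show ?case
 proof (cases "{a \<in> {0..<int X}. int p ^ (degree f * j + 1) dvd poly f a} = {}")
  case True
  show ?thesis unfolding True by simp
 next
  case False
  then obtain a0 where a0: "int p ^ (degree f * j + 1) dvd poly f a0" by blast
  define g where "g = synthetic_div f a0"
  have fg: "poly f a = (a - a0) * poly g a + poly f a0" for a
  proof -
   have "poly f a + poly (Polynomial.smult a0 g) a = poly (pCons (poly f a0) g) a"
    unfolding g_def using synthetic_div_correct[of f a0] by (metis poly_add)
   then show ?thesis by (simp add: algebra_simps)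
  qed
  have dg: "degree g = n" unfolding g_def using Suc.hyps by (simp add: degree_synthetic_div)
  have lg: "lead_coeff g = 1"
  proof -
   have e: "f + Polynomial.smult a0 g = pCons (poly f a0) g" unfolding g_def by (rule synthetic_div_correct)
   have "Polynomial.coeff (f + Polynomial.smult a0 g) (Suc n) = Polynomial.coeff f (Suc n)"
    using dg by (simp add: coeff_eq_0)
   then have "Polynomial.coeff g n = Polynomial.coeff f (Suc n)" unfolding e by simp
   then show ?thesis using Suc dg by simp
  qed
  have IH: "card {a \<in> {0..<int X}. int p ^ (n * j + 1) dvd poly g a} <= n * (X div p ^ (j + 1) + 1)"
   using Suc.hyps(1)[of g] dg lg by simp
  have ff: "finite {a \<in> {0..<int X}. Q a}" for Q by (rule finite_subset[of _ "{0..<int X}"]) auto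
  have "{a \<in> {0..<int X}. int p ^ (degree f * j + 1) dvd poly f a}
    \<subseteq> {a \<in> {0..<int X}. int (p ^ (j + 1)) dvd a - a0} \<union> {a \<in> {0..<int X}. int p ^ (n * j + 1) dvd poly g a}"
  proof safe
   fix a assume a: "int p ^ (degree f * j + 1) dvd poly f a" "~ int p ^ (n * j + 1) dvd poly g a"
   have "int p ^ (degree f * j + 1) dvd (a - a0) * poly g a"
    using a0 a(1) fg[of a] by (metis dvd_add_left_iff)
   moreover have "Suc (degree f * j + 1) = (j + 1) + (n * j + 1)" using Suc.hyps(2)[symmetric] by simp
   ultimately have "int p ^ (j + 1) dvd a - a0 \<or> int p ^ (n * j + 1) dvd poly g a"
    using prime_elem_power_dvd_cases[of "int p" "degree f * j + 1" "a - a0" "poly g a" "j + 1" "n * j + 1"] p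
    by (simp add: prime_imp_prime_elem)
   then show "int (p ^ (j + 1)) dvd a - a0" using a by simp
  qed
  then have "card {a \<in> {0..<int X}. int p ^ (degree f * j + 1) dvd poly f a}
    <= card ({a \<in> {0..<int X}. int (p ^ (j + 1)) dvd a - a0} \<union> {a \<in> {0..<int X}. int p ^ (n * j + 1) dvd poly g a})"
   by (intro card_mono finite_UnI ff)
  also have "... <= card {a \<in> {0..<int X}. int (p ^ (j + 1)) dvd a - a0} + card {a \<in> {0..<int X}. int p ^ (n * j + 1) dvd poly g a}"
   by (rule card_Un_le)
  also have "... <= (X div p ^ (j + 1) + 1) + n * (X div p ^ (j + 1) + 1)"
   using IH card_congruent_le[of "p ^ (j + 1)" X a0] p by (intro add_mono) (auto simp: prime_gt_0_nat)
  also have "... = degree f * (X div p ^ (j + 1) + 1)" using Suc.hyps(2)[symmetric] by simp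
  finally show ?thesis .
 qed
qed

section \<open>Elementary estimates for primes in the style of Chebyshev\<close>

lemma ln_eq_sum_multiplicity:
 assumes "N > 0" "N <= M"
 shows "ln (real N) = (\<Sum>p | prime p & p <= M. real (multiplicity p N) * ln (real p))"
proof -
 have "real N = (\<Prod>p\<in>prime_factors N. real p ^ multiplicity p N)"
 proof -
  have "real (\<Prod>p\<in>prime_factors N. p ^ multiplicity p N) = real N"
   using assms by (subst prod_prime_factors) auto
  then show ?thesis by simp
 qed
 moreover have "ln (\<Prod>p\<in>prime_factors N. real p ^ multiplicity p N) = (\<Sum>p\<in>prime_factors N. ln (real p ^ multiplicity p N))"
  by (rule ln_prod) (auto dest: in_prime_factors_imp_prime simp: prime_gt_0_nat)
 ultimately have "ln (real N) = (\<Sum>p\<in>prime_factors N. ln (real p ^ multiplicity p N))" by simp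
 also have "... = (\<Sum>p\<in>prime_factors N. real (multiplicity p N) * ln (real p))"
  by (intro sum.cong) (auto simp: ln_realpow in_prime_factors_imp_prime prime_gt_0_nat)
 also have "... = (\<Sum>p | prime p & p <= M. real (multiplicity p N) * ln (real p))"
 proof (rule sum.mono_neutral_left)
  show "prime_factors N \<subseteq> {p. prime p & p <= M}"
   using assms by (auto simp: in_prime_factors_iff dest!: dvd_imp_le)
  show "\<forall>p\<in>{p. prime p & p <= M} - prime_factors N. real (multiplicity p N) * ln (real p) = 0"
   using assms by (auto simp: in_prime_factors_iff not_dvd_imp_multiplicity_0)
 qed (rule finite_subset[of _ "{..M}"], auto)
 finally show ?thesis .
qed

lemma prod_primes_dvd:
 fixes A :: "nat set"
 assumes "finite A" "!!p. p \<in> A ==> prime p & p dvd n"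
 shows "\<Prod>A dvd n"
 using assms
proof (induction A rule: finite_induct)
 case (insert q A)
 have "coprime q (\<Prod>A)"
  using insert by (intro prod_coprime_right) (metis insertCI primes_coprime)
 then show ?case using insert by (simp add: divides_mult)
qed simp

text \<open>The primes between m and 2 m divide the central binomial coefficient, which is at most
  4^m.\<close>

lemma sum_ln_primes_dyadic:
 "(\<Sum>p | prime p & m < p & p <= 2 * m. ln (real p)) <= 2 * real m * ln 2"
proof -
 let ?A = "{p. prime p & m < p & p <= 2 * m}"
 have fin: "finite ?A" by (rule finite_subset[of _ "{..2*m}"]) auto
 have dvd: "prime p & p dvd (2 * m choose m)" if "p \<in> ?A" for p
 proof -
  have p: "prime p" "m < p" "p <= 2 * m" using that by auto
  have "p dvd fact (2 * m)" using p by (simp add: prime_dvd_fact_iff)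
  moreover have "fact (2 * m) = fact m * fact m * (2 * m choose m)"
   using binomial_fact_lemma[of m "2 * m"] by (simp add: mult_2)
  moreover have "~ p dvd fact m" using p by (simp add: prime_dvd_fact_iff)
  ultimately show ?thesis using p by (simp add: prime_dvd_mult_iff)
 qed
 have "\<Prod>?A <= (2 * m choose m)"
  using prod_primes_dvd[OF fin dvd] by (intro dvd_imp_le) auto
 also have "... <= 2 ^ (2 * m)" by (rule binomial_le_pow2)
 finally have "real (\<Prod>?A) <= 2 ^ (2 * m)" by (metis of_nat_le_iff of_nat_numeral of_nat_power)
 then have "ln (real (\<Prod>?A)) <= ln (2 ^ (2 * m))"
  using fin by (subst ln_le_cancel_iff) (auto intro!: prod_pos prime_gt_0_nat)
 moreover have "ln (real (\<Prod>?A)) = (\<Sum>p\<in>?A. ln (real p))"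
  unfolding of_nat_prod using fin by (intro ln_prod) (auto simp: prime_gt_0_nat)
 ultimately show ?thesis by (simp add: ln_realpow)
qed

lemma sum_ln_primes_div_dyadic:
 assumes "m > 0"
 shows "(\<Sum>p | prime p & m < p & p <= 2 ^ k * m. ln (real p) / real p) <= 2 * ln 2 * real k"
proof (induction k)
 case 0
 have "{p. prime p & m < p & p <= 2 ^ 0 * m} = {}" by auto
 then show ?case by (simp only: sum.empty)
next
 case (Suc k)
 define M where "M = 2 ^ k * m"
 have M: "M > 0" "2 ^ Suc k * m = 2 * M" using assms by (simp_all add: M_def)
 have "m < x" if "M < x" for x by (rule le_less_trans[OF _ that]) (simp add: M_def)
 then have eq: "{p. prime p & m < p & p <= 2 ^ Suc k * m}
   = {p. prime p & m < p & p <= M} \<union> {p. prime p & M < p & p <= 2 * M}" unfolding M(2) using M(1) by force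
 have fin: "finite {p. prime p & a < p & p <= b}" for a b :: nat
  by (rule finite_subset[of _ "{..b}"]) auto
 have "(\<Sum>p | prime p & M < p & p <= 2 * M. ln (real p) / real p)
   <= (\<Sum>p | prime p & M < p & p <= 2 * M. ln (real p) / real M)"
  using M by (intro sum_mono divide_left_mono) (auto simp: prime_ge_1_nat)
 also have "... = (\<Sum>p | prime p & M < p & p <= 2 * M. ln (real p)) / real M"
  by (simp add: sum_divide_distrib)
 also have "... <= 2 * real M * ln 2 / real M"
  using M by (intro divide_right_mono sum_ln_primes_dyadic) auto
 also have "... = 2 * ln 2" using M by simp
 finally have "(\<Sum>p | prime p & M < p & p <= 2 * M. ln (real p) / real p) <= 2 * ln 2" .
 then show ?case
  unfolding eq by (subst sum.union_disjoint) (use fin Suc[folded M_def] in \<open>auto simp: algebra_simps\<close>)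
qed

text \<open>Each doubling of the range contributes at most 2 ln 2. The number of doublings from a to
  b is rounded up, hence the additional term 2 ln 2.\<close>

lemma sum_ln_primes_div_le:
 assumes "1 <= a" "a <= b"
 shows "(\<Sum>p | prime p & a < p & p <= b. ln (real p) / real p) <= 2 * (ln (real b) - ln (real a)) + 2 * ln 2"
proof -
 define k where "k = nat \<lceil>log 2 (real b / real a)\<rceil>"
 have ge: "log 2 (real b / real a) >= 0" using assms by simp
 have k: "real k <= log 2 (real b / real a) + 1" "log 2 (real b / real a) <= real k"
  unfolding k_def using ge by linarith+
 have "real b / real a <= 2 powr real k"
  using k(2) assms by (subst (asm) log_le_iff) auto
 then have "real b <= 2 ^ k * real a" using assms by (simp add: powr_realpow field_simps)
 then have "b <= 2 ^ k * a" by (metis of_nat_le_iff of_nat_mult of_nat_numeral of_nat_power)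
 then have "(\<Sum>p | prime p & a < p & p <= b. ln (real p) / real p)
   <= (\<Sum>p | prime p & a < p & p <= 2 ^ k * a. ln (real p) / real p)"
  by (intro sum_mono2) (auto simp: prime_ge_1_nat intro: finite_subset[of _ "{..2 ^ k * a}"])
 also have "... <= 2 * ln 2 * real k" using assms by (intro sum_ln_primes_div_dyadic) auto
 also have "... <= 2 * ln 2 * (log 2 (real b / real a) + 1)" using k by (intro mult_left_mono) auto
 also have "... = 2 * (ln (real b) - ln (real a)) + 2 * ln 2"
  using assms by (simp add: log_def ln_div field_simps)
 finally show ?thesis .
qed

text \<open>Telescoping comparison of 1 / p^2 with 1 / (p - 1) - 1 / p.\<close>

lemma sum_inverse_squares_tail:
 assumes "k > 0" "finite A" "!!p. p \<in> A ==> k < p"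
 shows "(\<Sum>p\<in>A. 1 / real p ^ 2) <= 1 / real k"
proof -
 have "(\<Sum>p\<in>{k<..m}. 1 / real p ^ 2) <= 1 / real k - 1 / real (max k m)" for m
 proof (induction m)
  case (Suc m)
  show ?case
  proof (cases "Suc m <= k")
   case False
   then have km: "k <= m" by simp
   then have "{k<..Suc m} = insert (Suc m) {k<..m}" by auto
   then have "(\<Sum>p\<in>{k<..Suc m}. 1 / real p ^ 2) = 1 / real (Suc m) ^ 2 + (\<Sum>p\<in>{k<..m}. 1 / real p ^ 2)" by simp
   also have "... <= 1 / real (Suc m) ^ 2 + (1 / real k - 1 / real m)" using Suc km by simp
   also have "... <= 1 / real k - 1 / real (Suc m)"
   proof -
    have "1 / real (Suc m) ^ 2 <= 1 / (real m * real (Suc m))"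
     using km assms by (intro divide_left_mono) (auto simp: power2_eq_square)
    also have "... = 1 / real m - 1 / real (Suc m)" using km assms by (simp add: field_simps)
    finally show ?thesis by simp
   qed
   finally show ?thesis using km by simp
  qed auto
 qed simp
 moreover have "A \<subseteq> {k<..Max (insert 0 A)}" using assms by (auto intro: Max_ge)
 then have "(\<Sum>p\<in>A. 1 / real p ^ 2) <= (\<Sum>p\<in>{k<..Max (insert 0 A)}. 1 / real p ^ 2)"
  by (intro sum_mono2) auto
 ultimately have "(\<Sum>p\<in>A. 1 / real p ^ 2) <= 1 / real k - 1 / real (max k (Max (insert 0 A)))"
  by (meson order_trans)
 then show ?thesis by (smt (verit) divide_nonneg_nonneg of_nat_0_le_iff)
qed

section \<open>Norm forms and the kernels of their linear forms modulo p\<close>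

text \<open>An abstract norm form of rank n. \<open>lin\<close> are complex linear factors, bounded
  by \<open>c\<close> on the unit cube and shifted by integers in the direction \<open>i0\<close>,
  along which N is up to sign a monic polynomial. Outside \<open>bad\<close>, \<open>J p\<close>
  with \<open>L\<close> are the reductions at the primes of degree 1 above p, \<open>e\<close> is
  the vector of the number 1, and \<open>G p\<close> is a family of subgroups covering the vectors
  with p^2 | N. \<open>K\<close> bounds the sizes of both families independently of p.\<close>

locale norm_form =
 fixes N :: "('i::finite => int) => nat" and lin :: "nat => ('i => int) => complex"
  and n c K :: nat and i0 :: 'i and e :: "'i => int" and bad :: "nat set"
  and J :: "nat => 'j set" and L :: "nat => 'j => ('i => int) => int"
  and G :: "nat => ('i => int) set set"
 assumes n_eq: "CARD('i) = n"
  and norm_eq_prod: "real (N v) = (\<Prod>k<n. cmod (lin k v))"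
  and lin_bound: "k < n ==> (!!i. \<bar>v i\<bar> <= int B) ==> cmod (lin k v) <= real c * real B"
  and lin_upd: "k < n ==> lin k (v(i0 := a)) = lin k (v(i0 := 0)) + of_int a"
  and norm_eq_0: "N v = 0 \<longleftrightarrow> v = 0"
  and norm_fibre: "\<exists>f. degree f = n & lead_coeff f = 1 & (\<forall>a. int (N (v(i0 := a))) = \<bar>poly f a\<bar>)"
  and unit_vector: "\<bar>e i\<bar> <= 1"
  and finite_bad: "finite bad"
  and J_finite: "prime p ==> p \<notin> bad ==> finite (J p)"
  and J_card: "prime p ==> p \<notin> bad ==> card (J p) <= K"
  and L_diff: "prime p ==> p \<notin> bad ==> j \<in> J p ==> L p j (v - w) = L p j v - L p j w"
  and L_unit: "prime p ==> p \<notin> bad ==> j \<in> J p ==> L p j e = 1"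
  and L_norm: "prime p ==> p \<notin> bad ==> j \<in> J p ==> int p dvd L p j v ==> p dvd N v"
  and L_two: "prime p ==> p \<notin> bad ==> j \<in> J p ==> j' \<in> J p ==> j ~= j' ==>
    int p dvd L p j v ==> int p dvd L p j' v ==> p\<^sup>2 dvd N v"
  and norm_L: "prime p ==> p \<notin> bad ==> p dvd N v ==> ~ p\<^sup>2 dvd N v ==> \<exists>j\<in>J p. int p dvd L p j v"
  and G_finite: "prime p ==> p \<notin> bad ==> finite (G p) & card (G p) <= K"
  and G_diff: "prime p ==> p \<notin> bad ==> g \<in> G p ==> v \<in> g ==> w \<in> g ==> v - w \<in> g"
  and G_norm: "prime p ==> p \<notin> bad ==> g \<in> G p ==> v \<in> g ==> p\<^sup>2 dvd N v"
  and norm_G: "prime p ==> p \<notin> bad ==> p\<^sup>2 dvd N v ==> v ~= 0 ==> \<exists>g\<in>G p. v \<in> g"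
begin

text \<open>c + 1 instead of c makes the constant positive.\<close>

definition C :: nat where "C = (c + 1) ^ n"

lemma C_pos: "C > 0" by (simp add: C_def)

lemma n_pos [simp]: "n > 0" using n_eq by (metis zero_less_card_finite)

lemma norm_le:
 assumes "!!i. \<bar>v i\<bar> <= int B"
 shows "N v <= C * B ^ n"
proof -
 have "real (N v) <= (\<Prod>k<n. real c * real B)"
  unfolding norm_eq_prod using lin_bound[OF _ assms] by (intro prod_mono) auto
 also have "... = real (c ^ n * B ^ n)" by (simp add: power_mult_distrib)
 also have "... <= real (C * B ^ n)" unfolding C_def of_nat_le_iff by (intro mult_right_mono power_mono) auto
 finally show ?thesis unfolding of_nat_le_iff .
qed

lemma norm_box_le: "v \<in> box X ==> N v <= C * X ^ n"
 by (rule norm_le) (auto simp: box_def abs_of_nonneg less_imp_le)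

definition nz :: "nat => ('i => int) set" where "nz X = box X - {0}"

lemma finite_nz [simp, intro]: "finite (nz X)" by (simp add: nz_def)

lemma nz_norm_pos: "v \<in> nz X ==> N v > 0" using norm_eq_0[of v] by (auto simp: nz_def)

lemma card_nz_le: "card (nz X) <= X ^ n"
 unfolding nz_def by (metis card_box n_eq card_Diff1_le)

lemma coordinate_ge:
 assumes "D <= N v" "C * s ^ n < D"
 shows "\<exists>i. int s <= \<bar>v i\<bar>"
proof (rule ccontr)
 assume "~ ?thesis"
 then have "\<bar>v i\<bar> <= int s" for i by (meson not_le less_imp_le)
 then have "N v <= C * s ^ n" by (rule norm_le)
 then show False using assms by simp
qed

text \<open>Up to a constant factor this is the largest cube all of whose vectors have norm below D.
  The factor 2 in 2 C leaves room for the strict inequality.\<close>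

lemma box_side:
 assumes "real D > 2 * C"
 obtains s :: nat where "s > 0" "C * s ^ n < D" "real s <= root n (D / (2 * C))" "root n (D / (2 * C)) <= 2 * real s"
proof -
 define r where "r = root n (D / (2 * C))"
 have pos: "D / (2 * C) > 1" using assms C_pos by simp
 then have r1: "r > 1" unfolding r_def by (simp del: of_nat_mult)
 have rn: "r ^ n = D / (2 * C)" unfolding r_def using pos by (intro real_root_pow_pos2) auto
 define s where "s = nat \<lfloor>r\<rfloor>"
 have "\<lfloor>r\<rfloor> >= 1" using r1 by (simp add: le_floor_iff)
 then have "real s = of_int \<lfloor>r\<rfloor>" "\<lfloor>r\<rfloor> >= 1" unfolding s_def by simp_all
 then have s: "s > 0" "real s <= r" "r <= 2 * real s" by linarith+
 have "real (C * s ^ n) <= C * r ^ n"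
  using s unfolding of_nat_mult of_nat_power by (intro mult_left_mono power_mono) auto
 also have "... = D / 2" using rn C_pos by simp
 also have "... < D" using assms C_pos by simp
 finally have "C * s ^ n < D" unfolding of_nat_less_iff .
 then show thesis using s that unfolding r_def by blast
qed

text \<open>Nonzero elements of norm at least D have a coordinate of size about D^(1/n), so cells of
  that side count them. There is no additive error: a box too small to contain a norm D meets S at
  most in 0, which \<open>nz\<close> omits, and for D at most 2 C the whole box is within the
  bound.\<close>

lemma card_sparse:
 assumes diff: "!!v w. v \<in> S ==> w \<in> S ==> v - w \<in> S"
  and D: "D > 0" "!!v. v \<in> S ==> v ~= 0 ==> D <= N v"
 shows "real (card (S \<inter> nz X)) <= 2 * real C * 4 ^ n * real X ^ n / real D"
proof (cases "D > C * X ^ n")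
 case True
 have "S \<inter> nz X = {}" using D(2) norm_box_le True by (fastforce simp: nz_def)
 then show ?thesis by simp
next
 case le: False
 show ?thesis
 proof (cases "real D > 2 * C")
  case False
  have "real (card (S \<inter> nz X)) <= real (card (nz X))" by (simp add: card_mono)
  also have "... <= real X ^ n" using card_nz_le by (metis of_nat_le_iff of_nat_power)
  also have "... <= 2 * real C * 4 ^ n * real X ^ n / real D"
  proof -
   have "real D * real X ^ n <= (2 * real C * 4 ^ n) * real X ^ n"
   proof (rule mult_right_mono)
    have "(1::real) <= 4 ^ n" by simp
    then have "2 * real C * 1 <= 2 * real C * 4 ^ n" by (intro mult_left_mono) auto
    then show "real D <= 2 * real C * 4 ^ n" using False by simp
   qed simp
   then show ?thesis using D(1) by (simp add: field_simps)
  qed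
  finally show ?thesis .
 next
  case True
  define r where "r = root n (D / (2 * C))"
  obtain s where s: "s > 0" "C * s ^ n < D" "real s <= r" "r <= 2 * real s"
   using box_side[OF True] unfolding r_def by blast
  have rn: "r ^ n = D / (2 * C)" unfolding r_def by (intro real_root_pow_pos2) auto
  have "C * s ^ n < C * X ^ n" using s(2) le by linarith
  then have "s <= X" using C_pos by (metis linorder_not_le mult_le_mono2 power_mono zero_le less_imp_le)
  have "card (S \<inter> nz X) <= card (S \<inter> box X)" by (intro card_mono) (auto simp: nz_def)
  also have "... <= (X div s + 1) ^ n"
   using diff coordinate_ge[OF D(2) s(2)] s(1)
   by (intro card_sparse_box[of S, unfolded n_eq]) auto
  finally have "real (card (S \<inter> nz X)) <= real (X div s + 1) ^ n" by (metis of_nat_le_iff of_nat_power)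
  also have "... <= (4 * X / r) ^ n"
  proof (rule power_mono)
   have "real (X div s + 1) <= X / s + 1" using of_nat_div_le_of_nat[of X s] by simp
   also have "... <= 2 * X / s" using \<open>s <= X\<close> s(1) by (simp add: field_simps)
   also have "... <= 4 * X / r"
   proof -
    have "2 * real X * r <= 2 * real X * (2 * real s)" using s by (intro mult_left_mono) auto
    then show ?thesis using s by (simp add: field_simps)
   qed
   finally show "real (X div s + 1) <= 4 * X / r" .
  qed simp
  also have "... = 2 * real C * 4 ^ n * real X ^ n / real D"
   using rn C_pos D(1) by (simp add: power_mult_distrib power_divide)
  finally show ?thesis .
 qed
qed

definition good :: "nat => bool" where "good p \<longleftrightarrow> prime p & p \<notin> bad & p > 2 * C"

definition K1 :: real where "K1 = 2 * real C * 4 ^ n"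

lemma K1_pos: "K1 > 0" using C_pos by (simp add: K1_def)

definition ker :: "nat => 'j => ('i => int) set" where "ker p j = {v. int p dvd L p j v}"

lemma card_ker_le:
 assumes "good p" "j \<in> J p"
 shows "real (card (ker p j \<inter> nz X)) <= K1 * real X ^ n / p"
 unfolding K1_def
proof (rule card_sparse)
 show "v - w \<in> ker p j" if "v \<in> ker p j" "w \<in> ker p j" for v w
  using that assms L_diff unfolding ker_def good_def by simp
 show "p <= N v" if "v \<in> ker p j" "v ~= 0" for v
  using that assms L_norm[of p j v] norm_eq_0[of v] by (auto simp: ker_def good_def intro: dvd_imp_le)
qed (use assms in \<open>auto simp: good_def prime_gt_0_nat\<close>)

text \<open>Divisibility of the norm by p^2 confines v to one of at most K subgroups, each sparse at
  the level p^2. The proportion is O(1/p^2), so the sum over p beyond a large cut-off is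
  small.\<close>

lemma card_square_le:
 assumes "good p"
 shows "real (card {v \<in> nz X. p\<^sup>2 dvd N v}) <= K * (K1 * real X ^ n / p\<^sup>2)"
proof -
 have p: "prime p" "p \<notin> bad" "p > 0" using assms by (auto simp: good_def prime_gt_0_nat)
 have "{v \<in> nz X. p\<^sup>2 dvd N v} \<subseteq> (\<Union>g\<in>G p. g \<inter> nz X)"
  using norm_G[OF p(1,2)] by (fastforce simp: nz_def)
 then have "card {v \<in> nz X. p\<^sup>2 dvd N v} <= card (\<Union>g\<in>G p. g \<inter> nz X)"
  using G_finite[OF p(1,2)] by (intro card_mono) auto
 also have "... <= (\<Sum>g\<in>G p. card (g \<inter> nz X))" using G_finite[OF p(1,2)] by (intro card_UN_le) auto
 finally have "real (card {v \<in> nz X. p\<^sup>2 dvd N v}) <= (\<Sum>g\<in>G p. real (card (g \<inter> nz X)))"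
  unfolding of_nat_sum[symmetric] of_nat_le_iff .
 also have "... <= (\<Sum>g\<in>G p. K1 * real X ^ n / p\<^sup>2)"
 proof (rule sum_mono)
  fix g assume g: "g \<in> G p"
  show "real (card (g \<inter> nz X)) <= K1 * real X ^ n / p\<^sup>2"
   unfolding K1_def
  proof (rule card_sparse)
   show "p\<^sup>2 <= N v" if "v \<in> g" "v ~= 0" for v
    using that G_norm[OF p(1,2) g] norm_eq_0[of v] by (auto intro: dvd_imp_le)
  qed (use p g G_diff in auto)
 qed
 also have "... <= K * (K1 * real X ^ n / p\<^sup>2)"
  using G_finite[OF p(1,2)] K1_pos unfolding sum_constant by (intro mult_right_mono) auto
 finally show ?thesis by simp
qed

text \<open>The growth argument ends after m = 2 C 2^n + 1 rounds for every p, with a covering box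
  of side 6 m s + 1 <= 7 m s.\<close>

definition K2 :: real where "K2 = 7 * (2 * real C * 2 ^ n + 1)"

lemma K2_pos: "K2 > 0" unfolding K2_def by (intro mult_pos_pos add_nonneg_pos) auto

text \<open>Nonzero kernel vectors have norm at least p, so the kernel is sparse at scale p^(1/n).
  Cubes of that side have volume comparable with p, which makes the number of rounds of growth
  independent of p and the covering radius O(p^(1/n)).\<close>

lemma ker_cover:
 assumes "good p" "j \<in> J p"
 obtains R where "real R <= K2 * root n p" "!!d. \<exists>v\<in>box R. int p dvd L p j v - d"
proof -
 have p: "prime p" "p \<notin> bad" "p > 0" "real p > 2 * C" using assms by (auto simp: good_def prime_gt_0_nat)
 define r where "r = root n (p / (2 * C))"
 obtain s where s: "s > 0" "C * s ^ n < p" "real s <= r" "r <= 2 * real s"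
  using box_side[OF p(4)] unfolding r_def by blast
 have rn: "r ^ n = p / (2 * C)" unfolding r_def by (intro real_root_pow_pos2) auto
 define m where "m = 2 * C * 2 ^ n + 1"
 have "real p = 2 * C * r ^ n" using rn C_pos by simp
 also have "... <= 2 * C * (2 * real s) ^ n" using s p by (intro mult_left_mono power_mono) (auto simp: r_def)
 also have "... = real (2 * C * 2 ^ n * s ^ n)" by (simp add: power_mult_distrib)
 finally have "p <= 2 * C * 2 ^ n * s ^ n" unfolding of_nat_le_iff .
 moreover have "0 < s ^ n" using s(1) by simp
 ultimately have "p < 2 * C * 2 ^ n * s ^ n + s ^ n" by linarith
 then have "p < m * s ^ n" by (simp add: m_def add_mult_distrib add.commute)
 then have ms: "p < m * s ^ CARD('i)" by (simp add: n_eq)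
 have sparse: "\<exists>i. int s <= \<bar>v i\<bar>" if "int p dvd L p j v" "v ~= 0" for v
 proof (rule coordinate_ge[OF _ s(2)])
  show "p <= N v" using L_norm[OF p(1,2) assms(2) that(1)] norm_eq_0[of v] that(2) by (intro dvd_imp_le) auto
 qed
 have cover: "\<exists>v\<in>box (6 * m * s + 1). int p dvd L p j v - d" for d
  by (rule residue_covering[OF p(3) s(1) L_diff[OF p(1,2) assms(2)] unit_vector L_unit[OF p(1,2) assms(2)] sparse ms])
 have "r <= root n p"
  unfolding r_def
 proof (rule real_root_le_mono)
  show "p / (2 * C) <= real p" using C_pos p by (simp add: field_simps)
 qed simp
 then have sr: "real s <= root n p" using s by simp
 have "real (6 * m * s + 1) <= real (7 * m * s)"
 proof -
  have "1 <= m * s" using s(1) by (simp add: m_def)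
  then show ?thesis unfolding of_nat_le_iff by (simp add: mult.assoc)
 qed
 also have "... = K2 * real s" by (simp add: K2_def m_def)
 also have "... <= K2 * root n p" using sr K2_pos by simp
 finally show thesis using cover that by blast
qed

text \<open>The covering radius O(p^(1/n)) is negligible against X as long as p^(1/n) <= X^(1 -
  \<delta>). This is the origin of the restricted range of p. The - 1 accounts for the zero
  vector.\<close>

lemma card_ker_asymp:
 fixes \<delta> eps :: real
 assumes \<delta>: "0 < \<delta>" and eps: "0 < eps"
 shows "\<forall>\<^sub>F X in sequentially. \<forall>p j. good p --> j \<in> J p --> real p <= real X powr (n * (1 - \<delta>)) -->
   real (card (ker p j \<inter> nz X)) <= (1 + eps) * real X ^ n / real p &
   (1 - eps) * real X ^ n / real p - 1 <= real (card (ker p j \<inter> nz X))"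
proof -
 have lim: "(%X. K2 * real X powr (-\<delta>)) \<longlonglongrightarrow> K2 * 0"
  using \<delta> by (intro tendsto_mult tendsto_const tendsto_neg_powr filterlim_real_sequentially) auto
 have "(%X. (1 + K2 * real X powr (-\<delta>)) ^ n) \<longlonglongrightarrow> (1 + K2 * 0) ^ n"
  by (intro tendsto_intros lim)
 then have e1: "\<forall>\<^sub>F X in sequentially. (1 + K2 * real X powr (-\<delta>)) ^ n < 1 + eps"
  by (rule order_tendstoD) (use eps in auto)
 have "(%X. (1 - K2 * real X powr (-\<delta>)) ^ n) \<longlonglongrightarrow> (1 - K2 * 0) ^ n"
  by (intro tendsto_intros lim)
 then have e2: "\<forall>\<^sub>F X in sequentially. 1 - eps < (1 - K2 * real X powr (-\<delta>)) ^ n"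
  by (rule order_tendstoD) (use eps in auto)
 have e3: "\<forall>\<^sub>F X in sequentially. K2 * real X powr (-\<delta>) < 1"
  using lim by (rule order_tendstoD) auto
 show ?thesis
  using e1 e2 e3 eventually_gt_at_top[of 0]
 proof eventually_elim
  case (elim X)
  show ?case
  proof (intro allI impI)
   fix p j assume p: "good p" "j \<in> J p" "real p <= real X powr (n * (1 - \<delta>))"
   have p': "prime p" "p \<notin> bad" "p > 0" using p by (auto simp: good_def prime_gt_0_nat)
   obtain R where R: "real R <= K2 * root n p" "!!d. \<exists>v\<in>box R. int p dvd L p j v - d"
    using ker_cover[OF p(1,2)] by blast
   have "root n p <= root n (real X powr (n * (1 - \<delta>)))" using p(3) by simp
   also have "... = real X powr (1 - \<delta>)"
    using elim by (simp add: root_powr_inverse powr_powr)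
   also have "... = real X * real X powr (-\<delta>)"
    using elim by (simp add: powr_diff powr_minus_divide)
   finally have "K2 * root n p <= K2 * (real X * real X powr (-\<delta>))"
    using K2_pos by (intro mult_left_mono) auto
   then have RX: "real R <= real X * (K2 * real X powr (-\<delta>))"
    using R(1) by (simp add: mult_ac)
   define h where "h = card {v \<in> box X. int p dvd L p j v}"
   have set: "ker p j \<inter> nz X = {v \<in> box X. int p dvd L p j v} - {0}"
    by (auto simp: ker_def nz_def)
   have fin: "finite {v \<in> box X. int p dvd L p j v}" by (rule finite_subset[OF _ finite_box[of X]]) auto
   have h: "card (ker p j \<inter> nz X) <= h" "h <= card (ker p j \<inter> nz X) + 1"
    unfolding set h_def using fin by (auto intro: card_Diff1_le simp: card_Diff_singleton_if)
   have hb: "p * h <= (X + R) ^ n" "(X - R) ^ n <= p * h"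
    unfolding h_def using card_kernel_box[OF p'(3) L_diff[OF p'(1,2) p(2)] R(2)] by (auto simp: n_eq)
   have "real R < real X"
   proof -
    have "real X * (K2 * real X powr (-\<delta>)) < real X * 1" using elim by (intro mult_strict_left_mono) auto
    then show ?thesis using RX by simp
   qed
   have "real p * h <= (real X + R) ^ n" using hb(1) unfolding of_nat_add[symmetric] of_nat_power[symmetric] of_nat_mult[symmetric] of_nat_le_iff .
   also have "... <= (real X * (1 + K2 * real X powr (-\<delta>))) ^ n"
    using RX by (intro power_mono) (auto simp: algebra_simps)
   also have "... <= real X ^ n * (1 + eps)"
    unfolding power_mult_distrib using elim by (intro mult_left_mono) auto
   finally have u: "real h <= (1 + eps) * real X ^ n / real p" using p' by (simp add: field_simps)
   have "real X ^ n * (1 - eps) <= real X ^ n * (1 - K2 * real X powr (-\<delta>)) ^ n"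
    using elim by (intro mult_left_mono) auto
   also have "... = (real X * (1 - K2 * real X powr (-\<delta>))) ^ n" by (simp add: power_mult_distrib)
   also have "... <= (real X - real R) ^ n"
    using RX elim by (intro power_mono) (auto simp: algebra_simps)
   also have "... = real ((X - R) ^ n)" using \<open>real R < real X\<close> by (simp add: of_nat_diff)
   also have "... <= real p * h" using hb(2) unfolding of_nat_mult[symmetric] of_nat_le_iff .
   finally have "(1 - eps) * real X ^ n / real p <= real h" using p' by (simp add: field_simps)
   then show "real (card (ker p j \<inter> nz X)) <= (1 + eps) * real X ^ n / real p &
     (1 - eps) * real X ^ n / real p - 1 <= real (card (ker p j \<inter> nz X))"
    using u h by linarith
  qed
 qed
qed

end

lemma card_int_interval_le:
 fixes x r :: real
 assumes "r >= 0"
 shows "real (card {a \<in> A. \<bar>x + of_int a\<bar> < r}) <= 2 * r + 1"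
proof -
 have "{a \<in> A. \<bar>x + of_int a\<bar> < r} \<subseteq> {\<lceil>- x - r\<rceil>..\<lfloor>- x + r\<rfloor>}"
  by (auto simp: ceiling_le_iff le_floor_iff abs_less_iff)
 then have "card {a \<in> A. \<bar>x + of_int a\<bar> < r} <= card {\<lceil>- x - r\<rceil>..\<lfloor>- x + r\<rfloor>}"
  by (intro card_mono) auto
 also have "... = nat (\<lfloor>- x + r\<rfloor> + 1 - \<lceil>- x - r\<rceil>)" by simp
 finally have "real (card {a \<in> A. \<bar>x + of_int a\<bar> < r}) <= real (nat (\<lfloor>- x + r\<rfloor> + 1 - \<lceil>- x - r\<rceil>))"
  by (simp only: of_nat_le_iff)
 also have "... <= 2 * r + 1" using assms by linarith
 finally show ?thesis .
qed

section \<open>Upper bound for the weighted prime sum\<close>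

context norm_form
begin

lemma finite_good_le: "finite {p. Q p & p <= m}" for m :: nat
 by (rule finite_subset[of _ "{..m}"]) auto

text \<open>The sum whose asymptotics is sought. The cut-off \<open>k\<close> makes the tail of the
  sum of 1/p^2 beyond it as small as desired, and it changes \<open>A\<close> only by a bounded
  amount.\<close>

definition A :: "nat => real => real" where
 "A k Y = (\<Sum>p | good p & k < p & real p <= Y. card (J p) * ln p / p)"

text \<open>Evaluated in two ways, by the size of the norms and by their prime
  factorisations.\<close>

definition T :: "nat => real" where "T X = (\<Sum>v\<in>nz X. ln (N v))"

lemma finite_A: "finite {p. Q p & R p & real p <= Y}"
proof (rule finite_subset)
 show "{p. Q p & R p & real p <= Y} \<subseteq> {..nat \<lfloor>Y\<rfloor>}" by (auto simp: le_nat_floor)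
qed simp

lemma ln_norm_le:
 assumes v: "v \<in> nz X"
 shows "ln (N v) <= ln (C * real X ^ n)"
proof -
 have "N v <= C * X ^ n" using v norm_box_le by (auto simp: nz_def)
 then have "real (N v) <= C * real X ^ n" unfolding of_nat_power[symmetric] of_nat_mult[symmetric] of_nat_le_iff .
 moreover have "real (N v) > 0" using nz_norm_pos[OF v] by simp
 ultimately show ?thesis by simp
qed

lemma sum_card_swap:
 assumes "finite S" "finite I"
 shows "(\<Sum>j\<in>I. real (card {v \<in> S. P j v})) = (\<Sum>v\<in>S. real (card {j \<in> I. P j v}))"
proof -
 have "(\<Sum>j\<in>I. real (card {v \<in> S. P j v})) = (\<Sum>j\<in>I. \<Sum>v\<in>S. of_bool (P j v))"
  using assms by (intro sum.cong refl) (simp add: Int_def conj_commute)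
 also have "... = (\<Sum>v\<in>S. \<Sum>j\<in>I. of_bool (P j v))" by (rule sum.swap)
 also have "... = (\<Sum>v\<in>S. real (card {j \<in> I. P j v}))"
  using assms by (intro sum.cong refl) (simp add: Int_def conj_commute)
 finally show ?thesis .
qed

text \<open>If p^2 does not divide N v, then at most one form of \<open>J p\<close> vanishes at v,
  and only if p divides N v. All other vectors are charged with K forms.\<close>

lemma sum_ker_le:
 assumes "good p"
 shows "(\<Sum>j\<in>J p. real (card (ker p j \<inter> nz X))) <=
   real (card {v \<in> nz X. p dvd N v}) + K * real (card {v \<in> nz X. p\<^sup>2 dvd N v})"
proof -
 have p: "prime p" "p \<notin> bad" using assms by (auto simp: good_def)
 have "ker p j \<inter> nz X = {v \<in> nz X. int p dvd L p j v}" for j by (auto simp: ker_def)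
 then have "(\<Sum>j\<in>J p. real (card (ker p j \<inter> nz X))) = (\<Sum>v\<in>nz X. real (card {j \<in> J p. int p dvd L p j v}))"
  using sum_card_swap[OF finite_nz J_finite[OF p]] by simp
 also have "... <= (\<Sum>v\<in>nz X. of_bool (p dvd N v) + real K * of_bool (p\<^sup>2 dvd N v))"
 proof (rule sum_mono)
  fix v assume "v \<in> nz X"
  let ?S = "{j \<in> J p. int p dvd L p j v}"
  have fin: "finite ?S" using J_finite[OF p] by simp
  show "real (card ?S) <= of_bool (p dvd N v) + real K * of_bool (p\<^sup>2 dvd N v)"
  proof (cases "p\<^sup>2 dvd N v")
   case True
   have "card ?S <= card (J p)" using J_finite[OF p] by (intro card_mono) auto
   then have "card ?S <= K" using J_card[OF p] by simp
   then show ?thesis using True by simp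
  next
   case False
   then have "j = j'" if "j \<in> ?S" "j' \<in> ?S" for j j' using that L_two[OF p, of j j' v] by auto
   then have "card ?S <= 1" using fin by (simp add: card_le_Suc0_iff_eq)
   moreover have "card ?S = 0" if "~ p dvd N v"
   proof -
    have "?S = {}" using that L_norm[OF p] by auto
    then show ?thesis by (simp only: card.empty)
   qed
   ultimately show ?thesis by (cases "p dvd N v") auto
  qed
 qed
 also have "... = real (card {v \<in> nz X. p dvd N v}) + K * real (card {v \<in> nz X. p\<^sup>2 dvd N v})"
  by (simp add: sum.distrib Int_def conj_commute flip: sum_distrib_left)
 finally show ?thesis .
qed

lemma sum_primes_le_T:
 assumes "finite Q" "!!p. p \<in> Q ==> prime p"
 shows "(\<Sum>p\<in>Q. ln (real p) * real (card {v \<in> nz X. p dvd N v})) <= T X"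
proof -
 have "(\<Sum>p\<in>Q. ln (real p) * real (card {v \<in> nz X. p dvd N v}))
   = (\<Sum>p\<in>Q. \<Sum>v\<in>nz X. ln (real p) * of_bool (p dvd N v))"
  by (simp add: Int_def conj_commute flip: sum_distrib_left)
 also have "... = (\<Sum>v\<in>nz X. \<Sum>p\<in>Q. ln (real p) * of_bool (p dvd N v))" by (rule sum.swap)
 also have "... <= T X"
  unfolding T_def
 proof (rule sum_mono)
  fix v assume v: "v \<in> nz X"
  let ?Q = "{p \<in> Q. p dvd N v}"
  have fin: "finite ?Q" using assms by simp
  have "(\<Sum>p\<in>Q. ln (real p) * of_bool (p dvd N v)) = (\<Sum>p\<in>?Q. ln (real p))"
   using assms by (intro sum.mono_neutral_cong_right) auto
  also have "... = ln (real (\<Prod>?Q))"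
   unfolding of_nat_prod using fin assms by (intro ln_prod[symmetric]) (auto simp: prime_gt_0_nat)
  also have "... <= ln (real (N v))"
  proof -
   have "\<Prod>?Q dvd N v" using assms by (intro prod_primes_dvd) auto
   then have "\<Prod>?Q <= N v" using nz_norm_pos[OF v] by (rule dvd_imp_le)
   moreover have "\<Prod>?Q > 0" using assms by (intro prod_pos) (auto simp: prime_gt_0_nat)
   ultimately have "0 < real (\<Prod>?Q)" "real (\<Prod>?Q) <= real (N v)" unfolding of_nat_le_iff of_nat_0_less_iff by blast+
   then show ?thesis by (intro ln_mono) auto
  qed
  finally show "(\<Sum>p\<in>Q. ln (real p) * of_bool (p dvd N v)) <= ln (real (N v))" .
 qed
 finally show ?thesis .
qed

lemma T_le: "X > 0 ==> T X <= real X ^ n * ln (C * real X ^ n)"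
proof -
 assume X: "X > 0"
 have "T X <= (\<Sum>v\<in>nz X. ln (C * real X ^ n))" unfolding T_def using ln_norm_le by (intro sum_mono)
 also have "... = real (card (nz X)) * ln (C * real X ^ n)" by simp
 also have "... <= real (X ^ n) * ln (C * real X ^ n)"
 proof (rule mult_right_mono)
  have "1 <= C * X ^ n" using X C_pos by (simp add: Suc_leI)
  then show "0 <= ln (C * real X ^ n)" by (metis ln_ge_zero of_nat_1 of_nat_le_iff of_nat_mult of_nat_power)
 qed (use card_nz_le in \<open>simp only: of_nat_le_iff\<close>)
 finally show ?thesis by simp
qed

lemma ln_C_X: "X > 0 ==> ln (C * real X ^ n) = ln C + n * ln X"
 using C_pos by (simp add: ln_mult ln_realpow)

lemma eventually_const_le_ln: "d > 0 ==> \<forall>\<^sub>F X in sequentially. a <= d * (n * ln (real X))"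
proof -
 assume d: "d > 0"
 have "filterlim (%X. ln (real X)) at_top sequentially"
  by (rule filterlim_compose[OF ln_at_top filterlim_real_sequentially])
 then have "\<forall>\<^sub>F X in sequentially. a / (d * n) <= ln (real X)" by (simp add: filterlim_at_top)
 then show ?thesis by eventually_elim (use d in \<open>simp add: field_simps\<close>)
qed

lemma sum_ln_squares_le:
 assumes "k > 0" "finite Q" "!!p. p \<in> Q ==> k < p" "a >= 0" "B >= 0"
 shows "(\<Sum>p\<in>Q. a * (B / (real p)\<^sup>2)) <= a * B / k"
proof -
 have "(\<Sum>p\<in>Q. a * (B / (real p)\<^sup>2)) = a * B * (\<Sum>p\<in>Q. 1 / (real p)\<^sup>2)"
  by (simp add: sum_distrib_left)
 also have "... <= a * B * (1 / k)"
  using assms by (intro mult_left_mono sum_inverse_squares_tail) auto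
 finally show ?thesis by simp
qed

text \<open>The logarithms of the primes dividing a norm add up to at most its logarithm, and each
  kernel holds about X^n / p vectors, so X^n \<open>A k\<close> is at most \<open>T X\<close> <= X^n
  (n ln X + O(1)) up to errors. The errors are the vectors with p^2 | N for p beyond
  \<open>k\<close>, the omitted zero vectors and the factor 1 - eps.\<close>

lemma A_upper:
 fixes \<delta> \<eta> :: real
 assumes \<delta>: "0 < \<delta>" "\<delta> < 1" and \<eta>: "0 < \<eta>"
 shows "\<exists>k. \<forall>\<^sub>F X in sequentially. A k (real X powr (n * (1 - \<delta>))) <= (1 + \<eta>) * (n * ln (real X))"
proof -
 \<comment> \<open>Chosen for the final inequality 1 + 3 eps <= (1 - eps) (1 + \<eta>): one has
   \<eta> eps <= \<eta> / 2 and 4 eps <= \<eta> / 2.\<close>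
 define eps where "eps = min (1 / 2) (\<eta> / 8)"
 have eps: "0 < eps" "eps <= 1 / 2" "eps <= \<eta> / 8" using \<eta> by (auto simp: eps_def)
 obtain k :: nat where k: "k > 0" "real K * (real K * K1) / eps <= k"
  using real_arch_simple[of "max 1 (real K * (real K * K1) / eps)"] by (metis le_numeral_extra(2) max.bounded_iff nat_less_real_le not_gr_zero of_nat_0 zero_less_one_class.zero_less_one add_0)
 have kk: "real K * (real K * K1) / k <= eps" using k eps by (simp add: field_simps)
 have lim: "(%X. real K * real X powr (-(n*\<delta>))) \<longlonglongrightarrow> real K * 0"
  using \<delta> by (intro tendsto_mult tendsto_const tendsto_neg_powr filterlim_real_sequentially) auto
 have e3: "\<forall>\<^sub>F X in sequentially. real K * real X powr (-(n*\<delta>)) < eps"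
  using lim by (rule order_tendstoD) (use eps in auto)
 have "\<forall>\<^sub>F X in sequentially. A k (real X powr (n * (1 - \<delta>))) <= (1 + \<eta>) * (n * ln (real X))"
  using card_ker_asymp[OF \<delta>(1) eps(1)] e3 eventually_const_le_ln[OF eps(1), of "ln C"] eventually_gt_at_top[of 0]
 proof eventually_elim
  case (elim X)
  define l where "l = n * ln (real X)"
  have l0: "l >= 0" using elim by (simp add: l_def)
  define Y where "Y = real X powr (n * (1 - \<delta>))"
  define Q where "Q = {p. good p & k < p & real p <= Y}"
  have finQ: "finite Q" unfolding Q_def by (rule finite_A)
  have Xn: "real X powr n = real X ^ n" using elim by (simp add: powr_realpow)
  have YX: "Y = real X ^ n * real X powr (-(n*\<delta>))"
   unfolding Y_def using elim by (simp add: algebra_simps powr_diff powr_minus_divide Xn)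
  have YXn: "Y <= real X ^ n"
   unfolding Y_def Xn[symmetric] using elim \<delta> by (intro powr_mono) (auto simp: algebra_simps)
  have lnp: "0 <= ln (real p)" "ln (real p) <= l" "prime p" "p > 0" "p \<notin> bad" "good p" if "p \<in> Q" for p
  proof -
   show p: "prime p" "p > 0" "p \<notin> bad" "good p" using that by (auto simp: Q_def good_def prime_gt_0_nat)
   then show "0 <= ln (real p)" by (simp add: Suc_leI)
   have "real p <= real X ^ n" using that YXn unfolding Q_def by (blast intro: order_trans)
   then have "ln (real p) <= ln (real X ^ n)" using p elim by (subst ln_le_cancel_iff) auto
   then show "ln (real p) <= l" using elim by (simp add: l_def ln_realpow)
  qed
  have "real (card Q) <= Y"
  proof -
   have sub: "Q \<subseteq> {1..nat \<lfloor>Y\<rfloor>}"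
   proof
    fix p assume "p \<in> Q"
    then show "p \<in> {1..nat \<lfloor>Y\<rfloor>}" using lnp(4)[of p] by (simp add: Q_def le_nat_floor Suc_leI)
   qed
   have "card Q <= nat \<lfloor>Y\<rfloor>" using card_mono[OF _ sub] by simp
   moreover have "Y >= 0" by (simp add: Y_def)
   ultimately show ?thesis by linarith
  qed
  \<comment> \<open>\<open>K * l * Y\<close> pays for the zero vectors: at most Y primes, at most K
    forms each, and weight ln p <= l. Since Y = X^(n (1 - \<delta>)), it is o(X^n l).\<close>
  have "(1 - eps) * real X ^ n * A k Y - K * l * Y
    <= (\<Sum>p\<in>Q. ln p * (\<Sum>j\<in>J p. real (card (ker p j \<inter> nz X))))"
  proof -
   have "(1 - eps) * real X ^ n * A k Y - K * l * Y <= (1 - eps) * real X ^ n * A k Y - K * l * real (card Q)"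
    using \<open>real (card Q) <= Y\<close> l0 by (simp add: mult_left_mono)
   also have "... = (\<Sum>p\<in>Q. card (J p) * ln p * ((1 - eps) * real X ^ n / p) - K * l)"
    unfolding A_def Q_def[symmetric] by (simp add: sum_subtractf sum_distrib_left mult_ac)
   also have "... <= (\<Sum>p\<in>Q. ln p * (\<Sum>j\<in>J p. real (card (ker p j \<inter> nz X))))"
   proof (rule sum_mono)
    fix p assume p: "p \<in> Q"
    note lnp[OF p]
    have "card (J p) * ln p <= K * l" using lnp[OF p] J_card by (intro mult_mono) auto
    moreover have "(\<Sum>j\<in>J p. (1 - eps) * real X ^ n / p - 1) <= (\<Sum>j\<in>J p. real (card (ker p j \<inter> nz X)))"
     using elim(1) p lnp[OF p] unfolding Q_def Y_def by (intro sum_mono) blast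
    then have "ln p * (card (J p) * ((1 - eps) * real X ^ n / p - 1)) <= ln p * (\<Sum>j\<in>J p. real (card (ker p j \<inter> nz X)))"
     using lnp[OF p] by (intro mult_left_mono) auto
    ultimately show "card (J p) * ln p * ((1 - eps) * real X ^ n / p) - K * l <= ln p * (\<Sum>j\<in>J p. real (card (ker p j \<inter> nz X)))"
     by (simp add: algebra_simps)
   qed
   finally show ?thesis .
  qed
  also have "... <= (\<Sum>p\<in>Q. ln p * real (card {v \<in> nz X. p dvd N v}) + K * l * (K * (K1 * real X ^ n / (real p)\<^sup>2)))"
  proof (rule sum_mono)
   fix p assume p: "p \<in> Q"
   have "ln p * (\<Sum>j\<in>J p. real (card (ker p j \<inter> nz X))) <=
     ln p * (real (card {v \<in> nz X. p dvd N v}) + K * real (card {v \<in> nz X. p\<^sup>2 dvd N v}))"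
    using lnp[OF p] sum_ker_le by (intro mult_left_mono) auto
   also have "... = ln p * real (card {v \<in> nz X. p dvd N v}) + K * ln p * real (card {v \<in> nz X. p\<^sup>2 dvd N v})"
    by (simp add: algebra_simps)
   also have "K * ln p * real (card {v \<in> nz X. p\<^sup>2 dvd N v}) <= K * l * (K * (K1 * real X ^ n / (real p)\<^sup>2))"
    using lnp[OF p] l0 card_square_le[of p X] by (intro mult_mono mult_left_mono) auto
   finally show "ln p * (\<Sum>j\<in>J p. real (card (ker p j \<inter> nz X))) <=
     ln p * real (card {v \<in> nz X. p dvd N v}) + K * l * (K * (K1 * real X ^ n / (real p)\<^sup>2))" by simp
  qed
  also have "... <= T X + (\<Sum>p\<in>Q. (K * l * K) * (K1 * real X ^ n / (real p)\<^sup>2))"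
   using sum_primes_le_T[OF finQ, of X] lnp(3) by (simp add: sum.distrib mult_ac)
  also have "... <= T X + (K * l * K) * (K1 * real X ^ n) / k"
   using l0 K1_pos k finQ by (intro add_left_mono sum_ln_squares_le) (auto simp: Q_def)
  also have "... = T X + real X ^ n * l * (real K * (real K * K1) / k)"
   by (simp add: field_simps)
  also have "... <= T X + real X ^ n * l * eps"
   using kk l0 by (intro add_left_mono mult_left_mono) auto
  also have "T X <= real X ^ n * (ln C + l)"
   using T_le[of X] elim ln_C_X[of X] by (simp add: l_def)
  also have "... <= real X ^ n * (eps * l + l)"
   using elim by (intro mult_left_mono) (auto simp: l_def)
  finally have "(1 - eps) * real X ^ n * A k Y <= real X ^ n * (eps * l + l) + real X ^ n * l * eps + K * l * Y"
   by simp
  also have "K * l * Y = real X ^ n * l * (K * real X powr (-(n*\<delta>)))" by (simp add: YX)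
  also have "... <= real X ^ n * l * eps" using elim l0 by (intro mult_left_mono) auto
  finally have "real X ^ n * ((1 - eps) * A k Y) <= real X ^ n * ((1 + 3 * eps) * l)"
   by (simp add: algebra_simps)
  then have "(1 - eps) * A k Y <= (1 + 3 * eps) * l" using elim by simp
  also have "... <= ((1 - eps) * (1 + \<eta>)) * l"
  proof (rule mult_right_mono)
   have "\<eta> * eps <= \<eta> * (1 / 2)" using eps \<eta> by (intro mult_left_mono) auto
   moreover have "(1 - eps) * (1 + \<eta>) = 1 + \<eta> - eps - \<eta> * eps" by (simp add: algebra_simps)
   ultimately show "1 + 3 * eps <= (1 - eps) * (1 + \<eta>)" using eps by linarith
  qed fact
  finally have "(1 - eps) * A k Y <= (1 - eps) * ((1 + \<eta>) * l)" by (simp add: mult_ac)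
  then show "A k (real X powr (n * (1 - \<delta>))) <= (1 + \<eta>) * (n * ln (real X))"
   using eps unfolding Y_def l_def by (simp only: mult_le_cancel_left)
 qed
 then show ?thesis by blast
qed

end

section \<open>Lower bound and asymptotics of the weighted prime sum\<close>

context norm_form
begin

text \<open>If all n factors are at least \<theta> X in absolute value, the norm is at least
  \<theta>^n X^n. Moving along \<open>i0\<close> shifts a factor by integers, so on each line it is
  small at no more than 2 \<theta> X + 1 points.\<close>

lemma card_small_norm:
 fixes eps :: real
 assumes eps: "eps > 0"
 shows "\<exists>d>0. \<forall>\<^sub>F X in sequentially. real (card {v \<in> nz X. N v < d * real X ^ n}) <= eps * real X ^ n"
proof -
 define \<theta> where "\<theta> = eps / (4 * n)"
 have \<theta>: "\<theta> > 0" using eps by (simp add: \<theta>_def)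
 have "\<forall>\<^sub>F X in sequentially. 2 * n / eps <= real X"
  using filterlim_real_sequentially by (simp add: filterlim_at_top)
 then have "\<forall>\<^sub>F X in sequentially. real (card {v \<in> nz X. N v < \<theta> ^ n * real X ^ n}) <= eps * real X ^ n"
  using eventually_gt_at_top[of 0]
 proof eventually_elim
  case (elim X)
  define m where "m = nat \<lfloor>2 * (\<theta> * X) + 1\<rfloor>"
  have m: "real m <= 2 * (\<theta> * X) + 1" using \<theta> by (simp add: m_def)
  have "{v \<in> nz X. N v < \<theta> ^ n * real X ^ n} \<subseteq> (\<Union>k<n. {v \<in> box X. cmod (lin k v) < \<theta> * X})"
  proof clarify
   fix v assume v: "v \<in> nz X" "N v < \<theta> ^ n * real X ^ n"
   show "v \<in> (\<Union>k<n. {v \<in> box X. cmod (lin k v) < \<theta> * X})"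
   proof (rule ccontr)
    assume "~ ?thesis"
    then have "\<theta> * X <= cmod (lin k v)" if "k < n" for k
     using v that by (force simp: nz_def)
    then have "(\<Prod>k<n. \<theta> * X) <= (\<Prod>k<n. cmod (lin k v))" using \<theta> by (intro prod_mono) auto
    then show False using v(2) by (simp add: norm_eq_prod power_mult_distrib)
   qed
  qed
  then have "card {v \<in> nz X. N v < \<theta> ^ n * real X ^ n} <= card (\<Union>k<n. {v \<in> box X. cmod (lin k v) < \<theta> * X})"
   by (intro card_mono) (auto intro: finite_subset[OF _ finite_box[of X]])
  also have "... <= (\<Sum>k<n. card {v \<in> box X. cmod (lin k v) < \<theta> * X})" by (intro card_UN_le) auto
  also have "... <= (\<Sum>k<n. m * X ^ (n - 1))"
  proof (rule sum_mono)
   fix k assume k: "k \<in> {..<n}"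
   show "card {v \<in> box X. cmod (lin k v) < \<theta> * X} <= m * X ^ (n - 1)"
    unfolding n_eq[symmetric]
   proof (rule card_fibre_bound[where ?i0.0 = i0])
    fix v
    let ?x = "Re (lin k (v(i0 := 0)))"
    have sub: "{a \<in> {0..<int X}. cmod (lin k (v(i0 := a))) < \<theta> * X} \<subseteq> {a \<in> {0..<int X}. \<bar>?x + of_int a\<bar> < \<theta> * X}"
    proof clarify
     fix a assume "cmod (lin k (v(i0 := a))) < \<theta> * X"
     then show "\<bar>?x + of_int a\<bar> < \<theta> * X"
      using abs_Re_le_cmod[of "lin k (v(i0 := a))"] lin_upd[of k v a] k by simp
    qed
    have "card {a \<in> {0..<int X}. cmod (lin k (v(i0 := a))) < \<theta> * X} <= card {a \<in> {0..<int X}. \<bar>?x + of_int a\<bar> < \<theta> * X}"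
     by (rule card_mono[OF finite_subset[of _ "{0..<int X}"] sub]) auto
    then have "real (card {a \<in> {0..<int X}. cmod (lin k (v(i0 := a))) < \<theta> * X}) <= 2 * (\<theta> * X) + 1"
     using card_int_interval_le[of "\<theta> * X" "{0..<int X}" ?x] \<theta> by simp
    then show "card {a \<in> {0..<int X}. cmod (lin k (v(i0 := a))) < \<theta> * X} <= m"
     unfolding m_def by (rule le_nat_floor)
   qed
  qed
  finally have "card {v \<in> nz X. N v < \<theta> ^ n * real X ^ n} <= n * (m * X ^ (n - 1))" by simp
  then have "real (card {v \<in> nz X. N v < \<theta> ^ n * real X ^ n}) <= real (n * (m * X ^ (n - 1)))"
   unfolding of_nat_le_iff .
  also have "... = n * (real m * real X ^ (n - 1))" by simp
  also have "... <= n * ((2 * (\<theta> * X) + 1) * real X ^ (n - 1))"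
   using m by (intro mult_left_mono mult_right_mono) auto
  also have "... <= (eps * X) * real X ^ (n - 1)"
  proof -
   have "n * (2 * (\<theta> * X) + 1) <= eps * X" using elim eps by (simp add: \<theta>_def field_simps)
   then have "n * (2 * (\<theta> * X) + 1) * real X ^ (n - 1) <= (eps * X) * real X ^ (n - 1)"
    by (intro mult_right_mono) auto
   then show ?thesis by (simp add: mult.assoc)
  qed
  also have "... = eps * real X ^ n" by (metis mult.assoc n_pos power_minus_mult mult.commute)
  finally show ?case .
 qed
 moreover have "\<theta> ^ n > 0" using \<theta> by simp
 ultimately show ?thesis by blast
qed

text \<open>On each line in direction \<open>i0\<close> the norm is a monic polynomial of degree n
  up to sign, and the root count modulo p^(n j + 1) leaves a proportion of order 2^(-j). The
  argument covers the primes in \<open>bad\<close>.\<close>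

lemma card_high_power:
 fixes eps :: real
 assumes eps: "eps > 0" and p: "prime p"
 shows "\<exists>k. \<forall>\<^sub>F X in sequentially. real (card {v \<in> nz X. p ^ k dvd N v}) <= eps * real X ^ n"
proof -
 have "(%j. (1/2::real) ^ j) \<longlonglongrightarrow> 0" by (intro LIMSEQ_power_zero) auto
 then have "\<forall>\<^sub>F j in sequentially. (1/2::real) ^ j < eps / (2 * n)"
  by (rule order_tendstoD) (use eps in auto)
 then obtain j where j: "(1/2::real) ^ j < eps / (2 * n)" by (auto simp: eventually_sequentially)
 have "\<forall>\<^sub>F X in sequentially. 2 * n / eps <= real X"
  using filterlim_real_sequentially by (simp add: filterlim_at_top)
 then have "\<forall>\<^sub>F X in sequentially. real (card {v \<in> nz X. p ^ (n * j + 1) dvd N v}) <= eps * real X ^ n"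
  using eventually_gt_at_top[of 0]
 proof eventually_elim
  case (elim X)
  define m where "m = n * (X div p ^ (j + 1) + 1)"
  have "card {v \<in> nz X. p ^ (n * j + 1) dvd N v} <= card {v \<in> box X. p ^ (n * j + 1) dvd N v}"
   by (intro card_mono finite_subset[OF _ finite_box[of X]]) (auto simp: nz_def)
  also have "... <= m * X ^ (n - 1)"
   unfolding n_eq[symmetric]
  proof (rule card_fibre_bound[where ?i0.0 = i0])
   fix v :: "'i => int"
   obtain f where f: "degree f = n" "lead_coeff f = 1" "!!a. int (N (v(i0 := a))) = \<bar>poly f a\<bar>"
    using norm_fibre[of v] by blast
   have "(p ^ (n * j + 1) dvd N (v(i0 := a))) = (int p ^ (degree f * j + 1) dvd poly f a)" for a
    unfolding f(1) by (metis f(3) dvd_abs_iff int_dvd_int_iff of_nat_power)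
   then show "card {a \<in> {0..<int X}. p ^ (CARD('i) * j + 1) dvd N (v(i0 := a))} <= m"
    using card_poly_roots_mod_prime_power[OF p f(2), of X j] by (simp add: m_def f(1) n_eq)
  qed
  finally have "real (card {v \<in> nz X. p ^ (n * j + 1) dvd N v}) <= real (m * X ^ (n - 1))"
   unfolding of_nat_le_iff .
  also have "... = real m * real X ^ (n - 1)" by simp
  also have "... <= (eps * X) * real X ^ (n - 1)"
  proof (rule mult_right_mono)
   have "real (X div p ^ (j + 1)) <= X / p ^ (j + 1)"
    using of_nat_div_le_of_nat[of X "p ^ (j + 1)"] by simp
   also have "... <= X / 2 ^ j"
   proof (intro divide_left_mono)
    have "(2::real) ^ j <= real p ^ j" using prime_ge_2_nat[OF p] by (intro power_mono) auto
    also have "... <= real p ^ (j + 1)" using prime_ge_1_nat[OF p] by (intro power_increasing) auto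
    finally show "(2::real) ^ j <= real (p ^ (j + 1))" by simp
   qed (use prime_gt_0_nat[OF p] in auto)
   also have "... = (1/2) ^ j * X" by (simp add: power_one_over)
   also have "... <= eps / (2 * n) * X" using j by (intro mult_right_mono) auto
   finally have "real m <= n * (eps / (2 * n) * X + 1)" unfolding m_def of_nat_mult by (intro mult_left_mono) auto
   also have "... <= eps * X" using elim eps by (simp add: field_simps)
   finally show "real m <= eps * X" .
  qed simp
  also have "... = eps * real X ^ n" by (metis mult.assoc n_pos power_minus_mult mult.commute)
  finally show ?case .
 qed
 then show ?thesis by blast
qed

text \<open>All but a small proportion of the vectors have norm at least d X^n, with logarithm n ln
  X + ln d. For eps at least 1/3 the left side is not positive.\<close>

lemma T_ge:
 fixes eps :: real
 assumes eps: "eps > 0"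
 shows "\<forall>\<^sub>F X in sequentially. (1 - 3 * eps) * real X ^ n * (n * ln (real X)) <= T X"
proof (cases "eps < 1/3")
 case False
 have "\<forall>\<^sub>F X in sequentially. 0 < X" by (rule eventually_gt_at_top)
 then show ?thesis
 proof eventually_elim
  case (elim X)
  have "0 <= T X" unfolding T_def using nz_norm_pos by (intro sum_nonneg) (simp add: Suc_leI)
  moreover have "(1 - 3 * eps) * (real X ^ n * (n * ln (real X))) <= 0"
   using False elim by (intro mult_nonpos_nonneg) auto
  ultimately show ?case by (simp add: mult.assoc)
 qed
next
 case True
 obtain d where d: "d > 0" "\<forall>\<^sub>F X in sequentially. real (card {v \<in> nz X. N v < d * real X ^ n}) <= eps / 2 * real X ^ n"
  using card_small_norm[of "eps / 2"] eps by auto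
 have big: "\<forall>\<^sub>F X in sequentially. 2 / eps <= real X"
  using filterlim_real_sequentially by (simp add: filterlim_at_top)
 show ?thesis
  using d(2) big eventually_gt_at_top[of 0] eventually_const_le_ln[OF eps, of "- ln d"]
 proof eventually_elim
  case (elim X)
  define l where "l = n * ln (real X)"
  have l0: "l >= 0" using elim by (simp add: l_def)
  let ?S = "{v \<in> nz X. ~ N v < d * real X ^ n}"
  have l1: "(1 - eps) * l <= ln (d * real X ^ n)"
   using elim d(1) by (simp add: ln_mult ln_realpow l_def algebra_simps)
  have cardS: "(1 - eps) * real X ^ n <= real (card ?S)"
  proof -
   have "card (nz X) = card {v \<in> nz X. N v < d * real X ^ n} + card ?S"
    by (subst card_Un_disjoint[symmetric]) (auto intro!: arg_cong[where f = card])
   moreover have "X ^ n <= card (nz X) + 1"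
   proof -
    have "card (box X :: ('i => int) set) <= card (insert 0 (nz X))" by (intro card_mono) (auto simp: nz_def)
    then show ?thesis unfolding card_box n_eq by (simp add: card_insert_if split: if_splits)
   qed
   then have "real (X ^ n) <= real (card (nz X) + 1)" unfolding of_nat_le_iff .
   moreover have "1 <= eps / 2 * real X ^ n"
   proof -
    have "real X ^ 1 <= real X ^ n" using elim n_pos by (intro power_increasing) (auto simp: Suc_leI)
    then have "2 / eps <= real X ^ n" using elim(2) unfolding power_one_right by linarith
    then show ?thesis using eps by (simp add: field_simps)
   qed
   ultimately show ?thesis using elim(1) by (simp add: algebra_simps)
  qed
  have "(1 - 3 * eps) * real X ^ n * l <= ((1 - eps) * real X ^ n) * ((1 - eps) * l)"
  proof -
   have "(1 - 3 * eps) * (real X ^ n * l) <= ((1 - eps) * (1 - eps)) * (real X ^ n * l)"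
    using l0 eps by (intro mult_right_mono) (auto simp: algebra_simps)
   then show ?thesis by (simp add: mult_ac)
  qed
  also have "... <= real (card ?S) * ((1 - eps) * l)"
   using cardS l0 True by (intro mult_right_mono) auto
  also have "... = (\<Sum>v\<in>?S. (1 - eps) * l)" by simp
  also have "... <= (\<Sum>v\<in>?S. ln (N v))"
  proof (rule sum_mono)
   fix v assume "v \<in> ?S"
   then have "d * real X ^ n <= N v" by simp
   moreover have "0 < d * real X ^ n" using d elim by simp
   ultimately have "ln (d * real X ^ n) <= ln (N v)" by (intro ln_mono) auto
   then show "(1 - eps) * l <= ln (N v)" using l1 by simp
  qed
  also have "... <= T X"
   unfolding T_def using nz_norm_pos by (intro sum_mono2) (auto simp: Suc_leI)
  finally show ?case by (simp add: l_def)
 qed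
qed

lemma mult_ln_le:
 assumes "prime p" "v \<in> nz X"
 shows "multiplicity p (N v) * ln p <= ln (N v)"
proof -
 have "p ^ multiplicity p (N v) dvd N v" by (rule multiplicity_dvd)
 then have "p ^ multiplicity p (N v) <= N v" using nz_norm_pos[OF assms(2)] by (rule dvd_imp_le)
 then have "real (p ^ multiplicity p (N v)) <= real (N v)" unfolding of_nat_le_iff .
 moreover have "real p > 0" using assms prime_gt_0_nat by simp
 ultimately have "ln (real p ^ multiplicity p (N v)) <= ln (N v)" by (intro ln_mono) auto
 then show ?thesis using \<open>real p > 0\<close> by (simp add: ln_realpow)
qed

text \<open>A single prime carries a negligible part of \<open>T X\<close>: vectors whose norm is
  not divisible by p^k contribute at most k ln p each, and the remaining ones are few and contribute
  at most ln N <= 2 n ln X. This disposes of the bad and the small primes.\<close>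

lemma sum_mult_bad:
 fixes eps :: real
 assumes eps: "eps > 0" and p: "prime p"
 shows "\<forall>\<^sub>F X in sequentially. (\<Sum>v\<in>nz X. multiplicity p (N v) * ln p) <= eps * real X ^ n * (n * ln (real X))"
proof -
 obtain k where k: "\<forall>\<^sub>F X in sequentially. real (card {v \<in> nz X. p ^ k dvd N v}) <= eps / 4 * real X ^ n"
  using card_high_power[of "eps / 4" p] eps p by auto
 show ?thesis
  using k eventually_const_le_ln[OF half_gt_zero[OF eps], of "real k * ln p"]
   eventually_const_le_ln[OF zero_less_one, of "ln C"] eventually_gt_at_top[of 0]
 proof eventually_elim
  case (elim X)
  define l where "l = n * ln (real X)"
  have lnp: "ln (real p) >= 0" using prime_ge_1_nat[OF p] by simp
  have CX: "ln (C * real X ^ n) <= 2 * l" using elim ln_C_X[of X] by (simp add: l_def)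
  have "l >= 0" using elim by (simp add: l_def)
  have "(\<Sum>v\<in>nz X. multiplicity p (N v) * ln p) <= (\<Sum>v\<in>nz X. k * ln p + 2 * l * of_bool (p ^ k dvd N v))"
  proof (rule sum_mono)
   fix v assume v: "v \<in> nz X"
   show "multiplicity p (N v) * ln p <= k * ln p + 2 * l * of_bool (p ^ k dvd N v)"
   proof (cases "p ^ k dvd N v")
    case True
    have "multiplicity p (N v) * ln p <= 2 * l" using mult_ln_le[OF p v] ln_norm_le[OF v] CX by simp
    then show ?thesis using True lnp by (simp add: add_increasing)
   next
    case False
    have "multiplicity p (N v) < k"
     using False multiplicity_dvd' by (metis not_le)
    then have "real (multiplicity p (N v)) * ln p <= real k * ln p" using lnp by (intro mult_right_mono) auto
    then show ?thesis using False by simp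
   qed
  qed
  also have "... = real (card (nz X)) * (k * ln p) + 2 * l * card {v \<in> nz X. p ^ k dvd N v}"
   by (simp add: sum.distrib Int_def conj_commute flip: sum_distrib_left)
  also have "... <= real X ^ n * (eps / 2 * l) + 2 * l * (eps / 4 * real X ^ n)"
  proof (rule add_mono)
   show "real (card (nz X)) * (k * ln p) <= real X ^ n * (eps / 2 * l)"
   proof (rule mult_mono)
    show "real (card (nz X)) <= real X ^ n" using card_nz_le by (metis of_nat_le_iff of_nat_power)
    show "real k * ln p <= eps / 2 * l" using elim by (simp add: l_def)
   qed (use lnp in auto)
   show "2 * l * card {v \<in> nz X. p ^ k dvd N v} <= 2 * l * (eps / 4 * real X ^ n)"
    using elim \<open>l >= 0\<close> by (intro mult_left_mono) auto
  qed
  also have "... = eps * real X ^ n * l" by (simp add: field_simps)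
  finally show ?case by (simp add: l_def)
 qed
qed

text \<open>If p^2 does not divide the norm, the multiplicity is at most 1 and some form of
  \<open>J p\<close> detects it. Otherwise the crude bound multiplicity * ln p <= ln N is
  affordable, because such vectors have proportion O(1/p^2).\<close>

lemma sum_mult_good:
 assumes p: "good p" and X: "X > 0"
 shows "(\<Sum>v\<in>nz X. multiplicity p (N v) * ln p) <=
   ln p * (\<Sum>j\<in>J p. real (card (ker p j \<inter> nz X))) + ln (C * real X ^ n) * real (card {v \<in> nz X. p\<^sup>2 dvd N v})"
proof -
 have p': "prime p" "p \<notin> bad" using p by (auto simp: good_def)
 have lnp: "ln (real p) >= 0" using prime_ge_1_nat[OF p'(1)] by simp
 have "(\<Sum>v\<in>nz X. multiplicity p (N v) * ln p) <=
   (\<Sum>v\<in>nz X. ln p * real (card {j \<in> J p. int p dvd L p j v}) + ln (C * real X ^ n) * of_bool (p\<^sup>2 dvd N v))"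
 proof (rule sum_mono)
  fix v assume v: "v \<in> nz X"
  let ?S = "{j \<in> J p. int p dvd L p j v}"
  show "multiplicity p (N v) * ln p <= ln p * real (card ?S) + ln (C * real X ^ n) * of_bool (p\<^sup>2 dvd N v)"
  proof (cases "p\<^sup>2 dvd N v")
   case True
   have "multiplicity p (N v) * ln p <= ln (C * real X ^ n)"
    using mult_ln_le[OF p'(1) v] ln_norm_le[OF v] by simp
   then show ?thesis using True lnp by (simp add: add_increasing)
  next
   case False
   show ?thesis
   proof (cases "p dvd N v")
    case True
    have "multiplicity p (N v) < 2" using False multiplicity_dvd' by (metis not_le)
    moreover obtain j where "j \<in> ?S" using norm_L[OF p' True False] by blast
    then have "card ?S > 0" using J_finite[OF p'] by (auto simp: card_gt_0_iff)
    ultimately have "real (multiplicity p (N v)) * ln p <= real (card ?S) * ln p"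
     using lnp by (intro mult_right_mono) auto
    then show ?thesis using False by (simp add: mult.commute)
   next
    case False
    then have "multiplicity p (N v) = 0" by (rule not_dvd_imp_multiplicity_0)
    moreover have "~ p\<^sup>2 dvd N v" using False by (metis dvd_mult_left power2_eq_square)
    ultimately show ?thesis using lnp by simp
   qed
  qed
 qed
 also have "... = ln p * (\<Sum>v\<in>nz X. real (card {j \<in> J p. int p dvd L p j v})) + ln (C * real X ^ n) * real (card {v \<in> nz X. p\<^sup>2 dvd N v})"
  by (simp add: sum.distrib sum_distrib_left Int_def conj_commute)
 also have "(\<Sum>v\<in>nz X. real (card {j \<in> J p. int p dvd L p j v})) = (\<Sum>j\<in>J p. real (card (ker p j \<inter> nz X)))"
 proof -
  have "ker p j \<inter> nz X = {v \<in> nz X. int p dvd L p j v}" for j by (auto simp: ker_def)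
  then show ?thesis using sum_card_swap[OF finite_nz J_finite[OF p']] by simp
 qed
 finally show ?thesis .
qed

end

lemma nat_floor_half:
 fixes x :: real
 assumes "x >= 1"
 shows "nat \<lfloor>x\<rfloor> >= 1" "real (nat \<lfloor>x\<rfloor>) <= x" "x / 2 <= real (nat \<lfloor>x\<rfloor>)" "x < real (nat \<lfloor>x\<rfloor>) + 1"
proof -
 have "\<lfloor>x\<rfloor> >= 1" using assms by (simp add: le_floor_iff)
 then have "real (nat \<lfloor>x\<rfloor>) = of_int \<lfloor>x\<rfloor>" "\<lfloor>x\<rfloor> >= 1" by simp_all
 then show "nat \<lfloor>x\<rfloor> >= 1" "real (nat \<lfloor>x\<rfloor>) <= x" "x / 2 <= real (nat \<lfloor>x\<rfloor>)" "x < real (nat \<lfloor>x\<rfloor>) + 1"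
  by linarith+
qed

lemma nat_ceiling_double:
 fixes x :: real
 assumes "x >= 1"
 shows "x <= real (nat \<lceil>x\<rceil>)" "real (nat \<lceil>x\<rceil>) <= 2 * x"
 using assms by linarith+

context norm_form
begin

lemma T_eq_sum:
 "T X = (\<Sum>p | prime p & p <= C * X ^ n. \<Sum>v\<in>nz X. multiplicity p (N v) * ln p)"
proof -
 have "T X = (\<Sum>v\<in>nz X. \<Sum>p | prime p & p <= C * X ^ n. multiplicity p (N v) * ln p)"
  unfolding T_def
 proof (rule sum.cong[OF refl])
  fix v assume v: "v \<in> nz X"
  then have "N v <= C * X ^ n" using norm_box_le by (auto simp: nz_def)
  then show "ln (N v) = (\<Sum>p | prime p & p <= C * X ^ n. multiplicity p (N v) * ln p)"
   using nz_norm_pos[OF v] by (intro ln_eq_sum_multiplicity)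
 qed
 also have "... = (\<Sum>p | prime p & p <= C * X ^ n. \<Sum>v\<in>nz X. multiplicity p (N v) * ln p)"
  by (rule sum.swap)
 finally show ?thesis .
qed

lemma A_nonneg: "0 <= A k Y"
 unfolding A_def by (intro sum_nonneg) (auto simp: good_def prime_ge_1_nat)

text \<open>\<open>T X\<close> is bounded below by size and factored over the primes up to C X^n.
  Bad and small primes are negligible, primes up to X^(n (1 - \<delta>)) give \<open>A k\<close>,
  and the larger ones are responsible for the loss 2 K K1 \<delta>.\<close>

lemma A_lower:
 fixes \<delta> \<eta> :: real
 assumes \<delta>: "0 < \<delta>" "\<delta> < 1" and \<eta>: "0 < \<eta>"
 shows "\<exists>k. \<forall>\<^sub>F X in sequentially.
   (1 - \<eta> - 2 * K * K1 * \<delta>) * (n * ln (real X)) <= A k (real X powr (n * (1 - \<delta>)))"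
proof -
 \<comment> \<open>Seven errors: three from \<open>T_ge\<close>, one each from the bad primes, the
   squares and the additive constants, and one from dividing by 1 + eps.\<close>
 define eps where "eps = \<eta> / 7"
 have eps: "0 < eps" using \<eta> by (simp add: eps_def)
 define M where "M = real K * K1"
 have M0: "M >= 0" using K1_pos by (simp add: M_def)
 obtain k0 :: nat where "2 * M / eps <= k0" using real_arch_simple by blast
 define k where "k = Suc k0"
 have k: "k > 0" "2 * M / eps <= k" using \<open>2 * M / eps <= k0\<close> by (auto simp: k_def)
 have kk: "2 * M / k <= eps" using k eps by (simp add: field_simps)
 define F0 where "F0 = {p. prime p & (p <= max k (2 * C) \<or> p \<in> bad)}"
 have fF0: "finite F0"
  by (rule finite_subset[of _ "{..max k (2 * C)} \<union> bad"]) (use finite_bad in \<open>auto simp: F0_def\<close>)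
 define \<theta> where "\<theta> = eps / (card F0 + 1)"
 have \<theta>: "\<theta> > 0" "card F0 * \<theta> <= eps" using eps by (auto simp: \<theta>_def field_simps)
 have evF: "\<forall>\<^sub>F X in sequentially. \<forall>p\<in>F0. (\<Sum>v\<in>nz X. multiplicity p (N v) * ln p) <= \<theta> * real X ^ n * (n * ln (real X))"
  using fF0 by (intro eventually_ball_finite ballI sum_mult_bad \<theta>) (auto simp: F0_def)
 have "\<forall>\<^sub>F X in sequentially.
   (1 - \<eta> - 2 * K * K1 * \<delta>) * (n * ln (real X)) <= A k (real X powr (n * (1 - \<delta>)))"
  using card_ker_asymp[OF \<delta>(1) eps] T_ge[OF eps] evF
   eventually_const_le_ln[OF eps, of "M * (2 * ln C + 4 * ln 2)"]
   eventually_const_le_ln[OF zero_less_one, of "ln C"] eventually_gt_at_top[of 1]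
 proof eventually_elim
  case (elim X)
  define l where "l = n * ln (real X)"
  have l0: "l >= 0" using elim by (simp add: l_def)
  define Y where "Y = real X powr (n * (1 - \<delta>))"
  define a where "a = nat \<lfloor>Y\<rfloor>"
  have Y1: "Y >= 1" unfolding Y_def using elim \<delta> by (intro ge_one_powr_ge_zero) auto
  have a: "a >= 1" "real a <= Y" "Y / 2 <= real a" "Y < real a + 1"
   unfolding a_def using nat_floor_half[OF Y1] by simp_all
  have YX: "Y <= real X ^ n"
  proof -
   have "Y <= real X powr n" unfolding Y_def using elim \<delta> by (intro powr_mono) (auto simp: algebra_simps)
   then show ?thesis using elim by (simp add: powr_realpow)
  qed
  have lnY: "ln Y = (1 - \<delta>) * l" using elim by (simp add: Y_def l_def ln_powr)
  have lna: "ln (real a) >= (1 - \<delta>) * l - ln 2"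
  proof -
   have "ln (Y / 2) <= ln (real a)" using a Y1 by (intro ln_mono) auto
   then show ?thesis using Y1 lnY by (simp add: ln_div)
  qed
  have lCX: "ln (C * real X ^ n) = ln C + l" using ln_C_X[of X] elim by (simp add: l_def)
  then have lCX2: "ln (C * real X ^ n) <= 2 * l" using elim by (simp add: l_def)
  define P where "P = {p. prime p & p <= C * X ^ n}"
  have finP: "finite P" unfolding P_def by (rule finite_good_le)
  define Q1 where "Q1 = {p \<in> P. good p & k < p & real p <= Y}"
  define Q2 where "Q2 = {p \<in> P. good p & k < p & ~ real p <= Y}"
  define F where "F = {p \<in> P. ~ (good p & k < p)}"
  have fin: "finite Q1" "finite Q2" "finite F" using finP by (auto simp: Q1_def Q2_def F_def)
  have PU: "P = (Q1 \<union> Q2) \<union> F" by (auto simp: Q1_def Q2_def F_def)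
  have disj: "(Q1 \<union> Q2) \<inter> F = {}" "Q1 \<inter> Q2 = {}" by (auto simp: Q1_def Q2_def F_def)
  let ?m = "%p. \<Sum>v\<in>nz X. multiplicity p (N v) * ln p"
  let ?kc = "%p. ln (real p) * (\<Sum>j\<in>J p. real (card (ker p j \<inter> nz X)))"
  have Q: "good p" "k < p" "prime p" "p > 0" "p \<notin> bad" "ln (real p) >= 0" if "p \<in> Q1 \<union> Q2" for p
   using that by (auto simp: Q1_def Q2_def good_def prime_gt_0_nat prime_ge_1_nat)
  have "(1 - 3 * eps) * real X ^ n * l <= T X" using elim by (simp add: l_def)
  also have "T X = sum ?m (Q1 \<union> Q2) + sum ?m F"
   unfolding T_eq_sum P_def[symmetric] PU using fin disj(1) by (intro sum.union_disjoint) auto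
  also have "sum ?m F <= eps * real X ^ n * l"
  proof -
   have "sum ?m F <= sum ?m F0"
    using fF0 by (intro sum_mono2) (auto simp: F_def F0_def P_def good_def prime_ge_1_nat intro!: sum_nonneg)
   also have "... <= (\<Sum>p\<in>F0. \<theta> * real X ^ n * l)" using elim(3) unfolding l_def by (intro sum_mono) blast
   also have "... = (card F0 * \<theta>) * (real X ^ n * l)" by simp
   also have "... <= eps * (real X ^ n * l)" using \<theta> l0 by (intro mult_right_mono) auto
   finally show ?thesis by (simp add: mult.assoc)
  qed
  also have "sum ?m (Q1 \<union> Q2) <= (\<Sum>p\<in>Q1 \<union> Q2. ?kc p + 2 * l * (K * (K1 * real X ^ n / (real p)\<^sup>2)))"
  proof (rule sum_mono)
   fix p assume p: "p \<in> Q1 \<union> Q2"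
   have "?m p <= ?kc p + ln (C * real X ^ n) * real (card {v \<in> nz X. p\<^sup>2 dvd N v})"
    using sum_mult_good[OF Q(1)[OF p]] elim by simp
   also have "ln (C * real X ^ n) * real (card {v \<in> nz X. p\<^sup>2 dvd N v}) <= 2 * l * (K * (K1 * real X ^ n / (real p)\<^sup>2))"
    using lCX2 l0 card_square_le[OF Q(1)[OF p], of X] by (intro mult_mono) auto
   finally show "?m p <= ?kc p + 2 * l * (K * (K1 * real X ^ n / (real p)\<^sup>2))" by simp
  qed
  also have "... = sum ?kc Q1 + sum ?kc Q2 + (\<Sum>p\<in>Q1 \<union> Q2. (2 * l * K) * (K1 * real X ^ n / (real p)\<^sup>2))"
   using fin disj by (simp add: sum.distrib sum.union_disjoint mult.assoc)
  also have "(\<Sum>p\<in>Q1 \<union> Q2. (2 * l * K) * (K1 * real X ^ n / (real p)\<^sup>2)) <= (2 * l * K) * (K1 * real X ^ n) / k"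
   using l0 K1_pos k fin Q(2) by (intro sum_ln_squares_le) auto
  also have "... = (2 * M / k) * (real X ^ n * l)" by (simp add: M_def mult_ac)
  also have "... <= eps * (real X ^ n * l)" using kk l0 by (intro mult_right_mono) auto
  also have "sum ?kc Q1 <= (1 + eps) * real X ^ n * A k Y"
  proof -
   have "sum ?kc Q1 <= (\<Sum>p\<in>Q1. (1 + eps) * real X ^ n * (card (J p) * ln p / p))"
   proof (rule sum_mono)
    fix p assume p: "p \<in> Q1"
    then have pQ: "p \<in> Q1 \<union> Q2" by simp
    have "(\<Sum>j\<in>J p. real (card (ker p j \<inter> nz X))) <= (\<Sum>j\<in>J p. (1 + eps) * real X ^ n / p)"
     using elim(1) p Q[OF pQ] unfolding Q1_def Y_def by (intro sum_mono) blast
    then have "?kc p <= ln p * (card (J p) * ((1 + eps) * real X ^ n / p))"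
     using Q[OF pQ] by (intro mult_left_mono) auto
    then show "?kc p <= (1 + eps) * real X ^ n * (card (J p) * ln p / p)" by (simp add: mult_ac)
   qed
   also have "... = (1 + eps) * real X ^ n * (\<Sum>p\<in>Q1. card (J p) * ln p / p)" by (simp add: sum_distrib_left)
   also have "... <= (1 + eps) * real X ^ n * A k Y"
    unfolding A_def using eps finite_A
    by (intro mult_left_mono sum_mono2) (auto simp: Q1_def good_def prime_ge_1_nat)
   finally show ?thesis .
  qed
  \<comment> \<open>Beyond X^(n (1 - \<delta>)) only the bound K1 X^n / p for a kernel is available.
    The range has logarithmic length \<delta> n ln X + O(1), so Chebyshev's bound makes its
    contribution proportional to \<delta>.\<close>
  also have "sum ?kc Q2 <= real X ^ n * (2 * M * \<delta> * l + eps * l)"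
  proof -
   have "sum ?kc Q2 <= (\<Sum>p\<in>Q2. M * real X ^ n * (ln p / p))"
   proof (rule sum_mono)
    fix p assume p: "p \<in> Q2"
    then have pQ: "p \<in> Q1 \<union> Q2" by simp
    have "(\<Sum>j\<in>J p. real (card (ker p j \<inter> nz X))) <= (\<Sum>j\<in>J p. K1 * real X ^ n / p)"
     using Q[OF pQ] by (intro sum_mono card_ker_le)
    also have "... = card (J p) * (K1 * real X ^ n / p)" by simp
    also have "... <= K * (K1 * real X ^ n / p)"
     using J_card Q[OF pQ] K1_pos by (intro mult_right_mono) auto
    finally have "?kc p <= ln p * (K * (K1 * real X ^ n / p))"
     using Q[OF pQ] by (intro mult_left_mono) auto
    then show "?kc p <= M * real X ^ n * (ln p / p)" by (simp add: M_def mult_ac)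
   qed
   also have "... = M * real X ^ n * (\<Sum>p\<in>Q2. ln p / p)" by (simp add: sum_distrib_left)
   also have "... <= M * real X ^ n * (\<Sum>p | prime p & a < p & p <= C * X ^ n. ln p / p)"
   proof (intro mult_left_mono sum_mono2)
    show "finite {p. prime p & a < p & p <= C * X ^ n}" by (rule finite_subset[of _ "{..C * X ^ n}"]) auto
    show "Q2 \<subseteq> {p. prime p & a < p & p <= C * X ^ n}" using a(2) by (auto simp: Q2_def P_def)
   qed (use M0 in \<open>auto simp: prime_ge_1_nat\<close>)
   also have "... <= M * real X ^ n * (2 * (ln (real (C * X ^ n)) - ln (real a)) + 2 * ln 2)"
   proof (intro mult_left_mono sum_ln_primes_div_le)
    have "real a <= 1 * real X ^ n" using a(2) YX unfolding mult_1 by (rule order_trans)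
    also have "... <= C * real X ^ n" using C_pos by (intro mult_right_mono) (auto simp: Suc_leI)
    finally have "real a <= real (C * X ^ n)" by simp
    then show "a <= C * X ^ n" unfolding of_nat_le_iff .
   qed (use a M0 in auto)
   also have "... <= M * real X ^ n * (2 * (ln C + l - ((1 - \<delta>) * l - ln 2)) + 2 * ln 2)"
    using lna lCX M0 by (intro mult_left_mono) auto
   also have "... = real X ^ n * (2 * M * \<delta> * l + M * (2 * ln C + 4 * ln 2))" by (simp add: algebra_simps)
   also have "... <= real X ^ n * (2 * M * \<delta> * l + eps * l)"
    using elim by (intro mult_left_mono add_left_mono) (auto simp: l_def)
   finally show ?thesis .
  qed
  finally have "real X ^ n * ((1 - 3 * eps) * l) <=
    real X ^ n * ((1 + eps) * A k Y + (2 * M * \<delta> * l + eps * l) + eps * l + eps * l)"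
   by (simp add: algebra_simps)
  then have main: "(1 - 3 * eps) * l <= (1 + eps) * A k Y + (2 * M * \<delta> * l + eps * l) + eps * l + eps * l"
   using elim by (simp add: mult_le_cancel_left)
  define b where "b = 1 - 6 * eps - 2 * M * \<delta>"
  have b: "b * l <= (1 + eps) * A k Y" using main by (simp add: b_def algebra_simps)
  have "0 <= 2 * M * \<delta>" using M0 \<delta> by simp
  then have "b <= 1" using eps unfolding b_def by linarith
  have "(b - eps) * l <= A k Y"
  proof (cases "b - eps >= 0")
   case True
   have "(1 + eps) * ((b - eps) * l) = ((1 + eps) * (b - eps)) * l" by simp
   also have "... <= b * l"
   proof (rule mult_right_mono)
    have "b * eps <= 1 * eps" using \<open>b <= 1\<close> eps by (intro mult_right_mono) auto
    moreover have "0 <= eps * eps" by simp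
    moreover have "(1 + eps) * (b - eps) = b - eps + b * eps - eps * eps" by (simp add: algebra_simps)
    ultimately show "(1 + eps) * (b - eps) <= b" by linarith
   qed fact
   finally have "(1 + eps) * ((b - eps) * l) <= (1 + eps) * A k Y" using b by linarith
   then show ?thesis using eps by (simp add: mult_le_cancel_left)
  next
   case False
   then have "(b - eps) * l <= 0" using l0 by (intro mult_nonpos_nonneg) auto
   then show ?thesis using A_nonneg[of k Y] by linarith
  qed
  moreover have "b - eps = 1 - \<eta> - 2 * K * K1 * \<delta>" by (simp add: b_def eps_def M_def)
  ultimately show ?case by (simp add: l_def Y_def)
 qed
 then show ?thesis by blast
qed

lemma A_mono: "Y <= Y' ==> A k Y <= A k Y'"
 unfolding A_def using finite_A by (intro sum_mono2) (auto simp: good_def prime_ge_1_nat)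

lemma A_diff: "A k Y <= A 0 Y" "A 0 Y <= A k Y + A 0 (real k)"
proof -
 show "A k Y <= A 0 Y"
  unfolding A_def using finite_A by (intro sum_mono2) (auto simp: good_def prime_ge_1_nat)
 have "A 0 Y <= (\<Sum>p \<in> {p. good p & k < p & real p <= Y} \<union> {p. good p & 0 < p & real p <= k}. card (J p) * ln p / p)"
  unfolding A_def using finite_A by (intro sum_mono2 finite_UnI) (auto simp: good_def prime_ge_1_nat)
 also have "... = A k Y + A 0 (real k)"
  unfolding A_def using finite_A by (intro sum.union_disjoint) auto
 finally show "A 0 Y <= A k Y + A 0 (real k)" .
qed

lemma filterlim_nat_powr:
 assumes "(b::real) > 0"
 shows "filterlim (%Y::nat. nat \<lceil>real Y powr b\<rceil>) sequentially sequentially"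
  and "filterlim (%Y::nat. nat \<lfloor>real Y powr b\<rfloor>) sequentially sequentially"
proof -
 have "filterlim (%Y::nat. exp (b * ln (real Y))) at_top sequentially"
  by (intro filterlim_compose[OF exp_at_top] filterlim_tendsto_pos_mult_at_top[OF tendsto_const assms]
    filterlim_compose[OF ln_at_top filterlim_real_sequentially])
 then have lim: "filterlim (%Y::nat. real Y powr b) at_top sequentially"
  by (rule filterlim_at_top_mono)
   (auto simp: powr_def intro!: eventually_mono[OF eventually_gt_at_top[of "0::nat"]])
 show d: "filterlim (%Y::nat. nat \<lfloor>real Y powr b\<rfloor>) sequentially sequentially"
  by (intro filterlim_compose[OF filterlim_nat_sequentially] filterlim_compose[OF filterlim_floor_sequentially] lim)
 show "filterlim (%Y::nat. nat \<lceil>real Y powr b\<rceil>) sequentially sequentially"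
  by (rule filterlim_at_top_mono[OF d]) (auto intro!: always_eventually nat_mono floor_le_ceiling)
qed

text \<open>The two bounds hold along Y = X^(n (1 - s)). A given Y is reached from X = Y^b, b = 1 /
  (n (1 - s)), rounded up or down. Rounding changes n ln X by at most n ln 2, and 1 / (1 - s) tends
  to 1 with s.\<close>

theorem A_asymp: "(%Y::nat. A 0 (real Y) / ln (real Y)) \<longlonglongrightarrow> 1"
proof (rule LIMSEQ_I)
 fix r :: real assume r: "r > 0"
 define M where "M = 2 * K * K1"
 have M0: "M >= 0" using K1_pos by (simp add: M_def)
 \<comment> \<open>The entry r / 24 gives (1 + s) (1 + 2 s) <= 1 + r / 4 for the upper bound. The
   entries with 1 + M keep the coefficient g = 1 - s - M s of the lower bound nonnegative and at
   least 1 - r / 4.\<close>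
 define s where "s = min (1 / 2) (min (r / 24) (min (r / (4 * (1 + M))) (1 / (1 + M))))"
 have s: "0 < s" "s <= 1 / 2" "s <= r / 24" "s * (1 + M) <= r / 4" "s * (1 + M) <= 1"
 proof -
  show "0 < s" using r M0 by (auto simp: s_def)
  show "s <= 1 / 2" "s <= r / 24" unfolding s_def by linarith+
  have "s <= r / (4 * (1 + M))" "s <= 1 / (1 + M)" unfolding s_def by linarith+
  then show "s * (1 + M) <= r / 4" "s * (1 + M) <= 1" using M0 by (auto simp: field_simps)
 qed
 have s1: "s < 1" using s by simp
 define b where "b = 1 / (n * (1 - s))"
 have b: "b > 0" "b * (n * (1 - s)) = 1" using s1 by (auto simp: b_def)
 obtain k where k: "\<forall>\<^sub>F X in sequentially. A k (real X powr (n * (1 - s))) <= (1 + s) * (n * ln (real X))"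
  using A_upper[OF s(1) s1 s(1)] by blast
 obtain k' where k': "\<forall>\<^sub>F X in sequentially. (1 - s - 2 * K * K1 * s) * (n * ln (real X)) <= A k' (real X powr (n * (1 - s)))"
  using A_lower[OF s(1) s1 s(1)] by blast
 have lnlim: "filterlim (%Y. ln (real Y)) at_top sequentially"
  by (rule filterlim_compose[OF ln_at_top filterlim_real_sequentially])
 have big: "\<forall>\<^sub>F Y in sequentially. c <= ln (real Y)" for c
  using lnlim by (simp add: filterlim_at_top)
 let ?u = "%Y::nat. nat \<lceil>real Y powr b\<rceil>" and ?d = "%Y::nat. nat \<lfloor>real Y powr b\<rfloor>"
 have "\<forall>\<^sub>F Y in sequentially. \<bar>A 0 (real Y) / ln (real Y) - 1\<bar> < r"
  using eventually_compose_filterlim[OF k filterlim_nat_powr(1)[OF b(1)]]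
   eventually_compose_filterlim[OF k' filterlim_nat_powr(2)[OF b(1)]]
   big[of "4 * ((1 + s) * (n * ln 2) + A 0 (real k)) / r"] big[of "4 * (n * ln 2) / r"] big[of 1] eventually_gt_at_top[of 1]
 proof eventually_elim
  case (elim Y)
  define q where "q = real Y powr b"
  have q1: "q >= 1" unfolding q_def using elim b by (intro ge_one_powr_ge_zero) auto
  have qY: "q powr (n * (1 - s)) = real Y" unfolding q_def using elim b by (simp add: powr_powr)
  have lnq: "n * ln q = ln (real Y) / (1 - s)"
   using elim s1 by (simp add: q_def ln_powr b_def)
  define uu where "uu = ?u Y"
  define dd where "dd = ?d Y"
  note e1 = elim(1)[folded uu_def] and e2 = elim(2)[folded dd_def]
  have u: "q <= real (uu)" "real (uu) <= 2 * q"
   unfolding uu_def q_def[symmetric] using nat_ceiling_double[OF q1] by simp_all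
  have d: "1 <= dd" "real (dd) <= q" "q / 2 <= real (dd)"
   unfolding dd_def q_def[symmetric] using nat_floor_half[OF q1] by simp_all
  have lnY: "ln (real Y) > 0" using elim by simp
  have "1 / (1 - s) <= 1 + 2 * s"
  proof -
   have "s * s <= s * (1 / 2)" using s by (intro mult_left_mono) auto
   then have "1 <= (1 + 2 * s) * (1 - s)" by (simp add: algebra_simps)
   then show ?thesis using s1 by (simp add: field_simps)
  qed
  then have "ln (real Y) / (1 - s) <= ln (real Y) * (1 + 2 * s)"
   using lnY mult_left_mono[of "1 / (1 - s)" "1 + 2 * s" "ln (real Y)"] by simp
  then have qu: "n * ln q <= ln (real Y) * (1 + 2 * s)" using lnq by simp
  have ql: "n * ln q >= ln (real Y)"
  proof -
   have "ln (real Y) * (1 - s) <= ln (real Y) * 1" using lnY s by (intro mult_left_mono) auto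
   then show ?thesis unfolding lnq using s1 by (simp add: field_simps)
  qed
  have "A 0 (real Y) <= A k (real Y) + A 0 (real k)" by (rule A_diff)
  also have "A k (real Y) <= A k (real (uu) powr (n * (1 - s)))"
  proof (rule A_mono)
   have "q powr (n * (1 - s)) <= real (uu) powr (n * (1 - s))" using u(1) q1 s1 by (intro powr_mono2) auto
   then show "real Y <= real (uu) powr (n * (1 - s))" unfolding qY .
  qed
  also have "... <= (1 + s) * (n * ln (real (uu)))" by (rule e1)
  also have "... <= (1 + s) * (n * (ln 2 + ln q))"
  proof (intro mult_left_mono)
   have "ln (real (uu)) <= ln (2 * q)" using u q1 by (intro ln_mono) auto
   then show "ln (real (uu)) <= ln 2 + ln q" using q1 by (simp add: ln_mult)
  qed (use s in auto)
  also have "... = (1 + s) * (n * ln q) + (1 + s) * (n * ln 2)" by (simp add: algebra_simps)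
  also have "(1 + s) * (n * ln q) <= (1 + s) * (ln (real Y) * (1 + 2 * s))" using qu s by (intro mult_left_mono) auto
  also have "... = ((1 + s) * (1 + 2 * s)) * ln (real Y)" by simp
  also have "... <= (1 + r / 4) * ln (real Y)"
  proof (rule mult_right_mono)
   have "s * s <= s * (1 / 2)" using s by (intro mult_left_mono) auto
   moreover have "(1 + s) * (1 + 2 * s) = 1 + 3 * s + 2 * (s * s)" by (simp add: algebra_simps)
   ultimately show "(1 + s) * (1 + 2 * s) <= 1 + r / 4" using s by linarith
  qed (use lnY in simp)
  finally have up: "A 0 (real Y) <= (1 + r / 4) * ln (real Y) + ((1 + s) * (n * ln 2) + A 0 (real k))" by simp
  have "4 * ((1 + s) * (n * ln 2) + A 0 (real k)) <= r * ln (real Y)" using elim(3) r by (simp add: field_simps)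
  then have up: "A 0 (real Y) <= (1 + r / 2) * ln (real Y)" using up by (simp add: algebra_simps)
  define g where "g = 1 - s - M * s"
  have g: "0 <= g" "1 - r / 4 <= g" "g <= 1" using s M0 by (auto simp: g_def algebra_simps)
  have "g * (ln (real Y) - n * ln 2) <= g * (n * ln (real (dd)))"
  proof (intro mult_left_mono g)
   have "ln (q / 2) <= ln (real (dd))" using d q1 by (intro ln_mono) auto
   then have "n * (ln q - ln 2) <= n * ln (real (dd))" using q1 by (intro mult_left_mono) (auto simp: ln_div)
   then show "ln (real Y) - n * ln 2 <= n * ln (real (dd))" using ql by (simp add: algebra_simps)
  qed
  also have "... <= A k' (real (dd) powr (n * (1 - s)))" using e2 by (simp add: g_def M_def)
  also have "... <= A k' (real Y)"
  proof (rule A_mono)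
   have "real (dd) powr (n * (1 - s)) <= q powr (n * (1 - s))" using d(2) q1 s1 by (intro powr_mono2) auto
   then show "real (dd) powr (n * (1 - s)) <= real Y" unfolding qY .
  qed
  also have "... <= A 0 (real Y)" by (rule A_diff)
  finally have "g * ln (real Y) - g * (n * ln 2) <= A 0 (real Y)" by (simp add: algebra_simps)
  moreover have "g * (n * ln 2) <= 1 * (n * ln 2)" using g by (intro mult_right_mono) auto
  moreover have "ln (real Y) - r * ln (real Y) / 4 <= g * ln (real Y)"
   using mult_right_mono[OF g(2), of "ln (real Y)"] lnY by (simp add: left_diff_distrib)
  moreover have "4 * (n * ln 2) <= r * ln (real Y)" using elim(4) r by (simp add: field_simps)
  ultimately have lo: "ln (real Y) - r * ln (real Y) / 2 <= A 0 (real Y)" by linarith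
  have "A 0 (real Y) / ln (real Y) <= 1 + r / 2" "1 - r / 2 <= A 0 (real Y) / ln (real Y)"
   using up lo lnY by (simp_all add: field_simps)
  then show ?case using r by (simp add: abs_less_iff)
 qed
 then show "\<exists>no. \<forall>Y\<ge>no. norm (A 0 (real Y) / ln (real Y) - 1) < r"
  by (simp add: eventually_sequentially)
qed

end

section \<open>Logarithmic means over the primes and Dirichlet density\<close>

text \<open>A mean with weights ln p / p. It applies to counting functions of p and not only to
  sets, so such functions can be combined linearly before the result is turned into a
  density.\<close>

definition lmean :: "(nat => real) => real => bool" where
 "lmean f c \<longleftrightarrow> (%Y. (\<Sum>p | prime p & p <= Y. f p * (ln (real p) / real p)) / ln (real Y)) \<longlonglongrightarrow> c"

lemma ln_real_at_top: "filterlim (%Y::nat. ln (real Y)) at_top sequentially"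
 by (rule filterlim_compose[OF ln_at_top filterlim_real_sequentially])

lemma lmean_add: "lmean f c ==> lmean g d ==> lmean (%p. f p + g p) (c + d)"
 unfolding lmean_def by (drule (1) tendsto_add) (simp add: sum.distrib add_divide_distrib distrib_right)

lemma lmean_cmult: "lmean f c ==> lmean (%p. a * f p) (a * c)"
 unfolding lmean_def by (drule tendsto_mult_left[of _ _ _ a]) (simp add: sum_distrib_left mult.assoc)

text \<open>Finitely many primes change the sum by a constant, which disappears after division by ln
  Y.\<close>

lemma lmean_cong_cofinite:
 assumes "lmean f c" "finite F" "!!p. prime p ==> p \<notin> F ==> f p = g p"
 shows "lmean g c"
proof -
 define B where "B = (\<Sum>p\<in>{p\<in>F. prime p}. (g p - f p) * (ln (real p) / real p))"
 obtain m where m: "!!p. p \<in> F ==> p <= m" using assms(2) by (metis finite_nat_set_iff_bounded_le)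
 have "(%Y. (\<Sum>p | prime p & p <= Y. f p * (ln (real p) / real p)) / ln (real Y) + B / ln (real Y)) \<longlonglongrightarrow> c + 0"
  using assms(1) unfolding lmean_def
  by (intro tendsto_add real_tendsto_divide_at_top[OF tendsto_const ln_real_at_top])
 moreover have "\<forall>\<^sub>F Y in sequentially. (\<Sum>p | prime p & p <= Y. f p * (ln (real p) / real p)) / ln (real Y) + B / ln (real Y)
   = (\<Sum>p | prime p & p <= Y. g p * (ln (real p) / real p)) / ln (real Y)"
  using eventually_ge_at_top[of m]
 proof eventually_elim
  case (elim Y)
  have fin: "finite {p. prime p & p <= Y}" by (rule finite_subset[of _ "{..Y}"]) auto
  have "(\<Sum>p | prime p & p <= Y. g p * (ln (real p) / real p)) - (\<Sum>p | prime p & p <= Y. f p * (ln (real p) / real p))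
    = (\<Sum>p | prime p & p <= Y. (g p - f p) * (ln (real p) / real p))"
   by (simp only: sum_subtractf left_diff_distrib)
  also have "... = B" unfolding B_def
  proof (rule sum.mono_neutral_right[OF fin])
   show "{p \<in> F. prime p} \<subseteq> {p. prime p & p <= Y}" using m elim by (auto intro: order_trans)
   show "\<forall>p\<in>{p. prime p & p <= Y} - {p \<in> F. prime p}. (g p - f p) * (ln (real p) / real p) = 0"
   proof
    fix p assume "p \<in> {p. prime p & p <= Y} - {p \<in> F. prime p}"
    then have "f p = g p" by (intro assms(3)) auto
    then show "(g p - f p) * (ln (real p) / real p) = 0" by simp
   qed
  qed
  finally show ?case
   using arg_cong[where f = "%x. x / ln (real Y)"] by (simp only: diff_divide_distrib[symmetric] diff_eq_eq add_divide_distrib[symmetric] add.commute)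
 qed
 ultimately show ?thesis unfolding lmean_def using Lim_transform_eventually by fastforce
qed

lemma (in norm_form) lmean_card_J: "lmean (%p. real (card (J p))) 1"
proof -
 let ?F = "bad \<union> {..2 * C}"
 have "lmean (%p. if good p then real (card (J p)) else 0) 1"
  unfolding lmean_def
 proof (rule Lim_transform_eventually[OF A_asymp])
  show "\<forall>\<^sub>F Y in sequentially. A 0 (real Y) / ln (real Y) =
    (\<Sum>p | prime p & p <= Y. (if good p then real (card (J p)) else 0) * (ln (real p) / real p)) / ln (real Y)"
  proof (intro always_eventually allI arg_cong2[where f = "(/)"] refl)
   fix Y
   have "(\<Sum>p | prime p & p <= Y. (if good p then real (card (J p)) else 0) * (ln (real p) / real p))
     = (\<Sum>p | good p & 0 < p & real p <= real Y. card (J p) * ln p / p)"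
    by (rule sum.mono_neutral_cong_right)
     (auto simp: good_def prime_gt_0_nat intro: finite_subset[of _ "{..Y}"])
   then show "A 0 (real Y) = (\<Sum>p | prime p & p <= Y. (if good p then real (card (J p)) else 0) * (ln (real p) / real p))"
    by (simp add: A_def)
  qed
 qed
 then show ?thesis
  by (rule lmean_cong_cofinite[of _ _ ?F]) (use finite_bad in \<open>auto simp: good_def\<close>)
qed

lemma sum_by_parts:
 fixes d \<phi> :: "nat => real"
 shows "(\<Sum>k\<le>m. d k * \<phi> k) = (\<Sum>k\<le>m. d k) * \<phi> m + (\<Sum>k<m. (\<Sum>i\<le>k. d i) * (\<phi> k - \<phi> (Suc k)))"
 by (induction m) (simp_all add: algebra_simps)

text \<open>Abel summation: a comparison of the partial sums of d and a passes to the sums weighted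
  by any decreasing nonnegative sequence.\<close>

lemma sum_by_parts_bound:
 fixes a d \<phi> :: "nat => real"
 assumes anti: "!!k. \<phi> (Suc k) <= \<phi> k" and nonneg: "!!k. \<phi> k >= 0"
  and bound: "!!k. \<bar>\<Sum>i\<le>k. d i\<bar> <= eps * (\<Sum>i\<le>k. a i) + B"
 shows "\<bar>\<Sum>k\<le>m. d k * \<phi> k\<bar> <= eps * (\<Sum>k\<le>m. a k * \<phi> k) + B * \<phi> 0"
proof -
 let ?D = "%k. \<Sum>i\<le>k. d i" and ?A = "%k. eps * (\<Sum>i\<le>k. a i) + B"
 have "\<bar>\<Sum>k\<le>m. d k * \<phi> k\<bar> <= \<bar>?D m * \<phi> m\<bar> + (\<Sum>k<m. \<bar>?D k * (\<phi> k - \<phi> (Suc k))\<bar>)"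
  unfolding sum_by_parts[of d] by (rule order_trans[OF abs_triangle_ineq]) (intro add_left_mono sum_abs)
 also have "... <= ?A m * \<phi> m + (\<Sum>k<m. ?A k * (\<phi> k - \<phi> (Suc k)))"
  unfolding abs_mult using bound nonneg anti
  by (intro add_mono sum_mono mult_mono) (auto intro: order_trans[OF abs_ge_zero])
 also have "... = eps * ((\<Sum>i\<le>m. a i) * \<phi> m + (\<Sum>k<m. (\<Sum>i\<le>k. a i) * (\<phi> k - \<phi> (Suc k)))) + B * (\<phi> m + (\<Sum>k<m. \<phi> k - \<phi> (Suc k)))"
  by (simp add: algebra_simps sum.distrib sum_distrib_left sum_subtractf)
 also have "... = eps * (\<Sum>k\<le>m. a k * \<phi> k) + B * \<phi> 0"
  unfolding sum_by_parts[of a, symmetric] by (simp add: sum_lessThan_telescope')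
 finally show ?thesis .
qed

text \<open>Telescoping: with t = s - 1, the term 1 / (k + 1)^s is at most (1 / k^t - 1 / (k + 1)^t)
  / t, by 1 + x <= exp x and ln ((k + 1) / k) >= 1 / (k + 1).\<close>

lemma summable_powr_gt_1:
 assumes "s > (1::real)"
 shows "summable (%k. 1 / real k powr s)"
proof -
 define t where "t = s - 1"
 have t: "t > 0" using assms by (simp add: t_def)
 have step: "1 / real (Suc k) powr s <= (1 / real k powr t - 1 / real (Suc k) powr t) / t" if "k > 0" for k
 proof -
  have "1 + t * (1 / real (Suc k)) <= 1 + t * ln (real (Suc k) / real k)"
  proof -
   have "ln (real k / real (Suc k)) <= real k / real (Suc k) - 1" using that by (intro ln_le_minus_one) auto
   also have "... = - (1 / real (Suc k))" by (simp add: field_simps)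
   finally have "1 / real (Suc k) <= ln (real (Suc k) / real k)" using that by (simp add: ln_div)
   then have "t * (1 / real (Suc k)) <= t * ln (real (Suc k) / real k)" using t by (intro mult_left_mono) auto
   then show ?thesis by linarith
  qed
  also have "... <= exp (t * ln (real (Suc k) / real k))" by (rule exp_ge_add_one_self)
  also have "... = real (Suc k) powr t / real k powr t"
   using that by (simp add: powr_def ln_div right_diff_distrib exp_diff)
  finally have "t * (1 / real (Suc k)) <= real (Suc k) powr t / real k powr t - 1" by simp
  then have "t * (1 / real (Suc k)) / real (Suc k) powr t <= (real (Suc k) powr t / real k powr t - 1) / real (Suc k) powr t"
   by (rule divide_right_mono) simp
  also have "... = 1 / real k powr t - 1 / real (Suc k) powr t" using that by (simp add: field_simps)
  also have "t * (1 / real (Suc k)) / real (Suc k) powr t = t * (1 / real (Suc k) powr s)"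
   using powr_add[of "real (Suc k)" 1 t] by (simp add: t_def)
  finally show ?thesis using t by (simp add: field_simps)
 qed
 have "(\<Sum>k<m. 1 / real (Suc (Suc k)) powr s) <= (1 - 1 / real (Suc m) powr t) / t" for m
 proof (induction m)
  case (Suc m)
  have "(\<Sum>k<Suc m. 1 / real (Suc (Suc k)) powr s)
    <= (1 - 1 / real (Suc m) powr t) / t + (1 / real (Suc m) powr t - 1 / real (Suc (Suc m)) powr t) / t"
   unfolding sum.lessThan_Suc using Suc step[of "Suc m"] by (intro add_mono) auto
  also have "... = (1 - 1 / real (Suc (Suc m)) powr t) / t"
   unfolding add_divide_distrib[symmetric] by simp
  finally show ?case .
 qed simp
 also have "(1 - 1 / real (Suc m) powr t) / t <= 1 / t" for m using t by (intro divide_right_mono) auto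
 finally have "summable (%k. 1 / real (Suc (Suc k)) powr s)"
  by (intro summableI_nonneg_bounded[where x = "1 / t"]) auto
 then show ?thesis by (subst summable_iff_shift[where k = 2, symmetric]) simp
qed

text \<open>The weight k^(1 - s) / ln k turns ln p / p into p^(-s). It decreases and is at most 1 /
  ln 2 for all s > 1, so Abel summation gives |R - \<delta> P| <= eps P + B with B independent of s.
  Since P tends to infinity as s tends to 1, the quotient tends to \<delta>.\<close>

theorem lmean_imp_dirichlet_density:
 assumes one: "lmean (%_. 1) 1" and ind: "lmean (%p. of_bool (p \<in> S)) \<delta>"
 shows "has_dirichlet_density S \<delta>"
proof -
 define a :: "nat => real" where "a k = (if prime k then ln (real k) / real k else 0)" for k
 define d where "d k = (of_bool (k \<in> S) - \<delta>) * a k" for k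
 have a0: "a k >= 0" for k using prime_ge_1_nat[of k] by (auto simp: a_def)
 have fin: "finite {p. prime p & p <= Y}" for Y :: nat by (rule finite_subset[of _ "{..Y}"]) auto
 have suma: "(\<Sum>k\<le>Y. f k * a k) = (\<Sum>p | prime p & p <= Y. f p * (ln (real p) / real p))" for f Y
  by (rule sum.mono_neutral_cong_right) (auto simp: a_def)
 have limA: "(%Y. (\<Sum>k\<le>Y. a k) / ln (real Y)) \<longlonglongrightarrow> 1"
  using one unfolding lmean_def suma[symmetric] by simp
 have limD: "(%Y. (\<Sum>k\<le>Y. d k) / ln (real Y)) \<longlonglongrightarrow> 0"
 proof -
  have "(%Y. (\<Sum>k\<le>Y. of_bool (k \<in> S) * a k) / ln (real Y) - \<delta> * ((\<Sum>k\<le>Y. a k) / ln (real Y))) \<longlonglongrightarrow> \<delta> - \<delta> * 1"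
   using ind unfolding lmean_def suma[symmetric] by (intro tendsto_intros limA)
  then show ?thesis by (simp add: d_def left_diff_distrib sum_subtractf sum_distrib_left diff_divide_distrib)
 qed
 have evA: "\<forall>\<^sub>F Y in sequentially. ln (real Y) / 2 <= (\<Sum>k\<le>Y. a k)"
 proof -
  have "\<forall>\<^sub>F Y in sequentially. 1 / 2 < (\<Sum>k\<le>Y. a k) / ln (real Y)"
   using limA by (rule order_tendstoD) simp
  then show ?thesis using eventually_gt_at_top[of 1]
  proof eventually_elim
   case (elim Y)
   then have "ln (real Y) > 0" by simp
   then show ?case using elim by (simp add: field_simps)
  qed
 qed
 define P where "P s = (\<Sum>p. if prime p then 1 / real p powr s else 0)" for s :: real
 have summ: "summable (%p. if prime p & Q p then 1 / real p powr s else 0)" if "s > 1" for s :: real and Q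
  by (rule summable_comparison_test'[OF summable_powr_gt_1[OF that], of 0]) auto
 \<comment> \<open>Convergence would bound the sum of ln p / p from some m up to Y by (ln Y) / 4,
   against the lower bound (ln Y) / 2 that the mean provides.\<close>
 have nonsummable: "~ summable (%p::nat. if prime p then 1 / real p else 0)"
 proof
  assume sm: "summable (%p::nat. if prime p then 1 / real p else 0)"
  obtain m where m: "norm (\<Sum>p\<in>{m..<n}. if prime p then 1 / real p else 0) < 1 / 4" for n
   using sm unfolding summable_Cauchy by (metis le_refl zero_less_divide_1_iff zero_less_numeral)
  have le: "(\<Sum>k\<le>Y. a k) <= (\<Sum>k\<le>m. a k) + ln (real Y) * (1 / 4)" if "Y >= m" "Y >= 1" for Y
  proof -
   have "(\<Sum>k\<le>Y. a k) <= (\<Sum>k\<in>{..m} \<union> {m..<Suc Y}. a k)"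
    using a0 by (intro sum_mono2) auto
   also have "... <= (\<Sum>k\<le>m. a k) + (\<Sum>k\<in>{m..<Suc Y}. a k)"
    using a0 by (simp add: sum_Un sum_nonneg)
   also have "(\<Sum>k\<in>{m..<Suc Y}. a k) <= (\<Sum>k\<in>{m..<Suc Y}. ln (real Y) * (if prime k then 1 / real k else 0))"
   proof (rule sum_mono)
    fix k assume k: "k \<in> {m..<Suc Y}"
    show "a k <= ln (real Y) * (if prime k then 1 / real k else 0)"
    proof (cases "prime k")
     case True
     then have "ln (real k) <= ln (real Y)" using k prime_gt_0_nat[OF True] by (intro ln_mono) auto
     then show ?thesis using True by (simp add: a_def divide_right_mono)
    qed (simp add: a_def)
   qed
   also have "... = ln (real Y) * (\<Sum>k\<in>{m..<Suc Y}. if prime k then 1 / real k else 0)"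
    by (simp only: sum_distrib_left)
   also have "... <= ln (real Y) * (1 / 4)"
    using m[of "Suc Y"] that unfolding real_norm_def by (intro mult_left_mono) (linarith, simp)
   finally show ?thesis by simp
  qed
  have "\<forall>\<^sub>F Y in sequentially. 8 * (\<Sum>k\<le>m. a k) + 1 <= ln (real Y)"
   using ln_real_at_top by (simp add: filterlim_at_top)
  then have "\<forall>\<^sub>F Y::nat in sequentially. False"
   using evA eventually_ge_at_top[of m] eventually_ge_at_top[of 1]
  proof eventually_elim
   case (elim Y)
   have "(\<Sum>k\<le>m. a k) >= 0" using a0 by (intro sum_nonneg) auto
   then show ?case using le[of Y] elim by linarith
  qed
  then show False by simp
 qed
 have P_top: "filterlim P at_top (at_right 1)"
  unfolding filterlim_at_top
 proof
  fix Z :: real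
  have "\<exists>m. Z + 1 < (\<Sum>p<m. if prime p then 1 / real p else 0)"
  proof (rule ccontr)
   assume "~ ?thesis"
   then have "summable (%p::nat. if prime p then 1 / real p else 0)"
    by (intro summableI_nonneg_bounded[where x = "Z + 1"]) (auto simp: not_less)
   then show False using nonsummable by simp
  qed
  then obtain m where m: "Z + 1 < (\<Sum>p<m. if prime p then 1 / real p else 0)" by blast
  have "((%s. \<Sum>p<m. if prime p then 1 / real p powr s else 0) \<longlongrightarrow> (\<Sum>p<m. if prime p then 1 / real p powr 1 else 0)) (at_right 1)"
  proof (intro tendsto_sum)
   fix p
   show "((%s. if prime p then 1 / real p powr s else 0) \<longlongrightarrow> (if prime p then 1 / real p powr 1 else 0)) (at_right 1)"
   proof (cases "prime p")
    case True
    then have p: "real p > 0" using prime_gt_0_nat by simp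
    have "((%s. 1 / real p powr s) \<longlongrightarrow> 1 / real p powr 1) (at_right 1)"
     using p by (intro tendsto_intros) auto
    then show ?thesis using True by simp
   qed simp
  qed
  moreover have "(\<Sum>p<m. if prime p then 1 / real p powr 1 else 0) = (\<Sum>p<m. if prime p then 1 / real p else 0)"
   by (intro sum.cong) auto
  ultimately have "\<forall>\<^sub>F s in at_right 1. Z < (\<Sum>p<m. if prime p then 1 / real p powr s else 0)"
   using m by (intro order_tendstoD(1)) auto
  moreover have "\<forall>\<^sub>F s in at_right (1::real). s > 1" by (rule eventually_at_right_less)
  ultimately show "\<forall>\<^sub>F s in at_right 1. Z <= P s"
  proof eventually_elim
   case (elim s)
   have "(\<Sum>p<m. if prime p then 1 / real p powr s else 0) <= P s"
    unfolding P_def using summ[OF elim(2), of "%_. True"] by (intro sum_le_suminf) auto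
   then show ?case using elim by simp
  qed
 qed
 define R where "R s = (\<Sum>p. if prime p & p \<in> S then 1 / real p powr s else 0)" for s :: real
 have key: "\<exists>B. \<forall>s>1. \<bar>R s - \<delta> * P s\<bar> <= eps * P s + B" if eps: "eps > 0" for eps :: real
 proof -
  have "\<forall>\<^sub>F Y in sequentially. \<bar>\<Sum>k\<le>Y. d k\<bar> <= eps * (\<Sum>k\<le>Y. a k)"
  proof -
   have "\<forall>\<^sub>F Y in sequentially. dist ((\<Sum>k\<le>Y. d k) / ln (real Y)) 0 < eps / 2"
    using limD eps by (intro tendstoD) auto
   then show ?thesis using evA eventually_gt_at_top[of 1]
   proof eventually_elim
    case (elim Y)
    then have l: "ln (real Y) > 0" by simp
    have "\<bar>\<Sum>k\<le>Y. d k\<bar> <= eps * (ln (real Y) / 2)" using elim(1) l by (simp add: field_simps)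
    also have "... <= eps * (\<Sum>k\<le>Y. a k)" using elim(2) eps by (intro mult_left_mono) auto
    finally show ?case .
   qed
  qed
  then obtain m where m: "!!Y. Y >= m ==> \<bar>\<Sum>k\<le>Y. d k\<bar> <= eps * (\<Sum>k\<le>Y. a k)"
   by (auto simp: eventually_sequentially)
  define B where "B = (\<Sum>Y<m. \<bar>\<Sum>k\<le>Y. d k\<bar>)"
  have B0: "B >= 0" by (simp add: B_def sum_nonneg)
  have bound: "\<bar>\<Sum>i\<le>k. d i\<bar> <= eps * (\<Sum>i\<le>k. a i) + B" for k
  proof (cases "k >= m")
   case True
   then show ?thesis using m[of k] B0 by linarith
  next
   case False
   then have "\<bar>\<Sum>i\<le>k. d i\<bar> <= B"
    unfolding B_def by (intro member_le_sum[of k "{..<m}" "%Y. \<bar>\<Sum>i\<le>Y. d i\<bar>"]) auto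
   moreover have "eps * (\<Sum>i\<le>k. a i) >= 0" using eps a0 by (intro mult_nonneg_nonneg sum_nonneg) auto
   ultimately show ?thesis by linarith
  qed
  have "\<bar>R s - \<delta> * P s\<bar> <= eps * P s + B * (1 / ln 2)" if s: "s > 1" for s
  proof -
   \<comment> \<open>\<open>max 2 k\<close> keeps ln away from 0 and 1 and preserves monotonicity;
     \<open>a\<close> vanishes at k < 2.\<close>
   define \<phi> where "\<phi> k = (real (max 2 k) powr (1 - s)) / ln (real (max 2 k))" for k
   have nonneg: "\<phi> k >= 0" for k by (simp add: \<phi>_def)
   have anti: "\<phi> (Suc k) <= \<phi> k" for k
    unfolding \<phi>_def using s by (intro frac_le powr_mono2' ln_mono) auto
   have \<phi>0: "\<phi> 0 <= 1 / ln 2"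
   proof -
    have "(2::real) powr (1 - s) <= 2 powr 0" using s by (intro powr_mono) auto
    then show ?thesis by (simp add: \<phi>_def divide_right_mono)
   qed
   have a\<phi>: "a k * \<phi> k = (if prime k then 1 / real k powr s else 0)" for k
   proof (cases "prime k")
    case True
    then have "k >= 2" by (rule prime_ge_2_nat)
    then show ?thesis using True by (simp add: a_def \<phi>_def powr_diff max_def)
   qed (simp add: a_def)
   have d\<phi>: "d k * \<phi> k = (if prime k & k \<in> S then 1 / real k powr s else 0) - \<delta> * (if prime k then 1 / real k powr s else 0)" for k
    unfolding d_def mult.assoc a\<phi> by (auto simp: diff_divide_distrib)
   have sP: "(%k. a k * \<phi> k) sums P s"
    unfolding a\<phi> P_def using summ[OF s, of "%_. True"] by (simp add: summable_sums)
   have sD: "(%k. d k * \<phi> k) sums (R s - \<delta> * P s)"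
    unfolding d\<phi> P_def R_def
    using summ[OF s, of "%_. True"] summ[OF s, of "%k. k \<in> S"]
    by (intro sums_diff sums_mult summable_sums) auto
   have "(%m. \<bar>\<Sum>k\<le>m. d k * \<phi> k\<bar>) \<longlonglongrightarrow> \<bar>R s - \<delta> * P s\<bar>"
    using sD by (intro tendsto_rabs) (simp add: sums_def_le)
   moreover have "(%m. eps * (\<Sum>k\<le>m. a k * \<phi> k) + B * (1 / ln 2)) \<longlonglongrightarrow> eps * P s + B * (1 / ln 2)"
    using sP by (intro tendsto_intros) (simp add: sums_def_le)
   moreover have "\<bar>\<Sum>k\<le>m. d k * \<phi> k\<bar> <= eps * (\<Sum>k\<le>m. a k * \<phi> k) + B * (1 / ln 2)" for m
    using sum_by_parts_bound[where \<phi> = \<phi> and d = d and a = a and eps = eps and B = B and m = m, OF anti nonneg bound] mult_left_mono[OF \<phi>0 B0] by linarith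
   ultimately show ?thesis by (intro LIMSEQ_le) auto
  qed
  then show ?thesis by blast
 qed
 have "((%s. R s / P s) \<longlongrightarrow> \<delta>) (at_right 1)"
 proof (rule tendstoI)
  fix e :: real assume e: "e > 0"
  obtain B where B: "!!s. s > 1 ==> \<bar>R s - \<delta> * P s\<bar> <= e / 2 * P s + B" using key[of "e / 2"] e by auto
  have "\<forall>\<^sub>F s in at_right 1. 2 * \<bar>B\<bar> / e + 1 <= P s" using P_top by (simp add: filterlim_at_top)
  moreover have "\<forall>\<^sub>F s in at_right (1::real). s > 1" by (rule eventually_at_right_less)
  ultimately show "\<forall>\<^sub>F s in at_right 1. dist (R s / P s) \<delta> < e"
  proof eventually_elim
   case (elim s)
   have "2 * \<bar>B\<bar> / e >= 0" using e by simp
   then have P0: "P s > 0" using elim by linarith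
   have "2 * \<bar>B\<bar> / e < P s" using elim by linarith
   then have "2 * \<bar>B\<bar> < P s * e" using e by (simp add: pos_divide_less_eq)
   then have "e / 2 * P s + B < e * P s" by (simp add: mult.commute)
   then have "\<bar>R s - \<delta> * P s\<bar> < e * P s" using B[OF elim(2)] by linarith
   moreover have "R s / P s - \<delta> = (R s - \<delta> * P s) / P s" using P0 by (simp add: field_simps)
   ultimately show ?case using P0 by (simp add: dist_real_def abs_divide pos_divide_less_eq)
  qed
 qed
 then show ?thesis unfolding has_dirichlet_density_def R_def P_def .
qed

section \<open>Arithmetic of the Eisenstein integers\<close>

text \<open>The element a + b w of Z[w], where w is a primitive cube root of unity, is Eis a b.\<close>
datatype eis = Eis (e0: int) (e1: int)

lemma eis_eq_iff: "x = y \<longleftrightarrow> e0 x = e0 y & e1 x = e1 y"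
 by (cases x; cases y) auto

instantiation eis :: comm_ring_1
begin
definition "0 = Eis 0 0"
definition "1 = Eis 1 0"
definition "x + y = Eis (e0 x + e0 y) (e1 x + e1 y)"
definition "- x = Eis (- e0 x) (- e1 x)"
definition "x - y = Eis (e0 x - e0 y) (e1 x - e1 y)"
definition "x * y = Eis (e0 x * e0 y - e1 x * e1 y) (e0 x * e1 y + e1 x * e0 y - e1 x * e1 y)"
instance
 by standard (simp_all add: zero_eis_def one_eis_def plus_eis_def uminus_eis_def minus_eis_def times_eis_def algebra_simps)
end

lemma eis_sel [simp]:
 "e0 0 = 0" "e1 0 = 0" "e0 1 = 1" "e1 1 = 0"
 "e0 (x + y) = e0 x + e0 y" "e1 (x + y) = e1 x + e1 y"
 "e0 (x - y) = e0 x - e0 y" "e1 (x - y) = e1 x - e1 y"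
 "e0 (- x) = - e0 x" "e1 (- x) = - e1 x"
 "e0 (x * y) = e0 x * e0 y - e1 x * e1 y"
 "e1 (x * y) = e0 x * e1 y + e1 x * e0 y - e1 x * e1 y"
 by (simp_all add: zero_eis_def one_eis_def plus_eis_def uminus_eis_def minus_eis_def times_eis_def)

lemma eis_of_nat [simp]: "e0 (of_nat k) = int k" "e1 (of_nat k) = 0"
 by (induction k) auto

lemma eis_of_int [simp]: "e0 (of_int k) = k" "e1 (of_int k) = 0"
 by (cases k; simp)+

lemma eis_numeral [simp]: "e0 (numeral k) = numeral k" "e1 (numeral k) = 0"
 using eis_of_nat[of "numeral k"] by simp_all

definition enorm :: "eis => int" where
 "enorm x = (e0 x)\<^sup>2 - e0 x * e1 x + (e1 x)\<^sup>2"

definition econj :: "eis => eis" where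
 "econj x = Eis (e0 x - e1 x) (- e1 x)"

lemma econj_sel [simp]: "e0 (econj x) = e0 x - e1 x" "e1 (econj x) = - e1 x"
 by (simp_all add: econj_def)

lemma econj_add [simp]: "econj (x + y) = econj x + econj y"
 and econj_diff [simp]: "econj (x - y) = econj x - econj y"
 and econj_uminus [simp]: "econj (- x) = - econj x"
 and econj_mult [simp]: "econj (x * y) = econj x * econj y"
 and econj_econj [simp]: "econj (econj x) = x"
 and econj_0 [simp]: "econj 0 = 0"
 and econj_1 [simp]: "econj 1 = 1"
 by (simp_all add: eis_eq_iff algebra_simps)

lemma econj_power [simp]: "econj (x ^ k) = econj x ^ k"
 by (induction k) simp_all

lemma econj_eq_0_iff [simp]: "econj x = 0 \<longleftrightarrow> x = 0"
 by (auto simp: eis_eq_iff)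

lemma enorm_eq: "of_int (enorm x) = x * econj x"
 by (simp add: eis_eq_iff enorm_def ring2)

lemma enorm_mult: "enorm (x * y) = enorm x * enorm y"
 by (simp add: enorm_def ring2)

lemma enorm_4: "4 * enorm x = (2 * e0 x - e1 x)\<^sup>2 + 3 * (e1 x)\<^sup>2"
 by (simp add: enorm_def ring2)

lemma enorm_nonneg [simp]: "enorm x >= 0"
 using enorm_4[of x] by (smt (verit) zero_le_power2)

lemma enorm_eq_0_iff [simp]: "enorm x = 0 \<longleftrightarrow> x = 0"
proof
 assume "enorm x = 0"
 then have "(2 * e0 x - e1 x)\<^sup>2 + 3 * (e1 x)\<^sup>2 = 0" using enorm_4[of x] by simp
 then have "(e1 x)\<^sup>2 = 0" "(2 * e0 x - e1 x)\<^sup>2 = 0" by (smt (verit) zero_le_power2)+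
 then show "x = 0" by (simp add: eis_eq_iff)
qed (simp add: enorm_def)

lemma enorm_pos_iff: "enorm x > 0 \<longleftrightarrow> x ~= 0"
 using enorm_nonneg[of x] enorm_eq_0_iff[of x] by linarith

instance eis :: idom
proof
 fix a b :: eis assume "a ~= 0" "b ~= 0"
 then have "enorm (a * b) ~= 0" unfolding enorm_mult by simp
 then show "a * b ~= 0" by auto
qed

definition \<omega> :: eis where "\<omega> = Eis 0 1"

lemma \<omega>_sel [simp]: "e0 \<omega> = 0" "e1 \<omega> = 1" by (simp_all add: \<omega>_def)

lemma \<omega>_sq: "\<omega> * \<omega> = - 1 - \<omega>" and \<omega>_cube: "\<omega> ^ 3 = 1"
 by (simp_all add: eis_eq_iff power3_eq_cube)

definition round_div :: "int => int => int" where
 "round_div a n = (2 * a + n) div (2 * n)"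

lemma round_div_bound:
 assumes "n > 0"
 shows "2 * \<bar>a - n * round_div a n\<bar> <= n"
proof -
 define q where "q = n * round_div a n"
 define m where "m = (2 * a + n) mod (2 * n)"
 have "2 * a + n = 2 * n * round_div a n + m" unfolding round_div_def m_def by simp
 then have "2 * a + n = 2 * q + m" by (simp add: q_def)
 moreover have "0 <= m" "m < 2 * n" using assms by (auto simp: m_def)
 ultimately have "2 * \<bar>a - q\<bar> <= n" by arith
 then show ?thesis by (simp add: q_def)
qed

instantiation eis :: modulo
begin
definition "x div y = (if y = 0 then 0 else
  Eis (round_div (e0 (x * econj y)) (enorm y)) (round_div (e1 (x * econj y)) (enorm y)))" for x y :: eis
definition "x mod y = x - x div y * y" for x y :: eis
instance ..
end

text \<open>Rounding leaves both coordinates of r = (x mod y) * conj y at most n / 2 in absolute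
  value, where n is the norm of y. So r has norm at most 3 n^2 / 4, and this norm is n times that of
  the remainder.\<close>

lemma enorm_mod_less:
 fixes x y :: eis
 assumes "y ~= 0"
 shows "enorm (x mod y) < enorm y"
proof -
 define n where "n = enorm y"
 have n: "n > 0" using assms by (simp add: n_def enorm_pos_iff)
 define r where "r = (x mod y) * econj y"
 have r: "r = x * econj y - of_int n * (x div y)"
  unfolding r_def n_def modulo_eis_def enorm_eq by (simp add: algebra_simps)
 have b: "2 * \<bar>e0 r\<bar> <= n" "2 * \<bar>e1 r\<bar> <= n"
  using assms n round_div_bound[OF n]
  by (simp_all add: r divide_eis_def n_def[symmetric])
 have "4 * enorm r <= 3 * n\<^sup>2"
 proof -
  have "(2 * \<bar>e0 r\<bar>)\<^sup>2 <= n\<^sup>2" by (rule power_mono[OF b(1)]) simp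
  moreover have "(2 * \<bar>e1 r\<bar>)\<^sup>2 <= n\<^sup>2" by (rule power_mono[OF b(2)]) simp
  moreover have "(2 * \<bar>e0 r\<bar>) * (2 * \<bar>e1 r\<bar>) <= n * n" by (rule mult_mono[OF b]) (use n in auto)
  moreover have "- (e0 r * e1 r) <= \<bar>e0 r\<bar> * \<bar>e1 r\<bar>" by (metis abs_ge_minus_self abs_mult)
  ultimately show ?thesis by (simp add: enorm_def power2_eq_square power_mult_distrib)
 qed
 moreover have "enorm (econj y) = n" by (simp add: enorm_def n_def ring2)
 then have "enorm r = enorm (x mod y) * n" by (simp add: r_def enorm_mult)
 ultimately have "4 * (enorm (x mod y) * n) <= 3 * (n * n)" by (simp add: power2_eq_square)
 then have "n * (4 * enorm (x mod y)) <= n * (3 * n)" by (simp add: algebra_simps)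
 then have "4 * enorm (x mod y) <= 3 * n" using n by simp
 then show ?thesis using n unfolding n_def by simp
qed

text \<open>Bezout in Z[w]: the element of least norm in the ideal (a, b) divides both.\<close>
lemma eis_bezout:
 fixes a b :: eis
 obtains d u v where "d dvd a" "d dvd b" "d = u * a + v * b"
proof (cases "a = 0 & b = 0")
 case True
 then show thesis using that[of 0 0 0] by simp
next
 case False
 define I where "I = {u * a + v * b | u v. u * a + v * b ~= 0}"
 have ex: "\<exists>d. d \<in> I"
  using False unfolding I_def by (metis (mono_tags, lifting) add.left_neutral add.right_neutral lambda_one mem_Collect_eq mult_zero_left)
 define d where "d = arg_min (%x. nat (enorm x)) (%x. x \<in> I)"
 have d: "d \<in> I" "!!x. x \<in> I ==> nat (enorm d) <= nat (enorm x)"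
  using ex arg_min_nat_lemma[of "%x. x \<in> I" _ "%x. nat (enorm x)"] unfolding d_def by blast+
 obtain u v where uv: "d = u * a + v * b" "d ~= 0" using d(1) by (auto simp: I_def)
 have dvd: "d dvd s * a + t * b" for s t
 proof -
  let ?x = "s * a + t * b"
  define q where "q = ?x div d"
  have "?x mod d = (s - q * u) * a + (t - q * v) * b"
   unfolding modulo_eis_def q_def[symmetric] by (simp add: uv(1) algebra_simps)
  then have "?x mod d \<in> I \<or> ?x mod d = 0"
   unfolding I_def mem_Collect_eq by metis
  moreover have "?x mod d \<notin> I" using d(2)[of "?x mod d"] enorm_mod_less[OF uv(2), of ?x]
   by (smt (verit) enorm_nonneg nat_less_eq_zless not_le)
  ultimately have "?x = ?x div d * d" by (simp add: modulo_eis_def)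
  then show ?thesis by (metis dvd_triv_right)
 qed
 have "d dvd a" "d dvd b" using dvd[of 1 0] dvd[of 0 1] by simp_all
 then show thesis using that uv(1) by blast
qed

lemma is_unit_eis_iff: "x dvd 1 \<longleftrightarrow> enorm x = 1" for x :: eis
proof
 assume "x dvd 1"
 then obtain y where "1 = x * y" by (elim dvdE)
 then have "enorm x * enorm y = 1" by (metis enorm_mult enorm_def eis_sel(3,4) mult_zero_right diff_zero add_0_right one_power2 power_zero_numeral)
 then show "enorm x = 1" using enorm_nonneg[of x] by (metis zmult_eq_1_iff not_one_le_zero le_minus_one_simps(3) order_trans)
next
 assume "enorm x = 1"
 then have "1 = x * econj x" using enorm_eq[of x] by simp
 then show "x dvd 1" by (rule dvdI)
qed

text \<open>4 N = (2 a - b)^2 + 3 b^2 = 4 leaves only coordinates in {-1, 0, 1}, and the solutions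
  are the six powers of -\<omega>.\<close>

lemma eis_units:
 fixes x :: eis
 assumes "x dvd 1"
 obtains k where "k < 3" "x = \<omega> ^ k" | k where "k < 3" "x = - (\<omega> ^ k)"
proof -
 have "4 * enorm x = 4" using assms is_unit_eis_iff by simp
 then have eq: "(2 * e0 x - e1 x)\<^sup>2 + 3 * (e1 x)\<^sup>2 = 4" using enorm_4 by simp
 have "\<bar>e1 x\<bar> < 2"
 proof (rule ccontr)
  assume "~ ?thesis"
  then have "2\<^sup>2 <= \<bar>e1 x\<bar>\<^sup>2" by (intro power_mono) auto
  then have "4 <= (e1 x)\<^sup>2" by simp
  moreover have "0 <= (2 * e0 x - e1 x)\<^sup>2" by simp
  ultimately show False using eq by linarith
 qed
 then have e1: "e1 x \<in> {-1, 0, 1}" by auto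
 have "\<bar>e0 x\<bar> < 2"
 proof (rule ccontr)
  assume "~ ?thesis"
  then have "3 <= \<bar>2 * e0 x - e1 x\<bar>" using e1 by auto
  then have "3\<^sup>2 <= \<bar>2 * e0 x - e1 x\<bar>\<^sup>2" by (intro power_mono) auto
  then have "9 <= (2 * e0 x - e1 x)\<^sup>2" by simp
  moreover have "0 <= (e1 x)\<^sup>2" by simp
  ultimately show False using eq by linarith
 qed
 then have e0: "e0 x \<in> {-1, 0, 1}" by auto
 have w: "\<omega> ^ 0 = Eis 1 0" "\<omega> ^ 1 = Eis 0 1" "\<omega> ^ 2 = Eis (-1) (-1)"
  by (simp_all add: eis_eq_iff power2_eq_square)
 have "x = \<omega> ^ 0 \<or> x = \<omega> ^ 1 \<or> x = \<omega> ^ 2 \<or> x = - (\<omega> ^ 0) \<or> x = - (\<omega> ^ 1) \<or> x = - (\<omega> ^ 2)"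
  unfolding w using e0 e1 eq by (auto simp: eis_eq_iff)
 then show thesis using that(1)[of 0] that(1)[of 1] that(1)[of 2] that(2)[of 0] that(2)[of 1] that(2)[of 2] by auto
qed

subsection \<open>Unions of subgroups\<close>

definition diff_closed :: "'a::ab_group_add set => bool" where
 "diff_closed S \<longleftrightarrow> (\<forall>v\<in>S. \<forall>w\<in>S. v - w \<in> S)"

text \<open>A calculus for the families \<open>G p\<close> of a norm form: the number of subgroups
  adds under unions and multiplies under intersections, and is all that has to be tracked.\<close>

definition union_of_groups :: "nat => 'a::ab_group_add set => bool" where
 "union_of_groups k S \<longleftrightarrow> (\<exists>\<C>. finite \<C> & card \<C> <= k & (\<forall>g\<in>\<C>. diff_closed g) & \<Union>\<C> = S)"

lemma union_of_groups_single: "diff_closed S ==> union_of_groups 1 S"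
 unfolding union_of_groups_def by (intro exI[of _ "{S}"]) auto

lemma union_of_groups_mono: "union_of_groups k S ==> k <= l ==> union_of_groups l S"
 unfolding union_of_groups_def
proof (elim exE conjE)
 fix \<C> assume "finite \<C>" "card \<C> <= k" "\<forall>g\<in>\<C>. diff_closed g" "\<Union>\<C> = S" "k <= l"
 then show "\<exists>\<C>. finite \<C> & card \<C> <= l & (\<forall>g\<in>\<C>. diff_closed g) & \<Union>\<C> = S"
  by (intro exI[of _ "\<C>"]) auto
qed

lemma union_of_groups_Un: "union_of_groups k S ==> union_of_groups l T ==> union_of_groups (k + l) (S \<union> T)"
 unfolding union_of_groups_def
proof (elim exE conjE)
 fix \<C> \<D> assume "finite \<C>" "card \<C> <= k" "\<forall>g\<in>\<C>. diff_closed g" "\<Union>\<C> = S"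
  "finite \<D>" "card \<D> <= l" "\<forall>g\<in>\<D>. diff_closed g" "\<Union>\<D> = T"
 then show "\<exists>\<E>. finite \<E> & card \<E> <= k + l & (\<forall>g\<in>\<E>. diff_closed g) & \<Union>\<E> = S \<union> T"
  by (intro exI[of _ "\<C> \<union> \<D>"]) (auto intro: order_trans[OF card_Un_le])
qed

lemma union_of_groups_Int: "union_of_groups k S ==> union_of_groups l T ==> union_of_groups (k * l) (S \<inter> T)"
 unfolding union_of_groups_def
proof (elim exE conjE)
 fix \<C> \<D> assume *: "finite \<C>" "card \<C> <= k" "\<forall>g\<in>\<C>. diff_closed g" "\<Union>\<C> = S"
  "finite \<D>" "card \<D> <= l" "\<forall>g\<in>\<D>. diff_closed g" "\<Union>\<D> = T"
 let ?\<E> = "(%(g, h). g \<inter> h) ` (\<C> \<times> \<D>)"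
 have "card ?\<E> <= card (\<C> \<times> \<D>)" using * by (intro card_image_le) auto
 also have "... <= k * l" using * by (simp add: card_cartesian_product mult_mono)
 finally have "card ?\<E> <= k * l" .
 moreover have "\<forall>g\<in>?\<E>. diff_closed g" using * by (auto simp: diff_closed_def)
 moreover have "\<Union>?\<E> = S \<inter> T" using * by auto
 moreover have "finite ?\<E>" using * by auto
 ultimately show "\<exists>\<E>. finite \<E> & card \<E> <= k * l & (\<forall>g\<in>\<E>. diff_closed g) & \<Union>\<E> = S \<inter> T"
  by blast
qed

subsection \<open>Reduction modulo primes\<close>

text \<open>Substitution of an integer w for \<omega>. Modulo a divisor of w^2 + w + 1 it is a ring
  homomorphism; for a prime modulus it is the reduction at a prime of degree 1.\<close>

definition ev :: "int => eis => int" where "ev w x = e0 x + e1 x * w"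

lemma ev_simps [simp]: "ev w (x + y) = ev w x + ev w y" "ev w (x - y) = ev w x - ev w y"
 "ev w (- x) = - ev w x" "ev w 1 = 1" "ev w 0 = 0" "ev w (of_int k) = k" "ev w (numeral j) = numeral j"
 by (simp_all add: ev_def algebra_simps)

lemma ev_mult: "m dvd w * w + w + 1 ==> [ev w (x * y) = ev w x * ev w y] (mod m)"
proof -
 assume m: "m dvd w * w + w + 1"
 have "ev w (x * y) - ev w x * ev w y = - (e1 x * e1 y) * (w * w + w + 1)"
  by (simp add: ev_def algebra_simps)
 then have "m dvd ev w (x * y) - ev w x * ev w y" using m by simp
 then show ?thesis by (simp add: cong_iff_dvd_diff)
qed

lemma ev_power: "m dvd w * w + w + 1 ==> [ev w (x ^ k) = ev w x ^ k] (mod m)"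
proof (induction k)
 case (Suc k)
 have "[ev w (x * x ^ k) = ev w x * ev w (x ^ k)] (mod m)" using Suc.prems by (rule ev_mult)
 also have "[ev w x * ev w (x ^ k) = ev w x * ev w x ^ k] (mod m)" using Suc by (intro cong_mult cong_refl)
 finally show ?case by simp
qed simp

lemma ev_cong: "[w = w'] (mod m) ==> [ev w x = ev w' x] (mod m)"
 unfolding ev_def by (intro cong_add cong_mult cong_refl)

lemma enorm_ev: "m dvd w * w + w + 1 ==> [enorm x = ev w x * ev (- 1 - w) x] (mod m)"
proof -
 assume m: "m dvd w * w + w + 1"
 have "enorm x - ev w x * ev (- 1 - w) x = (e1 x * e1 x) * (w * w + w + 1)"
  by (simp add: ev_def enorm_def ring2)
 then have "m dvd enorm x - ev w x * ev (- 1 - w) x" using m by simp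
 then show ?thesis by (simp add: cong_iff_dvd_diff)
qed

lemma conj_root: "m dvd w * w + w + 1 ==> m dvd (- 1 - w) * (- 1 - w) + (- 1 - w) + (1::int)"
 by (simp add: algebra_simps)

lemma prime_int_inverse:
 assumes "prime p" "~ int p dvd a"
 obtains b where "[a * b = 1] (mod int p)"
proof -
 have "coprime a (int p)" using assms prime_imp_coprime[of "int p" a] by (simp add: coprime_commute)
 then show thesis using that cong_solve_coprime_int by blast
qed

lemma prime_dvd_mult_int: "prime p ==> int p dvd a * b \<longleftrightarrow> int p dvd a \<or> int p dvd b"
 by (simp add: prime_dvd_mult_iff)

lemma prime_sq_dvd_mult:
 assumes p: "prime p" and d: "(int p)\<^sup>2 dvd a * b"
 shows "(int p dvd a & int p dvd b) \<or> (int p)\<^sup>2 dvd a \<or> (int p)\<^sup>2 dvd b"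
proof -
 have pe: "prime_elem (int p)" using p by (simp add: prime_imp_prime_elem)
 show ?thesis
  using prime_power_dvd_multD[OF pe d] prime_power_dvd_multD[OF pe, of 2 b a] d
  by (metis mult.commute zero_less_numeral)
qed

text \<open>If p divides the norm of a + b \<omega> but not b, then w = -a / b modulo p is a root of
  w^2 + w + 1. This is the degree 1 prime that contains the element.\<close>

lemma enorm_root:
 assumes p: "prime p" and "int p dvd enorm x" "~ int p dvd e1 x"
 obtains w where "0 <= w" "w < int p" "int p dvd w * w + w + 1" "int p dvd ev w x"
proof -
 obtain b where b: "[e1 x * b = 1] (mod int p)" using prime_int_inverse[OF p assms(3)] by blast
 define w where "w = (- e0 x * b) mod int p"
 have w: "[w = - e0 x * b] (mod int p)" by (simp add: w_def cong_def)
 have "[ev w x = e0 x + e1 x * (- e0 x * b)] (mod int p)"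
  unfolding ev_def using w by (intro cong_add cong_mult cong_refl)
 moreover have "e0 x + e1 x * (- e0 x * b) = e0 x * (1 - e1 x * b)" by (simp add: algebra_simps)
 moreover have "[e0 x * (1 - e1 x * b) = e0 x * (1 - 1)] (mod int p)" using b by (intro cong_mult cong_diff cong_refl)
 ultimately have 1: "int p dvd ev w x" by (metis cong_0_iff cong_trans diff_self mult_zero_right)
 have "[enorm x = (e1 x * e1 x) * (w * w + w + 1)] (mod int p)"
 proof -
  have "enorm x - (e1 x * e1 x) * (w * w + w + 1) = ev w x * (e0 x - e1 x - e1 x * w)"
   by (simp add: ev_def enorm_def ring2)
  then show ?thesis using 1 by (simp add: cong_iff_dvd_diff)
 qed
 then have "int p dvd (e1 x * e1 x) * (w * w + w + 1)" using assms(2) cong_dvd_iff by blast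
 then have "int p dvd w * w + w + 1" using assms(3) prime_dvd_mult_int[OF p] by blast
 moreover have "0 <= w" "w < int p" using prime_gt_0_nat[OF p] by (simp_all add: w_def)
 ultimately show thesis using 1 that by blast
qed

lemma dvd_e0_of_e1:
 assumes "prime p" "int p dvd enorm x" "int p dvd e1 x"
 shows "int p dvd e0 x"
proof -
 have "(e0 x)\<^sup>2 = enorm x + e1 x * (e0 x - e1 x)" by (simp add: enorm_def ring2)
 then have "int p dvd (e0 x)\<^sup>2" using assms by (metis dvd_add dvd_mult2)
 then show ?thesis using assms(1) prime_dvd_power_int_iff[of "int p" 2 "e0 x"] by simp
qed

lemma sq_dvd_enorm:
 assumes "m dvd e0 x" "m dvd e1 x"
 shows "m\<^sup>2 dvd enorm x"
proof -
 obtain a b where "e0 x = m * a" "e1 x = m * b" using assms by (elim dvdE)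
 then have "enorm x = m\<^sup>2 * (a\<^sup>2 - a * b + b\<^sup>2)" by (simp add: enorm_def ring2)
 then show ?thesis by simp
qed

lemma ev_dvd_two:
 assumes p: "prime p" and "int p dvd ev w x" "int p dvd ev w' x" "~ int p dvd w - w'"
 shows "int p dvd e0 x" "int p dvd e1 x"
proof -
 have "ev w x - ev w' x = e1 x * (w - w')" by (simp add: ev_def algebra_simps)
 then have "int p dvd e1 x * (w - w')" using assms dvd_diff by metis
 then show e1: "int p dvd e1 x" using assms prime_dvd_mult_int[OF p] by blast
 have "e0 x = ev w x - e1 x * w" by (simp add: ev_def)
 then show "int p dvd e0 x" using e1 assms by (metis dvd_diff dvd_mult2)
qed

lemma prime_not_dvd_3:
 assumes "prime p" "p ~= 3"
 shows "~ int p dvd 3"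
proof
 assume "int p dvd 3"
 then have "p dvd 3" by presburger
 then have "p <= 3" by (rule dvd_imp_le) simp
 then have "p = 2" using assms prime_ge_2_nat[of p] by simp
 then show False using \<open>p dvd 3\<close> by simp
qed

text \<open>(2 w + 1)^2 = 4 (w^2 + w + 1) - 3. The number 2 w + 1 is both the derivative used in
  lifting and the difference of the roots w and -1 - w.\<close>

lemma root_conj_distinct:
 assumes p: "prime p" "p ~= 3" and w: "int p dvd w * w + w + 1"
 shows "~ int p dvd 2 * w + 1"
proof
 assume "int p dvd 2 * w + 1"
 then have "int p dvd 4 * (w * w + w + 1) - (2 * w + 1) * (2 * w + 1)" using w by (intro dvd_diff dvd_mult) auto
 then have "int p dvd 3" by (simp add: algebra_simps)
 then show False using prime_not_dvd_3[OF p] by simp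
qed

lemma poly_taylor2: "\<exists>q. poly f (a + h) = poly f a + h * poly (pderiv f) a + h * h * q" for f :: "int poly"
proof (induction f)
 case (pCons c f)
 then obtain q where q: "poly f (a + h) = poly f a + h * poly (pderiv f) a + h * h * q" by blast
 show ?case
  by (rule exI[of _ "(a + h) * q + poly (pderiv f) a"]) (simp add: pderiv_pCons q algebra_simps)
qed simp

lemma hensel_step:
 fixes f :: "int poly"
 assumes p: "prime p" and k: "k > 0" and f: "int p ^ k dvd poly f a" and df: "~ int p dvd poly (pderiv f) a"
 obtains b where "[b = a] (mod int p ^ k)" "int p ^ Suc k dvd poly f b"
proof -
 obtain s where s: "poly f a = int p ^ k * s" using f by (elim dvdE)
 obtain i where i: "[poly (pderiv f) a * i = 1] (mod int p)" using prime_int_inverse[OF p df] by blast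
 \<comment> \<open>The Newton correction -f(a) / f'(a), with \<open>i\<close> in place of the
   inverse of the derivative.\<close>
 define h where "h = int p ^ k * (- s * i)"
 obtain q where q: "poly f (a + h) = poly f a + h * poly (pderiv f) a + h * h * q"
  using poly_taylor2 by blast
 obtain t where t: "poly (pderiv f) a * i - 1 = int p * t" using i by (auto simp: cong_iff_dvd_diff elim: dvdE)
 have kk: "int p ^ k * int p ^ k = int p ^ Suc k * int p ^ (k - 1)"
 proof -
  have "k + k = Suc k + (k - 1)" using k by simp
  then show ?thesis by (metis power_add)
 qed
 have "poly f (a + h) = int p ^ k * s + h * poly (pderiv f) a + h * h * q" using q s by simp
 also have "... = int p ^ k * (- s * (poly (pderiv f) a * i - 1)) + (int p ^ k * int p ^ k) * (s * s * i * i * q)"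
  by (simp add: h_def algebra_simps)
 also have "... = int p ^ Suc k * (- s * t + int p ^ (k - 1) * (s * s * i * i * q))"
  unfolding t kk by (simp add: algebra_simps)
 finally have "int p ^ Suc k dvd poly f (a + h)" by simp
 moreover have "[a + h = a] (mod int p ^ k)" by (simp add: h_def cong_iff_dvd_diff)
 ultimately show thesis using that by blast
qed

lemma cube_root_unity_lift:
 assumes p: "prime p" "p ~= 3" and k: "k > 0" and w: "int p ^ k dvd w * w + w + 1"
 obtains W where "[W = w] (mod int p ^ k)" "int p ^ Suc k dvd W * W + W + 1"
proof -
 have "int p dvd w * w + w + 1" using w k by (meson dvd_power dvd_trans)
 then have "~ int p dvd 2 * w + 1" using root_conj_distinct[OF p] by blast
 then have "~ int p dvd poly (pderiv [:1, 1, 1:]) w" by (simp add: pderiv_pCons algebra_simps)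
 moreover have "int p ^ k dvd poly [:1, 1, 1:] w" using w by (simp add: algebra_simps)
 ultimately obtain W where "[W = w] (mod int p ^ k)" "int p ^ Suc k dvd poly [:1, 1, 1:] W"
  using hensel_step[OF p(1) k] by blast
 then show thesis using that by (simp add: algebra_simps)
qed

lemma cube_root_lift:
 assumes p: "prime p" "p ~= 3" and k: "k > 0" and r: "int p ^ k dvd r ^ 3 - m" "~ int p dvd m"
 obtains R where "[R = r] (mod int p ^ k)" "int p ^ Suc k dvd R ^ 3 - m"
proof -
 have "int p dvd r ^ 3 - m" using r(1) k by (meson dvd_power dvd_trans)
 then have "~ int p dvd r ^ 3" using r(2) by (metis diff_diff_cancel dvd_diff diff_add_cancel dvd_diffD1 minus_diff_eq dvd_add_right_iff)
 then have nr: "~ int p dvd r" by (simp add: power3_eq_cube) (metis dvd_mult2 mult.assoc)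
 have "~ int p dvd poly (pderiv [:- m, 0, 0, 1:]) r"
  using prime_not_dvd_3[OF p] nr prime_dvd_mult_int[OF p(1)] by (simp add: pderiv_pCons algebra_simps)
 moreover have "int p ^ k dvd poly [:- m, 0, 0, 1:] r" using r(1) by (simp add: ring3)
 ultimately obtain R where "[R = r] (mod int p ^ k)" "int p ^ Suc k dvd poly [:- m, 0, 0, 1:] R"
  using hensel_step[OF p(1) k] by blast
 then show thesis using that by (simp add: ring3)
qed

definition wroots :: "nat => int set" where
 "wroots p = {w \<in> {0..<int p}. int p dvd w * w + w + 1}"

lemma finite_wroots [simp]: "finite (wroots p)" unfolding wroots_def by (rule finite_subset[of _ "{0..<int p}"]) auto

text \<open>The factor 2 is X div p + 1 at X = p. It is harmless, since these counts enter only as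
  bounds independent of p.\<close>

lemma card_monic_roots_le:
 fixes f :: "int poly"
 assumes "prime p" "lead_coeff f = 1"
 shows "card {a \<in> {0..<int p}. int p dvd poly f a} <= 2 * degree f"
 using card_poly_roots_mod_prime_power[OF assms, of p 0] assms(1) by (simp add: prime_gt_0_nat)

lemma card_wroots_le: "prime p ==> card (wroots p) <= 4"
 using card_monic_roots_le[of p "[:1, 1, 1:]"] by (simp add: wroots_def algebra_simps)

lemma wroots_distinct:
 assumes "prime p" "w \<in> wroots p" "w' \<in> wroots p" "w ~= w'"
 shows "~ int p dvd w - w'"
proof
 assume "int p dvd w - w'"
 then have "w mod int p = w' mod int p" by (simp add: mod_eq_dvd_iff)
 then show False using assms by (auto simp: wroots_def)
qed

subsection \<open>The rational primes and the split primes of Q(w)\<close>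

text \<open>The instance Z of rank 1, with the identity as the only linear form: Mertens' theorem up
  to o(ln Y).\<close>

lemma lmean_primes: "lmean (%_. 1) 1"
proof -
 interpret norm_form "%v :: unit => int. nat \<bar>v ()\<bar>" "%_ v. of_int (v ())" 1 1 1 "()" "%_. 1" "{}"
  "%_. {()}" "%_ _ v. v ()" "%p. {{v. (int p)\<^sup>2 dvd v ()}}"
 proof
  show "\<exists>f. degree f = 1 & lead_coeff f = 1 & (\<forall>a. int (nat \<bar>(v(() := a)) ()\<bar>) = \<bar>poly f a\<bar>)" for v :: "unit => int"
   by (rule exI[of _ "[:0, 1:]"]) simp
  show "nat \<bar>v ()\<bar> = 0 \<longleftrightarrow> v = 0" for v :: "unit => int" by (auto simp: fun_eq_iff)
  show "p\<^sup>2 dvd nat \<bar>v ()\<bar>" if "g \<in> {{v. (int p)\<^sup>2 dvd v ()}}" "v \<in> g" for p g and v :: "unit => int"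
   using that by (simp flip: int_dvd_int_iff)
  show "\<exists>g\<in>{{v. (int p)\<^sup>2 dvd v ()}}. v \<in> g" if "p\<^sup>2 dvd nat \<bar>v ()\<bar>" for p and v :: "unit => int"
   using that by (simp flip: int_dvd_int_iff)
  show "cmod (of_int (v ())) <= real 1 * real B" if "!!i. \<bar>v i\<bar> <= int B" for v :: "unit => int" and B
   using that[of "()"] by simp
 qed (auto simp flip: int_dvd_int_iff)
 show ?thesis using lmean_card_J by simp
qed

definition c\<omega> :: complex where "c\<omega> = Complex (- (1/2)) (sqrt 3 / 2)"

lemma c\<omega>_sq: "c\<omega> * c\<omega> = - 1 - c\<omega>"
 by (simp add: c\<omega>_def complex_eq_iff)

lemma c\<omega>_cube: "c\<omega> ^ 3 = 1"
 by (simp add: power3_eq_cube c\<omega>_sq algebra_simps)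

lemma norm_c\<omega> [simp]: "cmod c\<omega> = 1"
 by (simp add: c\<omega>_def cmod_def power_divide)

definition ceis :: "eis => complex" where "ceis x = of_int (e0 x) + of_int (e1 x) * c\<omega>"

lemma ceis_simps [simp]: "ceis (x + y) = ceis x + ceis y" "ceis (x - y) = ceis x - ceis y"
 "ceis (- x) = - ceis x" "ceis 0 = 0" "ceis 1 = 1" "ceis (of_int k) = of_int k" "ceis (numeral j) = numeral j"
 by (simp_all add: ceis_def algebra_simps)

lemma ceis_mult [simp]: "ceis (x * y) = ceis x * ceis y"
proof -
 have "ceis x * ceis y = of_int (e0 x * e0 y) + of_int (e0 x * e1 y + e1 x * e0 y) * c\<omega> + of_int (e1 x * e1 y) * (c\<omega> * c\<omega>)"
  by (simp add: ceis_def algebra_simps)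
 then show ?thesis unfolding c\<omega>_sq by (simp add: ceis_def algebra_simps)
qed

lemma ceis_power [simp]: "ceis (x ^ k) = ceis x ^ k"
 by (induction k) simp_all

lemma enorm_cmod: "real_of_int (enorm x) = (cmod (ceis x))\<^sup>2"
proof -
 have "(cmod (ceis x))\<^sup>2 = (of_int (e0 x) - of_int (e1 x) / 2)\<^sup>2 + (of_int (e1 x) * (sqrt 3 / 2))\<^sup>2"
  by (simp add: cmod_power2 ceis_def c\<omega>_def)
 also have "... = real_of_int (enorm x)"
  by (simp add: enorm_def power2_eq_square field_simps)
 finally show ?thesis by simp
qed

lemma ceis_eq_0_iff [simp]: "ceis x = 0 \<longleftrightarrow> x = 0"
 using enorm_cmod[of x] by (metis enorm_eq_0_iff norm_eq_zero of_int_eq_0_iff zero_eq_power2)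

lemma cmod_ceis_le: "cmod (ceis x) <= \<bar>real_of_int (e0 x)\<bar> + \<bar>real_of_int (e1 x)\<bar>"
 unfolding ceis_def by (rule order_trans[OF norm_triangle_ineq]) (simp add: norm_mult)

text \<open>The instance Z[\<omega>] of rank 2. At a split prime p^2 divides the norm in three ways:
  p divides the element, or one of the two roots, lifted modulo p^2, sends it to 0. At an inert
  prime only the first way remains.\<close>

lemma lmean_wroots: "lmean (%p. real (card (wroots p))) 1"
proof -
 define E where "E v = Eis (v False) (v True)" for v :: "bool => int"
 have E [simp]: "e0 (E v) = v False" "e1 (E v) = v True" "E (v - w) = E v - E w" for v w
  by (simp_all add: E_def eis_eq_iff)
 have "\<exists>\<C>. finite \<C> & card \<C> <= 4 & (\<forall>g\<in>\<C>. diff_closed g) & \<Union>\<C> = {v. (int p)\<^sup>2 dvd enorm (E v)}"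
  if p: "prime p" "p \<notin> {3}" for p
 proof -
  let ?m = "int p ^ 2"
  have dc: "diff_closed {v. m dvd ev w (E v)}" for m w by (auto simp: diff_closed_def)
  have dc0: "diff_closed {v :: bool => int. int p dvd v False & int p dvd v True}" by (auto simp: diff_closed_def)
  have "union_of_groups 4 {v. (int p)\<^sup>2 dvd enorm (E v)}"
  proof (cases "\<exists>w. int p dvd w * w + w + 1")
   case True
   then obtain w where w: "int p dvd w * w + w + 1" by blast
   then obtain W where W: "[W = w] (mod int p)" "?m dvd W * W + W + 1"
    using cube_root_unity_lift[of p 1 w] p by (auto simp: numeral_2_eq_2)
   have Wp: "int p dvd W * W + W + 1" using W(2) by (meson dvd_power dvd_trans zero_less_numeral)
   have dist: "~ int p dvd W - (- 1 - W)"
    using root_conj_distinct[of p W] p Wp by (simp add: algebra_simps)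
   have "{v. ?m dvd enorm (E v)} = {v. int p dvd v False & int p dvd v True} \<union> ({v. ?m dvd ev W (E v)} \<union> {v. ?m dvd ev (- 1 - W) (E v)})"
    (is "?L = ?R")
   proof (intro equalityI subsetI)
    fix v assume "v \<in> ?L"
    then have d: "?m dvd ev W (E v) * ev (- 1 - W) (E v)" using enorm_ev[OF W(2), of "E v"] cong_dvd_iff by blast
    show "v \<in> ?R"
    proof (cases "int p dvd ev W (E v) & int p dvd ev (- 1 - W) (E v)")
     case True
     then show ?thesis using ev_dvd_two[OF p(1) _ _ dist, of "E v"] by simp
    next
     case False
     then have "?m dvd ev W (E v) \<or> ?m dvd ev (- 1 - W) (E v)"
      using prime_sq_dvd_mult[OF p(1) d] by blast
     then show ?thesis by auto
    qed
   next
    fix v assume "v \<in> ?R"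
    then show "v \<in> ?L"
     using enorm_ev[OF W(2), of "E v"] sq_dvd_enorm[of "int p" "E v"] by (auto simp: cong_dvd_iff)
   qed
   moreover have "union_of_groups (1 + (1 + 1)) ({v. int p dvd v False & int p dvd v True} \<union> ({v. ?m dvd ev W (E v)} \<union> {v. ?m dvd ev (- 1 - W) (E v)}))"
    by (intro union_of_groups_Un union_of_groups_single dc dc0)
   ultimately show ?thesis using union_of_groups_mono by fastforce
  next
   case False
   have "{v. ?m dvd enorm (E v)} = {v. int p dvd v False & int p dvd v True}" (is "?L = ?R")
   proof (intro equalityI subsetI)
    fix v assume "v \<in> ?L"
    then have d: "int p dvd enorm (E v)" by (auto intro: dvd_trans[rotated])
    then have "int p dvd v True" using enorm_root[OF p(1) d] False by auto
    then show "v \<in> ?R" using dvd_e0_of_e1[OF p(1) d] by simp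
   next
    fix v assume "v \<in> ?R"
    then show "v \<in> ?L" using sq_dvd_enorm[of "int p" "E v"] by simp
   qed
   then show ?thesis using union_of_groups_mono[OF union_of_groups_single[OF dc0], of 4] by simp
  qed
  then show ?thesis unfolding union_of_groups_def .
 qed
 then obtain \<C> where \<C>: "!!p. prime p ==> p \<notin> {3} ==> finite (\<C> p) & card (\<C> p) <= 4 & (\<forall>g\<in>\<C> p. diff_closed g) & \<Union>(\<C> p) = {v. (int p)\<^sup>2 dvd enorm (E v)}"
  by metis
 have nat_dvd: "m dvd nat (enorm x) \<longleftrightarrow> int m dvd enorm x" for m x by (simp flip: int_dvd_int_iff)
 \<comment> \<open>The same embedding is taken for both indices: the conjugate one has the same
   absolute value, and only absolute values enter.\<close>
 interpret norm_form "%v. nat (enorm (E v))" "%_ v. ceis (E v)" 2 2 4 False "%b. if b then 0 else 1" "{3}"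
  wroots "%p w v. ev w (E v)" \<C>
 proof
  show "real (nat (enorm (E v))) = (\<Prod>k<(2::nat). cmod (ceis (E v)))" for v
   using enorm_cmod[of "E v"] by (simp add: power2_eq_square)
  show "cmod (ceis (E v)) <= real 2 * real B" if "!!i. \<bar>v i\<bar> <= int B" for v B
  proof -
   have "\<bar>real_of_int (v i)\<bar> <= real B" for i using that[of i] by linarith
   from this[of False] this[of True] show ?thesis using cmod_ceis_le[of "E v"] by simp
  qed
  show "ceis (E (v(False := a))) = ceis (E (v(False := 0))) + of_int a" for v a
   by (simp add: ceis_def)
  show "nat (enorm (E v)) = 0 \<longleftrightarrow> v = 0" for v
  proof -
   have "nat (enorm (E v)) = 0 \<longleftrightarrow> E v = 0" using enorm_nonneg[of "E v"] enorm_eq_0_iff[of "E v"] by linarith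
   also have "... \<longleftrightarrow> v False = 0 & v True = 0" by (simp add: eis_eq_iff)
   also have "... \<longleftrightarrow> v = 0" by (auto simp: fun_eq_iff) (metis (full_types))
   finally show ?thesis .
  qed
  show "\<exists>f. degree f = 2 & lead_coeff f = 1 & (\<forall>a. int (nat (enorm (E (v(False := a))))) = \<bar>poly f a\<bar>)" for v
  proof (intro exI[of _ "[:(v True)\<^sup>2, - v True, 1:]"] conjI allI)
   fix a
   have "poly [:(v True)\<^sup>2, - v True, 1:] a = enorm (E (v(False := a)))"
    by (simp add: enorm_def ring2)
   then show "int (nat (enorm (E (v(False := a))))) = \<bar>poly [:(v True)\<^sup>2, - v True, 1:] a\<bar>" by simp
  qed auto
  fix p assume p: "prime p" "p \<notin> {3::nat}"
  show "p dvd nat (enorm (E v))" if "j \<in> wroots p" "int p dvd ev j (E v)" for j v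
   unfolding nat_dvd using enorm_ev[of "int p" j "E v"] that by (auto simp: wroots_def cong_dvd_iff)
  show "p\<^sup>2 dvd nat (enorm (E v))" if "j \<in> wroots p" "j' \<in> wroots p" "j ~= j'" "int p dvd ev j (E v)" "int p dvd ev j' (E v)" for j j' v
   unfolding nat_dvd using ev_dvd_two[OF p(1) that(4,5) wroots_distinct[OF p(1) that(1-3)]] sq_dvd_enorm by simp
  show "\<exists>j\<in>wroots p. int p dvd ev j (E v)" if "p dvd nat (enorm (E v))" "~ p\<^sup>2 dvd nat (enorm (E v))" for v
  proof -
   have d: "int p dvd enorm (E v)" "~ int p ^ 2 dvd enorm (E v)" using that unfolding nat_dvd by auto
   then have "~ int p dvd e1 (E v)" using dvd_e0_of_e1[OF p(1) d(1)] sq_dvd_enorm by blast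
   then show ?thesis using enorm_root[OF p(1) d(1)] by (auto simp: wroots_def)
  qed
  show "finite (\<C> p) & card (\<C> p) <= 4" using \<C>[OF p] by simp
  show "v - w \<in> g" if "g \<in> \<C> p" "v \<in> g" "w \<in> g" for g v w using \<C>[OF p] that by (auto simp: diff_closed_def)
  show "p\<^sup>2 dvd nat (enorm (E v))" if "g \<in> \<C> p" "v \<in> g" for g v using \<C>[OF p] that unfolding nat_dvd by auto
  show "\<exists>g\<in>\<C> p. v \<in> g" if "p\<^sup>2 dvd nat (enorm (E v))" for v using \<C>[OF p] that unfolding nat_dvd by auto
 qed (auto simp: card_wroots_le ev_def algebra_simps)
 show ?thesis by (rule lmean_card_J)
qed

subsection \<open>The cubic Fermat equation\<close>

text \<open>The prime above 3, with lam^2 = -3 \<omega>.\<close>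

definition lam :: eis where "lam = 1 - \<omega>"

lemma lam_sel [simp]: "e0 lam = 1" "e1 lam = -1" by (simp_all add: lam_def)

text \<open>Modulo lam the unit \<omega> is 1, so a + b \<omega> reduces to a + b in the field with
  three elements.\<close>

lemma lam_dvd_iff: "lam dvd x \<longleftrightarrow> 3 dvd e0 x + e1 x"
proof
 assume "lam dvd x"
 then obtain y where "x = lam * y" by (elim dvdE)
 then show "3 dvd e0 x + e1 x" by simp
next
 assume "3 dvd e0 x + e1 x"
 then obtain s where s: "e0 x + e1 x = 3 * s" by (elim dvdE)
 have "x = lam * Eis (e0 x - s) s" using s by (simp add: eis_eq_iff)
 then show "lam dvd x" by (rule dvdI)
qed

lemma lam_dvd_mult_iff: "lam dvd x * y \<longleftrightarrow> lam dvd x \<or> lam dvd y"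
proof -
 have "e0 (x * y) + e1 (x * y) = (e0 x + e1 x) * (e0 y + e1 y) - 3 * (e1 x * e1 y)"
  by (simp add: algebra_simps)
 then have "3 dvd e0 (x * y) + e1 (x * y) \<longleftrightarrow> 3 dvd (e0 x + e1 x) * (e0 y + e1 y)"
  by presburger
 moreover have "prime (3::int)" by simp
 ultimately show ?thesis unfolding lam_dvd_iff using prime_dvd_mult_iff by blast
qed

lemma lam_dvd_power: "lam dvd x ^ k ==> lam dvd x"
proof (induction k)
 case (Suc k)
 then show ?case by (auto simp: lam_dvd_mult_iff)
qed (simp add: lam_dvd_iff)

text \<open>For x = 1 + lam y one has x^3 - 1 = lam^3 y (y + 1) (y - \<omega>^2), and the three
  factors run through all residues modulo lam, so a fourth factor lam appears. The case x = -1
  modulo lam follows by changing the sign.\<close>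

lemma cube_mod_lam:
 assumes "~ lam dvd x"
 shows "lam ^ 4 dvd x ^ 3 - 1 \<or> lam ^ 4 dvd x ^ 3 + 1"
proof -
 have one: "lam ^ 4 dvd x ^ 3 - 1" if "lam dvd x - 1" for x
 proof -
  obtain y where y: "x = 1 + lam * y" using \<open>lam dvd x - 1\<close> by (metis dvdE diff_add_cancel add.commute)
  have "lam dvd y * (y + 1) * (y - \<omega> * \<omega>)"
  proof -
   have "lam dvd y \<or> lam dvd y + 1 \<or> lam dvd y - \<omega> * \<omega>"
    unfolding lam_dvd_iff by simp presburger
   then show ?thesis by (auto simp: lam_dvd_mult_iff)
  qed
  then obtain t where t: "y * (y + 1) * (y - \<omega> * \<omega>) = lam * t" by (elim dvdE)
  have "x ^ 3 - 1 = lam ^ 3 * (y * (y + 1) * (y - \<omega> * \<omega>))"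
   unfolding y by (simp add: eis_eq_iff power3_eq_cube) (simp add: algebra_simps)
  then have "x ^ 3 - 1 = lam ^ 4 * t" unfolding t by (simp add: eval_nat_numeral mult_ac)
  then show ?thesis by simp
 qed
 have "3 dvd e0 x + e1 x - 1 \<or> 3 dvd e0 x + e1 x + 1" using assms unfolding lam_dvd_iff by presburger
 then show ?thesis
 proof
  assume "3 dvd e0 x + e1 x - 1"
  then have "lam dvd x - 1" by (simp add: lam_dvd_iff algebra_simps)
  then show ?thesis using one by blast
 next
  assume "3 dvd e0 x + e1 x + 1"
  then have "lam dvd - x - 1" unfolding lam_dvd_iff by simp presburger
  then have "lam ^ 4 dvd - (x ^ 3 + 1)" using one[of "- x"] by simp
  then show ?thesis using dvd_minus_iff by blast
 qed
qed

text \<open>Coprimality as a Bezout identity, the form in which it is produced and consumed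
  throughout the descent.\<close>

definition cop :: "eis => eis => bool" where "cop a b \<longleftrightarrow> (\<exists>u v. u * a + v * b = 1)"

lemma copI: "u * a + v * b = 1 ==> cop a b" unfolding cop_def by blast

lemma cop_commute: "cop a b \<longleftrightarrow> cop b a" unfolding cop_def by (metis add.commute)

lemma cop_mult: "cop a b ==> cop a c ==> cop a (b * c)"
proof -
 assume "cop a b" "cop a c"
 then obtain u v s t where uv: "u * a + v * b = 1" "s * a + t * c = 1" unfolding cop_def by blast
 have "(u * s * a + u * t * c + v * b * s) * a + (v * t) * (b * c) = (u * a + v * b) * (s * a + t * c)"
  by (simp add: algebra_simps)
 then show ?thesis using uv copI by simp
qed

lemma cop_dvd: "cop a b ==> c dvd a ==> cop c b"
 unfolding cop_def by (metis dvd_def mult.assoc mult.commute)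

lemma cop_power: "cop a b ==> cop a (b ^ k)"
proof (induction k)
 case 0
 show ?case by (rule copI[of 0 _ 1]) simp
qed (simp add: cop_mult)

lemma cop_dvd_mult: "cop a b ==> a dvd b * c ==> a dvd c"
proof -
 assume "cop a b" "a dvd b * c"
 then obtain u v where "u * a + v * b = 1" unfolding cop_def by blast
 then have "c = (u * a + v * b) * c" by simp
 also have "... = a * (u * c) + v * (b * c)" by (simp add: algebra_simps)
 finally have "c = a * (u * c) + v * (b * c)" .
 then show "a dvd c" using \<open>a dvd b * c\<close> by (metis dvd_add dvd_mult dvd_triv_left)
qed

lemma cop_lam:
 assumes "~ lam dvd c"
 shows "cop lam c"
proof -
 obtain d u v where d: "d dvd lam" "d dvd c" "d = u * lam + v * c" using eis_bezout by blast
 obtain f where f: "lam = d * f" using d(1) by (elim dvdE)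
 have "enorm d * enorm f = 3" using f by (simp add: enorm_mult[symmetric]) (simp add: enorm_def)
 then have "enorm d dvd 3" by (metis dvd_triv_left)
 moreover have "prime (3::int)" by simp
 ultimately have "enorm d = 1 \<or> enorm d = 3"
  using enorm_nonneg[of d] by (metis abs_of_nonneg prime_int_iff)
 moreover have "enorm d ~= 3"
 proof
  assume "enorm d = 3"
  then have "enorm f = 1" using \<open>enorm d * enorm f = 3\<close> by simp
  then have "f dvd 1" using is_unit_eis_iff by blast
  then obtain g where "1 = f * g" by (elim dvdE)
  then have "d = lam * g" using f by (metis mult.assoc mult_1_right)
  then have "lam dvd c" using d(2) by (metis dvd_trans dvd_triv_left)
  then show False using assms by simp
 qed
 ultimately have "d dvd 1" using is_unit_eis_iff by blast
 then obtain g where "1 = d * g" by (elim dvdE)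
 then have "(g * u) * lam + (g * v) * c = 1" using d(3) by (simp add: algebra_simps)
 then show ?thesis by (rule copI)
qed

text \<open>Let d be a greatest common divisor of a and c, a = d a' and c = d c'. Then a' b = d^2
  c'^3 with a' prime to c' and d prime to b, so a' and d^2 divide each other and a is d^3 up to a
  unit.\<close>

lemma cube_of_cop_prod:
 assumes ab: "cop a b" and eq: "a * b = c ^ 3"
 shows "\<exists>d u. u dvd 1 & a = u * d ^ 3"
proof (cases "a = 0")
 case True
 then show ?thesis by (intro exI[of _ 0] exI[of _ 1]) simp
next
 case False
 obtain d s t where d: "d dvd a" "d dvd c" "d = s * a + t * c" using eis_bezout by blast
 obtain a' c' where ac: "a = d * a'" "c = d * c'" using d by (elim dvdE)
 have d0: "d ~= 0" using ac False by auto
 have "d * (s * a' + t * c') = d * 1" using d(3) ac by (simp add: algebra_simps)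
 then have "s * a' + t * c' = 1" using d0 by (metis mult_left_cancel)
 then have "cop a' c'" by (rule copI)
 then have c3: "cop a' (c' ^ 3)" by (rule cop_power)
 have "d * (a' * b) = d * (d ^ 2 * c' ^ 3)" using eq ac by (simp add: power_mult_distrib eval_nat_numeral algebra_simps)
 then have e: "a' * b = d ^ 2 * c' ^ 3" using d0 by simp
 then have "a' dvd c' ^ 3 * d ^ 2" by (metis dvd_triv_left mult.commute)
 then have "a' dvd d ^ 2" using c3 cop_dvd_mult by blast
 then obtain f where f: "d ^ 2 = a' * f" by (elim dvdE)
 have "cop d b" using ab d(1) by (rule cop_dvd)
 then have "cop b (d ^ 2)" using cop_power cop_commute by blast
 then have "cop (d ^ 2) b" using cop_commute by blast
 moreover have "d ^ 2 dvd b * a'" using e by (metis dvd_triv_left mult.commute)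
 ultimately have "d ^ 2 dvd a'" using cop_dvd_mult by blast
 then obtain g where g: "a' = d ^ 2 * g" by (elim dvdE)
 have "a' ~= 0" using ac False by auto
 have "a' * 1 = a' * (f * g)" using f g by (metis mult.assoc mult_1_right)
 then have "1 = f * g" using \<open>a' ~= 0\<close> by (metis mult_left_cancel)
 then have "g dvd 1" by (metis dvd_triv_right)
 moreover have "a = g * d ^ 3" using ac g by (simp add: eval_nat_numeral algebra_simps)
 ultimately show ?thesis by blast
qed

lemma cube_of_cop_prod_unit:
 assumes "cop a b" "a * b = eps * c ^ 3" "eps dvd 1"
 shows "\<exists>d u. u dvd 1 & a = u * d ^ 3"
proof -
 obtain \<eta> where \<eta>: "1 = eps * \<eta>" using assms(3) by (elim dvdE)
 have "a * (b * \<eta>) = (eps * \<eta>) * c ^ 3" using assms(2) by (simp add: mult_ac)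
 then have "a * (b * \<eta>) = c ^ 3" using \<eta> by simp
 moreover have "cop a \<eta>" by (rule copI[of 0 _ eps]) (use \<eta> in simp)
 then have "cop a (b * \<eta>)" using assms(1) cop_mult by blast
 ultimately show ?thesis using cube_of_cop_prod by blast
qed

text \<open>lam^3 has norm 27, whereas a unit plus or minus 1 has norm at most 4, so divisibility
  forces 0.\<close>

lemma unit_cong_pm1:
 assumes "eps dvd 1" "lam ^ 3 dvd eps - 1 \<or> lam ^ 3 dvd eps + 1"
 shows "eps = 1 \<or> eps = -1"
proof -
 have enlam: "enorm (lam ^ 3) = 27" by (simp add: enorm_def eval_nat_numeral)
 have "27 dvd enorm (eps - 1) \<or> 27 dvd enorm (eps + 1)"
  using assms(2) by (metis enlam dvdE enorm_mult dvd_triv_left)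
 moreover have w: "\<omega> ^ 0 = Eis 1 0" "\<omega> ^ 1 = Eis 0 1" "\<omega> ^ 2 = Eis (-1) (-1)"
  by (simp_all add: eis_eq_iff power2_eq_square)
 have "eps \<in> {Eis 1 0, Eis 0 1, Eis (-1) (-1), Eis (-1) 0, Eis 0 (-1), Eis 1 1}"
  using assms(1)
 proof (rule eis_units)
  fix k :: nat assume k: "k < 3" "eps = \<omega> ^ k"
  then have "k = 0 \<or> k = 1 \<or> k = 2" by auto
  then show ?thesis unfolding k(2) using w by (elim disjE) simp_all
 next
  fix k :: nat assume k: "k < 3" "eps = - (\<omega> ^ k)"
  then have "k = 0 \<or> k = 1 \<or> k = 2" by auto
  then show ?thesis unfolding k(2) using w by (elim disjE) (simp_all add: uminus_eis_def)
 qed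
 ultimately show ?thesis by (auto simp: enorm_def eis_eq_iff)
qed

text \<open>Descent on the exponent of lam. The left side splits into x + y, x + \<omega> y and x +
  \<omega>^2 y, each divisible by lam. The quotients are pairwise coprime, hence cubes up to units,
  and their linear relation is an equation of the same shape with exponent lowered by 1. The unit
  \<open>eps\<close> is in the statement because the descent creates one.\<close>

lemma fermat_cubic_lam:
 assumes "eps dvd 1" "cop x y" "~ lam dvd z" "n > 0" "x ^ 3 + y ^ 3 = eps * (lam ^ n * z) ^ 3"
 shows False
 using assms
proof (induction n arbitrary: x y z eps)
 case (Suc n x y z eps)
 have unit: "~ lam dvd eps" using Suc.prems(1) by (metis dvd_trans is_unit_eis_iff lam_dvd_iff eis_sel(3,4) add_0_right not_numeral_le_zero zdvd_imp_le zero_less_one less_numeral_extra(1) numeral_le_one_iff semiring_norm(70))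
 have lamsum: "lam dvd x ^ 3 + y ^ 3" unfolding Suc.prems(5) by (simp add: power_mult_distrib)
 have nx: "~ lam dvd x" "~ lam dvd y"
 proof -
  have no: "~ (lam dvd x & lam dvd y)"
  proof
   assume "lam dvd x & lam dvd y"
   moreover obtain u v where "u * x + v * y = 1" using Suc.prems(2) unfolding cop_def by blast
   ultimately have "lam dvd 1" by (metis dvd_add dvd_mult)
   then show False by (simp add: lam_dvd_iff)
  qed
  have "lam dvd y ^ 3" if "lam dvd x" using lamsum that by (metis dvd_add_right_iff dvd_power dvd_trans zero_less_numeral)
  moreover have "lam dvd x ^ 3" if "lam dvd y" using lamsum that by (metis dvd_add_left_iff dvd_power dvd_trans zero_less_numeral)
  ultimately show "~ lam dvd x" "~ lam dvd y" using no lam_dvd_power by blast+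
 qed
 \<comment> \<open>Both cubes are 1 or -1 modulo lam^4, and the signs are opposite because lam
   divides the sum. So the exponent is at least 2, which the descent requires.\<close>
 have l4: "lam ^ 4 dvd x ^ 3 + y ^ 3"
 proof -
  have d: "lam dvd lam ^ 4" by (simp add: eval_nat_numeral)
  have *: "lam ^ 4 dvd x ^ 3 + y ^ 3" if "lam ^ 4 dvd x ^ 3 - s" "lam ^ 4 dvd y ^ 3 - t" "s \<in> {1, -1}" "t \<in> {1, -1}" for s t
  proof -
   have dd: "lam ^ 4 dvd (x ^ 3 + y ^ 3) - (s + t)"
    using dvd_add[OF that(1,2)] by (simp add: algebra_simps)
   then have "lam dvd (x ^ 3 + y ^ 3) - (s + t)" using d dvd_trans by blast
   then have "lam dvd s + t" using lamsum by (metis dvd_diff diff_diff_cancel minus_diff_eq dvd_minus_iff dvd_diff_right_iff dvd_diffD1 dvd_add_right_iff diff_add_cancel)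
   then have "s + t = 0" using that(3,4) by (auto simp: lam_dvd_iff)
   then show ?thesis using dd by simp
  qed
  have "\<exists>s\<in>{1,-1}. lam ^ 4 dvd x ^ 3 - s" using cube_mod_lam[OF nx(1)] by auto
  moreover have "\<exists>t\<in>{1,-1}. lam ^ 4 dvd y ^ 3 - t" using cube_mod_lam[OF nx(2)] by auto
  ultimately show ?thesis using * by blast
 qed
 have lam0: "lam ~= 0" by (simp add: eis_eq_iff)
 have n0: "n > 0"
 proof (rule ccontr)
  assume "~ n > 0"
  then have "lam ^ 3 * lam dvd lam ^ 3 * (eps * z ^ 3)"
   using l4 Suc.prems(5) by (simp add: power_mult_distrib eval_nat_numeral mult_ac)
  then have "lam dvd eps * z ^ 3" using lam0 by (metis dvd_times_left_cancel_iff power_not_zero dvd_mult_cancel_left)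
  then show False using unit Suc.prems(3) lam_dvd_mult_iff lam_dvd_power by blast
 qed
 text \<open>Multiplying y by a cube root of unity makes x + y the factor with the high power of lam.\<close>
 have main: False if xy: "cop x y" "~ lam dvd y" "x ^ 3 + y ^ 3 = eps * (lam ^ Suc n * z) ^ 3" "lam ^ 2 dvd x + y" for y
 proof -
  obtain b where "x + y = lam ^ 2 * b" using xy(4) by (elim dvdE)
  then have a0: "x + y = lam * (lam * b)" by (simp add: power2_eq_square mult.assoc)
  define b0 where "b0 = lam * b"
  define b1 where "b1 = b0 - y"
  define b2 where "b2 = b0 + \<omega> * \<omega> * y"
  have a1: "x + \<omega> * y = lam * b1" using a0 by (simp add: b1_def b0_def lam_def algebra_simps)
  have a2: "x + \<omega> * \<omega> * y = lam * b2"
  proof -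
   have "lam * (\<omega> * \<omega> * y) = \<omega> * \<omega> * y - y" by (simp add: eis_eq_iff lam_def)
   moreover have "lam * b2 = lam * b0 + lam * (\<omega> * \<omega> * y)" by (simp add: b2_def distrib_left)
   ultimately have "lam * b2 = (x + y) + (\<omega> * \<omega> * y - y)" using a0 by (simp only: b0_def)
   then show ?thesis by simp
  qed
  have "lam ^ 3 * (b0 * b1 * b2) = (x + y) * (x + \<omega> * y) * (x + \<omega> * \<omega> * y)"
   using a0 a1 a2 by (simp add: b0_def eval_nat_numeral mult_ac)
  also have "... = x ^ 3 + y ^ 3" by (simp add: eis_eq_iff power3_eq_cube) (simp add: algebra_simps)
  also have "... = lam ^ 3 * (eps * (lam ^ n * z) ^ 3)"
   unfolding xy(3) by (simp add: power_mult_distrib mult_ac)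
  finally have prod: "b0 * b1 * b2 = eps * (lam ^ n * z) ^ 3" using lam0 by simp
  have nb1: "~ lam dvd b1" using xy(2) by (simp add: b1_def b0_def dvd_diff_right_iff)
  have nb2: "~ lam dvd b2"
  proof
   assume "lam dvd b2"
   then have "lam dvd \<omega> * \<omega> * y" unfolding b2_def b0_def by (metis dvd_add_right_iff dvd_triv_left)
   then show False using xy(2) by (auto simp: lam_dvd_mult_iff) (auto simp: lam_dvd_iff)
  qed
  \<comment> \<open>Neither \<open>b1\<close> nor \<open>b2\<close> is divisible by lam, so the
    whole power of lam sits in \<open>b0\<close>.\<close>
  have "cop (lam ^ (3 * n)) (b1 * b2)"
   using nb1 nb2 cop_lam cop_mult cop_power cop_commute lam_dvd_mult_iff by metis
  moreover have "lam ^ (3 * n) dvd (b1 * b2) * b0"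
  proof -
   have "(b1 * b2) * b0 = lam ^ (3 * n) * (eps * z ^ 3)"
    using prod by (simp add: power_mult_distrib power_mult mult_ac flip: power_mult)
   then show ?thesis by simp
  qed
  ultimately obtain A where A: "b0 = lam ^ (3 * n) * A" using cop_dvd_mult by blast
  have "lam ^ (3 * n) * (A * b1 * b2) = lam ^ (3 * n) * (eps * z ^ 3)"
   using prod A by (simp add: power_mult_distrib mult_ac flip: power_mult)
  then have prod': "A * b1 * b2 = eps * z ^ 3" using lam0 by simp
  obtain u v where uv: "u * x + v * y = 1" using xy(1) unfolding cop_def by blast
  have xb: "x = b1 - \<omega> * b0" "y = b0 - b1"
  proof -
   show "y = b0 - b1" by (simp add: b1_def)
   have "x = lam * b0 - y" using a0 by (simp add: b0_def eq_diff_eq)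
   then show "x = b1 - \<omega> * b0" by (simp add: b1_def lam_def algebra_simps)
  qed
  have c01: "cop b0 b1"
   by (rule copI[of "v - u * \<omega>" _ "u - v"]) (use uv in \<open>simp add: xb algebra_simps\<close>)
  have yb2: "y = \<omega> * (b2 - b0)" 
   by (simp add: b2_def eis_eq_iff)
  have xb02: "x = lam * b0 - \<omega> * (b2 - b0)" using a0 yb2 by (simp add: b0_def eq_diff_eq)
  have c02: "cop b0 b2"
   by (rule copI[of "u * lam + u * \<omega> - v * \<omega>" _ "v * \<omega> - u * \<omega>"])
    (use uv yb2 xb02 in \<open>simp add: algebra_simps\<close>)
  have yb12: "y = \<omega> * \<omega> * (b1 - b2)"
   by (simp add: b1_def b2_def eis_eq_iff)
  have xb12: "x = b2 - \<omega> * b1"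
  proof -
   have "b2 - \<omega> * b1 = lam * b0 + (\<omega> * \<omega> + \<omega>) * y" by (simp add: b1_def b2_def lam_def algebra_simps)
   also have "\<omega> * \<omega> + \<omega> = -1" by (simp add: \<omega>_sq)
   finally have "b2 - \<omega> * b1 = lam * b0 - y" by simp
   moreover have "x + y = lam * b0" using a0 by (simp add: b0_def)
   ultimately have "x + y = (b2 - \<omega> * b1) + y" by simp
   then show ?thesis by (simp only: add_right_cancel)
  qed
  have c12: "cop b1 b2"
   by (rule copI[of "v * (\<omega> * \<omega>) - u * \<omega>" _ "u - v * (\<omega> * \<omega>)"])
    (use uv yb12 xb12 in \<open>simp add: algebra_simps\<close>)
  have cA: "cop A b1" "cop A b2" using c01 c02 A cop_dvd by (metis dvd_triv_right)+
  obtain s1 t1 where s1: "t1 dvd 1" "b1 = t1 * s1 ^ 3"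
   using cube_of_cop_prod_unit[of b1 "A * b2" eps z] c12 cA cop_mult cop_commute prod' Suc.prems(1)
   by (metis mult.assoc mult.commute)
  obtain s2 t2 where s2: "t2 dvd 1" "b2 = t2 * s2 ^ 3"
   using cube_of_cop_prod_unit[of b2 "A * b1" eps z] c12 cA cop_mult cop_commute prod' Suc.prems(1)
   by (metis mult.assoc mult.commute)
  obtain s0 t0 where s0: "t0 dvd 1" "A = t0 * s0 ^ 3"
   using cube_of_cop_prod_unit[of A "b1 * b2" eps z] cA cop_mult prod' Suc.prems(1)
   by (metis mult.assoc)
  obtain t1' where t1': "1 = t1 * t1'" using s1(1) by (elim dvdE)
  \<comment> \<open>This relation between the three factors becomes the new equation after dividing
    by the unit in front of s1^3.\<close>
  have rel: "b0 + \<omega> * b1 + \<omega> * \<omega> * b2 = 0"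
   by (simp add: b1_def b2_def eis_eq_iff)
  have \<omega>3: "\<omega> * \<omega> * \<omega> = 1" by (simp add: eis_eq_iff)
  define eps1 where "eps1 = \<omega> * t2 * t1'"
  define eps2 where "eps2 = - (\<omega> * \<omega> * t0 * t1')"
  have "\<omega> dvd 1" using \<omega>3 by (metis dvd_triv_right)
  moreover have "t1' dvd 1" using t1' by (metis dvd_triv_right)
  moreover have "a * b dvd 1" if "a dvd 1" "b dvd 1" for a b :: eis using mult_dvd_mono[OF that] by simp
  ultimately have un: "eps1 dvd 1" "eps2 dvd 1"
   using s0(1) s2(1) unfolding eps1_def eps2_def by simp_all
  have eq: "s1 ^ 3 + eps1 * s2 ^ 3 = eps2 * (lam ^ n * s0) ^ 3"
  proof -
   have "(\<omega> * \<omega> * t1') * (b0 + \<omega> * b1 + \<omega> * \<omega> * b2) = 0" using rel by simp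
   then have "(\<omega> * \<omega> * t1') * b0 + (\<omega> * \<omega> * \<omega>) * (t1 * t1') * s1 ^ 3 + (\<omega> * \<omega> * \<omega>) * (\<omega> * t2 * t1') * s2 ^ 3 = 0"
    by (simp add: s1(2) s2(2) algebra_simps)
   then have "(\<omega> * \<omega> * t1') * (lam ^ (3 * n) * (t0 * s0 ^ 3)) + s1 ^ 3 + eps1 * s2 ^ 3 = 0"
    unfolding \<omega>3 t1'[symmetric] eps1_def[symmetric] A s0(2) by simp
   then show ?thesis unfolding eps2_def
    by (simp add: power_mult_distrib mult_ac eq_neg_iff_add_eq_0 add_ac flip: power_mult)
  qed
  have ns: "~ lam dvd s1" "~ lam dvd s2" using nb1 nb2 s1(2) s2(2) by (auto simp: lam_dvd_mult_iff power3_eq_cube)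
  \<comment> \<open>The right side of \<open>eq\<close> is divisible by lam^3 and the cubes are 1 or
    -1 modulo lam^3. This forces \<open>eps1\<close> to be 1 or -1, so it is its own cube and can be
    absorbed into s2.\<close>
  have "lam ^ 3 dvd eps1 - 1 \<or> lam ^ 3 dvd eps1 + 1"
  proof -
   have "lam ^ 3 dvd (lam ^ n) ^ 3" using n0 by (metis dvd_power_same dvd_power)
   then have d: "lam ^ 3 dvd s1 ^ 3 + eps1 * s2 ^ 3" unfolding eq by (simp add: power_mult_distrib dvd_mult dvd_mult2)
   have d34: "lam ^ 3 dvd lam ^ 4" by (simp add: le_imp_power_dvd)
   have *: "lam ^ 3 dvd eps1 - 1 \<or> lam ^ 3 dvd eps1 + 1"
    if "lam ^ 4 dvd s1 ^ 3 - s" "lam ^ 4 dvd s2 ^ 3 - t" "s \<in> {1, -1}" "t \<in> {1, -1}" for s t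
   proof -
    have "lam ^ 3 dvd s1 ^ 3 - s" "lam ^ 3 dvd eps1 * (s2 ^ 3 - t)" using dvd_trans[OF d34 that(1)] dvd_mult[OF dvd_trans[OF d34 that(2)]] by simp_all
    then have "lam ^ 3 dvd (s1 ^ 3 + eps1 * s2 ^ 3) - ((s1 ^ 3 - s) + eps1 * (s2 ^ 3 - t))"
     using d by (metis dvd_add dvd_diff)
    then have "lam ^ 3 dvd s + eps1 * t" by (simp add: algebra_simps)
    moreover have "lam ^ 3 dvd eps1 - 1 \<longleftrightarrow> lam ^ 3 dvd 1 - eps1" by (metis dvd_minus_iff minus_diff_eq)
    moreover have "lam ^ 3 dvd eps1 + 1 \<longleftrightarrow> lam ^ 3 dvd - 1 - eps1" by (metis dvd_minus_iff minus_add_distrib diff_conv_add_uminus add.commute)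
    ultimately show ?thesis using that(3,4) by (auto simp: add.commute)
   qed
   have "\<exists>s\<in>{1,-1}. lam ^ 4 dvd s1 ^ 3 - s" using cube_mod_lam[OF ns(1)] by auto
   moreover have "\<exists>t\<in>{1,-1}. lam ^ 4 dvd s2 ^ 3 - t" using cube_mod_lam[OF ns(2)] by auto
   ultimately show ?thesis using * by blast
  qed
  then have eps1: "eps1 = 1 \<or> eps1 = -1" using un(1) unit_cong_pm1 by blast
  have cs: "cop s1 s2"
  proof -
   have "s1 dvd b1" "s2 dvd b2" using s1(2) s2(2) by (auto simp: power3_eq_cube)
   then show ?thesis using c12 cop_dvd cop_commute by metis
  qed
  have nz0: "~ lam dvd s0"
  proof
   assume "lam dvd s0"
   then have "lam dvd A" using s0(2) by (simp add: power3_eq_cube)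
   then have "lam dvd eps * z ^ 3" unfolding prod'[symmetric] by (simp add: mult.assoc)
   then show False using unit Suc.prems(3) lam_dvd_mult_iff lam_dvd_power by blast
  qed
  have cs': "cop s1 (eps1 * s2)"
  proof -
   obtain a b where "a * s1 + b * s2 = 1" using cs unfolding cop_def by blast
   then have "a * s1 + (b * eps1) * (eps1 * s2) = 1" using eps1 by auto
   then show ?thesis by (rule copI)
  qed
  have "s1 ^ 3 + (eps1 * s2) ^ 3 = eps2 * (lam ^ n * s0) ^ 3" using eq eps1 by auto
  then show False using Suc.IH[OF un(2) cs' nz0 n0] by simp
 qed
 have copw: "cop x (\<omega> * y)" if xy: "cop x y" for y
 proof -
  obtain u v where uv: "u * x + v * y = 1" using xy unfolding cop_def by blast
  have "(v * \<omega> * \<omega>) * (\<omega> * y) = v * y * \<omega> ^ 3" by (simp add: power3_eq_cube mult_ac)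
  then have "u * x + (v * \<omega> * \<omega>) * (\<omega> * y) = 1" using uv by (simp only: \<omega>_cube mult_1_right)
  then show ?thesis by (rule copI)
 qed
 have w3: "(\<omega> * y) ^ 3 = y ^ 3" for y using \<omega>_cube by (simp add: power_mult_distrib)
 have nw: "~ lam dvd \<omega> * y" if "~ lam dvd y" for y
  using that by (auto simp: lam_dvd_mult_iff) (auto simp: lam_dvd_iff)
 have sum_dvd: "lam dvd x + y"
 proof -
  have cx: "3 dvd (e0 x + e1 x) ^ 3 - (e0 x + e1 x)" and cy: "3 dvd (e0 y + e1 y) ^ 3 - (e0 y + e1 y)"
  proof -
   have c: "3 dvd a ^ 3 - a" for a :: int
   proof -
    have "a ^ 3 - a = (a - 1) * a * (a + 1)" by (simp add: ring3)
    moreover have "3 dvd a - 1 \<or> 3 dvd a \<or> 3 dvd a + 1" by presburger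
    ultimately show ?thesis by auto
   qed
   show "3 dvd (e0 x + e1 x) ^ 3 - (e0 x + e1 x)" "3 dvd (e0 y + e1 y) ^ 3 - (e0 y + e1 y)" by (rule c)+
  qed
  moreover have cub: "3 dvd (e0 (x ^ 3) + e1 (x ^ 3)) - (e0 x + e1 x) ^ 3" for x
  proof -
   have "(e0 (x ^ 3) + e1 (x ^ 3)) - (e0 x + e1 x) ^ 3 = 3 * (- 3 * (e0 x * (e1 x * e1 x)))"
    by (simp add: ring3)
   then show ?thesis by simp
  qed
  moreover have ls: "3 dvd e0 (x ^ 3) + e1 (x ^ 3) + (e0 (y ^ 3) + e1 (y ^ 3))"
   using lamsum by (simp add: lam_dvd_iff algebra_simps)
  ultimately have "3 dvd (e0 (x ^ 3) + e1 (x ^ 3) + (e0 (y ^ 3) + e1 (y ^ 3)))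
    - ((e0 (x ^ 3) + e1 (x ^ 3)) - (e0 x + e1 x) ^ 3) - ((e0 (y ^ 3) + e1 (y ^ 3)) - (e0 y + e1 y) ^ 3)
    - ((e0 x + e1 x) ^ 3 - (e0 x + e1 x)) - ((e0 y + e1 y) ^ 3 - (e0 y + e1 y))"
   using dvd_diff[OF dvd_diff[OF dvd_diff[OF dvd_diff[OF ls cub[of x]] cub[of y]] cx] cy] by -
  also have "(e0 (x ^ 3) + e1 (x ^ 3) + (e0 (y ^ 3) + e1 (y ^ 3)))
    - ((e0 (x ^ 3) + e1 (x ^ 3)) - (e0 x + e1 x) ^ 3) - ((e0 (y ^ 3) + e1 (y ^ 3)) - (e0 y + e1 y) ^ 3)
    - ((e0 x + e1 x) ^ 3 - (e0 x + e1 x)) - ((e0 y + e1 y) ^ 3 - (e0 y + e1 y)) = e0 x + e1 x + (e0 y + e1 y)"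
   by linarith
  finally have "3 dvd e0 x + e1 x + (e0 y + e1 y)" .
  then show ?thesis by (simp add: lam_dvd_iff algebra_simps)
 qed
 obtain b where b: "x + y = lam * b" using sum_dvd by (elim dvdE)
 have "3 dvd e0 b + e1 b \<or> 3 dvd e0 b + e1 b - (e0 y + e1 y) \<or> 3 dvd e0 b + e1 b + (e0 y + e1 y)"
  using nx(2) unfolding lam_dvd_iff by presburger
 then have "lam dvd b \<or> lam dvd b - y \<or> lam dvd b + \<omega> * \<omega> * y"
 proof (elim disjE)
  assume "3 dvd e0 b + e1 b + (e0 y + e1 y)"
  moreover have "e0 (b + \<omega> * \<omega> * y) + e1 (b + \<omega> * \<omega> * y) = e0 b + e1 b + (e0 y + e1 y) + 3 * (- e0 y)"
   by (simp add: algebra_simps)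
  ultimately show ?thesis unfolding lam_dvd_iff by presburger
 qed (auto simp: lam_dvd_iff algebra_simps)
 then consider "lam ^ 2 dvd x + y" | "lam ^ 2 dvd x + \<omega> * y" | "lam ^ 2 dvd x + \<omega> * (\<omega> * y)"
 proof (elim disjE)
  assume "lam dvd b - y"
  moreover have "x + \<omega> * y = lam * (b - y)" using b by (simp add: lam_def algebra_simps)
  ultimately have "lam ^ 2 dvd x + \<omega> * y" by (simp add: power2_eq_square mult_dvd_mono)
  then show thesis using that by blast
 next
  assume "lam dvd b + \<omega> * \<omega> * y"
  moreover have "lam * (\<omega> * \<omega> * y) = \<omega> * \<omega> * y - y" by (simp add: eis_eq_iff lam_def)
  then have "x + \<omega> * (\<omega> * y) = lam * b + lam * (\<omega> * \<omega> * y)" unfolding b[symmetric] by (simp add: mult.assoc)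
  then have "x + \<omega> * (\<omega> * y) = lam * (b + \<omega> * \<omega> * y)" by (simp only: distrib_left)
  ultimately have "lam ^ 2 dvd x + \<omega> * (\<omega> * y)" by (simp add: power2_eq_square mult_dvd_mono)
  then show thesis using that by blast
 qed (use that b in \<open>simp add: power2_eq_square mult_dvd_mono\<close>)
 then show False
 proof cases
  case 1
  then show False using main[of y] Suc.prems nx by blast
 next
  case 2
  then show False using main[of "\<omega> * y"] Suc.prems nx copw nw w3 by simp
 next
  case 3
  then show False using main[of "\<omega> * (\<omega> * y)"] Suc.prems nx copw nw w3 by simp
 qed
qed simp

lemma lam_valuation:
 fixes x :: eis
 assumes "x ~= 0"
 obtains n y where "x = lam ^ n * y" "~ lam dvd y"
proof -
 have "\<exists>n y. x = lam ^ n * y & ~ lam dvd y"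
  using assms
 proof (induction "nat (enorm x)" arbitrary: x rule: less_induct)
  case less
  show ?case
  proof (cases "lam dvd x")
   case True
   then obtain z where z: "x = lam * z" by (elim dvdE)
   have "enorm x = 3 * enorm z" unfolding z enorm_mult by (simp add: enorm_def)
   moreover have "z ~= 0" using z less.prems by auto
   ultimately have "nat (enorm z) < nat (enorm x)" using enorm_pos_iff[of z] by simp
   then obtain n y where "z = lam ^ n * y" "~ lam dvd y" using less.hyps \<open>z ~= 0\<close> by blast
   then show ?thesis using z by (intro exI[of _ "Suc n"] exI[of _ y]) (simp add: mult.assoc)
  next
   case False
   then show ?thesis by (intro exI[of _ 0] exI[of _ x]) simp
  qed
 qed
 then show thesis using that by blast
qed

lemma fermat_cubic_3_dvd:
 fixes x y z :: int
 assumes "coprime x y" "3 dvd z" "z ~= 0"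
 shows "x ^ 3 + y ^ 3 ~= z ^ 3"
proof
 assume eq: "x ^ 3 + y ^ 3 = z ^ 3"
 obtain u v where "u * x + v * y = 1" using assms(1) by (metis bezout_int coprime_imp_gcd_eq_1)
 then have "of_int u * of_int x + of_int v * of_int y = (1::eis)" by (metis of_int_1 of_int_add of_int_mult)
 then have cop: "cop (of_int x) (of_int y)" by (rule copI)
 have "(of_int z :: eis) ~= 0" using assms(3) by (simp add: eis_eq_iff)
 then obtain n z' where z': "(of_int z :: eis) = lam ^ n * z'" "~ lam dvd z'" by (rule lam_valuation)
 have "lam dvd of_int z" using assms(2) by (simp add: lam_dvd_iff)
 then have "n > 0" using z' by (cases n) auto
 moreover have "(of_int x) ^ 3 + (of_int y) ^ 3 = 1 * (lam ^ n * z') ^ 3"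
  unfolding z'(1)[symmetric] by (simp flip: of_int_power of_int_add add: eq)
 ultimately show False using fermat_cubic_lam[of 1 "of_int x" "of_int y" z' n] cop z'(2) by simp
qed

lemma cube_mod_9: "(x::int) ^ 3 mod 9 \<in> (if 3 dvd x then {0} else {1, 8})"
proof -
 have "x mod 9 \<in> {0, 1, 2, 3, 4, 5, 6, 7, 8}" by auto
 moreover have "x ^ 3 mod 9 = (x mod 9) ^ 3 mod 9" by (simp add: power_mod)
 moreover have "3 dvd x \<longleftrightarrow> 3 dvd x mod 9" by (simp add: dvd_mod_iff)
 ultimately show ?thesis by (elim insertE emptyE) simp_all
qed

text \<open>After division by the gcd one of the three numbers is divisible by 3, because cubes
  prime to 3 are 1 or 8 modulo 9. Moving it to the right side by sign changes reduces to the case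
  settled by descent at lam.\<close>

theorem fermat_cubic:
 fixes x y z :: int
 assumes "x ^ 3 + y ^ 3 = z ^ 3"
 shows "x = 0 \<or> y = 0 \<or> z = 0"
proof (rule ccontr)
 assume nz: "~ ?thesis"
 define g where "g = gcd x y"
 have g0: "g ~= 0" using nz by (simp add: g_def)
 obtain x' y' where xy: "x = g * x'" "y = g * y'" "coprime x' y'"
  using gcd_coprime_exists[of x y] g0 unfolding g_def by (metis mult.commute)
 have "g ^ 3 * (x' ^ 3 + y' ^ 3) = z ^ 3" using assms xy by (simp add: power_mult_distrib distrib_left)
 then have "g ^ 3 dvd z ^ 3" by (metis dvd_triv_left)
 then have "g dvd z" by (simp add: pow_divides_pow_iff)
 then obtain z' where z: "z = g * z'" by (elim dvdE)
 have eq: "x' ^ 3 + y' ^ 3 = z' ^ 3"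
 proof -
  have "g ^ 3 * (x' ^ 3 + y' ^ 3) = g ^ 3 * z' ^ 3" using assms xy z by (simp add: power_mult_distrib distrib_left)
  then show ?thesis using g0 by simp
 qed
 have nz': "x' ~= 0" "y' ~= 0" "z' ~= 0" using nz xy z by auto
 have "3 dvd x' \<or> 3 dvd y' \<or> 3 dvd z'"
 proof (rule ccontr)
  assume n: "~ ?thesis"
  have "(x' ^ 3 mod 9 + y' ^ 3 mod 9) mod 9 = z' ^ 3 mod 9" using eq by (simp add: mod_add_eq)
  then show False using n cube_mod_9[of x'] cube_mod_9[of y'] cube_mod_9[of z'] by auto
 qed
 moreover have "coprime z' (- y')" "coprime z' (- x')"
 proof -
  have "gcd z' y' dvd x' ^ 3" "gcd z' x' dvd y' ^ 3"
  proof -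
   have d: "gcd a b dvd a ^ 3 - b ^ 3" for a b :: int
    by (rule dvd_diff[OF dvd_trans[OF gcd_dvd1 dvd_power] dvd_trans[OF gcd_dvd2 dvd_power]]) simp_all
   have "z' ^ 3 - y' ^ 3 = x' ^ 3" "z' ^ 3 - x' ^ 3 = y' ^ 3" using eq by simp_all
   then show "gcd z' y' dvd x' ^ 3" "gcd z' x' dvd y' ^ 3" using d[of z' y'] d[of z' x'] by (simp_all only:)
  qed
  moreover have "coprime (gcd z' y') (x' ^ 3)" "coprime (gcd z' x') (y' ^ 3)"
  proof -
   have "coprime (gcd z' y') x'" by (rule coprime_divisors[OF gcd_dvd2 dvd_refl]) (use xy(3) in \<open>simp add: coprime_commute\<close>)
   moreover have "coprime (gcd z' x') y'" by (rule coprime_divisors[OF gcd_dvd2 dvd_refl xy(3)])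
   ultimately show "coprime (gcd z' y') (x' ^ 3)" "coprime (gcd z' x') (y' ^ 3)" by simp_all
  qed
  ultimately have "is_unit (gcd z' y')" "is_unit (gcd z' x')" using coprime_absorb_left by blast+
  then show "coprime z' (- y')" "coprime z' (- x')" by (simp_all add: coprime_iff_gcd_eq_1)
 qed
 moreover have "z' ^ 3 + (- y') ^ 3 = x' ^ 3" "z' ^ 3 + (- x') ^ 3 = y' ^ 3" using eq by simp_all
 ultimately show False using fermat_cubic_3_dvd eq nz' xy(3) by blast
qed

text \<open>The 3-periodic points of t / (x^2 + x), t = m / d, are controlled by the cube roots of this number.\<close>
definition kap :: "int => int => eis" where
 "kap m d = of_int (d\<^sup>2) * (\<omega> * \<omega> * (of_int (27 * m) + of_int (3 * d) * (\<omega> * \<omega> - 1)))"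

lemma kap_sel: "e0 (kap m d) = d\<^sup>2 * (3 * d - 27 * m)" "e1 (kap m d) = d\<^sup>2 * (6 * d - 27 * m)"
 by (simp_all add: kap_def ring2)

text \<open>Modulo 2 the form becomes P^3 + P Q^2 + Q^3, which is odd unless both arguments are
  even.\<close>

lemma irreducible_cubic:
 fixes P Q :: int
 assumes "P ^ 3 - 6 * P\<^sup>2 * Q + 3 * P * Q\<^sup>2 + Q ^ 3 = 0"
 shows "P = 0 & Q = 0"
proof (rule ccontr)
 assume nz: "~ ?thesis"
 define g where "g = gcd P Q"
 have g0: "g ~= 0" using nz by (auto simp: g_def)
 obtain a b where ab: "P = g * a" "Q = g * b" "coprime a b"
  using gcd_coprime_exists[of P Q] g0 unfolding g_def by (metis mult.commute)
 have "g ^ 3 * (a ^ 3 - 6 * a\<^sup>2 * b + 3 * a * b\<^sup>2 + b ^ 3) = 0"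
  using assms unfolding ab by (simp add: ring3 power2_eq_square)
 then have "a ^ 3 - 6 * a\<^sup>2 * b + 3 * a * b\<^sup>2 + b ^ 3 = 0" using g0 by simp
 then have "even (a ^ 3 - 6 * a\<^sup>2 * b + 3 * a * b\<^sup>2 + b ^ 3)" by simp
 then have "even a & even b" by (auto simp: power2_eq_square)
 then show False using ab(3) by (metis coprime_common_divisor odd_one)
qed

text \<open>Multiplying by the cube of conj b makes the cofactor of kap an integer cube E^3. The
  coordinates S - 3 r^3 and S of w^3, with r = E d, have the cube n^3 as their norm, and this norm
  equation is equivalent to (6 r^3 - S)^3 + (3 r^3 + S)^3 = (3 r n)^3. Fermat leaves three cases: m
  = 0, a zero of the irreducible cubic form, or w = 0.\<close>

theorem kap_not_cube:
 assumes m: "m ~= 0" and d: "d ~= 0" and b: "b ~= 0" and eq: "a ^ 3 = kap m d * b ^ 3"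
 shows False
proof -
 define w where "w = a * econj b"
 define E where "E = enorm b"
 have E0: "E ~= 0" using b by (simp add: E_def)
 have w3: "w ^ 3 = kap m d * of_int (E ^ 3)"
 proof -
  have "w ^ 3 = kap m d * (b * econj b) ^ 3" by (simp add: w_def power_mult_distrib eq mult_ac)
  then show ?thesis by (simp add: enorm_eq[symmetric] E_def)
 qed
 define P where "P = e0 w"
 define Q where "Q = e1 w"
 have A: "P ^ 3 + Q ^ 3 - 3 * P * Q\<^sup>2 = E ^ 3 * (d\<^sup>2 * (3 * d - 27 * m))"
  using arg_cong[OF w3, of e0] by (simp add: kap_sel P_def Q_def ring23)
 have B: "3 * P * Q * (P - Q) = E ^ 3 * (d\<^sup>2 * (6 * d - 27 * m))"
  using arg_cong[OF w3, of e1] by (simp add: kap_sel P_def Q_def ring23)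
 define r where "r = E * d"
 define S where "S = 3 * P * Q * (P - Q)"
 have AS: "P ^ 3 + Q ^ 3 - 3 * P * Q\<^sup>2 = S - 3 * r ^ 3"
  unfolding A S_def B r_def by (simp add: ring23)
 have r0: "r ~= 0" using E0 d by (simp add: r_def)
 define n where "n = P\<^sup>2 - P * Q + Q\<^sup>2"
 have n: "n = enorm w" by (simp add: n_def enorm_def P_def Q_def)
 have nS: "n ^ 3 = (S - 3 * r ^ 3)\<^sup>2 - (S - 3 * r ^ 3) * S + S\<^sup>2"
  unfolding AS[symmetric] unfolding S_def n_def by (simp add: ring23)
 have "(6 * r ^ 3 - S) ^ 3 + (3 * r ^ 3 + S) ^ 3 = 27 * r ^ 3 * ((S - 3 * r ^ 3)\<^sup>2 - (S - 3 * r ^ 3) * S + S\<^sup>2)"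
  by (simp add: ring23)
 also have "... = (3 * r * n) ^ 3" unfolding nS[symmetric] by (simp add: power_mult_distrib)
 finally have "6 * r ^ 3 - S = 0 \<or> 3 * r ^ 3 + S = 0 \<or> 3 * r * n = 0" by (rule fermat_cubic)
 moreover have "6 * r ^ 3 - S ~= 0"
 proof -
  have "6 * r ^ 3 - S = 27 * m * (d\<^sup>2 * E ^ 3)" unfolding S_def B r_def by (simp add: ring23)
  then show ?thesis using m d E0 by simp
 qed
 moreover have "n ~= 0"
 proof
  assume "n = 0"
  then have "w = 0" using n by simp
  then have "S = 0" "S - 3 * r ^ 3 = 0" using AS by (simp_all add: S_def P_def Q_def)
  then show False using r0 by simp
 qed
 moreover have "3 * r ^ 3 + S ~= 0"
 proof
  assume s: "3 * r ^ 3 + S = 0"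
  then have "P ^ 3 + Q ^ 3 - 3 * P * Q\<^sup>2 = 2 * S" using AS by simp
  then have "P ^ 3 - 6 * P\<^sup>2 * Q + 3 * P * Q\<^sup>2 + Q ^ 3 = 0"
   by (simp add: S_def ring2)
  then have "P = 0 & Q = 0" by (rule irreducible_cubic)
  then have "w = 0" by (simp add: P_def Q_def eis_eq_iff)
  then show False using \<open>n ~= 0\<close> n by simp
 qed
 ultimately show False using r0 by simp
qed

subsection \<open>Cubic extensions of Q(w)\<close>

text \<open>The norm of x + y \<theta> + z \<theta>^2 for \<theta>^3 = m, over any commutative
  ring.\<close>

definition nu :: "'a::comm_ring_1 => 'a => 'a => 'a => 'a" where
 "nu m x y z = x ^ 3 + m * y ^ 3 + m ^ 2 * z ^ 3 - 3 * m * x * y * z"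

text \<open>If the norm form is isotropic modulo a prime, then m is a cube there: clear z first, then y.\<close>
lemma nu_isotropic:
 fixes Z :: "'a::comm_ring_1 => bool"
 assumes add: "!!a b. Z a ==> Z b ==> Z (a + b)"
  and mult: "!!a b. Z b ==> Z (a * b)"
  and prime: "!!a b. Z (a * b) ==> Z a \<or> Z b"
  and Z: "Z (nu m x y z)" and nz: "~ (Z x & Z y & Z z)"
 shows "\<exists>a b. ~ Z b & Z (a ^ 3 - m * b ^ 3)"
proof -
 have uminus: "Z (- a)" if "Z a" for a using mult[OF that, of "- 1"] by simp
 have diff: "Z (a - b)" if "Z a" "Z b" for a b using add[OF that(1) uminus[OF that(2)]] by simp
 have cube: "Z a" if "Z (a ^ 3)" for a using that prime by (auto simp: power3_eq_cube)
 \<comment> \<open>Multiplying x + y \<theta> + z \<theta>^2 by y - z \<theta> removes \<theta>^2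
   and gives -a + b \<theta>. Taking norms yields the identity \<open>id\<close>.\<close>
 define a where "a = z * z * m - x * y"
 define b where "b = y * y - x * z"
 have id: "a ^ 3 - m * b ^ 3 = (m * z ^ 3 - y ^ 3) * nu m x y z"
  unfolding a_def b_def nu_def by (simp add: power3_eq_cube power2_eq_square) (simp add: algebra_simps)
 show ?thesis
 proof (cases "Z b")
  case False
  moreover have "Z (a ^ 3 - m * b ^ 3)" unfolding id using mult[OF Z] .
  ultimately show ?thesis by blast
 next
  case True
  have "Z (a ^ 3 - m * b ^ 3)" unfolding id using mult[OF Z] .
  moreover have "Z (m * b ^ 3)" using True mult by (metis mult.assoc power3_eq_cube mult.commute)
  ultimately have "Z (a ^ 3)" using add by (metis diff_add_cancel)
  then have Za: "Z a" by (rule cube)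
  show ?thesis
  proof (cases "Z z")
   case False
   have "y ^ 3 - m * z ^ 3 = - (z * a) + y * b"
    unfolding a_def b_def by (simp add: ring3)
   then have "Z (y ^ 3 - m * z ^ 3)" using add uminus mult Za True by metis
   then show ?thesis using False by blast
  next
   case zz: True
   have "y * y = b + x * z" by (simp add: b_def)
   then have "Z (y * y)" using add True mult zz by metis
   then have Zy: "Z y" using prime by blast
   have "x ^ 3 = nu m x y z - (m * y ^ 2) * y - (m ^ 2 * z ^ 2) * z + (3 * m * x * y) * z"
    by (simp add: nu_def ring23)
   then have "Z (x ^ 3)" using add diff mult Z Zy zz by metis
   then have "Z x" by (rule cube)
   then show ?thesis using nz Zy zz by blast
  qed
 qed
qed

definition lf :: "'a::comm_ring_1 => 'a => 'a => 'a => 'a" where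
 "lf R X Y Z = X + R * Y + R ^ 2 * Z"

text \<open>The three conjugates of a linear form multiply to the norm form. Working modulo a
  divisor M of w^2 + w + 1 lets one statement serve integers modulo p and p^2 and, with M = 0, the
  rings Z[\<omega>] and C.\<close>

lemma lf_product:
 fixes R w :: "'a::comm_ring_1"
 assumes "M dvd w * w + w + 1"
 shows "M dvd lf R X Y Z * (lf (R * w) X Y Z * lf (R * (w * w)) X Y Z) - nu (R ^ 3) X Y Z"
proof -
 define b where "b = R * Y"
 define c where "c = R ^ 2 * Z"
 have 1: "lf (R * w) X Y Z = X + w * b + w * w * c" "lf R X Y Z = X + b + c"
  by (simp_all add: lf_def b_def c_def power2_eq_square mult_ac)
 have 2: "lf (R * (w * w)) X Y Z = X + w * w * b + (w * w) * (w * w) * c"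
  by (simp add: lf_def b_def c_def power2_eq_square mult_ac)
 have 3: "nu (R ^ 3) X Y Z = (X + b + c) * (X * X + b * b + c * c - X * b - X * c - b * c)"
  unfolding nu_def b_def c_def by (simp add: eval_nat_numeral) (simp add: algebra_simps)
 have "(X + w * b + w * w * c) * (X + w * w * b + (w * w) * (w * w) * c) - (X * X + b * b + c * c - X * b - X * c - b * c)
   = (w * w + w + 1) * (X * b + X * c * (1 - w + w * w) + b * b * (w - 1) + c * c * (w - 1 - w * w * w + w * w * w * w) + b * c * (1 - w + w * w * w))"
  by (simp add: algebra_simps)
 then have "M dvd (X + w * b + w * w * c) * (X + w * w * b + (w * w) * (w * w) * c) - (X * X + b * b + c * c - X * b - X * c - b * c)"
  using assms by simp
 then have "M dvd (X + b + c) * ((X + w * b + w * w * c) * (X + w * w * b + (w * w) * (w * w) * c) - (X * X + b * b + c * c - X * b - X * c - b * c))"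
  by (rule dvd_mult)
 then show ?thesis unfolding 1 2 3 by (simp add: right_diff_distrib)
qed

lemma nu_cong_int: "[m = m'] (mod M) ==> [X = X'] (mod M) ==> [Y = Y'] (mod M) ==> [Z = Z'] (mod M) ==>
  [nu m X Y Z = nu m' X' Y' Z'] (mod (M::int))"
 unfolding nu_def by (intro cong_add cong_diff cong_mult cong_pow cong_refl)

lemma lf_cong_int: "[R = R'] (mod M) ==> [X = X'] (mod M) ==> [Y = Y'] (mod M) ==> [Z = Z'] (mod M) ==>
  [lf R X Y Z = lf R' X' Y' Z'] (mod (M::int))"
 unfolding lf_def by (intro cong_add cong_mult cong_pow cong_refl)

lemma ev_nu:
 assumes "M dvd w * w + w + 1"
 shows "[ev w (nu m x y z) = nu (ev w m) (ev w x) (ev w y) (ev w z)] (mod M)"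
proof -
 note E = ev_mult[OF assms] ev_power[OF assms]
 have "[ev w (m * y ^ 3) = ev w m * ev w y ^ 3] (mod M)"
  by (rule cong_trans[OF E(1)]) (intro cong_mult cong_refl E)
 moreover have "[ev w (m ^ 2 * z ^ 3) = ev w m ^ 2 * ev w z ^ 3] (mod M)"
  by (rule cong_trans[OF E(1)]) (intro cong_mult cong_refl E)
 moreover have "[ev w (3 * m * x * y * z) = 3 * ev w m * ev w x * ev w y * ev w z] (mod M)"
 proof -
  have "[ev w (3 * m) = 3 * ev w m] (mod M)" using E(1)[of 3 m] by simp
  then have "[ev w (3 * m * x) = 3 * ev w m * ev w x] (mod M)" by (rule cong_trans[OF E(1) cong_mult]) simp
  then have "[ev w (3 * m * x * y) = 3 * ev w m * ev w x * ev w y] (mod M)" by (rule cong_trans[OF E(1) cong_mult]) simp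
  then show ?thesis by (rule cong_trans[OF E(1) cong_mult]) simp
 qed
 ultimately show ?thesis unfolding nu_def ev_simps by (intro cong_add cong_diff E)
qed

lemma int_nu_dvd_cases:
 assumes p: "prime p" and d: "int p dvd nu m X Y Z"
 shows "(int p dvd X & int p dvd Y & int p dvd Z) \<or> (\<exists>r. int p dvd r ^ 3 - m)"
proof (rule ccontr)
 assume neg: "~ ?thesis"
 have "\<exists>a b. ~ int p dvd b & int p dvd a ^ 3 - m * b ^ 3"
  by (rule nu_isotropic[of "%a. int p dvd a" m X Y Z]) (use neg d prime_dvd_mult_int[OF p] in auto)
 then obtain a b where ab: "~ int p dvd b" "int p dvd a ^ 3 - m * b ^ 3" by blast
 obtain c where c: "[b * c = 1] (mod int p)" using prime_int_inverse[OF p ab(1)] by blast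
 have "[m * (b * c) ^ 3 = m * 1 ^ 3] (mod int p)" by (intro cong_mult cong_pow cong_refl c)
 then have "int p dvd m * (b * c) ^ 3 - m" by (simp add: cong_iff_dvd_diff)
 moreover have "int p dvd (a ^ 3 - m * b ^ 3) * c ^ 3" using ab(2) by (rule dvd_mult2)
 ultimately have "int p dvd (a ^ 3 - m * b ^ 3) * c ^ 3 + (m * (b * c) ^ 3 - m)" by (rule dvd_add[rotated])
 also have "(a ^ 3 - m * b ^ 3) * c ^ 3 + (m * (b * c) ^ 3 - m) = (a * c) ^ 3 - m" by (simp add: power_mult_distrib algebra_simps)
 finally show False using neg by blast
qed

lemma prime_dvd_three:
 "prime p ==> int p dvd a * (b * c) \<longleftrightarrow> int p dvd a \<or> int p dvd b \<or> int p dvd c"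
 by (simp add: prime_dvd_mult_int)

lemma cube_roots_mod:
 assumes p: "prime p" and w: "int p dvd w * w + w + 1" and r: "int p dvd r ^ 3 - m" and s: "int p dvd s ^ 3 - m"
 shows "[s = r] (mod int p) \<or> [s = r * w] (mod int p) \<or> [s = r * (w * w)] (mod int p)"
proof -
 have "int p dvd (s ^ 3 - m) - (r ^ 3 - m)" using s r by (rule dvd_diff)
 moreover have "(s - r) * ((s - r * w) * (s - r * (w * w))) = (s ^ 3 - r ^ 3) + (w * w + w + 1) * ((s - r) * (- s * r + r * r * (w - 1)))"
  by (simp add: ring3)
 ultimately have "int p dvd (s - r) * ((s - r * w) * (s - r * (w * w)))"
  using w by simp
 then show ?thesis unfolding prime_dvd_three[OF p] by (simp add: cong_iff_dvd_diff)
qed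

lemma sq_dvd_triple:
 assumes p: "prime p"
 shows "(int p)\<^sup>2 dvd a * (b * c) \<longleftrightarrow>
   (int p dvd a & int p dvd b) \<or> (int p dvd a & int p dvd c) \<or> (int p dvd b & int p dvd c) \<or>
   (int p)\<^sup>2 dvd a \<or> (int p)\<^sup>2 dvd b \<or> (int p)\<^sup>2 dvd c"
proof
 assume d: "(int p)\<^sup>2 dvd a * (b * c)"
 show "(int p dvd a & int p dvd b) \<or> (int p dvd a & int p dvd c) \<or> (int p dvd b & int p dvd c) \<or>
   (int p)\<^sup>2 dvd a \<or> (int p)\<^sup>2 dvd b \<or> (int p)\<^sup>2 dvd c"
  using prime_sq_dvd_mult[OF p d] prime_sq_dvd_mult[OF p, of b c] prime_dvd_mult_int[OF p, of b c] by blast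
next
 have sq: "(int p)\<^sup>2 dvd x * y" if "int p dvd x" "int p dvd y" for x y
  unfolding power2_eq_square using that by (rule mult_dvd_mono)
 assume "(int p dvd a & int p dvd b) \<or> (int p dvd a & int p dvd c) \<or> (int p dvd b & int p dvd c) \<or>
   (int p)\<^sup>2 dvd a \<or> (int p)\<^sup>2 dvd b \<or> (int p)\<^sup>2 dvd c"
 then show "(int p)\<^sup>2 dvd a * (b * c)"
 proof (elim disjE conjE)
  assume "int p dvd a" "int p dvd c"
  then show ?thesis using sq[of a "b * c"] by simp
 next
  assume "int p dvd a" "int p dvd b"
  then show ?thesis using sq[of a "b * c"] by simp
 next
  assume "int p dvd b" "int p dvd c"
  then show ?thesis using sq[of b c] by simp
 qed simp_all
qed

text \<open>The pairs (w, r) are the homomorphisms to the field with p elements from the ring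
  generated by \<omega> and a cube root of \<mu>; they play the part of its primes of degree 1 above
  p.\<close>

definition jroots :: "eis => nat => (int \<times> int) set" where
 "jroots \<mu> p = (SIGMA w:wroots p. {r \<in> {0..<int p}. int p dvd r ^ 3 - ev w \<mu>})"

lemma finite_jroots [simp]: "finite (jroots \<mu> p)"
 unfolding jroots_def by (intro finite_SigmaI finite_wroots) (rule finite_subset[of _ "{0..<int p}"], auto)

lemma card_jroots_le: "prime p ==> card (jroots \<mu> p) <= 24"
proof -
 assume p: "prime p"
 have "card {r \<in> {0..<int p}. int p dvd r ^ 3 - ev w \<mu>} <= 6" for w
  using card_monic_roots_le[OF p, of "[:- ev w \<mu>, 0, 0, 1:]"] by (simp add: ring3)
 moreover have "finite {r \<in> {0..<int p}. int p dvd r ^ 3 - ev w \<mu>}" for w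
  by (rule finite_subset[of _ "{0..<int p}"]) auto
 then have "card (jroots \<mu> p) = (\<Sum>w\<in>wroots p. card {r \<in> {0..<int p}. int p dvd r ^ 3 - ev w \<mu>})"
  unfolding jroots_def by (intro card_SigmaI finite_wroots ballI)
 ultimately have "card (jroots \<mu> p) <= (\<Sum>w\<in>wroots p. 6)" by (simp only: sum_mono)
 then show ?thesis using card_wroots_le[OF p] by simp
qed

text \<open>Six coordinates: the first component selects the coefficient of 1, \<theta> or
  \<theta>^2, the second the coordinate of this coefficient in Z[\<omega>].\<close>

type_synonym idx = "bool option \<times> bool"

definition X1 :: "(idx => int) => eis" where "X1 v = Eis (v (None, False)) (v (None, True))"
definition X2 :: "(idx => int) => eis" where "X2 v = Eis (v (Some False, False)) (v (Some False, True))"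
definition X3 :: "(idx => int) => eis" where "X3 v = Eis (v (Some True, False)) (v (Some True, True))"

lemma X_diff [simp]: "X1 (v - w) = X1 v - X1 w" "X2 (v - w) = X2 v - X2 w" "X3 (v - w) = X3 v - X3 w"
 by (simp_all add: X1_def X2_def X3_def eis_eq_iff)

lemma X_zero_iff: "X1 v = 0 & X2 v = 0 & X3 v = 0 \<longleftrightarrow> v = 0"
proof
 assume z: "X1 v = 0 & X2 v = 0 & X3 v = 0"
 show "v = 0"
 proof
  fix i :: idx
  obtain a b where "i = (a, b)" by (cases i)
  then show "v i = 0 i" using z by (cases a; cases "the a"; cases b) (auto simp: X1_def X2_def X3_def eis_eq_iff)
 qed
qed (simp add: X1_def X2_def X3_def eis_eq_iff)

definition NU :: "eis => (idx => int) => eis" where "NU \<mu> v = nu \<mu> (X1 v) (X2 v) (X3 v)"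

text \<open>The linear form v \<mapsto> x + R y + R^2 z reduced modulo a root w of w^2 + w + 1.\<close>
definition LF :: "int => int => (idx => int) => int" where
 "LF w R v = lf R (ev w (X1 v)) (ev w (X2 v)) (ev w (X3 v))"

lemma LF_diff: "LF w R (v - u) = LF w R v - LF w R u"
 by (simp add: LF_def lf_def algebra_simps)

definition triv :: "nat => int => (idx => int) set" where
 "triv p w = {v. int p dvd ev w (X1 v) & int p dvd ev w (X2 v) & int p dvd ev w (X3 v)}"

lemma diff_closed_triv: "diff_closed (triv p w)"
 by (auto simp: diff_closed_def triv_def)

lemma diff_closed_LF: "diff_closed {v. M dvd LF w R v}"
 by (auto simp: diff_closed_def LF_diff)

lemma triv_NU:
 assumes "(int p)\<^sup>2 dvd w * w + w + 1" "v \<in> triv p w"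
 shows "(int p)\<^sup>2 dvd ev w (NU \<mu> v)"
proof -
 have "(int p)\<^sup>2 dvd nu (ev w \<mu>) (ev w (X1 v)) (ev w (X2 v)) (ev w (X3 v))"
 proof -
  have sq: "(int p)\<^sup>2 dvd a ^ 3" "(int p)\<^sup>2 dvd a * b" if "int p dvd a" "int p dvd b" for a b
   using that by (auto simp: power2_eq_square power3_eq_cube intro: mult_dvd_mono dvd_mult2)
  have d: "int p dvd ev w (X1 v)" "int p dvd ev w (X2 v)" "int p dvd ev w (X3 v)" using assms(2) by (auto simp: triv_def)
  have "3 * ev w \<mu> * ev w (X1 v) * ev w (X2 v) * ev w (X3 v) = (3 * ev w \<mu> * ev w (X3 v)) * (ev w (X1 v) * ev w (X2 v))"
   by (simp add: mult_ac)
  then show ?thesis unfolding nu_def using d sq by (intro dvd_add dvd_diff) (auto intro: dvd_mult)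
 qed
 then show ?thesis unfolding NU_def using ev_nu[OF assms(1)] cong_dvd_iff by blast
qed

lemma LF_product:
 assumes w: "M dvd w * w + w + 1" and R: "M dvd R ^ 3 - ev w \<mu>"
 shows "[ev w (NU \<mu> v) = LF w R v * (LF w (R * w) v * LF w (R * (w * w)) v)] (mod M)"
proof -
 let ?x = "ev w (X1 v)" and ?y = "ev w (X2 v)" and ?z = "ev w (X3 v)"
 have "[ev w (NU \<mu> v) = nu (ev w \<mu>) ?x ?y ?z] (mod M)" unfolding NU_def by (rule ev_nu[OF w])
 moreover have "[ev w \<mu> = R ^ 3] (mod M)" using R by (metis cong_iff_dvd_diff cong_sym)
 then have "[nu (ev w \<mu>) ?x ?y ?z = nu (R ^ 3) ?x ?y ?z] (mod M)" by (rule nu_cong_int) simp_all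
 moreover have "[nu (R ^ 3) ?x ?y ?z = lf R ?x ?y ?z * (lf (R * w) ?x ?y ?z * lf (R * (w * w)) ?x ?y ?z)] (mod M)"
  using lf_product[OF w, of R ?x ?y ?z] by (metis cong_iff_dvd_diff cong_sym)
 ultimately show ?thesis unfolding LF_def using cong_trans by blast
qed

text \<open>The locus where p, respectively p^2, divides the value of the norm form at w.\<close>
lemma union_of_groups_NU:
 assumes p: "prime p" "p ~= 3" and W: "(int p)\<^sup>2 dvd W * W + W + 1" and \<mu>: "~ int p dvd ev W \<mu>"
 shows "union_of_groups 3 {v. int p dvd ev W (NU \<mu> v)}"
  and "union_of_groups 6 {v. (int p)\<^sup>2 dvd ev W (NU \<mu> v)}"
proof -
 have Wp: "int p dvd W * W + W + 1" using W by (meson dvd_power dvd_trans zero_less_numeral)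
 have sqp: "int p dvd a" if "(int p)\<^sup>2 dvd a" for a using that by (meson dvd_power dvd_trans zero_less_numeral)
 have "union_of_groups 3 {v. int p dvd ev W (NU \<mu> v)} & union_of_groups 6 {v. (int p)\<^sup>2 dvd ev W (NU \<mu> v)}"
 proof (cases "\<exists>r. int p dvd r ^ 3 - ev W \<mu>")
  case False
  have "v \<in> triv p W" if "int p dvd ev W (NU \<mu> v)" for v
  proof -
   have "int p dvd nu (ev W \<mu>) (ev W (X1 v)) (ev W (X2 v)) (ev W (X3 v))"
    using that ev_nu[OF Wp] cong_dvd_iff unfolding NU_def by blast
   then show ?thesis using int_nu_dvd_cases[OF p(1)] False unfolding triv_def by blast
  qed
  then have "{v. int p dvd ev W (NU \<mu> v)} = triv p W" "{v. (int p)\<^sup>2 dvd ev W (NU \<mu> v)} = triv p W"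
   using triv_NU[OF W] sqp by blast+
  then show ?thesis using union_of_groups_mono[OF union_of_groups_single[OF diff_closed_triv]] by simp
 next
  case True
  then obtain r where r: "int p ^ 1 dvd r ^ 3 - ev W \<mu>" by auto
  then obtain R where R: "(int p)\<^sup>2 dvd R ^ 3 - ev W \<mu>"
   using cube_root_lift[OF p _ r \<mu>] by (auto simp: numeral_2_eq_2)
  let ?f = "%M s. {v. M dvd LF W s v}"
  let ?a = "R" and ?b = "R * W" and ?c = "R * (W * W)"
  have e1: "{v. int p dvd ev W (NU \<mu> v)} = ?f (int p) ?a \<union> (?f (int p) ?b \<union> ?f (int p) ?c)"
   using cong_dvd_iff[OF LF_product[OF Wp sqp[OF R]]] prime_dvd_three[OF p(1)] by auto
  have u1: "union_of_groups (1 + (1 + 1)) (?f (int p) ?a \<union> (?f (int p) ?b \<union> ?f (int p) ?c))"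
   by (intro union_of_groups_Un union_of_groups_single diff_closed_LF)
  \<comment> \<open>Six groups: two of the three forms vanish modulo p, in three ways, or one of
    them vanishes modulo p^2.\<close>
  have e2: "{v. (int p)\<^sup>2 dvd ev W (NU \<mu> v)} =
    (?f (int p) ?a \<inter> ?f (int p) ?b) \<union> ((?f (int p) ?a \<inter> ?f (int p) ?c) \<union> ((?f (int p) ?b \<inter> ?f (int p) ?c) \<union>
    (?f ((int p)\<^sup>2) ?a \<union> (?f ((int p)\<^sup>2) ?b \<union> ?f ((int p)\<^sup>2) ?c))))"
   using cong_dvd_iff[OF LF_product[OF W R]] sq_dvd_triple[OF p(1)] by auto
  have u2: "union_of_groups (1 * 1 + (1 * 1 + (1 * 1 + (1 + (1 + 1)))))
   ((?f (int p) ?a \<inter> ?f (int p) ?b) \<union> ((?f (int p) ?a \<inter> ?f (int p) ?c) \<union> ((?f (int p) ?b \<inter> ?f (int p) ?c) \<union>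
    (?f ((int p)\<^sup>2) ?a \<union> (?f ((int p)\<^sup>2) ?b \<union> ?f ((int p)\<^sup>2) ?c)))))"
   by (intro union_of_groups_Un union_of_groups_Int union_of_groups_single diff_closed_LF)
  show ?thesis unfolding e1 e2 using union_of_groups_mono[OF u1, of 3] union_of_groups_mono[OF u2, of 6] by simp
 qed
 then show "union_of_groups 3 {v. int p dvd ev W (NU \<mu> v)}" "union_of_groups 6 {v. (int p)\<^sup>2 dvd ev W (NU \<mu> v)}" by auto
qed

lemma eis_dvd_iff: "(of_int m :: eis) dvd x \<longleftrightarrow> m dvd e0 x & m dvd e1 x"
proof
 assume "of_int m dvd x"
 then obtain y where "x = of_int m * y" by (elim dvdE)
 then show "m dvd e0 x & m dvd e1 x" by simp
next
 assume "m dvd e0 x & m dvd e1 x"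
 then obtain a b where "e0 x = m * a" "e1 x = m * b" by (elim conjE dvdE)
 then have "x = of_int m * Eis a b" by (simp add: eis_eq_iff)
 then show "of_int m dvd x" by (rule dvdI)
qed

lemma inert_dvd_enorm:
 assumes "prime p" "!!w. ~ int p dvd w * w + w + 1" "int p dvd enorm x"
 shows "of_int (int p) dvd x"
 using assms enorm_root[OF assms(1,3)] dvd_e0_of_e1[OF assms(1,3)] unfolding eis_dvd_iff by blast

text \<open>An inert p stays prime in Z[\<omega>], and p^2 divides a norm iff p divides the element.
  So the norm form is studied over the residue field with p^2 elements: either \<mu> is a cube there
  and the form splits into linear factors, or it is anisotropic.\<close>

lemma union_of_groups_inert:
 assumes p: "prime p" and inert: "!!w. ~ int p dvd w * w + w + 1"
 shows "union_of_groups 3 {v. (int p)\<^sup>2 dvd enorm (NU \<mu> v)}"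
proof -
 let ?p = "of_int (int p) :: eis"
 have iff: "(int p)\<^sup>2 dvd enorm x \<longleftrightarrow> ?p dvd x" for x
 proof
  assume "(int p)\<^sup>2 dvd enorm x"
  then have "int p dvd enorm x" by (meson dvd_power dvd_trans zero_less_numeral)
  then show "?p dvd x" by (rule inert_dvd_enorm[OF p inert])
 next
  assume "?p dvd x"
  then show "(int p)\<^sup>2 dvd enorm x" unfolding eis_dvd_iff using sq_dvd_enorm by blast
 qed
 have prime: "?p dvd x \<or> ?p dvd y" if "?p dvd x * y" for x y
 proof -
  have "int p dvd enorm x * enorm y"
   using that iff[of "x * y"] unfolding enorm_mult by (meson dvd_power dvd_trans zero_less_numeral)
  then show ?thesis using prime_dvd_mult_int[OF p] inert_dvd_enorm[OF p inert] by blast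
 qed
 let ?t = "{v. ?p dvd X1 v & ?p dvd X2 v & ?p dvd X3 v}"
 let ?f = "%R. {v. ?p dvd lf R (X1 v) (X2 v) (X3 v)}"
 have dct: "diff_closed ?t" by (auto simp: diff_closed_def)
 have dcf: "diff_closed (?f R)" for R
 proof -
  have "lf R (X1 v - X1 w) (X2 v - X2 w) (X3 v - X3 w) = lf R (X1 v) (X2 v) (X3 v) - lf R (X1 w) (X2 w) (X3 w)" for v w
   by (simp add: lf_def algebra_simps)
  then show ?thesis by (auto simp: diff_closed_def)
 qed
 show ?thesis
 proof (cases "\<exists>R. ?p dvd R ^ 3 - \<mu>")
  case True
  then obtain R where R: "?p dvd R ^ 3 - \<mu>" by blast
  have "(?p dvd NU \<mu> v) = (?p dvd lf R (X1 v) (X2 v) (X3 v) * (lf (R * \<omega>) (X1 v) (X2 v) (X3 v) * lf (R * (\<omega> * \<omega>)) (X1 v) (X2 v) (X3 v)))" for v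
  proof -
   have "0 dvd \<omega> * \<omega> + \<omega> + (1::eis)" by (simp add: \<omega>_sq)
   from lf_product[OF this, of R "X1 v" "X2 v" "X3 v"]
   have 1: "lf R (X1 v) (X2 v) (X3 v) * (lf (R * \<omega>) (X1 v) (X2 v) (X3 v) * lf (R * (\<omega> * \<omega>)) (X1 v) (X2 v) (X3 v)) = nu (R ^ 3) (X1 v) (X2 v) (X3 v)"
    by simp
   have "nu (R ^ 3) (X1 v) (X2 v) (X3 v) - NU \<mu> v = (R ^ 3 - \<mu>) * (X2 v ^ 3 + (R ^ 3 + \<mu>) * X3 v ^ 3 - 3 * X1 v * X2 v * X3 v)"
    unfolding NU_def nu_def by (simp add: ring2)
   then have "?p dvd nu (R ^ 3) (X1 v) (X2 v) (X3 v) - NU \<mu> v" using R by simp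
   then show ?thesis unfolding 1 by (metis dvd_diff_left_iff dvd_diff_right_iff dvd_diff diff_add_cancel dvd_add)
  qed
  moreover have "?p dvd x * (y * z) \<longleftrightarrow> ?p dvd x \<or> ?p dvd y \<or> ?p dvd z" for x y z
   using prime[of x "y * z"] prime[of y z] by (auto intro: dvd_mult dvd_mult2)
  ultimately have "{v. (int p)\<^sup>2 dvd enorm (NU \<mu> v)} = ?f R \<union> (?f (R * \<omega>) \<union> ?f (R * (\<omega> * \<omega>)))"
   unfolding iff by auto
  moreover have "union_of_groups (1 + (1 + 1)) (?f R \<union> (?f (R * \<omega>) \<union> ?f (R * (\<omega> * \<omega>))))"
   by (intro union_of_groups_Un union_of_groups_single dcf)
  ultimately show ?thesis by (simp add: numeral_3_eq_3)
 next
  case False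
  have "v \<in> ?t" if v: "?p dvd NU \<mu> v" for v
  proof (rule ccontr)
   assume "v \<notin> ?t"
   then have "\<exists>a b. ~ ?p dvd b & ?p dvd a ^ 3 - \<mu> * b ^ 3"
    using v unfolding NU_def by (intro nu_isotropic[of "%a. ?p dvd a" \<mu> "X1 v" "X2 v" "X3 v"] prime) auto
   then obtain a b where ab: "~ ?p dvd b" "?p dvd a ^ 3 - \<mu> * b ^ 3" by blast
   have "~ int p dvd enorm b" using ab(1) inert_dvd_enorm[OF p inert] by blast
   then obtain c where c: "[enorm b * c = 1] (mod int p)" using prime_int_inverse[OF p] by blast
   \<comment> \<open>An inverse of b modulo p: conj b divided by the norm of b, which is prime to
     p.\<close>
   define b' where "b' = econj b * of_int c"
   have bb: "?p dvd b * b' - 1"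
   proof -
    have "b * b' - 1 = of_int (enorm b * c - 1)" by (simp add: b'_def enorm_eq)
    moreover obtain k where "enorm b * c - 1 = int p * k" using c unfolding cong_iff_dvd_diff by (elim dvdE)
    ultimately have "b * b' - 1 = ?p * of_int k" by (simp only: of_int_mult of_int_of_nat_eq)
    then show ?thesis by simp
   qed
   have "(b * b') ^ 3 - 1 = (b * b' - 1) * ((b * b') ^ 2 + b * b' + 1)" by (simp add: ring23)
   then have "?p dvd \<mu> * ((b * b') ^ 3 - 1)" using bb by simp
   moreover have "?p dvd (a ^ 3 - \<mu> * b ^ 3) * b' ^ 3" using ab(2) by simp
   moreover have "(a * b') ^ 3 - \<mu> = (a ^ 3 - \<mu> * b ^ 3) * b' ^ 3 + \<mu> * ((b * b') ^ 3 - 1)"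
    by (simp add: power_mult_distrib algebra_simps)
   ultimately have "?p dvd (a * b') ^ 3 - \<mu>" by simp
   then show False using False by blast
  qed
  moreover have "?p dvd NU \<mu> v" if "v \<in> ?t" for v
   using that unfolding NU_def nu_def by (auto intro!: dvd_add dvd_diff dvd_mult simp: power3_eq_cube)
  ultimately have "{v. (int p)\<^sup>2 dvd enorm (NU \<mu> v)} = ?t" unfolding iff by blast
  then show ?thesis using union_of_groups_mono[OF union_of_groups_single[OF dct], of 3] by simp
 qed
qed

lemma union_of_groups_enorm_NU:
 assumes p: "prime p" "p ~= 3" and \<mu>: "~ int p dvd enorm \<mu>"
 shows "union_of_groups 24 {v. (int p)\<^sup>2 dvd enorm (NU \<mu> v)}"
proof (cases "\<exists>w. int p dvd w * w + w + 1")
 case False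
 then show ?thesis using union_of_groups_mono[OF union_of_groups_inert[OF p(1)]] by fastforce
next
 case True
 then obtain w where "int p ^ 1 dvd w * w + w + 1" by auto
 then obtain W where W: "(int p)\<^sup>2 dvd W * W + W + 1"
  using cube_root_unity_lift[OF p, of 1 w] by (auto simp: numeral_2_eq_2)
 let ?W' = "- 1 - W"
 have W': "(int p)\<^sup>2 dvd ?W' * ?W' + ?W' + 1" by (rule conj_root[OF W])
 have Wp: "int p dvd W * W + W + 1" using W by (meson dvd_power dvd_trans zero_less_numeral)
 have "[enorm \<mu> = ev W \<mu> * ev ?W' \<mu>] (mod int p)" by (rule enorm_ev[OF Wp])
 then have "int p dvd enorm \<mu> \<longleftrightarrow> int p dvd ev W \<mu> * ev ?W' \<mu>" by (rule cong_dvd_iff)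
 then have n: "~ int p dvd ev W \<mu>" "~ int p dvd ev ?W' \<mu>" using \<mu> by auto
 let ?S = "%M w. {v. M dvd ev w (NU \<mu> v)}"
 have "{v. (int p)\<^sup>2 dvd enorm (NU \<mu> v)} = (?S (int p) W \<inter> ?S (int p) ?W') \<union> (?S ((int p)\<^sup>2) W \<union> ?S ((int p)\<^sup>2) ?W')"
  using cong_dvd_iff[OF enorm_ev[OF W]] prime_sq_dvd_mult[OF p(1)] mult_dvd_mono[of "int p" _ "int p"]
  by (auto simp: power2_eq_square)
 \<comment> \<open>21 groups are found; 24 is the bound \<open>K\<close> shared with the number of
   linear forms.\<close>
 moreover have "union_of_groups (3 * 3 + (6 + 6)) ((?S (int p) W \<inter> ?S (int p) ?W') \<union> (?S ((int p)\<^sup>2) W \<union> ?S ((int p)\<^sup>2) ?W'))"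
  by (intro union_of_groups_Un union_of_groups_Int union_of_groups_NU p W W' n)
 ultimately show ?thesis using union_of_groups_mono[of _ _ 24] by fastforce
qed

lemma ev_NU_of_LF:
 assumes "w \<in> wroots p" "int p dvd r ^ 3 - ev w \<mu>" "int p dvd LF w r v"
 shows "int p dvd ev w (NU \<mu> v)"
proof -
 have "int p dvd w * w + w + 1" using assms(1) by (simp add: wroots_def)
 from cong_dvd_iff[OF LF_product[OF this assms(2)]] show ?thesis using assms(3) by simp
qed

text \<open>Distinct pairs are distinct primes above p. If the roots w differ, p divides both
  coordinates of \<open>NU\<close>. If they agree, r and r' select two of the three factors in the
  product formula, which holds modulo p^2 after w and r have been lifted.\<close>

lemma LF_two:
 assumes p: "prime p" "p ~= 3" and \<mu>: "~ int p dvd enorm \<mu>"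
  and j: "(w, r) \<in> jroots \<mu> p" "(w', r') \<in> jroots \<mu> p" "(w, r) ~= (w', r')"
  and d: "int p dvd LF w r v" "int p dvd LF w' r' v"
 shows "(int p)\<^sup>2 dvd enorm (NU \<mu> v)"
proof -
 have w: "w \<in> wroots p" "w' \<in> wroots p" "r \<in> {0..<int p}" "r' \<in> {0..<int p}"
  "int p dvd r ^ 3 - ev w \<mu>" "int p dvd r' ^ 3 - ev w' \<mu>" using j by (auto simp: jroots_def)
 have wp: "int p ^ 1 dvd w * w + w + 1" using w by (simp add: wroots_def)
 show ?thesis
 proof (cases "w = w'")
  case False
  then show ?thesis
   using ev_dvd_two[OF p(1) ev_NU_of_LF[OF w(1,5) d(1)] ev_NU_of_LF[OF w(2,6) d(2)]] wroots_distinct[OF p(1) w(1,2)] sq_dvd_enorm by blast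
 next
  case True
  obtain W where W: "[W = w] (mod int p)" "(int p)\<^sup>2 dvd W * W + W + 1"
   using cube_root_unity_lift[OF p _ wp] by (auto simp: numeral_2_eq_2)
  have Wp: "int p dvd W * W + W + 1" using W(2) by (meson dvd_power dvd_trans zero_less_numeral)
  have "[enorm \<mu> = ev W \<mu> * ev (- 1 - W) \<mu>] (mod int p)" by (rule enorm_ev[OF Wp])
  then have "int p dvd enorm \<mu> \<longleftrightarrow> int p dvd ev W \<mu> * ev (- 1 - W) \<mu>" by (rule cong_dvd_iff)
  then have n: "~ int p dvd ev W \<mu>" using \<mu> by auto
  have Wmu: "[ev W \<mu> = ev w \<mu>] (mod int p)" using W(1) by (rule ev_cong)
  have roots: "int p dvd r ^ 3 - ev W \<mu>" "int p dvd r' ^ 3 - ev W \<mu>"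
   using w(5,6) True Wmu by (metis cong_iff_dvd_diff cong_sym cong_trans)+
  obtain R where R: "[R = r] (mod int p)" "(int p)\<^sup>2 dvd R ^ 3 - ev W \<mu>"
   using cube_root_lift[OF p _ _ n, of 1 r] roots(1) by (auto simp: numeral_2_eq_2)
  have Rp: "int p dvd R ^ 3 - ev W \<mu>" using R(2) by (meson dvd_power dvd_trans zero_less_numeral)
  have LFc: "[LF W s v = LF w s' v] (mod int p)" if "[s = s'] (mod int p)" for s s'
   unfolding LF_def using that W(1) by (intro lf_cong_int ev_cong)
  have dR: "int p dvd LF W R v" using LFc[OF R(1)] d(1) cong_dvd_iff by blast
  have ne: "~ [r' = R] (mod int p)"
  proof
   assume "[r' = R] (mod int p)"
   then have "[r' = r] (mod int p)" using R(1) cong_trans by blast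
   then show False using w(3,4) j(3) True by (simp add: cong_def)
  qed
  have "[r' = R] (mod int p) \<or> [r' = R * W] (mod int p) \<or> [r' = R * (W * W)] (mod int p)"
   by (rule cube_roots_mod[OF p(1) Wp Rp roots(2)])
  then have "int p dvd LF W (R * W) v \<or> int p dvd LF W (R * (W * W)) v"
   using ne d(2) True LFc cong_dvd_iff cong_sym by metis
  then have "(int p)\<^sup>2 dvd LF W R v * (LF W (R * W) v * LF W (R * (W * W)) v)"
   using dR sq_dvd_triple[OF p(1)] by blast
  then have "(int p)\<^sup>2 dvd ev W (NU \<mu> v)" using LF_product[OF W(2) R(2)] cong_dvd_iff by blast
  then show ?thesis using enorm_ev[OF W(2), of "NU \<mu> v"] cong_dvd_iff by (metis dvd_mult2)
 qed
qed

text \<open>As p^2 does not divide the norm, p does not divide \<open>NU\<close> itself and a root w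
  exists. The three coefficients do not all vanish at w, since this would again give p^2. So \<mu>
  has a cube root there, and one of the three conjugate forms vanishes.\<close>

lemma LF_exists:
 assumes p: "prime p" "p ~= 3" and d: "int p dvd enorm (NU \<mu> v)" "~ (int p)\<^sup>2 dvd enorm (NU \<mu> v)"
 shows "\<exists>(w, r)\<in>jroots \<mu> p. int p dvd LF w r v"
proof -
 have "~ int p dvd e1 (NU \<mu> v)" using d dvd_e0_of_e1[OF p(1) d(1)] sq_dvd_enorm by blast
 then obtain w where w: "0 <= w" "w < int p" "int p dvd w * w + w + 1" "int p dvd ev w (NU \<mu> v)"
  using enorm_root[OF p(1) d(1)] by blast
 have "int p dvd nu (ev w \<mu>) (ev w (X1 v)) (ev w (X2 v)) (ev w (X3 v))"
  using w(4) ev_nu[OF w(3)] cong_dvd_iff unfolding NU_def by blast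
 moreover have "~ v \<in> triv p w"
 proof
  assume t: "v \<in> triv p w"
  obtain W where W: "[W = w] (mod int p)" "(int p)\<^sup>2 dvd W * W + W + 1"
   using cube_root_unity_lift[OF p, of 1 w] w(3) by (auto simp: numeral_2_eq_2)
  have "v \<in> triv p W" using t W(1) ev_cong cong_dvd_iff unfolding triv_def by blast
  then have "(int p)\<^sup>2 dvd ev W (NU \<mu> v)" using triv_NU[OF W(2)] by blast
  then have "(int p)\<^sup>2 dvd enorm (NU \<mu> v)" using enorm_ev[OF W(2), of "NU \<mu> v"] cong_dvd_iff by (metis dvd_mult2)
  then show False using d by simp
 qed
 ultimately obtain r where r: "int p dvd r ^ 3 - ev w \<mu>"
  using int_nu_dvd_cases[OF p(1)] unfolding triv_def by blast
 have "int p dvd LF w r v * (LF w (r * w) v * LF w (r * (w * w)) v)"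
  using LF_product[OF w(3) r] w(4) cong_dvd_iff by blast
 then have "\<exists>s. int p dvd s ^ 3 - ev w \<mu> & int p dvd LF w s v"
 proof -
  have c: "int p dvd w ^ 3 - 1"
  proof -
   have "w ^ 3 - 1 = (w - 1) * (w * w + w + 1)" by (simp add: ring3)
   then show ?thesis using w(3) by simp
  qed
  then have w1: "[w ^ 3 = 1] (mod int p)" by (simp add: cong_iff_dvd_diff)
  have "[(r * w) ^ 3 = r ^ 3 * 1] (mod int p)" unfolding power_mult_distrib by (intro cong_mult cong_refl w1)
  moreover have "[(r * (w * w)) ^ 3 = r ^ 3 * (1 * 1)] (mod int p)" unfolding power_mult_distrib by (intro cong_mult cong_refl w1)
  ultimately have "int p dvd (r * w) ^ 3 - ev w \<mu>" "int p dvd (r * (w * w)) ^ 3 - ev w \<mu>"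
   using r by (metis cong_iff_dvd_diff cong_trans mult_1_right)+
  then show ?thesis using \<open>int p dvd LF w r v * _\<close> r prime_dvd_three[OF p(1)] by blast
 qed
 then obtain s where s: "int p dvd s ^ 3 - ev w \<mu>" "int p dvd LF w s v" by blast
 have sm: "[s mod int p = s] (mod int p)" by simp
 then have "[(s mod int p) ^ 3 = s ^ 3] (mod int p)" by (rule cong_pow)
 then have "int p dvd (s mod int p) ^ 3 - ev w \<mu>" using s(1) by (metis cong_iff_dvd_diff cong_trans)
 moreover have "[LF w (s mod int p) v = LF w s v] (mod int p)" unfolding LF_def using sm by (intro lf_cong_int cong_refl)
 then have "int p dvd LF w (s mod int p) v" using s(2) cong_dvd_iff by blast
 moreover have "s mod int p \<in> {0..<int p}" using p prime_gt_0_nat by simp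
 ultimately show ?thesis using w
  by (intro bexI[of _ "(w, s mod int p)"]) (simp_all add: jroots_def wroots_def)
qed

text \<open>The isotropy argument for the set {0} of Z[\<omega>]: a nontrivial zero would make \<mu>
  a cube in Q(\<omega>).\<close>

lemma NU_zero_iff:
 assumes "!!a b. b ~= 0 ==> a ^ 3 ~= \<mu> * b ^ 3"
 shows "NU \<mu> v = 0 \<longleftrightarrow> v = 0"
proof
 assume z: "NU \<mu> v = 0"
 show "v = 0"
 proof (rule ccontr)
  assume "v ~= 0"
  then have nz: "~ (X1 v = 0 & X2 v = 0 & X3 v = 0)" using X_zero_iff by blast
  have "\<exists>a b. ~ b = 0 & a ^ 3 - \<mu> * b ^ 3 = 0"
   by (rule nu_isotropic[of "%a. a = 0" \<mu> "X1 v" "X2 v" "X3 v"]) (use z nz in \<open>auto simp: NU_def\<close>)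
  then show False using assms by auto
 qed
next
 assume "v = 0"
 then have "X1 v = 0" "X2 v = 0" "X3 v = 0" using X_zero_iff by blast+
 then show "NU \<mu> v = 0" by (simp add: NU_def nu_def)
qed

text \<open>In the first coordinate the value is A + B \<omega> with A a monic cubic and B of degree
  at most 2, so the norm A^2 - A B + B^2 is monic of degree 6.\<close>

lemma NU_fibre:
 "\<exists>f :: int poly. degree f = 6 & lead_coeff f = 1 & (\<forall>a. int (nat (enorm (NU \<mu> (v((None, False) := a))))) = \<bar>poly f a\<bar>)"
proof -
 define b where "b = v (None, True)"
 define P where "P = - (3 * \<mu> * X2 v * X3 v)"
 define Q where "Q = \<mu> * X2 v ^ 3 + \<mu> ^ 2 * X3 v ^ 3"
 define A where "A = [:b ^ 3 - e1 P * b + e0 Q, e0 P - 3 * b\<^sup>2, 0, 1:]"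
 define B where "B = [:e0 P * b - e1 P * b + e1 Q, e1 P - 3 * b\<^sup>2, 3 * b:]"
 have ev: "e0 (NU \<mu> (v((None, False) := a))) = poly A a" "e1 (NU \<mu> (v((None, False) := a))) = poly B a" for a
 proof -
  have X: "X1 (v((None, False) := a)) = Eis a b" "X2 (v((None, False) := a)) = X2 v" "X3 (v((None, False) := a)) = X3 v"
   by (simp_all add: X1_def X2_def X3_def b_def)
  have "NU \<mu> (v((None, False) := a)) = Eis a b ^ 3 + P * Eis a b + Q"
   unfolding NU_def X nu_def P_def Q_def by (simp add: algebra_simps)
  then show "e0 (NU \<mu> (v((None, False) := a))) = poly A a" "e1 (NU \<mu> (v((None, False) := a))) = poly B a"
   by (simp_all add: A_def B_def ring23)
 qed
 have dA: "degree A = 3" "lead_coeff A = 1" by (simp_all add: A_def)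
 have dB: "degree B <= 2" unfolding B_def by (rule order_trans[OF degree_pCons_le], simp)+ 
 have dBA: "degree (B - A) <= 3" using dA dB by (intro degree_diff_le) auto
 define f where "f = A * A + B * (B - A)"
 have d2: "degree (B * (B - A)) <= 5" using degree_mult_le[of B "B - A"] dB dBA by linarith
 have d1: "degree (A * A) = 6" using dA by (subst degree_mult_eq) auto
 have "degree f = 6" unfolding f_def using d1 d2 by (subst degree_add_eq_left) auto
 moreover have "lead_coeff f = 1"
 proof -
  have "lead_coeff f = lead_coeff (A * A)" unfolding f_def using d1 d2 by (intro lead_coeff_add_le[symmetric, THEN trans[OF _ refl]] | simp add: coeff_eq_0 \<open>degree f = 6\<close>[unfolded f_def])+
  then show ?thesis using dA by (simp add: lead_coeff_mult)
 qed
 moreover have "int (nat (enorm (NU \<mu> (v((None, False) := a))))) = \<bar>poly f a\<bar>" for a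
 proof -
  have "enorm (NU \<mu> (v((None, False) := a))) = poly f a"
   by (simp add: enorm_def ev f_def ring2)
  then show ?thesis using enorm_nonneg[of "NU \<mu> (v((None, False) := a))"] by simp
 qed
 ultimately show ?thesis by blast
qed

text \<open>The sextic instance. That \<mu> is not a cube guarantees that only the zero vector has
  norm 0; the primes dividing 3 or the norm of \<mu> are declared bad.\<close>

lemma lmean_jroots:
 assumes nc: "!!a b. b ~= 0 ==> a ^ 3 ~= \<mu> * b ^ 3"
 shows "lmean (%p. real (card (jroots \<mu> p))) 1"
proof -
 have \<mu>0: "enorm \<mu> ~= 0" using nc[of 1 0] by auto
 define bad where "bad = {p. p = 3 \<or> int p dvd enorm \<mu>}"
 have fin: "finite bad"
 proof -
  have pos: "nat (enorm \<mu>) > 0" using \<mu>0 enorm_nonneg[of \<mu>] by linarith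
  have "p dvd nat (enorm \<mu>)" if "int p dvd enorm \<mu>" for p
   using that enorm_nonneg[of \<mu>] by (subst of_nat_dvd_iff[symmetric, where ?'a = int]) simp
  then have "bad \<subseteq> insert 3 {p. p dvd nat (enorm \<mu>)}" by (auto simp: bad_def)
  then show ?thesis using finite_subset finite_divisors_nat[OF pos] by blast
 qed
 have "\<exists>\<C>. finite \<C> & card \<C> <= 24 & (\<forall>g\<in>\<C>. diff_closed g) & \<Union>\<C> = {v. (int p)\<^sup>2 dvd enorm (NU \<mu> v)}"
  if "prime p" "p \<notin> bad" for p
  using union_of_groups_enorm_NU[of p \<mu>] that unfolding bad_def union_of_groups_def by blast
 then obtain \<C> where \<C>: "!!p. prime p ==> p \<notin> bad ==> finite (\<C> p) & card (\<C> p) <= 24 & (\<forall>g\<in>\<C> p. diff_closed g) & \<Union>(\<C> p) = {v. (int p)\<^sup>2 dvd enorm (NU \<mu> v)}"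
  by metis
 define u where "u = rcis (root 3 (cmod (ceis \<mu>))) (Arg (ceis \<mu>) / 3)"
 have u: "u ^ 3 = ceis \<mu>"
  unfolding u_def DeMoivre2 by (simp add: rcis_cmod_Arg)
 \<comment> \<open>For k = 3, 4, 5 the factors repeat those for 0, 1, 2. They stand for the complex
   conjugate embeddings, as the norm is the square of the absolute value of the product of
   three.\<close>
 define l where "l k v = lf (u * c\<omega> ^ k) (ceis (X1 v)) (ceis (X2 v)) (ceis (X3 v))" for k v
 define c where "c = nat \<lceil>2 * (1 + cmod u + (cmod u)\<^sup>2)\<rceil>"
 have nat_dvd: "m dvd nat (enorm x) \<longleftrightarrow> int m dvd enorm x" for m x by (simp flip: int_dvd_int_iff)
 have prod: "ceis (NU \<mu> v) = l 0 v * (l 1 v * l 2 v)" for v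
 proof -
  have "0 dvd c\<omega> * c\<omega> + c\<omega> + 1" by (simp add: c\<omega>_sq)
  from lf_product[OF this, of u "ceis (X1 v)" "ceis (X2 v)" "ceis (X3 v)"]
  have "l 0 v * (l 1 v * l 2 v) = nu (u ^ 3) (ceis (X1 v)) (ceis (X2 v)) (ceis (X3 v))"
   by (simp add: l_def power2_eq_square)
  then show ?thesis unfolding u by (simp add: NU_def nu_def)
 qed
 interpret norm_form "%v. nat (enorm (NU \<mu> v))" l 6 c 24 "(None, False)" "%i. if i = (None, False) then 1 else 0" bad
  "jroots \<mu>" "%p j v. LF (fst j) (snd j) v" \<C>
 proof
  show "CARD(idx) = 6" by simp
  show "real (nat (enorm (NU \<mu> v))) = (\<Prod>k<6. cmod (l k v))" for v
  proof -
   have "c\<omega> ^ 4 = c\<omega> ^ 3 * c\<omega> ^ 1" "c\<omega> ^ 5 = c\<omega> ^ 3 * c\<omega> ^ 2" unfolding power_add[symmetric] by simp_all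
   then have l3: "l 3 v = l 0 v" "l 4 v = l 1 v" "l 5 v = l 2 v" unfolding l_def by (simp_all add: c\<omega>_cube)
   have "{..<6} = {0, 1, 2, 3, 4, 5 :: nat}" by auto
   then have "(\<Prod>k<6. cmod (l k v)) = cmod (l 0 v) * cmod (l 1 v) * cmod (l 2 v) * (cmod (l 3 v) * cmod (l 4 v) * cmod (l 5 v))"
    by simp
   also have "... = (cmod (ceis (NU \<mu> v)))\<^sup>2" unfolding l3 prod by (simp add: norm_mult power2_eq_square)
   finally show ?thesis using enorm_cmod[of "NU \<mu> v"] by simp
  qed
  show "cmod (l k v) <= real c * real B" if "!!i. \<bar>v i\<bar> <= int B" for k v B
  proof -
   have b: "\<bar>real_of_int (v i)\<bar> <= real B" for i using that[of i] by linarith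
   have x: "cmod (ceis (X1 v)) <= 2 * real B" "cmod (ceis (X2 v)) <= 2 * real B" "cmod (ceis (X3 v)) <= 2 * real B"
    using cmod_ceis_le[of "X1 v"] cmod_ceis_le[of "X2 v"] cmod_ceis_le[of "X3 v"]
     b[of "(None, False)"] b[of "(None, True)"] b[of "(Some False, False)"] b[of "(Some False, True)"] b[of "(Some True, False)"] b[of "(Some True, True)"]
    by (simp_all add: X1_def X2_def X3_def)
   have "cmod (l k v) <= cmod (ceis (X1 v)) + cmod u * cmod (ceis (X2 v)) + (cmod u)\<^sup>2 * cmod (ceis (X3 v))"
    unfolding l_def lf_def by (intro order_trans[OF norm_triangle_ineq] add_mono) (simp_all add: norm_mult norm_power)
   also have "... <= 2 * real B + cmod u * (2 * real B) + (cmod u)\<^sup>2 * (2 * real B)"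
    by (intro add_mono mult_left_mono x) auto
   also have "... = 2 * (1 + cmod u + (cmod u)\<^sup>2) * real B" by (simp add: algebra_simps)
   also have "... <= real c * real B" unfolding c_def by (intro mult_right_mono real_nat_ceiling_ge) auto
   finally show ?thesis .
  qed
  show "l k (v((None, False) := a)) = l k (v((None, False) := 0)) + of_int a" for k v a
   by (simp add: l_def lf_def X1_def X2_def X3_def ceis_def)
  show "nat (enorm (NU \<mu> v)) = 0 \<longleftrightarrow> v = 0" for v
   using enorm_nonneg[of "NU \<mu> v"] enorm_eq_0_iff[of "NU \<mu> v"] NU_zero_iff[OF nc, of v] by (metis int_nat_eq nat_0 of_nat_0)
  show "\<exists>f. degree f = 6 & lead_coeff f = 1 & (\<forall>a. int (nat (enorm (NU \<mu> (v((None, False) := a))))) = \<bar>poly f a\<bar>)" for v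
   by (rule NU_fibre)
  fix p assume p: "prime p" "p \<notin> bad"
  have p3: "p ~= 3" "~ int p dvd enorm \<mu>" using p by (auto simp: bad_def)
  show "card (jroots \<mu> p) <= 24" using card_jroots_le[OF p(1)] .
  show "LF (fst j) (snd j) (%i. if i = (None, False) then 1 else 0) = 1" for j
   by (simp add: LF_def lf_def ev_def X1_def X2_def X3_def)
  show "p dvd nat (enorm (NU \<mu> v))" if "j \<in> jroots \<mu> p" "int p dvd LF (fst j) (snd j) v" for j v
  proof -
   have "fst j \<in> wroots p" "int p dvd snd j ^ 3 - ev (fst j) \<mu>" using that(1) by (auto simp: jroots_def)
   then have "int p dvd ev (fst j) (NU \<mu> v)" "int p dvd fst j * fst j + fst j + 1"
    using ev_NU_of_LF that(2) by (auto simp: wroots_def)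
   then show ?thesis unfolding nat_dvd using enorm_ev[of "int p" "fst j"] by (metis cong_dvd_iff dvd_mult2)
  qed
  show "p\<^sup>2 dvd nat (enorm (NU \<mu> v))" if "j \<in> jroots \<mu> p" "j' \<in> jroots \<mu> p" "j ~= j'"
   "int p dvd LF (fst j) (snd j) v" "int p dvd LF (fst j') (snd j') v" for j j' v
   unfolding nat_dvd using LF_two[OF p(1) p3, of "fst j" "snd j" "fst j'" "snd j'" v] that by (simp add: prod_eq_iff)
  show "\<exists>j\<in>jroots \<mu> p. int p dvd LF (fst j) (snd j) v" if "p dvd nat (enorm (NU \<mu> v))" "~ p\<^sup>2 dvd nat (enorm (NU \<mu> v))" for v
   using LF_exists[OF p(1) p3(1), of \<mu> v] that unfolding nat_dvd by (auto simp: case_prod_beta)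
  show "finite (\<C> p) & card (\<C> p) <= 24" using \<C>[OF p] by simp
  show "v - w \<in> g" if "g \<in> \<C> p" "v \<in> g" "w \<in> g" for g v w using \<C>[OF p] that by (auto simp: diff_closed_def)
  show "p\<^sup>2 dvd nat (enorm (NU \<mu> v))" if "g \<in> \<C> p" "v \<in> g" for g v using \<C>[OF p] that unfolding nat_dvd by auto
  show "\<exists>g\<in>\<C> p. v \<in> g" if "p\<^sup>2 dvd nat (enorm (NU \<mu> v))" for v using \<C>[OF p] that unfolding nat_dvd by auto
 qed (auto simp: fin LF_diff)
 show ?thesis by (rule lmean_card_J)
qed

subsection \<open>Homogeneous coordinates\<close>

abbreviation (input) "cf \<equiv> Polynomial.coeff"

text \<open>Homogenisation in degree 2 whatever \<open>degree f\<close> is, so that numerator and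
  denominator are compatible at infinity.\<close>

definition hq :: "rat poly => 'a::field_char_0 => 'a => 'a" where
 "hq f x y = of_rat (cf f 2) * x\<^sup>2 + of_rat (cf f 1) * (x * y) + of_rat (cf f 0) * y\<^sup>2"

definition pt :: "'a::field => 'a => 'a option" where
 "pt x y = (if y = 0 then None else Some (x / y))"

lemma pt_eq_iff:
 "(x, y) ~= (0, 0) ==> (x', y') ~= (0, 0) ==> pt x y = pt x' y' \<longleftrightarrow> x * y' = x' * y"
 by (cases "y = 0"; cases "y' = 0") (auto simp: pt_def frac_eq_eq)

lemma pt_surj: obtains x y :: "'a::field" where "P = pt x y" "(x, y) ~= (0, 0)"
proof (cases P)
 case None
 then show thesis using that[of 1 0] by (simp add: pt_def)
next
 case (Some z)
 then show thesis using that[of z 1] by (simp add: pt_def)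
qed

lemma moebius_act_pt:
 assumes "(x, y) ~= (0, 0)"
 shows "moebius_act a b c d (pt x y) = pt (a * x + b * y) (c * x + d * y)"
proof (cases "y = 0")
 case True
 then show ?thesis using assms by (simp add: moebius_act_def pt_def)
next
 case False
 then have "a * (x / y) + b = (a * x + b * y) / y" "c * (x / y) + d = (c * x + d * y) / y"
  by (simp_all add: add_divide_distrib)
 then show ?thesis using False by (simp add: moebius_act_def pt_def)
qed

lemma poly_degree_2:
 fixes f :: "'a::comm_semiring_1 poly"
 assumes "degree f <= 2"
 shows "poly f x = cf f 2 * x\<^sup>2 + cf f 1 * x + cf f 0"
proof -
 have "f = [:cf f 0, cf f 1, cf f 2:]"
  using assms by (intro poly_eqI) (auto simp: coeff_pCons numeral_2_eq_2 coeff_eq_0 split: nat.split)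
 then have "poly f x = poly [:cf f 0, cf f 1, cf f 2:] x" by simp
 then show ?thesis by (simp add: ring2)
qed

lemma degree_of_rat_poly_le: "degree (map_poly of_rat f) <= degree f"
 by (rule degree_le) (simp add: coeff_map_poly coeff_eq_0)

lemma coeff_of_rat_poly [simp]: "cf (map_poly of_rat f) i = of_rat (cf f i)"
 by (simp add: coeff_map_poly)

lemma poly_of_rat_poly_2:
 "degree f <= 2 ==> poly (map_poly of_rat f) x = hq f x (1 :: 'a::field_char_0)"
 by (subst poly_degree_2) (auto simp: hq_def intro: order_trans[OF degree_of_rat_poly_le])

text \<open>The Euclidean algorithm; its measure places the zero polynomial below the nonzero
  constants, which have the same \<open>degree\<close>.\<close>

lemma field_poly_bezout:
 fixes f g :: "'a::field poly"
 assumes "coprime f g"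
 shows "\<exists>u v. u * f + v * g = 1"
 using assms
proof (induction "if g = 0 then 0 else Suc (degree g)" arbitrary: f g rule: less_induct)
 case less
 show ?case
 proof (cases "g = 0")
  case True
  then have "f dvd 1" using less.prems by simp
  then obtain u where "1 = f * u" by (elim dvdE)
  then have "u * f + 0 * g = 1" by (simp add: mult.commute)
  then show ?thesis by blast
 next
  case False
  have "coprime g (f mod g)" using less.prems False by (simp add: coprime_commute)
  moreover have "(if f mod g = 0 then 0 else Suc (degree (f mod g))) < (if g = 0 then 0 else Suc (degree g))"
   using degree_mod_less[OF False, of f] False by auto
  ultimately obtain u v where uv: "u * g + v * (f mod g) = 1" using less.hyps by blast
  have "v * f + (u - v * (f div g)) * g = u * g + v * (f - f div g * g)" by (simp add: algebra_simps)
  also have "f - f div g * g = f mod g" by (rule minus_div_mult_eq_mod)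
  finally have "v * f + (u - v * (f div g)) * g = 1" unfolding uv .
  then show ?thesis by blast
 qed
qed

lemma rat_poly_bezout_eval:
 fixes f g :: "rat poly" and z :: "'a::field_char_0"
 assumes "coprime f g"
 shows "poly (map_poly of_rat f) z ~= 0 \<or> poly (map_poly of_rat g) z ~= 0"
proof -
 obtain u v where uv: "u * f + v * g = 1"
  using field_poly_bezout[OF assms] by blast
 have hom: "map_poly of_rat (a * b) = map_poly of_rat a * (map_poly of_rat b :: 'a poly)"
  "map_poly of_rat (a + b) = map_poly of_rat a + (map_poly of_rat b :: 'a poly)" for a b :: "rat poly"
  by (rule poly_eqI; simp add: coeff_mult of_rat_sum of_rat_mult of_rat_add)+
 have "map_poly of_rat (u * f + v * g) = (1 :: 'a poly)" unfolding uv by (simp add: map_poly_1)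
 then have "poly (map_poly of_rat u) z * poly (map_poly of_rat f) z + poly (map_poly of_rat v) z * poly (map_poly of_rat g) z = 1"
  unfolding hom by (metis poly_1 poly_add poly_mult)
 then show ?thesis by auto
qed

locale quad_map =
 fixes f g :: "rat poly"
 assumes rf: "is_rat_fun f g" and deg: "rat_fun_deg f g = 2"
begin

lemma degs: "degree f <= 2" "degree g <= 2" "cf f 2 ~= 0 \<or> cf g 2 ~= 0" "coprime f g" "g ~= 0"
proof -
 show "degree f <= 2" "degree g <= 2" using deg by (auto simp: rat_fun_deg_def)
 show "coprime f g" "g ~= 0" using rf by (auto simp: is_rat_fun_def)
 have "degree f = 2 \<or> degree g = 2" using deg by (auto simp: rat_fun_deg_def max_def split: if_splits)
 then show "cf f 2 ~= 0 \<or> cf g 2 ~= 0" by (metis leading_coeff_0_iff degree_0 zero_neq_numeral)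
qed

lemma hq_dehom: "y ~= 0 ==> hq h x y = y\<^sup>2 * hq h (x / y) (1 :: 'a::field_char_0)"
 by (simp add: hq_def field_simps power2_eq_square)

lemma hq_nonzero:
 fixes x y :: "'a::field_char_0"
 assumes "(x, y) ~= (0, 0)"
 shows "(hq f x y, hq g x y) ~= (0, 0)"
proof (cases "y = 0")
 case True
 then show ?thesis using assms degs(3) by (auto simp: hq_def)
next
 case False
 then show ?thesis
  using rat_poly_bezout_eval[OF degs(4), of "x / y"] degs(1,2)
  by (auto simp: hq_dehom[OF False, of f x] hq_dehom[OF False, of g x] poly_of_rat_poly_2)
qed

lemma rf_act_pt:
 fixes x y :: "'a::field_char_0"
 assumes "(x, y) ~= (0, 0)"
 shows "rf_act f g (pt x y) = pt (hq f x y) (hq g x y)"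
proof (cases "y = 0")
 case True
 then have x: "x ~= 0" using assms by simp
 have "cf g 2 = 0 \<longleftrightarrow> degree g < degree f"
 proof
  assume "cf g 2 = 0"
  then have "degree f = 2" using degs(1,3) le_degree[of f 2] by simp
  moreover have "degree g ~= 2" using \<open>cf g 2 = 0\<close> degs(5) by (metis leading_coeff_0_iff)
  ultimately show "degree g < degree f" using degs(2) by simp
 next
  assume "degree g < degree f"
  then show "cf g 2 = 0" using degs(1) by (simp add: coeff_eq_0)
 qed
 moreover have "degree g = 2" if "cf g 2 ~= 0" using that le_degree degs(2) by (metis le_antisym)
 ultimately show ?thesis using True x by (auto simp: rf_act_def pt_def hq_def)
next
 case False
 have "hq g x y = y\<^sup>2 * hq g (x / y) 1" "hq f x y = y\<^sup>2 * hq f (x / y) 1" by (rule hq_dehom[OF False])+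
 then show ?thesis using False degs(1,2) by (simp add: rf_act_def pt_def poly_of_rat_poly_2)
qed

end

lemma of_rat_hq [simp]: "of_rat (hq f x y) = (hq f (of_rat x) (of_rat y) :: 'a::field_char_0)"
 by (simp add: hq_def of_rat_add of_rat_mult of_rat_power)

subsection \<open>The normal form\<close>

text \<open>The coordinates (a x + b y : c x + d y) conjugate (f : g) to X \<mapsto> t / (X^2 + X).\<close>
definition normal_form :: "rat poly => rat poly => rat => rat => rat => rat => rat => rat => bool" where
 "normal_form f g a b c d l t \<longleftrightarrow> a * d - b * c ~= 0 & l ~= 0 & t ~= 0 &
   a * cf f 2 + b * cf g 2 = l * t * c\<^sup>2 &
   a * cf f 1 + b * cf g 1 = l * t * (2 * c * d) &
   a * cf f 0 + b * cf g 0 = l * t * d\<^sup>2 &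
   c * cf f 2 + d * cf g 2 = l * (a\<^sup>2 + a * c) &
   c * cf f 1 + d * cf g 1 = l * (2 * a * b + a * d + b * c) &
   c * cf f 0 + d * cf g 0 = l * (b\<^sup>2 + b * d)"

lemma normal_form_act:
 fixes x y :: "'a::field_char_0"
 assumes "normal_form f g a b c d l t"
 defines "U \<equiv> of_rat a * x + of_rat b * y" and "V \<equiv> of_rat c * x + of_rat d * y"
 shows "of_rat a * hq f x y + of_rat b * hq g x y = of_rat l * (of_rat t * V\<^sup>2)"
  and "of_rat c * hq f x y + of_rat d * hq g x y = of_rat l * (U\<^sup>2 + U * V)"
proof -
 have lin: "of_rat s * hq f x y + of_rat r * hq g x y
   = of_rat (s * cf f 2 + r * cf g 2) * x\<^sup>2 + of_rat (s * cf f 1 + r * cf g 1) * (x * y)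
    + of_rat (s * cf f 0 + r * cf g 0) * y\<^sup>2" for s r
  by (simp add: hq_def of_rat_add of_rat_mult algebra_simps)
 show "of_rat a * hq f x y + of_rat b * hq g x y = of_rat l * (of_rat t * V\<^sup>2)"
  unfolding lin using assms(1) unfolding normal_form_def V_def
  by (simp add: of_rat_add of_rat_mult of_rat_power ring2)
 show "of_rat c * hq f x y + of_rat d * hq g x y = of_rat l * (U\<^sup>2 + U * V)"
  unfolding lin using assms(1) unfolding normal_form_def U_def V_def
  by (simp add: of_rat_add of_rat_mult of_rat_power ring2)
qed

text \<open>In coordinates that send the critical point to infinity and its image to 0.\<close>
lemma two_cycle_coordinates:
 fixes p0 p1 q0 q1 :: "'a::field_char_0"
 defines "D \<equiv> q1 * p0 - q0 * p1"
 assumes D: "D ~= 0" and q: "q0 = hq f p0 p1" "q1 = hq g p0 p1"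
  and per: "p1 * hq f q0 q1 - p0 * hq g q0 q1 = 0"
 defines "\<alpha> \<equiv> - 1 / D" and "\<beta> \<equiv> - (p1 * hq f (p0 + q0) (p1 + q1) - p0 * hq g (p0 + q0) (p1 + q1) + D) / D\<^sup>2"
 shows "p1 * hq f x y - p0 * hq g x y =
   (q1 * x - q0 * y) * (\<alpha> * (q1 * x - q0 * y) + \<beta> * (p1 * x - p0 * y))"
proof -
 define H where "H x y = p1 * hq f x y - p0 * hq g x y" for x y
 \<comment> \<open>A quadratic form is determined by its values at p, q and p + q. Its value at q
   vanishes because the cycle closes, which produces the linear factor q1 x - q0 y.\<close>
 have pol: "D\<^sup>2 * H x y = H p0 p1 * (q1 * x - q0 * y)\<^sup>2 - (H (p0 + q0) (p1 + q1) - H p0 p1 - H q0 q1) * ((q1 * x - q0 * y) * (p1 * x - p0 * y)) + H q0 q1 * (p1 * x - p0 * y)\<^sup>2"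
 proof -
  define h2 where "h2 = p1 * of_rat (cf f 2) - p0 * of_rat (cf g 2)"
  define h1 where "h1 = p1 * of_rat (cf f 1) - p0 * of_rat (cf g 1)"
  define h0 where "h0 = p1 * of_rat (cf f 0) - p0 * of_rat (cf g 0)"
  have H: "H x y = h2 * (x * x) + h1 * (x * y) + h0 * (y * y)" for x y
   by (simp add: H_def hq_def h2_def h1_def h0_def ring2)
  show ?thesis unfolding H D_def by (simp add: ring2)
 qed
 have Hp: "H p0 p1 = - D" unfolding H_def D_def q[symmetric] by (simp add: algebra_simps)
 have Hq: "H q0 q1 = 0" unfolding H_def using per .
 have ab: "\<alpha> = H p0 p1 / D\<^sup>2" "\<beta> = - (H (p0 + q0) (p1 + q1) - H p0 p1 - H q0 q1) / D\<^sup>2"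
  unfolding \<alpha>_def \<beta>_def Hp Hq using D by (simp_all add: H_def power2_eq_square)
 have "H x y = (D\<^sup>2 * H x y) / D\<^sup>2" using D by simp
 also have "... = (q1 * x - q0 * y) * (\<alpha> * (q1 * x - q0 * y) + \<beta> * (p1 * x - p0 * y))"
  unfolding pol ab Hq using D by (simp add: field_simps power2_eq_square)
 finally show ?thesis unfolding H_def .
qed

lemma map_poly_of_rat_mult [simp]:
 "map_poly of_rat (a * b) = map_poly of_rat a * (map_poly of_rat b :: 'a::field_char_0 poly)"
 by (rule poly_eqI) (simp add: coeff_mult of_rat_sum of_rat_mult)

lemma map_poly_of_rat_add [simp]:
 "map_poly of_rat (a + b) = map_poly of_rat a + (map_poly of_rat b :: 'a::field_char_0 poly)"
 by (rule poly_eqI) (simp add: of_rat_add)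

text \<open>Conjugation over Q for irrational roots of a rational quadratic.\<close>
lemma rat_poly_conjugate_root:
 fixes z z' :: "'a::field_char_0" and q :: "rat poly"
 assumes irr: "z \<notin> \<rat>" and z: "z + z' = of_rat s" "z * z' = of_rat m"
  and q: "poly (map_poly of_rat q) z = 0"
 shows "poly (map_poly of_rat q) z' = 0"
proof -
 define k where "k = [:m, - s, 1:]"
 have kz: "poly (map_poly of_rat k) z = 0" "poly (map_poly of_rat k) z' = 0"
 proof -
  have m: "map_poly of_rat k = [:z * z', - (z + z'), 1:]"
   by (rule poly_eqI) (simp add: k_def z coeff_pCons of_rat_minus split: nat.split)
  show "poly (map_poly of_rat k) z = 0" "poly (map_poly of_rat k) z' = 0" unfolding m by (simp_all add: algebra_simps)
 qed
 have dq: "q = k * (q div k) + q mod k" by simp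
 have dm: "q mod k = 0 \<or> degree (q mod k) < degree k" by (rule degree_mod_less) (simp add: k_def)
 have "degree k = 2" by (simp add: k_def)
 then have "degree (q mod k) <= 1" using dm by auto
 then have "q mod k = [:cf (q mod k) 0, cf (q mod k) 1:]"
  by (intro poly_eqI) (auto simp: coeff_pCons coeff_eq_0 split: nat.split)
 then obtain u v where uv: "q mod k = [:u, v:]" by blast
 have "poly (map_poly of_rat q) x = poly (map_poly of_rat k) x * poly (map_poly of_rat (q div k)) x + poly (map_poly of_rat (q mod k)) x" for x :: 'a
  by (metis dq map_poly_of_rat_add map_poly_of_rat_mult poly_add poly_mult)
 moreover have "poly (map_poly of_rat [:u, v:]) x = of_rat u + of_rat v * x" for x :: 'a
 proof -
  have "map_poly of_rat [:u, v:] = [:of_rat u, of_rat v :: 'a:]"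
   by (rule poly_eqI) (simp add: coeff_pCons split: nat.split)
  then show ?thesis by (simp add: mult.commute)
 qed
 ultimately have e: "poly (map_poly of_rat q) x = poly (map_poly of_rat k) x * poly (map_poly of_rat (q div k)) x + (of_rat u + of_rat v * x)" for x :: 'a
  unfolding uv by metis
 have "of_rat u + of_rat v * z = 0" using e[of z] q kz by simp
 have "v = 0"
 proof (rule ccontr)
  assume "v ~= 0"
  then have "z = of_rat (- u / v)" using \<open>of_rat u + of_rat v * z = 0\<close>
   by (simp add: of_rat_divide of_rat_minus field_simps eq_neg_iff_add_eq_0)
  then show False using irr by simp
 qed
 then have "u = 0" using \<open>of_rat u + of_rat v * z = 0\<close> by simp
 then show ?thesis using e[of z'] kz \<open>v = 0\<close> by simp
qed

context quad_map
begin

text \<open>Ramification says that the fibre form over the image has a double zero at the point, so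
  it is a multiple of the square of the linear form vanishing there. Homogeneous coordinates treat
  infinity in the same way.\<close>

lemma fibre_poly_coeffs:
 fixes p0 p1 q0 q1 :: complex
 assumes p: "(p0 = 1 & p1 = 0) \<or> p1 = 1" and q: "q0 = hq f p0 p1" "q1 = hq g p0 p1"
  and crit: "critical_pt f g (pt p0 p1)"
 shows "\<exists>c. \<forall>x y. q1 * hq f x y - q0 * hq g x y = c * (p1 * x - p0 * y)\<^sup>2"
proof -
 define h where "h = fibre_poly f g (rf_act f g (pt p0 p1))"
 have p0: "(p0, p1) ~= (0, 0)" using p by auto
 have act: "rf_act f g (pt p0 p1) = pt q0 q1" unfolding q using rf_act_pt[OF p0] .
 obtain s where s: "!!i. q1 * of_rat (cf f i) - q0 * of_rat (cf g i) = s * cf h i"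
 proof (cases "q1 = 0")
  case True
  then show thesis using that[of "- q0"] unfolding h_def act by (simp add: pt_def fibre_poly_def)
 next
  case False
  then show thesis using that[of q1] unfolding h_def act by (simp add: pt_def fibre_poly_def field_simps)
 qed
 have "degree h <= 2"
  unfolding h_def act using degs(1,2)
  by (auto simp: pt_def fibre_poly_def intro!: degree_diff_le order_trans[OF degree_smult_le] order_trans[OF degree_of_rat_poly_le])
 have "\<exists>k. cf h 2 = k * p1\<^sup>2 & cf h 1 = k * (- 2 * p0 * p1) & cf h 0 = k * p0\<^sup>2"
  using p
 proof
  assume p: "p0 = 1 & p1 = 0"
  then have "2 - degree h >= 2" using crit deg unfolding critical_pt_def ram_index_def h_def by (simp add: pt_def)
  then have "degree h = 0" by simp
  then show ?thesis using p by (intro exI[of _ "cf h 0"]) (simp add: coeff_eq_0)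
 next
  assume p: "p1 = 1"
  then have "Polynomial.order p0 h >= 2" using crit unfolding critical_pt_def ram_index_def h_def by (simp add: pt_def)
  then have "[:- p0, 1:] ^ 2 dvd h" using order_divides by blast
  then obtain k where k: "h = [:- p0, 1:] ^ 2 * k" by (elim dvdE)
  show ?thesis
  proof (cases "k = 0")
   case True
   then show ?thesis using k by (intro exI[of _ 0]) simp
  next
   case False
   then have "degree h = 2 + degree k" unfolding k by (subst degree_mult_eq) (auto simp: degree_power_eq)
   then have "degree k = 0" using \<open>degree h <= 2\<close> by simp
   then obtain a where "k = [:a:]" by (metis degree_0_id)
   then show ?thesis using k p
    by (intro exI[of _ a]) (simp add: power2_eq_square numeral_2_eq_2 coeff_pCons)
  qed
 qed
 then obtain k where k: "cf h 2 = k * p1\<^sup>2" "cf h 1 = k * (- 2 * p0 * p1)" "cf h 0 = k * p0\<^sup>2" by blast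
 have "q1 * hq f x y - q0 * hq g x y = (s * k) * (p1 * x - p0 * y)\<^sup>2" for x y
 proof -
  have "q1 * hq f x y - q0 * hq g x y = (q1 * of_rat (cf f 2) - q0 * of_rat (cf g 2)) * x\<^sup>2
    + (q1 * of_rat (cf f 1) - q0 * of_rat (cf g 1)) * (x * y) + (q1 * of_rat (cf f 0) - q0 * of_rat (cf g 0)) * y\<^sup>2"
   by (simp add: hq_def algebra_simps)
  then show ?thesis unfolding s k by (simp add: ring2)
 qed
 then show ?thesis by blast
qed

lemma quadratic_form_eqI:
 fixes a b c a' b' c' :: "'a::field_char_0"
 assumes "!!x y. a * x\<^sup>2 + b * (x * y) + c * y\<^sup>2 = a' * x\<^sup>2 + b' * (x * y) + c' * y\<^sup>2"
 shows "a = a' & b = b' & c = c'"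
 using assms[of 1 0] assms[of 0 1] assms[of 1 1] by simp

text \<open>Half the Jacobian determinant of the homogenised pair (f, g): a quadratic form with
  rational coefficients whose zeros are the critical points.\<close>

definition jac :: "'a::field_char_0 => 'a => 'a" where
 "jac x y = of_rat (cf f 2 * cf g 1 - cf f 1 * cf g 2) * x\<^sup>2
   + of_rat (2 * (cf f 2 * cf g 0 - cf f 0 * cf g 2)) * (x * y)
   + of_rat (cf f 1 * cf g 0 - cf f 0 * cf g 1) * y\<^sup>2"

text \<open>The Jacobian of c Y^2 and X (\<alpha> X + \<beta> Y) is a multiple of Y (2 \<alpha> X +
  \<beta> Y), so the second critical point has 2 \<alpha> X + \<beta> Y = 0. It lies on the 2-cycle
  iff \<beta> = 0.\<close>

lemma jac_coordinates:
 fixes p0 p1 q0 q1 :: "'a::field_char_0"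
 assumes D: "q1 * p0 - q0 * p1 ~= 0"
  and F: "!!x y. q1 * hq f x y - q0 * hq g x y = c * (p1 * x - p0 * y)\<^sup>2"
  and G: "!!x y. p1 * hq f x y - p0 * hq g x y = (q1 * x - q0 * y) * (\<alpha> * (q1 * x - q0 * y) + \<beta> * (p1 * x - p0 * y))"
 shows "jac x y = - c * (p1 * x - p0 * y) * (2 * \<alpha> * (q1 * x - q0 * y) + \<beta> * (p1 * x - p0 * y))"
proof -
 let ?f = "%i. of_rat (cf f i) :: 'a" and ?g = "%i. of_rat (cf g i) :: 'a"
 have cf: "q1 * ?f 2 - q0 * ?g 2 = c * p1\<^sup>2 & q1 * ?f 1 - q0 * ?g 1 = c * (- 2 * p1 * p0) & q1 * ?f 0 - q0 * ?g 0 = c * p0\<^sup>2"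
 proof (rule quadratic_form_eqI)
  fix x y
  show "(q1 * ?f 2 - q0 * ?g 2) * x\<^sup>2 + (q1 * ?f 1 - q0 * ?g 1) * (x * y) + (q1 * ?f 0 - q0 * ?g 0) * y\<^sup>2
    = c * p1\<^sup>2 * x\<^sup>2 + c * (- 2 * p1 * p0) * (x * y) + c * p0\<^sup>2 * y\<^sup>2"
   using F[of x y] by (simp add: hq_def ring2)
 qed
 have cg: "p1 * ?f 2 - p0 * ?g 2 = \<alpha> * q1\<^sup>2 + \<beta> * (q1 * p1) & p1 * ?f 1 - p0 * ?g 1 = \<alpha> * (- 2 * q1 * q0) + \<beta> * (- q1 * p0 - q0 * p1)
   & p1 * ?f 0 - p0 * ?g 0 = \<alpha> * q0\<^sup>2 + \<beta> * (q0 * p0)"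
 proof (rule quadratic_form_eqI)
  fix x y
  show "(p1 * ?f 2 - p0 * ?g 2) * x\<^sup>2 + (p1 * ?f 1 - p0 * ?g 1) * (x * y) + (p1 * ?f 0 - p0 * ?g 0) * y\<^sup>2
    = (\<alpha> * q1\<^sup>2 + \<beta> * (q1 * p1)) * x\<^sup>2 + (\<alpha> * (- 2 * q1 * q0) + \<beta> * (- q1 * p0 - q0 * p1)) * (x * y) + (\<alpha> * q0\<^sup>2 + \<beta> * (q0 * p0)) * y\<^sup>2"
   using G[of x y] by (simp add: hq_def ring2)
 qed
 let ?D = "q1 * p0 - q0 * p1"
 have det: "(q1 * a - q0 * b) * (p1 * a' - p0 * b') - (q1 * a' - q0 * b') * (p1 * a - p0 * b) = - ?D * (a * b' - a' * b)" for a b a' b'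
  by (simp add: algebra_simps)
 have "- ?D * jac x y = - ?D * (- c * (p1 * x - p0 * y) * (2 * \<alpha> * (q1 * x - q0 * y) + \<beta> * (p1 * x - p0 * y)))"
 proof -
  have "- ?D * jac x y = (- ?D * (?f 2 * ?g 1 - ?f 1 * ?g 2)) * x\<^sup>2 + 2 * (- ?D * (?f 2 * ?g 0 - ?f 0 * ?g 2)) * (x * y) + (- ?D * (?f 1 * ?g 0 - ?f 0 * ?g 1)) * y\<^sup>2"
   by (simp add: jac_def of_rat_diff of_rat_mult algebra_simps)
  also have "... = - ?D * (- c * (p1 * x - p0 * y) * (2 * \<alpha> * (q1 * x - q0 * y) + \<beta> * (p1 * x - p0 * y)))"
 unfolding det[symmetric] cf[THEN conjunct1] cf[THEN conjunct2, THEN conjunct1] cf[THEN conjunct2, THEN conjunct2]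
    cg[THEN conjunct1] cg[THEN conjunct2, THEN conjunct1] cg[THEN conjunct2, THEN conjunct2]
   by (simp add: ring2)
  finally show ?thesis .
 qed
 then show ?thesis by (rule mult_left_cancel[THEN iffD1, rotated]) (use D in simp)
qed

text \<open>If both critical points lie on the 2-cycle, the map is Y^2 : X^2 up to constants and the
 rotation of order 3 about the critical points, defined over a quadratic extension, commutes with it.\<close>
lemma beta_nonzero:
 fixes p0 p1 q0 q1 :: complex
 assumes D: "q1 * p0 - q0 * p1 ~= 0" and c: "c ~= 0" and \<alpha>: "\<alpha> ~= 0" and aut: "trivial_Aut f g"
  and F: "!!x y. q1 * hq f x y - q0 * hq g x y = c * (p1 * x - p0 * y)\<^sup>2"
  and G: "!!x y. p1 * hq f x y - p0 * hq g x y = (q1 * x - q0 * y) * (\<alpha> * (q1 * x - q0 * y) + \<beta> * (p1 * x - p0 * y))"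
 shows "\<beta> ~= 0"
proof
 assume b0: "\<beta> = 0"
 define r0 where "r0 = cf f 2 * cf g 1 - cf f 1 * cf g 2"
 define r1 where "r1 = 2 * (cf f 2 * cf g 0 - cf f 0 * cf g 2)"
 define r2 where "r2 = cf f 1 * cf g 0 - cf f 0 * cf g 1"
 define j0 j1 j2 :: complex where "j0 = of_rat r0" and "j1 = of_rat r1" and "j2 = of_rat r2"
 define s where "s = - (r1\<^sup>2 - 4 * r0 * r2) / 3"
 define e where "e = csqrt (of_rat s)"
 define k where "k = - 2 * c * \<alpha>"
 define E where "E = k * (q1 * p0 - q0 * p1)"
 have k0: "k ~= 0" using c \<alpha> by (simp add: k_def)
 have E0: "E ~= 0" using k0 D by (simp add: E_def)
 have "j0 = k * (q1 * p1) & j1 = k * (- q1 * p0 - q0 * p1) & j2 = k * (q0 * p0)"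
 proof (rule quadratic_form_eqI)
  fix x y
  have "j0 * x\<^sup>2 + j1 * (x * y) + j2 * y\<^sup>2 = jac x y"
   by (simp add: jac_def j0_def j1_def j2_def r0_def r1_def r2_def)
  also have "... = k * ((q1 * x - q0 * y) * (p1 * x - p0 * y))"
   unfolding jac_coordinates[OF D F G] b0 k_def by (simp add: algebra_simps)
  finally show "j0 * x\<^sup>2 + j1 * (x * y) + j2 * y\<^sup>2 = k * (q1 * p1) * x\<^sup>2 + k * (- q1 * p0 - q0 * p1) * (x * y) + k * (q0 * p0) * y\<^sup>2"
   by (simp add: ring2)
 qed
 then have j: "j0 = k * (q1 * p1)" "j1 = k * (- q1 * p0 - q0 * p1)" "j2 = k * (q0 * p0)" by auto
 have ee: "e * e = of_rat s" unfolding e_def by (simp flip: power2_eq_square)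
 have "of_rat s = - (j1\<^sup>2 - 4 * j0 * j2) / 3"
  by (simp add: s_def j0_def j1_def j2_def of_rat_divide of_rat_minus of_rat_diff of_rat_mult of_rat_power)
 also have "j1\<^sup>2 - 4 * j0 * j2 = E\<^sup>2" unfolding j E_def by (simp add: ring2)
 finally have e3: "3 * (e * e) = - (E * E)" using ee by (simp add: power2_eq_square)
 have alg: "algebraic (e + of_rat r)" for r
 proof -
  have "poly [:of_rat (r * r - s), of_rat (- 2 * r), 1:] (e + of_rat r) = (0 :: complex)"
   using ee by (simp add: of_rat_diff of_rat_mult of_rat_minus algebra_simps)
  then show ?thesis
   by (intro algebraicI'[of "[:of_rat (r * r - s), of_rat (- 2 * r), 1:]"]) (auto simp: coeff_pCons split: nat.split)
 qed
 have algr: "algebraic (of_rat r :: complex)" for r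
  by (intro algebraicI'[of "[:- of_rat r, 1:]"]) (auto simp: coeff_pCons split: nat.split)
 \<comment> \<open>The matrix e I + M, where the rational matrix M built from \<open>jac\<close> has
   the two critical points as eigenlines with eigenvalues E and -E. It multiplies X by e + E and Y
   by e - E, and 3 e^2 = -E^2 makes the cubes of these factors equal.\<close>
 let ?a = "e - j1" and ?b = "- 2 * j2" and ?c = "2 * j0" and ?d = "e + j1"
 have algs: "algebraic ?a" "algebraic ?b" "algebraic ?c" "algebraic ?d"
  using alg[of "- r1"] alg[of r1] algr[of "- 2 * r2"] algr[of "2 * r0"]
  by (simp_all add: j0_def j1_def j2_def of_rat_minus of_rat_mult)
 have det: "?a * ?d - ?b * ?c ~= 0"
 proof -
  have "?a * ?d - ?b * ?c = e * e - (j1\<^sup>2 - 4 * j0 * j2)" by (simp add: ring2)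
  also have "j1\<^sup>2 - 4 * j0 * j2 = E * E" unfolding j E_def by (simp add: ring2)
  finally have "?a * ?d - ?b * ?c = e * e - E * E" .
  moreover have "3 * (e * e - E * E) = - 4 * (E * E)" using e3 by (simp add: algebra_simps)
  ultimately show ?thesis using E0 by (metis mult_eq_0_iff mult_zero_right neg_equal_0_iff_equal zero_neq_numeral minus_mult_left)
 qed
 have mob: "moebius_act ?a ?b ?c ?d (pt x y) = pt (?a * x + ?b * y) (?c * x + ?d * y)" if "(x, y) ~= (0, 0)" for x y
  using that by (rule moebius_act_pt)
 have nz: "(?a * x + ?b * y, ?c * x + ?d * y) ~= (0, 0)" if "(x, y) ~= (0, 0)" for x y
 proof
  assume z: "(?a * x + ?b * y, ?c * x + ?d * y) = (0, 0)"
  have "(?a * ?d - ?b * ?c) * x = ?d * (?a * x + ?b * y) - ?b * (?c * x + ?d * y)"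
   "(?a * ?d - ?b * ?c) * y = ?a * (?c * x + ?d * y) - ?c * (?a * x + ?b * y)" by (simp_all add: algebra_simps)
  then show False using z det that by simp
 qed
 have X: "q1 * (?a * x + ?b * y) - q0 * (?c * x + ?d * y) = (e + E) * (q1 * x - q0 * y)"
  and Y: "p1 * (?a * x + ?b * y) - p0 * (?c * x + ?d * y) = (e - E) * (p1 * x - p0 * y)" for x y
  unfolding j E_def by (simp_all add: algebra_simps)
 have cross: "(q1 * p0 - q0 * p1) * (u * v' - u' * v) = - ((q1 * u - q0 * v) * (p1 * u' - p0 * v') - (q1 * u' - q0 * v') * (p1 * u - p0 * v))" for u v u' v'
  by (simp add: algebra_simps)
 have "moebius_act ?a ?b ?c ?d \<circ> rf_act f g = rf_act f g \<circ> moebius_act ?a ?b ?c ?d"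
 proof
  fix P :: "complex option"
  obtain x y where P: "P = pt x y" and xy: "(x, y) ~= (0, 0)" by (rule pt_surj)
  let ?x' = "?a * x + ?b * y" and ?y' = "?c * x + ?d * y"
  let ?u = "hq f x y" and ?v = "hq g x y"
  have "(q1 * p0 - q0 * p1) * ((?a * ?u + ?b * ?v) * hq g ?x' ?y' - hq f ?x' ?y' * (?c * ?u + ?d * ?v)) = 0"
  proof -
   have cube: "(e + E) * (e + E) * (e + E) = (e - E) * (e - E) * (e - E)"
   proof -
    have "(e + E) * (e + E) * (e + E) - (e - E) * (e - E) * (e - E) = 2 * E * (3 * (e * e) + E * E)"
     by (simp add: algebra_simps)
    then show ?thesis using e3 by simp
   qed
   have "(q1 * p0 - q0 * p1) * ((?a * ?u + ?b * ?v) * hq g ?x' ?y' - hq f ?x' ?y' * (?c * ?u + ?d * ?v))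
    = - (((e + E) * (c * (p1 * x - p0 * y)\<^sup>2)) * (((e + E) * (q1 * x - q0 * y)) * (\<alpha> * ((e + E) * (q1 * x - q0 * y))))
     - (c * ((e - E) * (p1 * x - p0 * y))\<^sup>2) * ((e - E) * ((q1 * x - q0 * y) * (\<alpha> * (q1 * x - q0 * y)))))"
    unfolding cross X Y F G b0 by simp
   also have "... = - (c * \<alpha> * (p1 * x - p0 * y)\<^sup>2 * (q1 * x - q0 * y)\<^sup>2) * ((e + E) * (e + E) * (e + E) - (e - E) * (e - E) * (e - E))"
    by (simp add: ring2)
   finally show ?thesis using cube by simp
  qed
  then have "(?a * ?u + ?b * ?v) * hq g ?x' ?y' = hq f ?x' ?y' * (?c * ?u + ?d * ?v)" using D by simp
  then have "pt (?a * ?u + ?b * ?v) (?c * ?u + ?d * ?v) = pt (hq f ?x' ?y') (hq g ?x' ?y')"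
   using nz[OF hq_nonzero[OF xy]] hq_nonzero[OF nz[OF xy]] by (subst pt_eq_iff) auto
  then show "(moebius_act ?a ?b ?c ?d \<circ> rf_act f g) P = (rf_act f g \<circ> moebius_act ?a ?b ?c ?d) P"
   unfolding P comp_def rf_act_pt[OF xy] mob[OF xy] mob[OF hq_nonzero[OF xy]] rf_act_pt[OF nz[OF xy]] .
 qed
 then have id: "moebius_act ?a ?b ?c ?d = id" using aut algs det unfolding trivial_Aut_def by blast
 let ?x = "p0 + q0" and ?y = "p1 + q1"
 have XY: "q1 * ?x - q0 * ?y = q1 * p0 - q0 * p1" "p1 * ?x - p0 * ?y = - (q1 * p0 - q0 * p1)" by (simp_all add: algebra_simps)
 have xy: "(?x, ?y) ~= (0, 0)" using XY D by auto
 have "pt (?a * ?x + ?b * ?y) (?c * ?x + ?d * ?y) = pt ?x ?y" using mob[OF xy] id by simp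
 then have "(?a * ?x + ?b * ?y) * ?y = ?x * (?c * ?x + ?d * ?y)" using pt_eq_iff[OF nz[OF xy] xy] by simp
 then have "(q1 * p0 - q0 * p1) * ((?a * ?x + ?b * ?y) * ?y - ?x * (?c * ?x + ?d * ?y)) = 0" by simp
 then have "2 * E * ((q1 * p0 - q0 * p1) * (q1 * p0 - q0 * p1)) = 0" unfolding cross X Y XY by (simp add: algebra_simps)
 then show False using E0 D by simp
qed

end

context quad_map
begin

text \<open>With Y and X the linear forms vanishing at the critical point P and at its image, the
  map is c Y^2 : X (\<alpha> X + \<beta> Y). Once P is known to be rational, all constants are
  rational, and since \<beta> is nonzero a scaling of X brings them to the normal form.\<close>

theorem normal_form_exists:
 assumes crit: "\<exists>P. alg_point P & critical_pt f g P & periodic_pt (=) (rf_act f g) 2 P"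
  and aut: "trivial_Aut f g"
 shows "\<exists>a b c d l t. normal_form f g a b c d l t"
proof -
 obtain P :: "complex option" where P: "critical_pt f g P" "rf_act f g (rf_act f g P) = P" "rf_act f g P ~= P"
  using crit unfolding periodic_pt_def by (auto simp: numeral_2_eq_2 dest: spec[of _ "1::nat"])
 obtain p0 p1 :: complex where p: "P = pt p0 p1" "(p0 = 1 & p1 = 0) \<or> p1 = 1"
 proof (cases P)
  case None
  then show thesis using that[of 1 0] by (simp add: pt_def)
 next
  case (Some z)
  then show thesis using that[of z 1] by (simp add: pt_def)
 qed
 have pnz: "(p0, p1) ~= (0, 0)" using p(2) by auto
 define q0 where "q0 = hq f p0 p1"
 define q1 where "q1 = hq g p0 p1"
 have qnz: "(q0, q1) ~= (0, 0)" unfolding q0_def q1_def by (rule hq_nonzero[OF pnz])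
 have Q: "rf_act f g P = pt q0 q1" unfolding p q0_def q1_def by (rule rf_act_pt[OF pnz])
 have "pt q0 q1 ~= pt p0 p1" using P(3) unfolding Q unfolding p(1) .
 then have "p0 * q1 ~= q0 * p1" using pt_eq_iff[OF qnz pnz] by auto
 then have D: "q1 * p0 - q0 * p1 ~= 0" by (simp add: mult.commute)
 have "pt (hq f q0 q1) (hq g q0 q1) = pt p0 p1" using P(2) unfolding Q rf_act_pt[OF qnz] unfolding p(1) .
 then have "hq f q0 q1 * p1 = p0 * hq g q0 q1" using pt_eq_iff[OF hq_nonzero[OF qnz] pnz] by simp
 then have per: "p1 * hq f q0 q1 - p0 * hq g q0 q1 = 0" by (simp add: mult.commute)
 obtain c where F: "!!x y. q1 * hq f x y - q0 * hq g x y = c * (p1 * x - p0 * y)\<^sup>2"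
  using fibre_poly_coeffs[OF p(2) q0_def q1_def] P(1) unfolding p by blast
 let ?D = "q1 * p0 - q0 * p1"
 define \<alpha> where "\<alpha> = - 1 / ?D"
 define \<beta> where "\<beta> = - (p1 * hq f (p0 + q0) (p1 + q1) - p0 * hq g (p0 + q0) (p1 + q1) + ?D) / ?D\<^sup>2"
 have G: "p1 * hq f x y - p0 * hq g x y = (q1 * x - q0 * y) * (\<alpha> * (q1 * x - q0 * y) + \<beta> * (p1 * x - p0 * y))" for x y
  unfolding \<alpha>_def \<beta>_def by (rule two_cycle_coordinates[OF D q0_def q1_def per])
 have \<alpha>0: "\<alpha> ~= 0" using D by (simp add: \<alpha>_def)
 have c0: "c ~= 0"
 proof
  assume "c = 0"
  then have 1: "q1 * hq f q0 q1 - q0 * hq g q0 q1 = 0" using F by simp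
  have "?D * hq f q0 q1 = p0 * (q1 * hq f q0 q1 - q0 * hq g q0 q1) - q0 * (p1 * hq f q0 q1 - p0 * hq g q0 q1)"
   "?D * hq g q0 q1 = p1 * (q1 * hq f q0 q1 - q0 * hq g q0 q1) - q1 * (p1 * hq f q0 q1 - p0 * hq g q0 q1)"
   by (simp_all add: algebra_simps)
  then have "?D * hq f q0 q1 = 0" "?D * hq g q0 q1 = 0" using 1 per by simp_all
  then show False using D hq_nonzero[OF qnz] by simp
 qed
 have \<beta>0: "\<beta> ~= 0" by (rule beta_nonzero[OF D c0 \<alpha>0 aut F G])
 have jac: "jac x y = - c * (p1 * x - p0 * y) * (2 * \<alpha> * (q1 * x - q0 * y) + \<beta> * (p1 * x - p0 * y))" for x y
  by (rule jac_coordinates[OF D F G])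
 text \<open>The 2-cycle equation factors through the fixed point equation.\<close>
 have cycle: "?D * (x * hq g (hq f x y) (hq g x y) - hq f (hq f x y) (hq g x y) * y)
   = - c * \<alpha> * (q1 * x - q0 * y) * (p1 * x - p0 * y) * (?D * (x * hq g x y - hq f x y * y))" for x y
 proof -
  define X where "X = q1 * x - q0 * y"
  define Y where "Y = p1 * x - p0 * y"
  have cross: "?D * (u * v' - u' * v) = (q1 * u' - q0 * v') * (p1 * u - p0 * v) - (q1 * u - q0 * v) * (p1 * u' - p0 * v')" for u v u' v'
   by (simp add: algebra_simps)
  show ?thesis
   unfolding cross F G X_def[symmetric] Y_def[symmetric] by (simp add: ring2)
 qed
 \<comment> \<open>If P is irrational, its conjugate z' is the other zero of \<open>jac\<close> and
   satisfies the equation of the second iterate without being fixed. By \<open>cycle\<close> it is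
   then the image of P, so both critical points lie on the 2-cycle, against \<beta> ~= 0.\<close>
 have rat: "\<exists>r0 r1 :: rat. p0 = of_rat r0 & p1 = of_rat r1"
 proof (rule ccontr)
  assume neg: "~ ?thesis"
  have p1: "p1 = 1"
  proof (rule ccontr)
   assume "p1 ~= 1"
   then have "p0 = of_rat 1 & p1 = of_rat 0" using p(2) by simp
   then show False using neg by blast
  qed
  have irr: "p0 \<notin> \<rat>"
  proof
   assume "p0 \<in> \<rat>"
   then obtain r where "p0 = of_rat r" by (elim Rats_cases)
   moreover have "p1 = of_rat 1" using p1 by simp
   ultimately show False using neg by blast
  qed
  define j0 where "j0 = cf f 2 * cf g 1 - cf f 1 * cf g 2"
  define j1 where "j1 = 2 * (cf f 2 * cf g 0 - cf f 0 * cf g 2)"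
  define j2 where "j2 = cf f 1 * cf g 0 - cf f 0 * cf g 1"
  have J: "jac x y = of_rat j0 * x\<^sup>2 + of_rat j1 * (x * y) + of_rat j2 * y\<^sup>2" for x y :: complex
   by (simp add: jac_def j0_def j1_def j2_def)
  have Jp: "of_rat j0 * p0\<^sup>2 + of_rat j1 * p0 + of_rat j2 = 0"
   using jac[of p0 p1] unfolding J p1 by simp
  have j00: "j0 ~= 0"
  proof
   assume z: "j0 = 0"
   have "j1 = 0"
   proof (rule ccontr)
    assume "j1 ~= 0"
    then have "p0 = of_rat (- j2 / j1)" using Jp z by (simp add: of_rat_divide of_rat_minus field_simps eq_neg_iff_add_eq_0)
    then show False using irr by simp
   qed
   then have "j2 = 0" using Jp z by simp
   then have zero: "jac x y = 0" for x y :: complex unfolding J using z \<open>j1 = 0\<close> by simp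
   have "jac q0 q1 = - c * (?D * - 1) * (\<beta> * (?D * - 1))" unfolding jac by (simp add: algebra_simps)
   then show False using zero[of q0 q1] c0 D \<beta>0 by simp
  qed
  define z' where "z' = - of_rat (j1 / j0) - p0"
  have sm: "p0 + z' = of_rat (- j1 / j0)" by (simp add: z'_def of_rat_minus of_rat_divide)
  have pr: "p0 * z' = of_rat (j2 / j0)"
  proof -
   have "of_rat j0 * z' = - of_rat j1 - of_rat j0 * p0"
    using j00 by (simp add: z'_def of_rat_divide right_diff_distrib)
   moreover have "of_rat j0 * (p0 * z') = p0 * (of_rat j0 * z')" by simp
   moreover have "p0 * (- of_rat j1 - of_rat j0 * p0) = of_rat j2 - (of_rat j0 * p0\<^sup>2 + of_rat j1 * p0 + of_rat j2)"
    by (simp add: ring2)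
   ultimately have "of_rat j0 * (p0 * z') = of_rat j2" using Jp by (simp only: diff_0_right)
   then show ?thesis using j00 by (simp add: of_rat_divide field_simps)
  qed
  have Jz: "of_rat j0 * z'\<^sup>2 + of_rat j1 * z' + of_rat j2 = 0"
  proof -
   have "of_rat j2 = of_rat j0 * (p0 * z')" "of_rat j1 = - of_rat j0 * (p0 + z')"
    unfolding sm pr using j00 by (simp_all add: of_rat_divide of_rat_minus)
   then have "of_rat j0 * (p0 + z') + of_rat j1 = 0" "of_rat j2 - of_rat j0 * (p0 * z') = 0" by simp_all
   moreover have "of_rat j0 * z'\<^sup>2 + of_rat j1 * z' + of_rat j2 = z' * (of_rat j0 * (p0 + z') + of_rat j1) + (of_rat j2 - of_rat j0 * (p0 * z'))"
    by (simp add: ring2)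
   ultimately show ?thesis by (simp only: mult_zero_right add_0_left)
  qed
  have irr': "z' \<notin> \<rat>"
  proof
   assume "z' \<in> \<rat>"
   then have "of_rat (- j1 / j0) - z' \<in> \<rat>" by (intro Rats_diff Rats_of_rat)
   then show False using irr sm by (metis add_diff_cancel_right')
  qed
  have ne: "z' ~= p0"
  proof
   assume "z' = p0"
   then have p0: "of_rat (- j1 / j0) / 2 = p0" unfolding sm[symmetric] by simp
   have "(of_rat (- j1 / j0) / 2 :: complex) \<in> \<rat>" by (intro Rats_divide Rats_of_rat) simp
   then show False using irr unfolding p0 by blast
  qed
  \<comment> \<open>\<open>h1\<close> and, below, \<open>h2\<close> are rational polynomials for the
    fixed points of the map and of its second iterate; conjugation over Q permutes their
    roots.\<close>
  define h1 where "h1 = [:0, 1:] * g - f"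
  have deg1: "poly (map_poly of_rat h1) z = z * hq g z 1 - hq f z 1" for z :: complex
  proof -
   have "map_poly of_rat h1 = [:0, 1:] * map_poly of_rat g - (map_poly of_rat f :: complex poly)"
    by (rule poly_eqI) (simp add: h1_def coeff_pCons of_rat_diff split: nat.split)
   then show ?thesis using degs(1,2) by (simp add: poly_of_rat_poly_2)
  qed
  define H where "H h = Polynomial.smult (cf h 2) (f * f) + Polynomial.smult (cf h 1) (f * g) + Polynomial.smult (cf h 0) (g * g)" for h
  have polyH: "poly (map_poly of_rat (H h)) z = hq h (hq f z 1) (hq g z 1)" for h and z :: complex
  proof -
   have sm: "map_poly of_rat (Polynomial.smult r u) = Polynomial.smult (of_rat r) (map_poly of_rat u :: complex poly)" for r u
    by (rule poly_eqI) (simp add: of_rat_mult)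
   show ?thesis using degs(1,2)
    by (simp add: H_def sm poly_of_rat_poly_2) (simp add: hq_def[of h] ring2)
  qed
  define h2 where "h2 = [:0, 1:] * H g - H f"
  have deg2: "poly (map_poly of_rat h2) z = z * hq g (hq f z 1) (hq g z 1) - hq f (hq f z 1) (hq g z 1)" for z :: complex
  proof -
   have "map_poly of_rat h2 = [:0, 1:] * map_poly of_rat (H g) - (map_poly of_rat (H f) :: complex poly)"
    by (rule poly_eqI) (simp add: h2_def coeff_pCons of_rat_diff split: nat.split)
   then show ?thesis by (simp add: polyH)
  qed
  have "poly (map_poly of_rat h2) p0 = 0"
   using cycle[of p0 p1] D unfolding deg2 p1 by simp
  then have S: "poly (map_poly of_rat h2) z' = 0" by (rule rat_poly_conjugate_root[OF irr sm pr])
  have T: "poly (map_poly of_rat h1) z' ~= 0"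
  proof
   assume "poly (map_poly of_rat h1) z' = 0"
   moreover have "z' + p0 = of_rat (- j1 / j0)" "z' * p0 = of_rat (j2 / j0)"
    using sm pr by (simp_all only: add.commute mult.commute)
   ultimately have "poly (map_poly of_rat h1) p0 = 0" using rat_poly_conjugate_root[OF irr'] by blast
   then have "p0 * q1 = q0 * p1" unfolding deg1 q0_def q1_def p1 by simp
   then show False using D by (simp add: mult.commute)
  qed
  have "c * \<alpha> * (q1 * z' - q0 * 1) * (p1 * z' - p0 * 1) * (?D * (z' * hq g z' 1 - hq f z' 1 * 1)) = 0"
   using cycle[of z' 1] S unfolding deg2 by simp
  then have "(q1 * z' - q0) * (z' - p0) = 0"
   using c0 \<alpha>0 D T unfolding deg1 p1 by simp
  then have X: "q1 * z' - q0 = 0" using ne by simp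
  have "jac z' 1 = 0" unfolding J using Jz by simp
  then show False unfolding jac using X p1 c0 \<beta>0 ne by simp
 qed
 then obtain r0 r1 :: rat where r: "p0 = of_rat r0" "p1 = of_rat r1" by blast
 define s0 where "s0 = hq f r0 r1"
 define s1 where "s1 = hq g r0 r1"
 have s: "q0 = of_rat s0" "q1 = of_rat s1" by (simp_all add: q0_def q1_def s0_def s1_def r)
 define E where "E = s1 * r0 - s0 * r1"
 have E: "of_rat E = ?D" by (simp add: E_def r s of_rat_diff of_rat_mult)
 have E0: "E ~= 0" using D E by auto
 define a' where "a' = - 1 / E"
 define b' where "b' = - (r1 * hq f (r0 + s0) (r1 + s1) - r0 * hq g (r0 + s0) (r1 + s1) + E) / E\<^sup>2"
 define c' where "c' = (s1 * hq f s0 s1 - s0 * hq g s0 s1) / E\<^sup>2"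
 have ab: "\<alpha> = of_rat a'" "\<beta> = of_rat b'"
  unfolding \<alpha>_def \<beta>_def a'_def b'_def of_rat_divide of_rat_minus of_rat_power E
  by (simp_all add: r s of_rat_add of_rat_diff of_rat_mult of_rat_divide of_rat_minus of_rat_power E[unfolded r s])
 have cc: "c = of_rat c'"
 proof -
  have "q1 * hq f q0 q1 - q0 * hq g q0 q1 = c * ?D\<^sup>2" unfolding F by (simp add: ring2)
  then have "c = (q1 * hq f q0 q1 - q0 * hq g q0 q1) / ?D\<^sup>2" using D by simp
  then show ?thesis unfolding E[symmetric] c'_def by (simp add: s of_rat_divide of_rat_diff of_rat_mult of_rat_power)
 qed
 have nz: "a' ~= 0" "b' ~= 0" "c' ~= 0" using \<alpha>0 \<beta>0 c0 unfolding ab cc by auto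
 have F': "s1 * hq f x y - s0 * hq g x y = c' * (r1 * x - r0 * y)\<^sup>2" for x y
 proof -
  have "(of_rat (s1 * hq f x y - s0 * hq g x y) :: complex) = of_rat (c' * (r1 * x - r0 * y)\<^sup>2)"
   using F[of "of_rat x" "of_rat y"] unfolding r s cc by (simp add: of_rat_diff of_rat_mult of_rat_power)
  then show ?thesis by simp
 qed
 have G': "r1 * hq f x y - r0 * hq g x y = (s1 * x - s0 * y) * (a' * (s1 * x - s0 * y) + b' * (r1 * x - r0 * y))" for x y
 proof -
  have "(of_rat (r1 * hq f x y - r0 * hq g x y) :: complex) = of_rat ((s1 * x - s0 * y) * (a' * (s1 * x - s0 * y) + b' * (r1 * x - r0 * y)))"
   using G[of "of_rat x" "of_rat y"] unfolding r s ab by (simp add: of_rat_diff of_rat_add of_rat_mult)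
  then show ?thesis by simp
 qed
 \<comment> \<open>In coordinates U = k X, V = Y the pair becomes k c Y^2 : X (\<alpha> X + \<beta>
   Y). Equating it with l t V^2 : l (U^2 + U V) gives l k^2 = \<alpha>, l k = \<beta> and l t = k
   c.\<close>
 define k where "k = a' / b'"
 define l where "l = b'\<^sup>2 / a'"
 define t where "t = a'\<^sup>2 * c' / b' ^ 3"
 have lt: "l * t = k * c'" using nz by (simp add: l_def t_def k_def field_simps power2_eq_square power3_eq_cube)
 have lk: "l * (k * k) = a'" "l * k = b'" using nz by (simp_all add: l_def k_def field_simps power2_eq_square)
 have k0: "k ~= 0" using nz by (simp add: k_def)
 have "k * s1 * cf f 2 + - k * s0 * cf g 2 = l * t * r1\<^sup>2 &
   k * s1 * cf f 1 + - k * s0 * cf g 1 = l * t * (2 * r1 * - r0) &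
   k * s1 * cf f 0 + - k * s0 * cf g 0 = l * t * (- r0)\<^sup>2"
 proof (rule quadratic_form_eqI)
  fix x y
  have "(k * s1 * cf f 2 + - k * s0 * cf g 2) * x\<^sup>2 + (k * s1 * cf f 1 + - k * s0 * cf g 1) * (x * y) + (k * s1 * cf f 0 + - k * s0 * cf g 0) * y\<^sup>2
   = k * (s1 * hq f x y - s0 * hq g x y)" by (simp add: hq_def algebra_simps)
  also have "... = (l * t) * (r1 * x - r0 * y)\<^sup>2" unfolding F' lt by simp
  finally show "(k * s1 * cf f 2 + - k * s0 * cf g 2) * x\<^sup>2 + (k * s1 * cf f 1 + - k * s0 * cf g 1) * (x * y) + (k * s1 * cf f 0 + - k * s0 * cf g 0) * y\<^sup>2
   = l * t * r1\<^sup>2 * x\<^sup>2 + l * t * (2 * r1 * - r0) * (x * y) + l * t * (- r0)\<^sup>2 * y\<^sup>2"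
   by (simp add: ring2)
 qed
 moreover have "r1 * cf f 2 + - r0 * cf g 2 = l * ((k * s1)\<^sup>2 + k * s1 * r1) &
   r1 * cf f 1 + - r0 * cf g 1 = l * (2 * (k * s1) * (- k * s0) + k * s1 * - r0 + - k * s0 * r1) &
   r1 * cf f 0 + - r0 * cf g 0 = l * ((- k * s0)\<^sup>2 + - k * s0 * - r0)"
 proof (rule quadratic_form_eqI)
  fix x y
  have "(r1 * cf f 2 + - r0 * cf g 2) * x\<^sup>2 + (r1 * cf f 1 + - r0 * cf g 1) * (x * y) + (r1 * cf f 0 + - r0 * cf g 0) * y\<^sup>2
   = r1 * hq f x y - r0 * hq g x y" by (simp add: hq_def algebra_simps)
  also have "... = (s1 * x - s0 * y) * (l * (k * k) * (s1 * x - s0 * y) + l * k * (r1 * x - r0 * y))" unfolding G' lk ..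
  finally show "(r1 * cf f 2 + - r0 * cf g 2) * x\<^sup>2 + (r1 * cf f 1 + - r0 * cf g 1) * (x * y) + (r1 * cf f 0 + - r0 * cf g 0) * y\<^sup>2
   = l * ((k * s1)\<^sup>2 + k * s1 * r1) * x\<^sup>2 + l * (2 * (k * s1) * (- k * s0) + k * s1 * - r0 + - k * s0 * r1) * (x * y) + l * ((- k * s0)\<^sup>2 + - k * s0 * - r0) * y\<^sup>2"
   by (simp add: ring2)
 qed
 moreover have "k * s1 * (- r0) - (- k * s0) * r1 ~= 0"
 proof -
  have "k * s1 * (- r0) - (- k * s0) * r1 = - (k * E)" by (simp add: E_def algebra_simps)
  then show ?thesis using k0 E0 by simp
 qed
 moreover have "l ~= 0" "t ~= 0" using nz by (simp_all add: l_def t_def)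
 ultimately have "normal_form f g (k * s1) (- k * s0) r1 (- r0) l t"
  unfolding normal_form_def by blast
 then show ?thesis by blast
qed

end

subsection \<open>Three-cycles\<close>

text \<open>Equating consecutive values of t and cancelling y gives x^2 + x = z (y + 1) and its
  cyclic shifts. Their sum is (z - y)^2 + (z - y) (y - x) + (y - x)^2 = 0, so w^2 + w + 1 = 0. It
  follows that y = w x - 1: the cycle is an orbit of an affine map of order 3, and t = y (x^2 + x)
  becomes a cubic in x whose cube is completed.\<close>

lemma three_cycle_equations:
 fixes x y z t :: "'a::field"
 assumes t: "t ~= 0" and ne: "x ~= y"
  and cyc: "y * (x * x + x) = t" "z * (y * y + y) = t" "x * (z * z + z) = t"
 obtains w where "w * w + w + 1 = 0" "(3 * x + 1 - w * w) ^ 3 = w * w * (27 * t - 3 + 3 * (w * w))"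
  "w * (x * x * (x + 1)) = x * x + x + t"
proof -
 have nz: "x ~= 0" "y ~= 0" "z ~= 0" using t cyc by auto
 have "y * (x * x + x - z * (y + 1)) = 0" "z * (y * y + y - x * (z + 1)) = 0" "x * (z * z + z - y * (x + 1)) = 0"
  using cyc by (simp_all add: algebra_simps)
 then have e: "x * x + x - z * (y + 1) = 0" "y * y + y - x * (z + 1) = 0" "z * z + z - y * (x + 1) = 0"
  using nz by simp_all
 define w where "w = (z - y) / (y - x)"
 have d0: "y - x ~= 0" using ne by simp
 have wz: "w * (y - x) = z - y" using d0 by (simp add: w_def)
 have "((y - x) * (y - x)) * (w * w + w + 1) = (w * (y - x)) * (w * (y - x)) + (w * (y - x)) * (y - x) + (y - x) * (y - x)"
  by (simp add: algebra_simps)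
 also have "... = (x * x + x - z * (y + 1)) + (y * y + y - x * (z + 1)) + (z * z + z - y * (x + 1))"
  unfolding wz by (simp add: algebra_simps)
 finally have w: "w * w + w + 1 = 0" using e d0 by simp
 have "(y - x) * (x + (1 + w) * (y + 1)) = (y - x) * (x + y + 1) + (w * (y - x)) * (y + 1)" by (simp add: algebra_simps)
 also have "... = - (x * x + x - z * (y + 1))" unfolding wz by (simp add: algebra_simps)
 finally have q: "x + (1 + w) * (y + 1) = 0" using e d0 by simp
 have "w * x - (y + 1) = w * (x + (1 + w) * (y + 1)) - (w * w + w + 1) * (y + 1)" by (simp add: algebra_simps)
 then have y: "y = w * x - 1" unfolding q w by (simp add: algebra_simps)
 have tx: "t = (w * x - 1) * (x * x + x)" using cyc(1) unfolding y by simp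
 have "(3 * x + 1 - w * w) ^ 3 = w * w * (27 * t - 3 + 3 * (w * w))"
 proof -
  have ww: "w * w = - 1 - w" using w by (simp add: eq_neg_iff_add_eq_0 algebra_simps)
  have "(3 * x + 1 - (- 1 - w)) ^ 3 - (- 1 - w) * (27 * ((w * x - 1) * (x * x + x)) - 3 + 3 * (- 1 - w))
   = (w * w + w + 1) * (27 * (x * x * x) + 27 * (x * x) + 9 * x + w + 2)"
   by (simp add: ring3)
  then show ?thesis unfolding tx w unfolding ww by simp
 qed
 moreover have "w * (x * x * (x + 1)) = x * x + x + t" unfolding tx by (simp add: algebra_simps)
 ultimately show thesis using that w by blast
qed

text \<open>Infinity and 0 form the 2-cycle of the normal form, so an orbit of period 3 avoids both
  and has affine coordinates throughout.\<close>

lemma (in quad_map) three_cycle_coordinates: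
 fixes x0 y0 :: "'a::field_char_0"
 assumes nf: "normal_form f g a b c d l t" and nz: "(x0, y0) ~= (0, 0)"
  and per: "periodic_pt (=) (rf_act f g) 3 (pt x0 y0)"
 defines "U \<equiv> %x y. of_rat a * x + of_rat b * y" and "V \<equiv> %x y. of_rat c * x + of_rat d * (y :: 'a)"
 obtains y z where "V x0 y0 ~= 0" "U x0 y0 / V x0 y0 ~= y"
  "y * ((U x0 y0 / V x0 y0) * (U x0 y0 / V x0 y0) + U x0 y0 / V x0 y0) = of_rat t"
  "z * (y * y + y) = of_rat t" "(U x0 y0 / V x0 y0) * (z * z + z) = of_rat t"
proof -
 define x1 where "x1 = hq f x0 y0" define y1 where "y1 = hq g x0 y0"
 define x2 where "x2 = hq f x1 y1" define y2 where "y2 = hq g x1 y1"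
 define x3 where "x3 = hq f x2 y2" define y3 where "y3 = hq g x2 y2"
 have n1: "(x1, y1) ~= (0, 0)" unfolding x1_def y1_def by (rule hq_nonzero[OF nz])
 have n2: "(x2, y2) ~= (0, 0)" unfolding x2_def y2_def by (rule hq_nonzero[OF n1])
 have n3: "(x3, y3) ~= (0, 0)" unfolding x3_def y3_def by (rule hq_nonzero[OF n2])
 have a1: "rf_act f g (pt x0 y0) = pt x1 y1" unfolding x1_def y1_def by (rule rf_act_pt[OF nz])
 have a2: "rf_act f g (pt x1 y1) = pt x2 y2" unfolding x2_def y2_def by (rule rf_act_pt[OF n1])
 have a3: "rf_act f g (pt x2 y2) = pt x3 y3" unfolding x3_def y3_def by (rule rf_act_pt[OF n2])
 have "(rf_act f g ^^ 3) (pt x0 y0) = pt x3 y3" "(rf_act f g ^^ 1) (pt x0 y0) = pt x1 y1" "(rf_act f g ^^ 2) (pt x0 y0) = pt x2 y2"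
  by (simp_all add: a1 a2 a3 numeral_3_eq_3 numeral_2_eq_2)
 moreover have "(rf_act f g ^^ 3) (pt x0 y0) = pt x0 y0" "(rf_act f g ^^ 1) (pt x0 y0) ~= pt x0 y0" "(rf_act f g ^^ 2) (pt x0 y0) ~= pt x0 y0"
  using per unfolding periodic_pt_def by auto
 ultimately have eqs: "pt x3 y3 = pt x0 y0" "pt x1 y1 ~= pt x0 y0" "pt x2 y2 ~= pt x0 y0" by simp_all
 let ?D = "of_rat a * of_rat d - of_rat b * of_rat c :: 'a"
 have D0: "?D ~= 0"
 proof -
  have "?D = of_rat (a * d - b * c)" by (simp add: of_rat_diff of_rat_mult)
  then show ?thesis using nf by (simp add: normal_form_def)
 qed
 have par: "pt x y = pt x' y' \<longleftrightarrow> U x y * V x' y' = U x' y' * V x y"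
  if "(x, y) ~= (0, 0)" "(x', y') ~= (0, 0)" for x y x' y'
 proof -
  have "U x y * V x' y' - U x' y' * V x y = ?D * (x * y' - x' * y)" unfolding U_def V_def by (simp add: algebra_simps)
  then show ?thesis using pt_eq_iff[OF that] D0 by auto
 qed
 have UV0: "U x y ~= 0 \<or> V x y ~= 0" if "(x, y) ~= (0, 0)" for x y
 proof -
  have "?D * x = of_rat d * U x y - of_rat b * V x y" "?D * y = of_rat a * V x y - of_rat c * U x y"
   unfolding U_def V_def by (simp_all add: algebra_simps)
  then show ?thesis using that D0 by auto
 qed
 have step: "U (hq f x y) (hq g x y) = of_rat l * (of_rat t * (V x y)\<^sup>2)"
  "V (hq f x y) (hq g x y) = of_rat l * ((U x y)\<^sup>2 + U x y * V x y)" for x y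
  unfolding U_def V_def by (rule normal_form_act[OF nf])+
 note s1 = step[of x0 y0, folded x1_def y1_def] and s2 = step[of x1 y1, folded x2_def y2_def]
  and s3 = step[of x2 y2, folded x3_def y3_def]
 have e0: "U x3 y3 * V x0 y0 = U x0 y0 * V x3 y3" using eqs(1) par[OF n3 nz] by simp
 have e1: "U x1 y1 * V x0 y0 ~= U x0 y0 * V x1 y1" using eqs(2) par[OF n1 nz] by simp
 have e2: "U x2 y2 * V x0 y0 ~= U x0 y0 * V x2 y2" using eqs(3) par[OF n2 nz] by simp
 have V0: "V x0 y0 ~= 0"
 proof
  assume z: "V x0 y0 = 0"
  then have "U x1 y1 = 0" using s1 by simp
  then have "V x2 y2 = 0" using s2 by simp
  then show False using e2 z by simp
 qed
 have U0: "U x0 y0 ~= 0"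
 proof
  assume z: "U x0 y0 = 0"
  then have "V x1 y1 = 0" using s1 by simp
  then have "U x2 y2 = 0" using s2 by simp
  then show False using e2 z by simp
 qed
 have UV3: "U x3 y3 ~= 0" "V x3 y3 ~= 0" using e0 V0 U0 UV0[OF n3] by auto
 have V1: "V x1 y1 ~= 0"
 proof
  assume "V x1 y1 = 0"
  then have "U x2 y2 = 0" using s2 by simp
  then show False using s3 UV3 by simp
 qed
 have V2: "V x2 y2 ~= 0" using s3 UV3 by auto
 have quot: "(u' / v') * ((u / v) * (u / v) + u / v) = of_rat t"
  if "u' = of_rat l * (of_rat t * v\<^sup>2)" "v' = of_rat l * (u\<^sup>2 + u * v)" "v ~= 0" "v' ~= 0" for u v u' v' :: 'a
 proof -
  have "(u / v) * (u / v) + u / v = (u\<^sup>2 + u * v) / v\<^sup>2" using that(3) by (simp add: field_simps power2_eq_square)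
  moreover have "of_rat l ~= (0 :: 'a)" "u\<^sup>2 + u * v ~= 0" using that(2,4) by auto
  ultimately show ?thesis using that by simp
 qed
 have "U x3 y3 / V x3 y3 = U x0 y0 / V x0 y0" using e0 UV3 V0 by (simp add: frac_eq_eq)
 then have c3: "(U x0 y0 / V x0 y0) * ((U x2 y2 / V x2 y2) * (U x2 y2 / V x2 y2) + U x2 y2 / V x2 y2) = of_rat t"
  using quot[OF s3 V2 UV3(2)] by simp
 have "U x0 y0 / V x0 y0 ~= U x1 y1 / V x1 y1" using e1 V0 V1 by (simp add: frac_eq_eq)
 then show thesis using that V0 quot[OF s1 V0 V1] quot[OF s2 V1 V2] c3 by blast
qed

subsection \<open>The Kummer extension\<close>

text \<open>Elements of the extension generated by a cube root of \<kappa>, as functions of the choice of that root.\<close>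
definition kummer_fun :: "eis => (complex => complex) => bool" where
 "kummer_fun \<kappa> h \<longleftrightarrow> (\<exists>(N::int) X Y Z. N ~= 0 &
   (\<forall>\<rho>. \<rho> ^ 3 = ceis \<kappa> --> of_int N * h \<rho> = ceis X + ceis Y * \<rho> + ceis Z * (\<rho> * \<rho>)))"

lemma kummer_funI:
 fixes N :: int
 assumes "N ~= 0" "!!\<rho>. \<rho> ^ 3 = ceis \<kappa> ==> of_int N * h \<rho> = ceis X + ceis Y * \<rho> + ceis Z * (\<rho> * \<rho>)"
 shows "kummer_fun \<kappa> h"
 unfolding kummer_fun_def using assms by blast

lemma kummer_fun_rat: "kummer_fun \<kappa> (%_. of_rat r)"
proof -
 obtain a b where ab: "quotient_of r = (a, b)" by (cases "quotient_of r")
 have b: "b > 0" using quotient_of_denom_pos[OF ab] .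
 have "r = of_int a / of_int b" using quotient_of_div[OF ab] .
 then have "of_int b * of_rat r = (of_int a :: complex)" using b by (simp add: of_rat_divide)
 then show ?thesis using b by (intro kummer_funI[of b \<kappa> _ "of_int a" 0 0]) auto
qed

lemma kummer_fun_eis: "kummer_fun \<kappa> (%_. ceis x)"
 by (rule kummer_funI[of 1 \<kappa> _ x 0 0]) auto

lemma kummer_fun_id: "kummer_fun \<kappa> (%\<rho>. \<rho>)"
 by (rule kummer_funI[of 1 \<kappa> _ 0 1 0]) auto

lemma kummer_fun_add:
 assumes "kummer_fun \<kappa> h" "kummer_fun \<kappa> k"
 shows "kummer_fun \<kappa> (%\<rho>. h \<rho> + k \<rho>)"
proof -
 obtain N :: int and X Y Z where 1: "N ~= 0" "!!\<rho>. \<rho> ^ 3 = ceis \<kappa> ==> of_int N * h \<rho> = ceis X + ceis Y * \<rho> + ceis Z * (\<rho> * \<rho>)"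
  using assms(1) unfolding kummer_fun_def by blast
 obtain M :: int and X' Y' Z' where 2: "M ~= 0" "!!\<rho>. \<rho> ^ 3 = ceis \<kappa> ==> of_int M * k \<rho> = ceis X' + ceis Y' * \<rho> + ceis Z' * (\<rho> * \<rho>)"
  using assms(2) unfolding kummer_fun_def by blast
 show ?thesis
 proof (rule kummer_funI)
  show "N * M ~= 0" using 1 2 by simp
  fix \<rho> assume r: "\<rho> ^ 3 = ceis \<kappa>"
  have "of_int (N * M) * (h \<rho> + k \<rho>) = of_int M * (of_int N * h \<rho>) + of_int N * (of_int M * k \<rho>)" by (simp add: algebra_simps)
  also have "... = ceis (of_int M * X + of_int N * X') + ceis (of_int M * Y + of_int N * Y') * \<rho> + ceis (of_int M * Z + of_int N * Z') * (\<rho> * \<rho>)"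
   unfolding 1(2)[OF r] 2(2)[OF r] by (simp add: algebra_simps)
  finally show "of_int (N * M) * (h \<rho> + k \<rho>) = ceis (of_int M * X + of_int N * X') + ceis (of_int M * Y + of_int N * Y') * \<rho> + ceis (of_int M * Z + of_int N * Z') * (\<rho> * \<rho>)" .
 qed
qed

lemma kummer_fun_mult:
 assumes "kummer_fun \<kappa> h" "kummer_fun \<kappa> k"
 shows "kummer_fun \<kappa> (%\<rho>. h \<rho> * k \<rho>)"
proof -
 obtain N :: int and X Y Z where 1: "N ~= 0" "!!\<rho>. \<rho> ^ 3 = ceis \<kappa> ==> of_int N * h \<rho> = ceis X + ceis Y * \<rho> + ceis Z * (\<rho> * \<rho>)"
  using assms(1) unfolding kummer_fun_def by blast
 obtain M :: int and X' Y' Z' where 2: "M ~= 0" "!!\<rho>. \<rho> ^ 3 = ceis \<kappa> ==> of_int M * k \<rho> = ceis X' + ceis Y' * \<rho> + ceis Z' * (\<rho> * \<rho>)"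
  using assms(2) unfolding kummer_fun_def by blast
 show ?thesis
 proof (rule kummer_funI)
  show "N * M ~= 0" using 1 2 by simp
  fix \<rho> assume r: "\<rho> ^ 3 = ceis \<kappa>"
  have "of_int (N * M) * (h \<rho> * k \<rho>) = (of_int N * h \<rho>) * (of_int M * k \<rho>)" by (simp add: algebra_simps)
  also have "... = ceis X * ceis X' + \<rho> ^ 3 * (ceis Y * ceis Z' + ceis Z * ceis Y')
    + (ceis X * ceis Y' + ceis Y * ceis X' + \<rho> ^ 3 * (ceis Z * ceis Z')) * \<rho>
    + (ceis X * ceis Z' + ceis Y * ceis Y' + ceis Z * ceis X') * (\<rho> * \<rho>)"
   unfolding 1(2)[OF r] 2(2)[OF r] by (simp add: ring3)
  also have "... = ceis (X * X' + \<kappa> * (Y * Z' + Z * Y')) + ceis (X * Y' + Y * X' + \<kappa> * (Z * Z')) * \<rho>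
    + ceis (X * Z' + Y * Y' + Z * X') * (\<rho> * \<rho>)"
   unfolding r by simp
  finally show "of_int (N * M) * (h \<rho> * k \<rho>) = ceis (X * X' + \<kappa> * (Y * Z' + Z * Y')) + ceis (X * Y' + Y * X' + \<kappa> * (Z * Z')) * \<rho>
    + ceis (X * Z' + Y * Y' + Z * X') * (\<rho> * \<rho>)" .
 qed
qed

lemma kummer_fun_power: "kummer_fun \<kappa> h ==> kummer_fun \<kappa> (%\<rho>. h \<rho> ^ n)"
proof (induction n)
 case 0
 show ?case using kummer_fun_rat[of \<kappa> 1] by simp
next
 case (Suc n)
 then show ?case using kummer_fun_mult[of \<kappa> h "%\<rho>. h \<rho> ^ n"] by simp
qed

lemma kummer_fun_sum: "finite I ==> (!!i. i \<in> I ==> kummer_fun \<kappa> (h i)) ==> kummer_fun \<kappa> (%\<rho>. \<Sum>i\<in>I. h i \<rho>)"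
proof (induction I rule: finite_induct)
 case empty
 show ?case using kummer_fun_rat[of \<kappa> 0] by simp
next
 case (insert i I)
 then show ?case using kummer_fun_add[of \<kappa> "h i" "%\<rho>. \<Sum>i\<in>I. h i \<rho>"] by simp
qed

text \<open>A vanishing combination of 1, \<sigma>, \<sigma>^2 has norm 0, and as \<kappa> is not a
  cube its coefficients vanish. The function is then zero at all three cube roots. This replaces the
  Galois action over Q(\<omega>).\<close>

lemma kummer_fun_zero:
 assumes nc: "!!a b. b ~= 0 ==> a ^ 3 ~= \<kappa> * b ^ 3" and h: "kummer_fun \<kappa> h"
  and z: "\<sigma> ^ 3 = ceis \<kappa>" "h \<sigma> = 0" and r: "\<rho> ^ 3 = ceis \<kappa>"
 shows "h \<rho> = 0"
proof -
 obtain N :: int and X Y Z where 1: "N ~= 0" "!!\<rho>. \<rho> ^ 3 = ceis \<kappa> ==> of_int N * h \<rho> = ceis X + ceis Y * \<rho> + ceis Z * (\<rho> * \<rho>)"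
  using h unfolding kummer_fun_def by blast
 have L: "ceis X + ceis Y * \<sigma> + ceis Z * (\<sigma> * \<sigma>) = 0" using 1(2)[OF z(1)] z(2) by simp
 have "nu (\<sigma> ^ 3) A B C = (A + B * \<sigma> + C * (\<sigma> * \<sigma>)) * (A * A + B * B * \<sigma> * \<sigma> + C * C * \<sigma> ^ 4 - A * B * \<sigma> - A * C * \<sigma> * \<sigma> - B * C * \<sigma> ^ 3)"
  for A B C by (simp add: nu_def power3_eq_cube power2_eq_square power4_eq_xxxx algebra_simps)
 then have "nu (\<sigma> ^ 3) (ceis X) (ceis Y) (ceis Z) = 0" using L by simp
 then have "ceis (nu \<kappa> X Y Z) = 0" unfolding z(1) by (simp add: nu_def)
 then have nu: "nu \<kappa> X Y Z = 0" by simp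
 have XYZ: "X = 0 & Y = 0 & Z = 0"
 proof (rule ccontr)
  assume nz: "~ ?thesis"
  have "\<exists>a b. ~ b = 0 & a ^ 3 - \<kappa> * b ^ 3 = 0"
   by (rule nu_isotropic[of "%a. a = 0" \<kappa> X Y Z]) (use nu nz in auto)
  then show False using nc by auto
 qed
 show ?thesis using 1(2)[OF r] 1(1) XYZ by simp
qed

lemma cnj_c\<omega>: "cnj c\<omega> = - 1 - c\<omega>"
 by (simp add: c\<omega>_def complex_eq_iff)

lemma cnj_ceis: "cnj (ceis x) = ceis (econj x)"
 by (simp add: ceis_def cnj_c\<omega> algebra_simps)

lemma c\<omega>_ne: "c\<omega> ~= 1" "c\<omega> * c\<omega> ~= 1" "c\<omega> ~= 0" "c\<omega> * c\<omega> ~= c\<omega>"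
 unfolding c\<omega>_sq by (auto simp: c\<omega>_def complex_eq_iff)

lemma cnj_of_rat [simp]: "cnj (of_rat r) = of_rat r"
 by (cases r) (simp add: of_rat_rat)

lemma poly_of_rat_cnj: "poly (map_poly of_rat q) (cnj z) = cnj (poly (map_poly of_rat q) z)"
 by (induction q) (simp_all add: map_poly_pCons)

lemma poly_of_rat_sum:
 "poly (map_poly of_rat q) (z :: complex) = (\<Sum>i\<le>degree q. of_rat (cf q i) * z ^ i)"
proof -
 have "degree (map_poly of_rat q :: complex poly) = degree q" by (rule degree_map_poly) simp
 then show ?thesis by (simp add: poly_altdef)
qed

text \<open>A rational polynomial vanishing at one of these numbers vanishes at the three obtained
  from the cube roots of \<kappa> and at their complex conjugates. Six values arise because a
  rational Moebius map is injective and commutes with conjugation. The map accounts for the change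
  of coordinates.\<close>

lemma kummer_degree:
 fixes e :: int and \<alpha> \<beta> \<gamma> \<delta> :: rat and q :: "rat poly"
 assumes nc: "!!a b. b ~= 0 ==> a ^ 3 ~= \<kappa> * b ^ 3" and e: "e ~= 0" and det: "\<alpha> * \<delta> - \<beta> * \<gamma> ~= 0"
  and r: "\<rho> ^ 3 = ceis \<kappa>"
 defines "xx \<equiv> %r. (c\<omega> * c\<omega> - 1 + r / of_int e) / 3"
 shows "of_rat \<gamma> * xx \<rho> + of_rat \<delta> ~= 0"
  and "q ~= 0 ==> poly (map_poly of_rat q) ((of_rat \<alpha> * xx \<rho> + of_rat \<beta>) / (of_rat \<gamma> * xx \<rho> + of_rat \<delta>)) = 0 ==> 6 <= degree q"
proof -
 have \<kappa>0: "\<kappa> ~= 0" using nc[of 1 0] by auto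
 have r0: "s ~= 0" if "s ^ 3 = ceis \<kappa>" for s using that \<kappa>0 by auto
 have rw: "(\<rho> * c\<omega>) ^ 3 = ceis \<kappa>" "(\<rho> * (c\<omega> * c\<omega>)) ^ 3 = ceis \<kappa>"
  using r by (simp_all add: power_mult_distrib c\<omega>_cube)
 define Rt where "Rt = {\<rho>, \<rho> * c\<omega>, \<rho> * (c\<omega> * c\<omega>)}"
 have R: "s ^ 3 = ceis \<kappa>" if "s \<in> Rt" for s using that r rw unfolding Rt_def by auto
 have cR: "card Rt = 3" unfolding Rt_def using r0[OF r] c\<omega>_ne by auto
 have lin: "kummer_fun \<kappa> (%s. of_rat u * xx s + of_rat v)" for u v
 proof -
  have "xx = (%s. of_rat (1 / 3) * ceis (\<omega> * \<omega> - 1) + of_rat (1 / (3 * of_int e)) * s)"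
   using e by (simp add: fun_eq_iff xx_def ceis_def c\<omega>_sq of_rat_divide of_rat_mult field_simps)
  then show ?thesis by (simp only:) (intro kummer_fun_add kummer_fun_mult kummer_fun_rat kummer_fun_eis kummer_fun_id)
 qed
 have injx: "s = s'" if "xx s = xx s'" for s s' using that e by (simp add: xx_def)
 have den: "of_rat \<gamma> * xx s + of_rat \<delta> ~= 0" if s: "s ^ 3 = ceis \<kappa>" for s
 proof
  assume z: "of_rat \<gamma> * xx s + of_rat \<delta> = 0"
  have "of_rat \<gamma> * xx \<rho> + of_rat \<delta> = 0" "of_rat \<gamma> * xx (\<rho> * c\<omega>) + of_rat \<delta> = 0"
   using kummer_fun_zero[OF nc lin s z r] kummer_fun_zero[OF nc lin s z rw(1)] by simp_all
  then have "of_rat \<gamma> * xx \<rho> = of_rat \<gamma> * xx (\<rho> * c\<omega>)" unfolding add_eq_0_iff2 by simp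
  moreover have "xx \<rho> ~= xx (\<rho> * c\<omega>)" using injx[of \<rho> "\<rho> * c\<omega>"] r0[OF r] c\<omega>_ne by auto
  ultimately have "\<gamma> = 0" by simp
  then show False using z det by simp
 qed
 show "of_rat \<gamma> * xx \<rho> + of_rat \<delta> ~= 0" by (rule den[OF r])
 define M where "M u = (of_rat \<alpha> * u + of_rat \<beta>) / (of_rat \<gamma> * u + of_rat \<delta> :: complex)" for u
 have Mcnj: "M (cnj u) = cnj (M u)" for u by (simp add: M_def)
 \<comment> \<open>A coincidence says that (s + S)^3 = conj \<kappa> for one cube root s of
   \<kappa>, hence for all of them, with S a nonzero multiple of 1 + 2 \<omega>.\<close>
 have disj: "xx s ~= cnj (xx s')" if s: "s ^ 3 = ceis \<kappa>" and s': "s' ^ 3 = ceis \<kappa>" for s s'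
 proof
  assume eq: "xx s = cnj (xx s')"
  define S where "S = of_int e * (- 1 - 2 * c\<omega>)"
  have x3: "3 * xx r = c\<omega> * c\<omega> - 1 + r / of_int e" for r by (simp add: xx_def)
  have "cnj (3 * xx s') = cnj c\<omega> * cnj c\<omega> - 1 + cnj s' / of_int e" unfolding x3 by simp
  moreover have "cnj (3 * xx s') = 3 * xx s" using eq by simp
  ultimately have "c\<omega> * c\<omega> - 1 + s / of_int e = cnj c\<omega> * cnj c\<omega> - 1 + cnj s' / of_int e" unfolding x3 by simp
  moreover have "cnj c\<omega> * cnj c\<omega> = c\<omega>" unfolding cnj_c\<omega> by (simp add: algebra_simps c\<omega>_sq)
  ultimately have "cnj s' / of_int e = s / of_int e + (- 1 - 2 * c\<omega>)" using c\<omega>_sq by (simp add: algebra_simps)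
  then have "cnj s' = s + S" using e by (simp add: S_def field_simps)
  then have "(s + S) ^ 3 = cnj (s' ^ 3)" by simp
  then have h0: "(s + S) ^ 3 + - ceis (econj \<kappa>) = 0" unfolding s' cnj_ceis by simp
  have "S = ceis (of_int e * (- 1 - 2 * \<omega>))" by (simp add: S_def ceis_def algebra_simps)
  then have "kummer_fun \<kappa> (%s. (s + S) ^ 3 + ceis (- econj \<kappa>))"
   by (simp only:) (intro kummer_fun_add kummer_fun_power kummer_fun_eis kummer_fun_id)
  then have kf: "kummer_fun \<kappa> (%s. (s + S) ^ 3 + - ceis (econj \<kappa>))" by simp
  have E: "(v + S) ^ 3 + - ceis (econj \<kappa>) = 0" if "v ^ 3 = ceis \<kappa>" for v
   by (rule kummer_fun_zero[OF nc kf s h0 that])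
  define K where "K = ceis \<kappa> + S ^ 3 - ceis (econj \<kappa>)"
  have E': "3 * S * (v * v) + 3 * (S * S) * v + K = 0" if v: "v ^ 3 = ceis \<kappa>" for v
  proof -
   have "3 * S * (v * v) + 3 * (S * S) * v + K = (v + S) ^ 3 + - ceis (econj \<kappa>)"
    unfolding K_def v[symmetric] by (simp add: ring3)
   then show ?thesis using E[OF v] by simp
  qed
  have w3: "c\<omega> * c\<omega> * (c\<omega> * c\<omega>) = c\<omega>" using c\<omega>_cube by (simp add: power3_eq_cube mult.assoc)
  \<comment> \<open>Summing over the three cube roots cancels the linear and quadratic terms, so K =
    0. Then every cube root equals -S, although there are three of them.\<close>
  have "(3 * S * (\<rho> * \<rho>) + 3 * (S * S) * \<rho> + K) + (3 * S * ((\<rho> * c\<omega>) * (\<rho> * c\<omega>)) + 3 * (S * S) * (\<rho> * c\<omega>) + K)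
    + (3 * S * ((\<rho> * (c\<omega> * c\<omega>)) * (\<rho> * (c\<omega> * c\<omega>))) + 3 * (S * S) * (\<rho> * (c\<omega> * c\<omega>)) + K)
    = 3 * S * (\<rho> * \<rho>) * (1 + c\<omega> * c\<omega> + c\<omega> * c\<omega> * (c\<omega> * c\<omega>)) + 3 * (S * S) * \<rho> * (1 + c\<omega> + c\<omega> * c\<omega>) + 3 * K"
   by (simp add: algebra_simps)
  also have "... = 3 * K" unfolding w3 by (simp add: c\<omega>_sq)
  finally have "K = 0" unfolding E'[OF r] E'[OF rw(1)] E'[OF rw(2)] by simp
  have S0: "S ~= 0" using e by (simp add: S_def c\<omega>_def complex_eq_iff)
  have "v = - S" if v: "v ^ 3 = ceis \<kappa>" for v
  proof -
   have "3 * S * v * (v + S) = 0" using E'[OF v] \<open>K = 0\<close> by (simp add: algebra_simps)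
   then show ?thesis using S0 r0[OF v] by (simp add: eq_neg_iff_add_eq_0)
  qed
  then have "\<rho> = \<rho> * c\<omega>" using r rw(1) by metis
  then show False using r0[OF r] c\<omega>_ne by simp
 qed
 show "6 <= degree q" if q0: "q ~= 0" and z: "poly (map_poly of_rat q) ((of_rat \<alpha> * xx \<rho> + of_rat \<beta>) / (of_rat \<gamma> * xx \<rho> + of_rat \<delta>)) = 0"
 proof -
  let ?Q = "map_poly of_rat q :: complex poly"
  let ?T = "xx ` Rt \<union> cnj ` xx ` Rt"
  define h where "h s = (\<Sum>i\<le>degree q. of_rat (cf q i) * (of_rat \<alpha> * xx s + of_rat \<beta>) ^ i * (of_rat \<gamma> * xx s + of_rat \<delta>) ^ (degree q - i))" for s
  have kh: "kummer_fun \<kappa> h"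
   unfolding h_def by (intro kummer_fun_sum kummer_fun_mult kummer_fun_power kummer_fun_rat lin) simp
  have hM: "h s = (of_rat \<gamma> * xx s + of_rat \<delta>) ^ degree q * poly ?Q (M (xx s))" if s: "s ^ 3 = ceis \<kappa>" for s
   unfolding h_def poly_of_rat_sum sum_distrib_left
  proof (rule sum.cong)
   fix i assume i: "i \<in> {..degree q}"
   let ?A = "of_rat \<alpha> * xx s + of_rat \<beta>" and ?B = "of_rat \<gamma> * xx s + of_rat \<delta>"
   have "?B ^ degree q = ?B ^ i * ?B ^ (degree q - i)" using i by (simp flip: power_add)
   then show "of_rat (cf q i) * ?A ^ i * ?B ^ (degree q - i) = ?B ^ degree q * (of_rat (cf q i) * M (xx s) ^ i)"
    using den[OF s] by (simp add: M_def power_divide)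
  qed simp
  have "h \<rho> = 0" unfolding hM[OF r] using z by (simp add: M_def)
  then have "h s = 0" if "s ^ 3 = ceis \<kappa>" for s using kummer_fun_zero[OF nc kh r _ that] by blast
  then have root: "poly ?Q (M (xx s)) = 0" if "s \<in> Rt" for s
   using hM[OF R[OF that]] den[OF R[OF that]] R[OF that] by simp
  have sub: "M ` ?T \<subseteq> {u. poly ?Q u = 0}"
   using root by (auto simp: Mcnj poly_of_rat_cnj)
  have denT: "of_rat \<gamma> * u + of_rat \<delta> ~= (0 :: complex)" if u: "u \<in> ?T" for u
  proof -
   obtain s where s: "s \<in> Rt" "u = xx s \<or> u = cnj (xx s)" using u by blast
   have "cnj (of_rat \<gamma> * xx s + of_rat \<delta>) = of_rat \<gamma> * cnj (xx s) + of_rat \<delta>" by simp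
   then show ?thesis using den[OF R[OF s(1)]] s(2) by (metis complex_cnj_zero_iff)
  qed
  have injM: "inj_on M ?T"
  proof (rule inj_onI)
   fix u v assume uv: "u \<in> ?T" "v \<in> ?T" "M u = M v"
   then have "(of_rat \<alpha> * u + of_rat \<beta>) * (of_rat \<gamma> * v + of_rat \<delta>) = (of_rat \<alpha> * v + of_rat \<beta>) * (of_rat \<gamma> * u + of_rat \<delta> :: complex)"
    unfolding M_def using denT frac_eq_eq by metis
   then have "(of_rat \<alpha> * of_rat \<delta> - of_rat \<beta> * of_rat \<gamma>) * (u - v) = 0" by (simp add: algebra_simps)
   moreover have "of_rat \<alpha> * of_rat \<delta> - of_rat \<beta> * of_rat \<gamma> = (of_rat (\<alpha> * \<delta> - \<beta> * \<gamma>) :: complex)" by (simp add: of_rat_diff of_rat_mult)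
   ultimately show "u = v" using det by simp
  qed
  have c1: "card (xx ` Rt) = 3" using cR by (subst card_image) (auto intro: inj_onI injx)
  moreover have "card (cnj ` xx ` Rt) = 3" using c1 by (subst card_image) (auto simp: inj_on_def)
  moreover have "xx ` Rt \<inter> cnj ` xx ` Rt = {}" using disj R by blast
  ultimately have "card ?T = 6" by (subst card_Un_disjoint) auto
  then have "6 = card (M ` ?T)" using card_image[OF injM] by simp
  also have Q0: "?Q ~= 0"
  proof
   assume "?Q = 0"
   then have "cf ?Q (degree q) = 0" by simp
   then show False using q0 by (simp add: coeff_map_poly)
  qed
  have "card (M ` ?T) <= card {u. poly ?Q u = 0}" by (rule card_mono[OF poly_roots_finite[OF Q0] sub])
  also have "... <= degree ?Q" by (rule card_poly_roots_bound[OF Q0])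
  also have "... = degree q" by (rule degree_map_poly) simp
  finally show ?thesis .
 qed
qed

subsection \<open>The degree of a 3-periodic point\<close>

text \<open>The relation is B = w A with A = x^2 (x + 1) and B = x^2 + x + t. Eliminating w by w^2 +
  w + 1 = 0 gives A^2 + A B + B^2 = 0, which is then made homogeneous in the coordinates U and
  V.\<close>

lemma (in quad_map) sextic:
 assumes nf: "normal_form f g a b c d l t"
 obtains q :: "rat poly" where "q ~= 0" "degree q <= 6"
  "!!X w x :: complex. of_rat c * X + of_rat d ~= 0 ==> x = (of_rat a * X + of_rat b) / (of_rat c * X + of_rat d) ==>
    w * w + w + 1 = 0 ==> w * (x * x * (x + 1)) = x * x + x + of_rat t ==> poly (map_poly of_rat q) X = 0"
proof -
 define U where "U = [:b, a:]"
 define V where "V = [:d, c:]"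
 define A where "A = U * U * (U + V)"
 define B where "B = V * (U * U + U * V + Polynomial.smult t (V * V))"
 define q where "q = A * A + A * B + B * B"
 have det: "a * d - b * c ~= 0" and t0: "t ~= 0" using nf by (simp_all add: normal_form_def)
 have pq: "poly q r = (poly A r)\<^sup>2 + poly A r * poly B r + (poly B r)\<^sup>2" for r
  by (simp add: q_def power2_eq_square)
 have pA: "poly A r = poly U r * poly U r * (poly U r + poly V r)" for r by (simp add: A_def)
 have pB: "poly B r = poly V r * (poly U r * poly U r + poly U r * poly V r + t * (poly V r * poly V r))" for r by (simp add: B_def)
 \<comment> \<open>At a zero of V the value is U^6, at a zero of U it is (t V^3)^2. A zero of V is
   used when a = 0, a zero of U otherwise.\<close>
 have "\<exists>r. poly q r ~= 0"
 proof (cases "a = 0")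
  case True
  then have c: "c ~= 0" "b ~= 0" using det by auto
  have "poly V (- d / c) = 0" "poly U (- d / c) = b" using c True by (simp_all add: U_def V_def)
  then have "poly q (- d / c) = (b * b * b)\<^sup>2" unfolding pq pA pB by simp
  then show ?thesis using c by (metis mult_eq_0_iff zero_eq_power2)
 next
  case False
  have U: "poly U (- b / a) = 0" using False by (simp add: U_def)
  have V: "poly V (- b / a) ~= 0" using False det by (simp add: V_def field_simps)
  have "poly q (- b / a) = (t * (poly V (- b / a) * poly V (- b / a) * poly V (- b / a)))\<^sup>2" unfolding pq pA pB U by (simp add: algebra_simps)
  then show ?thesis using V t0 by (metis mult_eq_0_iff zero_eq_power2)
 qed
 then have "q ~= 0" by auto
 moreover have "degree q <= 6"
 proof -
  have UV: "degree U <= 1" "degree V <= 1" by (simp_all add: U_def V_def)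
  have m: "degree (r * s) <= i + j" if "degree r <= i" "degree s <= j" for r s :: "rat poly" and i j
   using degree_mult_le[of r s] that by linarith
  have UU: "degree (U * U) <= 1 + 1" "degree (U * V) <= 1 + 1" "degree (V * V) <= 1 + 1" by (intro m UV)+
  have "degree A <= 1 + 1 + 1" unfolding A_def by (intro m UV degree_add_le)
  moreover have "degree B <= 1 + (1 + 1)" unfolding B_def
   by (intro m UV degree_add_le order_trans[OF degree_smult_le])
  ultimately have AB: "degree A <= 3" "degree B <= 3" by simp_all
  have "degree q <= 3 + 3" unfolding q_def by (intro degree_add_le m AB)
  then show ?thesis by simp
 qed
 moreover have "poly (map_poly of_rat q) X = 0"
  if v: "of_rat c * X + of_rat d ~= 0" and x: "x = (of_rat a * X + of_rat b) / (of_rat c * X + of_rat d)"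
   and w: "w * w + w + 1 = 0" and rel: "w * (x * x * (x + 1)) = x * x + x + of_rat t" for X w x :: complex
 proof -
  define u where "u = of_rat a * X + of_rat b"
  define v where "v = of_rat c * X + of_rat d"
  have v0: "v ~= 0" and ux: "u = x * v" using that by (simp_all add: u_def v_def)
  have sm: "map_poly of_rat (Polynomial.smult r p) = Polynomial.smult (of_rat r) (map_poly of_rat p :: complex poly)" for r p
   by (rule poly_eqI) (simp add: of_rat_mult)
  have mU: "poly (map_poly of_rat U) X = u" "poly (map_poly of_rat V) X = v"
   by (simp_all add: U_def V_def u_def v_def map_poly_pCons algebra_simps)
  have "poly (map_poly of_rat A) X = u * u * (u + v)" unfolding A_def by (simp add: mU)
  then have mA: "poly (map_poly of_rat A) X = (x * x * (x + 1)) * v ^ 3" unfolding ux by (simp add: ring3)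
  have "poly (map_poly of_rat B) X = v * (u * u + u * v + of_rat t * (v * v))" unfolding B_def by (simp add: mU sm)
  then have "poly (map_poly of_rat B) X = (x * x + x + of_rat t) * v ^ 3" unfolding ux by (simp add: ring3)
  then have mB: "poly (map_poly of_rat B) X = w * poly (map_poly of_rat A) X" unfolding mA rel[symmetric] by simp
  have "poly (map_poly of_rat q) X = (w * w + w + 1) * (poly (map_poly of_rat A) X * poly (map_poly of_rat A) X)"
   unfolding q_def by (simp add: mB algebra_simps)
  then show ?thesis using w by simp
 qed
 ultimately show thesis using that by blast
qed

text \<open>The lower bound is the Kummer degree applied to the inverse coordinate change, the upper
  bound is the explicit sextic.\<close>

theorem (in quad_map) degree_three_periodic:
 assumes nf: "normal_form f g a b c d l t" and per: "periodic_pt (=) (rf_act f g) 3 P"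
 shows "field_of_def_degree P = 6"
proof -
 obtain x0 y0 :: complex where P: "P = pt x0 y0" and y01: "(x0 = 1 & y0 = 0) \<or> y0 = 1"
 proof (cases P)
  case None
  then show thesis using that[of 1 0] by (simp add: pt_def)
 next
  case (Some z)
  then show thesis using that[of z 1] by (simp add: pt_def)
 qed
 have nz: "(x0, y0) ~= (0, 0)" using y01 by auto
 have det: "a * d - b * c ~= 0" and t0: "t ~= 0" using nf by (simp_all add: normal_form_def)
 define u where "u = of_rat a * x0 + of_rat b * y0"
 define v where "v = of_rat c * x0 + of_rat d * y0"
 define x where "x = u / v"
 obtain y z where v0: "v ~= 0" and xy: "x ~= y" and cyc: "y * (x * x + x) = of_rat t" "z * (y * y + y) = of_rat t" "x * (z * z + z) = of_rat t"
  using three_cycle_coordinates[OF nf nz per[unfolded P]] unfolding u_def v_def x_def by blast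
 have tc: "of_rat t ~= (0 :: complex)" using t0 by simp
 obtain w where w: "w * w + w + 1 = 0" and cube: "(3 * x + 1 - w * w) ^ 3 = w * w * (27 * of_rat t - 3 + 3 * (w * w))"
  and rel: "w * (x * x * (x + 1)) = x * x + x + of_rat t"
  using three_cycle_equations[OF tc xy cyc] by blast
 obtain m e where me: "quotient_of t = (m, e)" by (cases "quotient_of t")
 have e0: "e > 0" using quotient_of_denom_pos[OF me] .
 have tme: "t = of_int m / of_int e" using quotient_of_div[OF me] .
 have m0: "m ~= 0" using t0 tme by auto
 define \<kappa> where "\<kappa> = kap m e"
 have e1: "e ~= 0" using e0 by simp
 have nc: "r ^ 3 ~= \<kappa> * s ^ 3" if "s ~= 0" for r s
  using kap_not_cube[OF m0 e1 that] unfolding \<kappa>_def by blast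
 have ck: "ceis \<kappa> = of_int e ^ 3 * (c\<omega> * c\<omega> * (27 * of_rat t - 3 + 3 * (c\<omega> * c\<omega>)))"
 proof -
  have "ceis \<omega> = c\<omega>" by (simp add: ceis_def)
  then have "ceis \<kappa> = of_int (e * e) * (c\<omega> * c\<omega> * (of_int (27 * m) + of_int (3 * e) * (c\<omega> * c\<omega> - 1)))"
   unfolding \<kappa>_def kap_def power2_eq_square by (simp only: ceis_mult ceis_simps)
  moreover have "of_int m = of_int e * (of_rat t :: complex)" using tme e0 by (simp add: of_rat_divide)
  ultimately show ?thesis by (simp add: ring3)
 qed
 define xx where "xx r = (c\<omega> * c\<omega> - 1 + r / of_int e) / 3" for r
 have "(w - c\<omega>) * (w - (- 1 - c\<omega>)) = (w * w + w + 1) - (1 + c\<omega> + c\<omega> * c\<omega>)" by (simp add: algebra_simps)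
 then have wcases: "w = c\<omega> \<or> w = cnj c\<omega>" using w by (simp add: c\<omega>_sq cnj_c\<omega>)
 \<comment> \<open>The cycle may belong to either primitive cube root of unity; complex conjugation
   reduces to the chosen one and does not affect rational polynomials.\<close>
 obtain \<rho> where \<rho>: "\<rho> ^ 3 = ceis \<kappa>" and x': "x = xx \<rho> \<or> cnj x = xx \<rho>"
 proof -
  have sol: "\<exists>\<rho>. \<rho> ^ 3 = ceis \<kappa> & X = xx \<rho>" if "(3 * X + 1 - c\<omega> * c\<omega>) ^ 3 = c\<omega> * c\<omega> * (27 * of_rat t - 3 + 3 * (c\<omega> * c\<omega>))" for X
  proof (intro exI conjI)
   show "(of_int e * (3 * X + 1 - c\<omega> * c\<omega>)) ^ 3 = ceis \<kappa>" unfolding power_mult_distrib that ck ..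
   show "X = xx (of_int e * (3 * X + 1 - c\<omega> * c\<omega>))" using e0 by (simp add: xx_def)
  qed
  show thesis
  proof (cases "w = c\<omega>")
   case True
   then show thesis using sol[of x] cube that by blast
  next
   case False
   then have wc: "w = cnj c\<omega>" using wcases by blast
   have "cnj ((3 * x + 1 - w * w) ^ 3) = cnj (w * w * (27 * of_rat t - 3 + 3 * (w * w)))" unfolding cube ..
   then have "(3 * cnj x + 1 - c\<omega> * c\<omega>) ^ 3 = c\<omega> * c\<omega> * (27 * of_rat t - 3 + 3 * (c\<omega> * c\<omega>))" unfolding wc by simp
   then show thesis using sol[of "cnj x"] that by blast
  qed
 qed
 have det': "d * a - (- b) * (- c) ~= 0" using det by (simp add: mult.commute)
 have kd1: "of_rat (- c) * xx \<rho> + of_rat a ~= 0"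
  unfolding xx_def by (rule kummer_degree(1)[OF nc e1 det' \<rho>])
 have kd2: "6 <= degree q"
  if "q ~= 0" "poly (map_poly of_rat q) ((of_rat d * xx \<rho> + of_rat (- b)) / (of_rat (- c) * xx \<rho> + of_rat a)) = 0" for q
  by (rule kummer_degree(2)[OF nc e1 det' \<rho> that[unfolded xx_def]])
 let ?D = "of_rat a * of_rat d - of_rat b * of_rat c :: complex"
 have Dn: "?D ~= 0"
 proof -
  have "?D = of_rat (a * d - b * c)" by (simp add: of_rat_diff of_rat_mult)
  then show ?thesis using det by simp
 qed
 have nd: "of_rat (- c) * x + of_rat a = ?D * y0 / v" "of_rat d * x + of_rat (- b) = ?D * x0 / v"
  using v0 unfolding x_def by (simp_all add: of_rat_minus field_simps) (simp_all add: u_def v_def algebra_simps)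
 have "of_rat (- c) * x + of_rat a ~= (0 :: complex)"
 proof -
  have "cnj (of_rat (- c) * x + of_rat a) = of_rat (- c) * cnj x + of_rat a" by simp
  then show ?thesis using kd1 x' by (metis complex_cnj_zero)
 qed
 \<comment> \<open>The point at infinity would annihilate the denominator of the inverse coordinate
   change, which \<open>kummer_degree\<close> excludes.\<close>
 then have "y0 ~= 0" unfolding nd by auto
 then have y0: "y0 = 1" using y01 by auto
 have X: "(of_rat d * x + of_rat (- b)) / (of_rat (- c) * x + of_rat a) = x0" unfolding nd using Dn v0 y0 by simp
 have ge: "6 <= degree q" if q: "q ~= 0" "poly (map_poly of_rat q) x0 = 0" for q :: "rat poly"
 proof (rule kd2[OF q(1)])
  have "poly (map_poly of_rat q) (cnj x0) = 0" using q(2) by (simp add: poly_of_rat_cnj)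
  moreover have "cnj x0 = (of_rat d * cnj x + of_rat (- b)) / (of_rat (- c) * cnj x + of_rat a)" unfolding X[symmetric] by simp
  ultimately show "poly (map_poly of_rat q) ((of_rat d * xx \<rho> + of_rat (- b)) / (of_rat (- c) * xx \<rho> + of_rat a)) = 0"
   using x' X q(2) by metis
 qed
 obtain q :: "rat poly" where q: "q ~= 0" "degree q <= 6" "poly (map_poly of_rat q) x0 = 0"
 proof (rule sextic[OF nf])
  fix q :: "rat poly"
  assume "q ~= 0" "degree q <= 6" and root: "!!X w x :: complex. of_rat c * X + of_rat d ~= 0 ==> x = (of_rat a * X + of_rat b) / (of_rat c * X + of_rat d) ==>
    w * w + w + 1 = 0 ==> w * (x * x * (x + 1)) = x * x + x + of_rat t ==> poly (map_poly of_rat q) X = 0"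
  have "poly (map_poly of_rat q) x0 = 0"
   by (rule root[OF _ _ w rel]) (use v0 in \<open>simp_all add: x_def u_def v_def y0\<close>)
  then show thesis using that \<open>q ~= 0\<close> \<open>degree q <= 6\<close> by blast
 qed
 have "degree q = 6" using q ge[of q] by simp
 then have "alg_degree x0 = 6" unfolding alg_degree_def using q ge by (intro Least_equality) auto
 then show ?thesis unfolding P field_of_def_degree_def using y0 by (simp add: pt_def)
qed

subsection \<open>Cubic residues\<close>

definition cres :: "nat => int => bool" where
 "cres p m \<longleftrightarrow> (\<exists>r. int p dvd r ^ 3 - m)"

lemma root_unity_not_one:
 assumes p: "prime p" "p ~= 3" and w: "int p dvd w * w + w + 1"
 shows "~ int p dvd w - 1"
proof
 assume "int p dvd w - 1"
 then have "int p dvd (w * w + w + 1) - (w - 1) * (w + 2)" using w by (blast intro: dvd_diff dvd_mult2)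
 moreover have "(w * w + w + 1) - (w - 1) * (w + 2) = 3" by (simp add: algebra_simps)
 ultimately show False using prime_not_dvd_3[OF p] by simp
qed

lemma root_unity_unit:
 assumes p: "prime p" and w: "int p dvd w * w + w + 1"
 shows "~ int p dvd w"
proof
 assume "int p dvd w"
 then have "int p dvd (w * w + w + 1) - w * (w + 1)" using w by (intro dvd_diff dvd_mult2)
 then show False using not_prime_unit[of "int p"] p by (simp add: algebra_simps)
qed

text \<open>At a split prime the cube roots of a unit are r, r w and r w^2, which are distinct
  because w - 1, w + 1 and w are units.\<close>

lemma card_cube_roots:
 assumes p: "prime p" "p ~= 3" and w: "int p dvd w * w + w + 1" and m: "~ int p dvd m"
 shows "card {r \<in> {0..<int p}. int p dvd r ^ 3 - m} = 3 * of_bool (cres p m)"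
proof (cases "cres p m")
 case False
 then have "{r \<in> {0..<int p}. int p dvd r ^ 3 - m} = {}" by (auto simp: cres_def)
 then show ?thesis using False by (simp only: card.empty of_bool_eq(1) mult_0_right)
next
 case True
 then obtain r where r: "int p dvd r ^ 3 - m" by (auto simp: cres_def)
 have p0: "int p > 0" using p(1) prime_gt_0_nat by simp
 have nr: "~ int p dvd r"
 proof
  assume "int p dvd r"
  then have "int p dvd r ^ 3" by (simp add: power3_eq_cube)
  then have "int p dvd r ^ 3 - (r ^ 3 - m)" using r by (rule dvd_diff)
  then show False using m by simp
 qed
 note nw = root_unity_not_one[OF p w] root_unity_unit[OF p(1) w]
 have nw2: "~ int p dvd w + 1"
 proof
  assume "int p dvd w + 1"
  then have "int p dvd (w * w + w + 1) - (w + 1) * w" using w by (intro dvd_diff dvd_mult2)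
  then show False using not_prime_unit[of "int p"] p by (simp add: algebra_simps)
 qed
 have ne: "r mod int p ~= (r * w) mod int p" "r mod int p ~= (r * (w * w)) mod int p" "(r * w) mod int p ~= (r * (w * w)) mod int p"
 proof -
  have "r * w - r = r * (w - 1)" "r * (w * w) - r = r * ((w - 1) * (w + 1))" "r * (w * w) - r * w = r * (w * (w - 1))"
   by (simp_all add: algebra_simps)
  then have "~ int p dvd r * w - r" "~ int p dvd r * (w * w) - r" "~ int p dvd r * (w * w) - r * w"
   using nr nw nw2 by (simp_all add: prime_dvd_mult_int[OF p(1)])
  then show "r mod int p ~= (r * w) mod int p" "r mod int p ~= (r * (w * w)) mod int p" "(r * w) mod int p ~= (r * (w * w)) mod int p"
   unfolding mod_eq_dvd_iff by (simp_all add: dvd_diff_commute)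
 qed
 have sub: "int p dvd (s mod int p) ^ 3 - m \<longleftrightarrow> int p dvd s ^ 3 - m" for s
  unfolding mod_eq_dvd_iff[symmetric] by (simp add: power_mod)
 have "{s \<in> {0..<int p}. int p dvd s ^ 3 - m} = {r mod int p, (r * w) mod int p, (r * (w * w)) mod int p}"
 proof
  show "{s \<in> {0..<int p}. int p dvd s ^ 3 - m} \<subseteq> {r mod int p, (r * w) mod int p, (r * (w * w)) mod int p}"
  proof
   fix s assume s: "s \<in> {s \<in> {0..<int p}. int p dvd s ^ 3 - m}"
   then have "s mod int p = s" by simp
   then show "s \<in> {r mod int p, (r * w) mod int p, (r * (w * w)) mod int p}"
    using cube_roots_mod[OF p(1) w r, of s] s by (auto simp: cong_def)
  qed
  have 1: "int p dvd (r * w) ^ 3 - m"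
  proof -
   have "(r * w) ^ 3 - m = (r ^ 3 - m) + (w * w + w + 1) * (r ^ 3 * (w - 1))" by (simp add: ring3)
   then show ?thesis using dvd_add[OF r dvd_mult2[OF w]] by (simp only:)
  qed
  have 2: "int p dvd (r * (w * w)) ^ 3 - m"
  proof -
   have "(r * (w * w)) ^ 3 - m = ((r * w) ^ 3 - m) + (w * w + w + 1) * ((r * w) ^ 3 * (w - 1))" by (simp add: ring3)
   then show ?thesis using dvd_add[OF 1 dvd_mult2[OF w]] by (simp only:)
  qed
  show "{r mod int p, (r * w) mod int p, (r * (w * w)) mod int p} \<subseteq> {s \<in> {0..<int p}. int p dvd s ^ 3 - m}"
   using r 1 2 p0 by (simp add: sub)
 qed
 then show ?thesis using ne True by simp
qed

lemma three_dvd_split_prime: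
 assumes p: "prime p" "p ~= 3" and w: "int p dvd w * w + w + 1"
 shows "3 dvd p - 1"
proof -
 define W where "W = nat (w mod int p)"
 have p0: "int p > 0" using p(1) prime_gt_0_nat by simp
 have W: "[int W = w] (mod int p)" using p0 by (simp add: W_def cong_def)
 have cW: "coprime p W"
 proof -
  have "~ p dvd W"
  proof
   assume "p dvd W"
   then have "int p dvd int W" by simp
   then show False using root_unity_unit[OF p(1) w] cong_dvd_iff[OF W] by simp
  qed
  then show ?thesis using p(1) prime_imp_coprime by blast
 qed
 have "[W ^ 3 = 1] (mod p)"
 proof -
  have "int p dvd (w * w + w + 1) * (w - 1)" using w by (rule dvd_mult2)
  also have "(w * w + w + 1) * (w - 1) = w ^ 3 - 1" by (simp add: ring3)
  finally have "[w ^ 3 = 1] (mod int p)" by (simp add: cong_iff_dvd_diff)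
  then have "[int W ^ 3 = 1] (mod int p)" using cong_trans[OF cong_pow[OF W]] by blast
  then have "[int (W ^ 3) = int 1] (mod int p)" by simp
  then show ?thesis unfolding cong_int_iff .
 qed
 then have "ord p W dvd 3" by (simp only: ord_divides)
 moreover have "ord p W ~= 1"
 proof
  assume "ord p W = 1"
  then have "[W ^ 1 = 1] (mod p)" using ord_divides[of W 1 p] by simp
  then have "[int W = int 1] (mod int p)" unfolding cong_int_iff by simp
  then have "[w = 1] (mod int p)" using W by (simp add: cong_def)
  then show False using root_unity_not_one[OF p w] by (simp add: cong_iff_dvd_diff)
 qed
 moreover have "prime (3::nat)" by simp
 ultimately have "ord p W = 3" unfolding prime_nat_iff by blast
 then show ?thesis using order_divides_totient[OF cW] totient_prime[OF p(1)] by simp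
qed

text \<open>\<open>k\<close> is a discrete logarithm to a primitive root. It is additive modulo p -
  1, hence modulo 3, and a cube has a logarithm divisible by 3.\<close>

lemma cubic_character:
 assumes p: "prime p" and three: "3 dvd p - 1"
 obtains k :: "int => nat" where "!!a. ~ int p dvd a ==> cres p a \<longleftrightarrow> 3 dvd k a"
  "!!a b. ~ int p dvd a ==> ~ int p dvd b ==> [k (a * b) = k a + k b] (mod 3)"
proof -
 have p0: "int p > 0" and p1: "p > 1" using p prime_gt_0_nat prime_gt_1_nat by simp_all
 obtain g where "g \<in> totatives p" and og: "ord p g = p - 1" using residue_prime_has_primroot[OF p] by blast
 then have cg: "coprime p g" by (simp add: totatives_def coprime_commute)
 then have g: "residue_primroot p g" using og p1 totient_prime[OF p] by (simp add: residue_primroot_def)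
 have ex: "\<exists>i. [a = int (g ^ i)] (mod int p)" if a: "~ int p dvd a" for a
 proof -
  define A where "A = nat (a mod int p)"
  have A: "int A = a mod int p" using p0 by (simp add: A_def)
  have "a mod int p ~= 0" using a by (simp add: dvd_eq_mod_eq_0)
  moreover have "a mod int p >= 0" "a mod int p < int p" using p0 by simp_all
  ultimately have A0: "A > 0" "A < p" using A by linarith+
  then have "~ p dvd A" by (auto dest: dvd_imp_le)
  then have "coprime A p" using p prime_imp_coprime coprime_commute by blast
  then have "A \<in> totatives p" using A0 by (simp add: totatives_def)
  then obtain i where "A = g ^ i mod p"
   using bij_betw_imp_surj_on[OF residue_primroot_is_generator[OF p1 g]] by blast
  then have "a mod int p = int (g ^ i) mod int p" using A by (simp only: of_nat_mod)
  then show ?thesis unfolding cong_def by blast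
 qed
 define k where "k a = (SOME i. [a = int (g ^ i)] (mod int p))" for a
 have k: "[a = int (g ^ k a)] (mod int p)" if "~ int p dvd a" for a
  unfolding k_def using ex[OF that] by (rule someI_ex)
 have exp: "[i = j] (mod 3)" if "[int (g ^ i) = int (g ^ j)] (mod int p)" for i j
 proof -
  have "[g ^ i = g ^ j] (mod p)" using that unfolding cong_int_iff .
  then have "[i = j] (mod (p - 1))" using order_divides_expdiff[OF cg] og by simp
  then show ?thesis using three by (rule cong_dvd_modulus_nat)
 qed
 show thesis
 proof (rule that)
  fix a assume a: "~ int p dvd a"
  show "cres p a \<longleftrightarrow> 3 dvd k a"
  proof
   assume "cres p a"
   then obtain r where r: "int p dvd r ^ 3 - a" by (auto simp: cres_def)
   then have ra: "[r ^ 3 = a] (mod int p)" by (simp add: cong_iff_dvd_diff)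
   have "~ int p dvd r"
   proof
    assume "int p dvd r"
    then have "int p dvd r ^ 3" by (simp add: power3_eq_cube)
    then show False using a cong_dvd_iff[OF ra] by simp
   qed
   then have "[r ^ 3 = int (g ^ k r) ^ 3] (mod int p)" using k by (intro cong_pow)
   then have "[int (g ^ k r) ^ 3 = a] (mod int p)" using ra cong_trans cong_sym by blast
   then have "[int (g ^ k r) ^ 3 = int (g ^ k a)] (mod int p)" using k[OF a] cong_trans by blast
   then have "[int (g ^ (k r * 3)) = int (g ^ k a)] (mod int p)" by (simp add: power_mult)
   then have "[k r * 3 = k a] (mod 3)" by (rule exp)
   then show "3 dvd k a" using cong_dvd_iff by fastforce
  next
   assume "3 dvd k a"
   then obtain j where "k a = j * 3" by (auto elim: dvdE)
   then have "[a = int (g ^ j) ^ 3] (mod int p)" using k[OF a] by (simp add: power_mult)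
   then have "int p dvd int (g ^ j) ^ 3 - a" by (simp add: cong_iff_dvd_diff dvd_diff_commute)
   then show "cres p a" unfolding cres_def by blast
  qed
 next
  fix a b assume a: "~ int p dvd a" and b: "~ int p dvd b"
  then have "~ int p dvd a * b" by (simp add: prime_dvd_mult_int[OF p])
  then have "[int (g ^ k (a * b)) = a * b] (mod int p)" using k cong_sym by blast
  moreover have "[a * b = int (g ^ k a) * int (g ^ k b)] (mod int p)" using k[OF a] k[OF b] by (rule cong_mult)
  ultimately have "[int (g ^ k (a * b)) = int (g ^ k a) * int (g ^ k b)] (mod int p)" by (rule cong_trans)
  then have "[int (g ^ k (a * b)) = int (g ^ (k a + k b))] (mod int p)" by (simp add: power_add)
  then show "[k (a * b) = k a + k b] (mod 3)" by (rule exp)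
 qed
qed

text \<open>Orthogonality of the characters of the group (Z/3)^2, applied to the cubic characters of a and b.\<close>
lemma cres_both:
 assumes p: "prime p" "3 dvd p - 1" and a: "~ int p dvd a" and b: "~ int p dvd b"
 shows "3 * of_bool (cres p a & cres p b) =
  of_bool (cres p a) + of_bool (cres p b) + of_bool (cres p (a * b)) + of_bool (cres p (a * b * b)) - (1 :: real)"
proof -
 obtain k :: "int => nat" where k: "!!a. ~ int p dvd a ==> cres p a \<longleftrightarrow> 3 dvd k a"
  "!!a b. ~ int p dvd a ==> ~ int p dvd b ==> [k (a * b) = k a + k b] (mod 3)"
  using cubic_character[OF p] by blast
 have ab: "~ int p dvd a * b" "~ int p dvd a * b * b" using a b by (simp_all add: prime_dvd_mult_int[OF p(1)])
 have 1: "k (a * b) mod 3 = (k a + k b) mod 3" "k (a * b * b) mod 3 = (k (a * b) + k b) mod 3"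
  using k(2)[OF a b] k(2)[OF ab(1) b] by (simp_all add: cong_def)
 have "3 dvd k (a * b) \<longleftrightarrow> 3 dvd k a + k b" "3 dvd k (a * b * b) \<longleftrightarrow> 3 dvd k a + 2 * k b"
  using 1 by presburger+
 moreover have "3 dvd k a & 3 dvd k b & 3 dvd k a + k b & 3 dvd k a + 2 * k b
   \<or> 3 dvd k a & ~ 3 dvd k b & ~ 3 dvd k a + k b & ~ 3 dvd k a + 2 * k b
   \<or> ~ 3 dvd k a & 3 dvd k b & ~ 3 dvd k a + k b & ~ 3 dvd k a + 2 * k b
   \<or> ~ 3 dvd k a & ~ 3 dvd k b & ~ 3 dvd k a + k b & 3 dvd k a + 2 * k b
   \<or> ~ 3 dvd k a & ~ 3 dvd k b & 3 dvd k a + k b & ~ 3 dvd k a + 2 * k b" by presburger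
 ultimately show ?thesis unfolding k(1)[OF a] k(1)[OF b] k(1)[OF ab(1)] k(1)[OF ab(2)] by auto
qed

subsection \<open>Density of the primes with a cube root of the Kummer generator\<close>

lemma cres_cong: "[a = b] (mod int p) ==> cres p a \<longleftrightarrow> cres p b"
proof -
 have *: "cres p b" if ab: "[a = b] (mod int p)" and a: "cres p a" for a b
 proof -
  obtain r where "int p dvd r ^ 3 - a" using a by (auto simp: cres_def)
  moreover have "int p dvd a - b" using ab by (simp add: cong_iff_dvd_diff)
  ultimately have "int p dvd (r ^ 3 - a) + (a - b)" by (rule dvd_add)
  then show ?thesis unfolding cres_def by auto
 qed
 assume "[a = b] (mod int p)"
 then show ?thesis using * cong_sym by blast
qed

lemma ev_unit:
 assumes "int p dvd w * w + w + 1" "~ int p dvd enorm \<mu>"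
 shows "~ int p dvd ev w \<mu>"
proof
 assume "int p dvd ev w \<mu>"
 then have "int p dvd ev w \<mu> * ev (- 1 - w) \<mu>" by (rule dvd_mult2)
 then show False using assms(2) cong_dvd_iff[OF enorm_ev[OF assms(1), of \<mu>]] by simp
qed

lemma card_jroots:
 assumes p: "prime p" "p ~= 3" and \<mu>: "~ int p dvd enorm \<mu>"
 shows "card (jroots \<mu> p) = 3 * (\<Sum>w\<in>wroots p. of_bool (cres p (ev w \<mu>)))"
proof -
 have "finite {r \<in> {0..<int p}. int p dvd r ^ 3 - ev w \<mu>}" for w
  by (rule finite_subset[of _ "{0..<int p}"]) auto
 then have "card (jroots \<mu> p) = (\<Sum>w\<in>wroots p. card {r \<in> {0..<int p}. int p dvd r ^ 3 - ev w \<mu>})"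
  unfolding jroots_def by (intro card_SigmaI finite_wroots ballI)
 also have "... = (\<Sum>w\<in>wroots p. 3 * of_bool (cres p (ev w \<mu>)))"
 proof (rule sum.cong)
  fix w assume "w \<in> wroots p"
  then have w: "int p dvd w * w + w + 1" by (simp add: wroots_def)
  show "card {r \<in> {0..<int p}. int p dvd r ^ 3 - ev w \<mu>} = 3 * of_bool (cres p (ev w \<mu>))"
   by (rule card_cube_roots[OF p w ev_unit[OF w \<mu>]])
 qed simp
 finally show ?thesis by (simp add: sum_distrib_left)
qed

lemma wroots_cases:
 assumes p: "prime p" "p ~= 3"
 shows "wroots p = {} \<or> (\<exists>w w'. wroots p = {w, w'} & w ~= w' & [w' = - 1 - w] (mod int p) & [w = - 1 - w'] (mod int p) &
  int p dvd w * w + w + 1 & int p dvd w' * w' + w' + 1)"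
proof (cases "wroots p = {}")
 case False
 then obtain w where w: "w \<in> wroots p" by blast
 have p0: "int p > 0" using p(1) prime_gt_0_nat by simp
 define w' where "w' = (- 1 - w) mod int p"
 have c: "[w' = - 1 - w] (mod int p)" by (simp add: w'_def cong_def)
 have c': "[w = - 1 - w'] (mod int p)"
 proof -
  have "int p dvd w' - (- 1 - w)" using c by (simp add: cong_iff_dvd_diff)
  moreover have "w' - (- 1 - w) = w - (- 1 - w')" by simp
  ultimately show ?thesis by (simp only: cong_iff_dvd_diff)
 qed
 have wr: "int p dvd w * w + w + 1" using w by (simp add: wroots_def)
 have "[w' * w' + w' + 1 = (- 1 - w) * (- 1 - w) + (- 1 - w) + 1] (mod int p)"
  using c by (intro cong_add cong_mult cong_refl)
 then have wr': "int p dvd w' * w' + w' + 1" using conj_root[OF wr] cong_dvd_iff by blast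
 have ne: "w ~= w'"
 proof
  assume "w = w'"
  then have "int p dvd 2 * w + 1" using c by (simp add: cong_iff_dvd_diff algebra_simps)
  then show False using root_conj_distinct[OF p wr] by blast
 qed
 have w'm: "w' \<in> wroots p" using wr' p0 by (simp add: wroots_def w'_def)
 have "v \<in> {w, w'}" if v: "v \<in> wroots p" for v
 proof (rule ccontr)
  assume n: "v \<notin> {w, w'}"
  have "int p dvd (v * v + v + 1) - (w * w + w + 1)" using v wr by (intro dvd_diff) (auto simp: wroots_def)
  moreover have "(v * v + v + 1) - (w * w + w + 1) = (v - w) * (v - (- 1 - w))" by (simp add: algebra_simps)
  ultimately have "int p dvd v - w \<or> int p dvd v - (- 1 - w)" by (simp only: prime_dvd_mult_int[OF p(1)])
  moreover have "~ int p dvd v - w" using wroots_distinct[OF p(1) v w] n by simp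
  ultimately have "[v = w'] (mod int p)" using c by (metis cong_iff_dvd_diff cong_sym cong_trans)
  then show False using wroots_distinct[OF p(1) v w'm] n by (simp add: cong_iff_dvd_diff)
 qed
 then have "wroots p = {w, w'}" using w w'm by blast
 then show ?thesis using ne c c' wr wr' by blast
qed simp

text \<open>Card / 3 counts the roots w at which \<mu> is a cube; the second root sees \<mu> as the
  first sees its conjugate. The bracket is 6 if \<mu> and its conjugate are both cubes and 0
  otherwise: summing the character relation over the two roots gives 6 [both] + 2, and 2 is the
  number of roots. For an inert p all terms vanish.\<close>

lemma jroots_nonempty_eq:
 assumes p: "prime p" "p ~= 3" and \<mu>: "~ int p dvd enorm \<mu>"
 shows "of_bool (jroots \<mu> p ~= {}) = real (card (jroots \<mu> p)) / 3
   - ((real (card (jroots \<mu> p)) + real (card (jroots (econj \<mu>) p)) + real (card (jroots (\<mu> * econj \<mu>) p))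
     + real (card (jroots (\<mu> * econj \<mu> * econj \<mu>) p))) / 3 - real (card (wroots p))) / 6"
proof -
 have nc: "enorm (econj \<mu>) = enorm \<mu>" by (simp add: enorm_def ring2)
 have n: "~ int p dvd enorm (econj \<mu>)" "~ int p dvd enorm (\<mu> * econj \<mu>)" "~ int p dvd enorm (\<mu> * econj \<mu> * econj \<mu>)"
  using \<mu> by (simp_all add: enorm_mult nc prime_dvd_mult_int[OF p(1)])
 note cards = card_jroots[OF p \<mu>] card_jroots[OF p n(1)] card_jroots[OF p n(2)] card_jroots[OF p n(3)]
 have empty: "jroots \<mu> p ~= {} \<longleftrightarrow> (\<exists>w\<in>wroots p. cres p (ev w \<mu>))"
 proof -
  have p0: "int p > 0" using p(1) prime_gt_0_nat by simp
  have red: "\<exists>r\<in>{0..<int p}. int p dvd r ^ 3 - m" if r: "int p dvd r ^ 3 - m" for r m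
  proof -
   have "int p dvd (r mod int p) ^ 3 - m"
    using r unfolding mod_eq_dvd_iff[symmetric] by (simp add: power_mod)
   then show ?thesis using p0 by (intro bexI[of _ "r mod int p"]) simp_all
  qed
  show ?thesis
  proof
   assume "jroots \<mu> p ~= {}"
   then obtain q where "q \<in> jroots \<mu> p" by blast
   then show "\<exists>w\<in>wroots p. cres p (ev w \<mu>)" by (auto simp: jroots_def cres_def)
  next
   assume "\<exists>w\<in>wroots p. cres p (ev w \<mu>)"
   then obtain w r where w: "w \<in> wroots p" and r: "int p dvd r ^ 3 - ev w \<mu>" by (auto simp: cres_def)
   then obtain s where "s \<in> {0..<int p}" "int p dvd s ^ 3 - ev w \<mu>" using red[OF r] by blast
   then have "(w, s) \<in> jroots \<mu> p" using w by (simp add: jroots_def)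
   then show "jroots \<mu> p ~= {}" by blast
  qed
 qed
 show ?thesis
  using wroots_cases[OF p]
 proof (elim disjE exE conjE)
  assume e: "wroots p = {}"
  show ?thesis unfolding empty cards e by simp
 next
  fix w w' assume e: "wroots p = {w, w'}" and ne: "w ~= w'" and c: "[w' = - 1 - w] (mod int p)" "[w = - 1 - w'] (mod int p)"
   and wr: "int p dvd w * w + w + 1" and wr': "int p dvd w' * w' + w' + 1"
  have three: "3 dvd p - 1" by (rule three_dvd_split_prime[OF p wr])
  have ev_conj: "ev v (econj \<mu>) = ev (- 1 - v) \<mu>" for v by (simp add: ev_def algebra_simps)
  have cc: "cres p (ev w (econj \<mu>)) \<longleftrightarrow> cres p (ev w' \<mu>)" "cres p (ev w' (econj \<mu>)) \<longleftrightarrow> cres p (ev w \<mu>)"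
   unfolding ev_conj using ev_cong[OF c(1), of \<mu>] ev_cong[OF c(2), of \<mu>] cres_cong cong_sym by blast+
  have B: "3 * of_bool (cres p (ev v \<mu>) & cres p (ev v (econj \<mu>))) =
   of_bool (cres p (ev v \<mu>)) + of_bool (cres p (ev v (econj \<mu>))) + of_bool (cres p (ev v (\<mu> * econj \<mu>))) + of_bool (cres p (ev v (\<mu> * econj \<mu> * econj \<mu>))) - (1 :: real)"
   if v: "int p dvd v * v + v + 1" for v
  proof -
   have 1: "[ev v (\<mu> * econj \<mu>) = ev v \<mu> * ev v (econj \<mu>)] (mod int p)" by (rule ev_mult[OF v])
   have 2: "[ev v (\<mu> * econj \<mu> * econj \<mu>) = ev v (\<mu> * econj \<mu>) * ev v (econj \<mu>)] (mod int p)" by (rule ev_mult[OF v])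
   have 3: "[ev v (\<mu> * econj \<mu> * econj \<mu>) = ev v \<mu> * ev v (econj \<mu>) * ev v (econj \<mu>)] (mod int p)"
    by (rule cong_trans[OF 2 cong_mult[OF 1 cong_refl]])
   show ?thesis unfolding cres_cong[OF 1] cres_cong[OF 3]
    by (rule cres_both[OF p(1) three ev_unit[OF v \<mu>] ev_unit[OF v n(1)]])
  qed
  have S: "(\<Sum>v\<in>wroots p. h v) = h w + h w'" for h :: "int => nat" unfolding e using ne by simp
  have cw: "card (wroots p) = 2" unfolding e using ne by simp
  have ex: "(\<exists>v\<in>wroots p. cres p (ev v \<mu>)) \<longleftrightarrow> cres p (ev w \<mu>) \<or> cres p (ev w' \<mu>)" unfolding e by simp
  have incl_excl: "of_bool (P \<or> Q) = (3 * (of_bool P + of_bool Q)) / 3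
    - ((3 * (of_bool P + of_bool Q) + 3 * (of_bool Q + of_bool P) + 3 * (i + i') + 3 * (j + j')) / 3 - 2) / (6 :: real)"
   if "3 * of_bool (P & Q) = of_bool P + of_bool Q + i + j - (1 :: real)" "3 * of_bool (Q & P) = of_bool Q + of_bool P + i' + j' - (1 :: real)"
   for P Q i j i' j'
   using that by (cases P; cases Q) (simp_all add: field_simps)
  show ?thesis
   unfolding empty ex cards S cw cc
   using incl_excl[OF B[OF wr, unfolded cc] B[OF wr', unfolded cc]]
   by (simp only: of_nat_add of_nat_mult of_nat_of_bool of_nat_numeral)
 qed
qed

text \<open>A cube has three cube roots at each root w, so its mean is 3 instead of 1. Either case
  may occur for the products of \<mu> and its conjugate.\<close>

lemma lmean_jroots_ge_1:
 assumes "\<mu> ~= 0"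
 shows "\<exists>A\<ge>1. lmean (%p. real (card (jroots \<mu> p))) A"
proof (cases "\<exists>a b. b ~= 0 & a ^ 3 = \<mu> * b ^ 3")
 case False
 then have "lmean (%p. real (card (jroots \<mu> p))) 1" by (intro lmean_jroots) blast
 then show ?thesis by (intro exI[of _ 1]) simp
next
 case True
 then obtain a b where ab: "b ~= 0" "a ^ 3 = \<mu> * b ^ 3" by blast
 define N where "N = nat (enorm (\<mu> * b))"
 have N0: "N > 0" and N: "int N = enorm (\<mu> * b)"
  using assms ab(1) enorm_pos_iff[of "\<mu> * b"] by (simp_all add: N_def)
 have "lmean (%p. 3 * real (card (wroots p))) (3 * 1)" by (intro lmean_cmult lmean_wroots)
 moreover have "finite (insert 3 {p. p dvd N})" using finite_divisors_nat[OF N0] by simp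
 moreover have "3 * real (card (wroots p)) = real (card (jroots \<mu> p))"
  if p: "prime p" and np: "p \<notin> insert 3 {p. p dvd N}" for p
 proof -
  have p3: "p ~= 3" using np by simp
  have "~ int p dvd int N" using np by simp
  then have nd: "~ int p dvd enorm \<mu>" "~ int p dvd enorm b" unfolding N enorm_mult by (auto intro: dvd_mult dvd_mult2)
  have c: "cres p (ev w \<mu>)" if w: "w \<in> wroots p" for w
  proof -
   have wr: "int p dvd w * w + w + 1" using w by (simp add: wroots_def)
   obtain i where i: "[ev w b * i = 1] (mod int p)" using prime_int_inverse[OF p ev_unit[OF wr nd(2)]] by blast
   have "[ev w a ^ 3 = ev w (\<mu> * b ^ 3)] (mod int p)" using cong_sym[OF ev_power[OF wr, of a 3]] unfolding ab(2) .
   then have "[ev w a ^ 3 = ev w \<mu> * ev w (b ^ 3)] (mod int p)" using ev_mult[OF wr] cong_trans by blast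
   then have "[ev w a ^ 3 = ev w \<mu> * ev w b ^ 3] (mod int p)"
    using cong_trans[OF _ cong_mult[OF cong_refl ev_power[OF wr, of b 3]]] by blast
   then have "[ev w a ^ 3 * i ^ 3 = ev w \<mu> * ev w b ^ 3 * i ^ 3] (mod int p)" by (intro cong_mult cong_refl)
   moreover have "[ev w \<mu> * (ev w b * i) ^ 3 = ev w \<mu> * 1 ^ 3] (mod int p)" using i by (intro cong_mult cong_pow cong_refl)
   ultimately have "[(ev w a * i) ^ 3 = ev w \<mu>] (mod int p)"
    by (simp add: power_mult_distrib mult.assoc) (metis cong_trans)
   then show ?thesis unfolding cres_def cong_iff_dvd_diff by blast
  qed
  have "card (jroots \<mu> p) = 3 * (\<Sum>w\<in>wroots p. 1)"
   unfolding card_jroots[OF p p3 nd(1)] using c by simp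
  then show ?thesis by simp
 qed
 ultimately have "lmean (%p. real (card (jroots \<mu> p))) (3 * 1)" by (rule lmean_cong_cofinite)
 then show ?thesis by (intro exI[of _ 3]) simp
qed

text \<open>The independent case A = B = 1 is the worst and gives 13/18, slightly above 0.72. A cube
  among the two products raises the density.\<close>

theorem density_without_cube_root:
 assumes nc: "!!a b. b ~= 0 ==> a ^ 3 ~= \<mu> * b ^ 3"
  and S: "finite F" "!!p. prime p ==> p \<notin> F ==> p \<in> S \<longleftrightarrow> jroots \<mu> p = {}"
 shows "\<exists>\<delta>>0.72. has_dirichlet_density S \<delta>"
proof -
 have \<mu>0: "\<mu> ~= 0" using nc[of 1 0] by auto
 have nc': "a ^ 3 ~= econj \<mu> * b ^ 3" if "b ~= 0" for a b
 proof
  assume "a ^ 3 = econj \<mu> * b ^ 3"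
  then have "econj (a ^ 3) = econj (econj \<mu> * b ^ 3)" by simp
  moreover have "econj (econj \<mu> * b ^ 3) = \<mu> * econj b ^ 3" by (simp add: eis_eq_iff)
  ultimately have "econj a ^ 3 = \<mu> * econj b ^ 3" by simp
  then show False using nc[of "econj b" "econj a"] that by simp
 qed
 obtain A where A: "A >= 1" "lmean (%p. real (card (jroots (\<mu> * econj \<mu>) p))) A"
  using lmean_jroots_ge_1[of "\<mu> * econj \<mu>"] \<mu>0 by auto
 obtain B where B: "B >= 1" "lmean (%p. real (card (jroots (\<mu> * econj \<mu> * econj \<mu>) p))) B"
  using lmean_jroots_ge_1[of "\<mu> * econj \<mu> * econj \<mu>"] \<mu>0 by auto
 \<comment> \<open>The coefficients of one minus the inclusion-exclusion formula: -1/3 + 1/18 =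
   -5/18 for \<mu>, 1/18 for the other three counts, and -1/6 for the number of roots w.\<close>
 define \<delta> where "\<delta> = 1 + ((- 5 / 18) * 1 + ((1 / 18) * 1 + ((1 / 18) * A + ((1 / 18) * B + (- 1 / 6) * 1))))"
 define h where "h p = 1 + ((- 5 / 18) * real (card (jroots \<mu> p)) + ((1 / 18) * real (card (jroots (econj \<mu>) p))
   + ((1 / 18) * real (card (jroots (\<mu> * econj \<mu>) p)) + ((1 / 18) * real (card (jroots (\<mu> * econj \<mu> * econj \<mu>) p)) + (- 1 / 6) * real (card (wroots p))))))" for p
 have "lmean h \<delta>" unfolding h_def \<delta>_def
  by (intro lmean_add lmean_cmult lmean_primes lmean_wroots lmean_jroots A B nc nc')
 define N where "N = nat (enorm \<mu>)"
 have N0: "N > 0" and N: "int N = enorm \<mu>" using \<mu>0 enorm_pos_iff[of \<mu>] by (simp_all add: N_def)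
 have fin: "finite (insert 3 ({p. p dvd N} \<union> F))" using finite_divisors_nat[OF N0] S(1) by simp
 have eq: "h p = of_bool (p \<in> S)" if p: "prime p" and np: "p \<notin> insert 3 ({p. p dvd N} \<union> F)" for p
 proof -
  have "~ int p dvd int N" using np by simp
  then have nd: "~ int p dvd enorm \<mu>" unfolding N .
  have "p ~= 3" using np by simp
  have "of_bool (p \<in> S) = 1 - (of_bool (jroots \<mu> p ~= {}) :: real)" using S(2)[OF p] np by simp
  then show ?thesis unfolding jroots_nonempty_eq[OF p \<open>p ~= 3\<close> nd] h_def by (simp add: field_simps)
 qed
 have "lmean (%p. of_bool (p \<in> S)) \<delta>" by (rule lmean_cong_cofinite[OF \<open>lmean h \<delta>\<close> fin eq])
 then have "has_dirichlet_density S \<delta>" by (rule lmean_imp_dirichlet_density[OF lmean_primes])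
 moreover have "\<delta> > 0.72" using A(1) B(1) by (simp add: \<delta>_def)
 ultimately show ?thesis by blast
qed

subsection \<open>The p-adic absolute value\<close>

locale padic =
 fixes p :: nat
 assumes prime_p: "prime p"
begin

abbreviation N :: "rat => real" where "N \<equiv> padic_abs p"

lemma padic_val_frac:
 assumes "a ~= 0" "b ~= 0"
 shows "padic_val p (of_int a / of_int b) = int (multiplicity (int p) a) - int (multiplicity (int p) b)"
proof -
 obtain n d where nd: "quotient_of (of_int a / of_int b) = (n, d)" by (cases "quotient_of (of_int a / of_int b)")
 have d: "d > 0" using quotient_of_denom_pos[OF nd] .
 have "of_int a / of_int b = (of_int n / of_int d :: rat)" using quotient_of_div[OF nd] .
 then have "of_int (a * d) = (of_int (n * b) :: rat)" using assms d by (simp add: frac_eq_eq)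
 then have e: "a * d = n * b" by (simp only: of_int_eq_iff)
 then have n: "n ~= 0" using assms d by auto
 have pe: "prime_elem (int p)" using prime_p by (simp add: prime_imp_prime_elem)
 have "multiplicity (int p) (a * d) = multiplicity (int p) a + multiplicity (int p) d"
  using pe assms d by (intro prime_elem_multiplicity_mult_distrib) auto
 moreover have "multiplicity (int p) (n * b) = multiplicity (int p) n + multiplicity (int p) b"
  using pe assms n by (intro prime_elem_multiplicity_mult_distrib) auto
 ultimately have "multiplicity (int p) a + multiplicity (int p) d = multiplicity (int p) n + multiplicity (int p) b" using e by simp
 then show ?thesis unfolding padic_val_def nd by simp
qed

lemma N_frac:
 assumes "a ~= 0" "b ~= 0"
 shows "N (of_int a / of_int b) = real p powr (real (multiplicity (int p) b) - real (multiplicity (int p) a))"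
 using assms by (simp add: padic_abs_def padic_val_frac)

lemma p_gt_1: "real p > 1" using prime_gt_1_nat[OF prime_p] by simp

lemma N_0 [simp]: "N 0 = 0" by (simp add: padic_abs_def)

lemma N_pos: "x ~= 0 ==> N x > 0" using p_gt_1 by (simp add: padic_abs_def)

lemma N_nonneg [simp]: "N x >= 0" by (cases "x = 0") (auto intro: less_imp_le N_pos)

lemma N_eq_0_iff [simp]: "N x = 0 \<longleftrightarrow> x = 0" using N_pos[of x] by (cases "x = 0") auto

lemma rat_frac: obtains a b :: int where "(x :: rat) = of_int a / of_int b" "b ~= 0"
proof -
 obtain a b where ab: "quotient_of x = (a, b)" by (cases "quotient_of x")
 show thesis using that[OF quotient_of_div[OF ab]] quotient_of_denom_pos[OF ab] by simp
qed

lemma N_mult: "N (x * y) = N x * N y"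
proof (cases "x = 0 \<or> y = 0")
 case False
 obtain a b where x: "x = of_int a / of_int b" "b ~= 0" by (rule rat_frac)
 obtain c d where y: "y = of_int c / of_int d" "d ~= 0" by (rule rat_frac)
 have nz: "a ~= 0" "c ~= 0" using False x y by auto
 have pe: "prime_elem (int p)" using prime_p by (simp add: prime_imp_prime_elem)
 have "x * y = of_int (a * c) / of_int (b * d)" unfolding x y by simp
 then have "N (x * y) = real p powr (real (multiplicity (int p) (b * d)) - real (multiplicity (int p) (a * c)))"
  using N_frac[of "a * c" "b * d"] nz x y by simp
 also have "... = real p powr ((real (multiplicity (int p) b) - real (multiplicity (int p) a)) + (real (multiplicity (int p) d) - real (multiplicity (int p) c)))"
  using nz x y prime_elem_multiplicity_mult_distrib[OF pe] by (simp add: algebra_simps)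
 also have "... = N x * N y" unfolding powr_add x y using N_frac nz x y by simp
 finally show ?thesis .
qed auto

lemma N_of_int_le: "N (of_int k) <= 1"
proof (cases "k = 0")
 case False
 have "N (of_int k) = real p powr (- real (multiplicity (int p) k))" using N_frac[OF False, of 1] by simp
 also have "... <= real p powr 0" using p_gt_1 by (intro powr_mono) auto
 finally show ?thesis using p_gt_1 by simp
qed simp

lemma N_of_int_power_dvd:
 assumes "int p ^ n dvd k"
 shows "N (of_int k) <= (1 / real p) ^ n"
proof (cases "k = 0")
 case False
 have "n <= multiplicity (int p) k"
  using assms False prime_p by (intro multiplicity_geI) auto
 moreover have "N (of_int k) = real p powr (- real (multiplicity (int p) k))" using N_frac[OF False, of 1] by simp
 ultimately have "N (of_int k) <= real p powr (- real n)" using p_gt_1 by (simp add: powr_mono)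
 also have "... = (1 / real p) ^ n" using p_gt_1 by (simp add: powr_minus powr_realpow power_one_over inverse_eq_divide)
 finally show ?thesis .
qed simp

lemma N_of_int_eq_1: "~ int p dvd k ==> N (of_int k) = 1"
 using N_frac[of k 1] p_gt_1 by (cases "k = 0") (simp_all add: not_dvd_imp_multiplicity_0)

lemma N_of_int_less_1_iff: "N (of_int k) < 1 \<longleftrightarrow> int p dvd k"
proof
 assume "N (of_int k) < 1"
 then show "int p dvd k" using N_of_int_eq_1[of k] by fastforce
next
 assume "int p dvd k"
 then have "N (of_int k) <= 1 / real p" using N_of_int_power_dvd[of 1 k] by simp
 also have "... < 1" using p_gt_1 by simp
 finally show "N (of_int k) < 1" .
qed

lemma N_1 [simp]: "N 1 = 1" using N_of_int_eq_1[of 1] p_gt_1 by auto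

lemma N_uminus [simp]: "N (- x) = N x"
proof -
 have "N (- 1) = 1" using N_of_int_eq_1[of "- 1"] p_gt_1 by auto
 then show ?thesis using N_mult[of "- 1" x] by simp
qed

lemma N_power: "N (x ^ n) = N x ^ n" by (induction n) (simp_all add: N_mult)

lemma N_divide: "N (x / y) = N x / N y"
proof (cases "y = 0")
 case False
 then have "N x = N (x / y) * N y" by (simp flip: N_mult)
 then show ?thesis using False by simp
qed simp

lemma N_add: "N (x + y) <= max (N x) (N y)"
proof (cases "x = 0 \<or> y = 0 \<or> x + y = 0")
 case True
 then show ?thesis by (auto simp: le_max_iff_disj)
next
 case False
 obtain a b where x: "x = of_int a / of_int b" "b ~= 0" by (rule rat_frac)
 obtain c d where y: "y = of_int c / of_int d" "d ~= 0" by (rule rat_frac)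
 define u where "u = a * d" define v where "v = c * b" define e where "e = b * d"
 have e: "e ~= 0" using x y by (simp add: e_def)
 have xy: "x = of_int u / of_int e" "y = of_int v / of_int e" "x + y = of_int (u + v) / of_int e"
  using x y by (simp_all add: u_def v_def e_def field_simps)
 have nz: "u ~= 0" "v ~= 0" "u + v ~= 0" using False xy by auto
 let ?m = "multiplicity (int p)"
 have "int p ^ min (?m u) (?m v) dvd u + v"
  by (intro dvd_add multiplicity_dvd') auto
 then have "min (?m u) (?m v) <= ?m (u + v)" using nz(3) prime_p by (intro multiplicity_geI) auto
 then have "?m u <= ?m (u + v) \<or> ?m v <= ?m (u + v)" by linarith
 moreover have "N (x + y) = real p powr (real (?m e) - real (?m (u + v)))" unfolding xy(3) by (rule N_frac[OF nz(3) e])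
 moreover have "N x = real p powr (real (?m e) - real (?m u))" unfolding xy(1) by (rule N_frac[OF nz(1) e])
 moreover have "N y = real p powr (real (?m e) - real (?m v))" unfolding xy(2) by (rule N_frac[OF nz(2) e])
 ultimately have "N (x + y) <= N x \<or> N (x + y) <= N y" using p_gt_1 by (auto intro!: powr_mono)
 then show ?thesis by auto
qed

lemma N_diff: "N (x - y) <= max (N x) (N y)"
 using N_add[of x "- y"] by simp

lemma N_minus_commute: "N (x - y) = N (y - x)"
 using N_uminus[of "x - y"] by simp

lemma N_numeral_le [simp]: "N (numeral k) <= 1"
 using N_of_int_le[of "numeral k"] by simp

lemma N_add_le: "N x <= r ==> N y <= r ==> N (x + y) <= r" using N_add[of x y] by simp
lemma N_diff_le: "N x <= r ==> N y <= r ==> N (x - y) <= r" using N_diff[of x y] by simp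
lemma N_add_less: "N x < r ==> N y < r ==> N (x + y) < r" using N_add[of x y] by simp
lemma N_diff_less: "N x < r ==> N y < r ==> N (x - y) < r" using N_diff[of x y] by simp
lemma N_mult_le: "N x <= 1 ==> N y <= r ==> N (x * y) <= r"
 unfolding N_mult using mult_mono[of "N x" 1 "N y" r] by simp
lemma N_mult_le': "N x <= r ==> N y <= 1 ==> N (x * y) <= r"
 using N_mult_le[of y x] by (simp add: mult.commute)
lemma N_mult_less: "N x <= 1 ==> N y < r ==> N (x * y) < r"
 using N_mult_le[of x y "N y"] by simp
lemma N_mult_less': "N x < r ==> N y <= 1 ==> N (x * y) < r"
 using N_mult_less[of y x] by (simp add: mult.commute)

lemmas N_int = N_add_le[of _ 1] N_diff_le[of _ 1] N_mult_le[of _ _ 1] N_numeral_le N_of_int_le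

lemma N_unit_add: "N x = 1 ==> N y < 1 ==> N (x + y) = 1"
 using N_add[of x y] N_diff[of "x + y" y] by (auto simp: max_def split: if_splits)

lemma integral_approx:
 assumes "N x <= 1"
 obtains k :: int where "N (x - of_int k) < 1"
proof (cases "x = 0")
 case True
 then show thesis using that[of 0] by simp
next
 case False
 obtain a b where ab: "quotient_of x = (a, b)" by (cases "quotient_of x")
 have b: "b > 0" and x: "x = of_int a / of_int b" and cop: "coprime a b"
  using quotient_of_denom_pos[OF ab] quotient_of_div[OF ab] quotient_of_coprime[OF ab] by auto
 have "~ int p dvd b"
 proof
  assume pb: "int p dvd b"
  have "~ int p dvd a"
  proof
   assume "int p dvd a"
   then have "is_unit (int p)" using pb cop by (meson coprime_common_divisor)
   then show False using prime_p not_prime_unit by auto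
  qed
  then have "N (of_int a) = 1" by (rule N_of_int_eq_1)
  moreover have "N (of_int b) < 1" using pb by (simp add: N_of_int_less_1_iff)
  moreover have "N (of_int b) > 0" using b by (intro N_pos) simp
  ultimately show False using assms unfolding x N_divide by (simp add: divide_le_eq)
 qed
 then obtain i where i: "[b * i = 1] (mod int p)" using prime_int_inverse[OF prime_p] by blast
 have nb: "N (of_int b) = 1" using \<open>~ int p dvd b\<close> by (rule N_of_int_eq_1)
 have "x - of_int (a * i) = of_int (a * (1 - b * i)) / of_int b" using b by (simp add: x field_simps)
 moreover have "int p dvd 1 - b * i" using i cong_sym by (simp add: cong_iff_dvd_diff dvd_diff_commute)
 then have "N (of_int (a * (1 - b * i))) < 1" by (simp only: N_of_int_less_1_iff dvd_mult)
 ultimately have "N (x - of_int (a * i)) < 1" unfolding N_divide nb by (simp add: N_divide nb)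
 then show thesis using that by blast
qed

subsection \<open>Cauchy and null sequences\<close>

lemma null_mono: "padic_null p y ==> (!!n. N (x n) <= N (y n)) ==> padic_null p x"
 unfolding padic_null_def by (meson le_less_trans)

lemma null_eventually_mono:
 assumes "padic_null p y" "!!n. n >= m ==> N (x n) <= N (y n)"
 shows "padic_null p x"
 unfolding padic_null_def
proof (intro allI impI)
 fix e :: real assume "e > 0"
 then obtain M where M: "!!n. n >= M ==> N (y n) < e" using assms(1) unfolding padic_null_def by blast
 show "\<exists>M. \<forall>n\<ge>M. N (x n) < e"
  by (intro exI[of _ "max M m"] allI impI le_less_trans[OF assms(2) M]) auto
qed

lemma null_zero [simp]: "padic_null p (%_. 0)" by (simp add: padic_null_def)

lemma null_max:
 assumes "padic_null p y" "padic_null p z" "!!n. N (x n) <= max (N (y n)) (N (z n))"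
 shows "padic_null p x"
 unfolding padic_null_def
proof (intro allI impI)
 fix e :: real assume e: "e > 0"
 obtain M where M: "!!n. n >= M ==> N (y n) < e" using assms(1) e unfolding padic_null_def by blast
 obtain K where K: "!!n. n >= K ==> N (z n) < e" using assms(2) e unfolding padic_null_def by blast
 show "\<exists>M. \<forall>n\<ge>M. N (x n) < e"
 proof (intro exI[of _ "max M K"] allI impI)
  fix n assume "n >= max M K"
  then show "N (x n) < e" using M[of n] K[of n] assms(3)[of n] by simp
 qed
qed

lemma null_bounded:
 assumes "padic_null p y" "B > 0" "!!n. N (x n) <= B * N (y n)"
 shows "padic_null p x"
 unfolding padic_null_def
proof (intro allI impI)
 fix e :: real assume "e > 0"
 then have "e / B > 0" using assms(2) by simp
 then obtain M where M: "!!n. n >= M ==> N (y n) < e / B" using assms(1) unfolding padic_null_def by blast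
 show "\<exists>M. \<forall>n\<ge>M. N (x n) < e"
 proof (intro exI[of _ M] allI impI)
  fix n assume "n >= M"
  then have "B * N (y n) < e" using M[of n] assms(2) by (simp add: pos_less_divide_eq mult.commute)
  then show "N (x n) < e" using assms(3)[of n] by simp
 qed
qed

lemma null_power: "padic_null p x" if x: "!!n. N (x n) <= (1 / real p) ^ Suc n"
 unfolding padic_null_def
proof (intro allI impI)
 fix e :: real assume e: "e > 0"
 obtain M where M: "(1 / real p) ^ M < e" using real_arch_pow_inv[of e "1 / real p"] e p_gt_1 by auto
 show "\<exists>M. \<forall>n\<ge>M. N (x n) < e"
 proof (intro exI[of _ M] allI impI)
  fix n assume "n >= M"
  then have "(1 / real p) ^ Suc n <= (1 / real p) ^ M" using p_gt_1 by (intro power_decreasing) auto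
  then show "N (x n) < e" using x[of n] M by linarith
 qed
qed

lemma cauchy_bounded:
 assumes "padic_cauchy p s"
 obtains B where "B >= 1" "!!n. N (s n) <= B"
proof -
 obtain M where M: "!!m n. m >= M ==> n >= M ==> N (s m - s n) < 1"
  using assms unfolding padic_cauchy_def by (meson zero_less_one)
 define B where "B = 1 + (\<Sum>i\<le>M. N (s i))"
 have le: "N (s i) <= (\<Sum>i\<le>M. N (s i))" if "i <= M" for i
  using that by (intro member_le_sum) auto
 have S0: "(\<Sum>i\<le>M. N (s i)) >= 0" by (intro sum_nonneg) simp
 have "N (s n) <= B" for n
 proof (cases "n <= M")
  case True
  then show ?thesis using le[OF True] by (simp add: B_def)
 next
  case False
  have "N (s n) <= max (N (s n - s M)) (N (s M))" using N_add[of "s n - s M" "s M"] by simp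
  then show ?thesis using M[of n M] False le[of M] S0 by (auto simp: B_def)
 qed
 moreover have "B >= 1" using S0 by (simp add: B_def)
 ultimately show thesis using that by blast
qed

lemma cauchy_nonnull:
 assumes "padic_cauchy p s" "~ padic_null p s"
 obtains e M where "e > 0" "!!n. n >= M ==> N (s n) >= e"
proof -
 obtain e where e: "e > 0" "!!M. \<exists>n\<ge>M. ~ N (s n) < e" using assms(2) unfolding padic_null_def by blast
 obtain M where M: "!!m n. m >= M ==> n >= M ==> N (s m - s n) < e"
  using assms(1) e(1) unfolding padic_cauchy_def by blast
 obtain n0 where n0: "n0 >= M" "~ N (s n0) < e" using e(2) by blast
 have "N (s n) >= e" if "n >= M" for n
  using N_add[of "s n0 - s n" "s n"] M[OF n0(1) that] n0(2) by simp
 then show thesis using that e(1) by blast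
qed

lemma cauchy_const [simp]: "padic_cauchy p (%_. x)" by (simp add: padic_cauchy_def)

lemma cauchy_add:
 assumes "padic_cauchy p s" "padic_cauchy p r"
 shows "padic_cauchy p (%n. s n + r n)"
 unfolding padic_cauchy_def
proof (intro allI impI)
 fix e :: real assume e: "e > 0"
 obtain M where M: "!!m n. m >= M ==> n >= M ==> N (s m - s n) < e" using assms(1) e unfolding padic_cauchy_def by blast
 obtain K where K: "!!m n. m >= K ==> n >= K ==> N (r m - r n) < e" using assms(2) e unfolding padic_cauchy_def by blast
 show "\<exists>M. \<forall>m\<ge>M. \<forall>n\<ge>M. N (s m + r m - (s n + r n)) < e"
 proof (intro exI[of _ "max M K"] allI impI)
  fix m n assume "m >= max M K" "n >= max M K"
  then have "N ((s m - s n) + (r m - r n)) < e" using M[of m n] K[of m n] by (intro N_add_less) auto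
  then show "N (s m + r m - (s n + r n)) < e" by (simp add: algebra_simps)
 qed
qed

lemma cauchy_mult:
 assumes "padic_cauchy p s" "padic_cauchy p r"
 shows "padic_cauchy p (%n. s n * r n)"
 unfolding padic_cauchy_def
proof (intro allI impI)
 fix e :: real assume e: "e > 0"
 obtain B where B: "B >= 1" "!!n. N (s n) <= B" using cauchy_bounded[OF assms(1)] by blast
 obtain C where C: "C >= 1" "!!n. N (r n) <= C" using cauchy_bounded[OF assms(2)] by blast
 have eC: "e / C > 0" "e / B > 0" using e B C by simp_all
 obtain M where M: "!!m n. m >= M ==> n >= M ==> N (s m - s n) < e / C" using assms(1) eC unfolding padic_cauchy_def by blast
 obtain K where K: "!!m n. m >= K ==> n >= K ==> N (r m - r n) < e / B" using assms(2) eC unfolding padic_cauchy_def by blast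
 show "\<exists>M. \<forall>m\<ge>M. \<forall>n\<ge>M. N (s m * r m - s n * r n) < e"
 proof (intro exI[of _ "max M K"] allI impI)
  fix m n assume mn: "m >= max M K" "n >= max M K"
  have "N (s m * (r m - r n)) <= B * N (r m - r n)" unfolding N_mult using B by (intro mult_right_mono) auto
  also have "... < e" using K[of m n] mn B(1) by (simp add: pos_less_divide_eq mult.commute)
  finally have 1: "N (s m * (r m - r n)) < e" .
  have "N (r n * (s m - s n)) <= C * N (s m - s n)" unfolding N_mult using C by (intro mult_right_mono) auto
  also have "... < e" using M[of m n] mn C(1) by (simp add: pos_less_divide_eq mult.commute)
  finally have "N (s m * (r m - r n) + r n * (s m - s n)) < e" by (intro N_add_less 1)
  then show "N (s m * r m - s n * r n) < e" by (simp add: algebra_simps)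
 qed
qed

lemma cauchy_inverse:
 assumes "padic_cauchy p r" "~ padic_null p r"
 shows "padic_cauchy p (%n. 1 / r n)"
 unfolding padic_cauchy_def
proof (intro allI impI)
 fix e :: real assume e: "e > 0"
 obtain \<eta> K where \<eta>: "\<eta> > 0" and K: "!!n. n >= K ==> N (r n) >= \<eta>" using cauchy_nonnull[OF assms] by blast
 have "e * (\<eta> * \<eta>) > 0" using e \<eta> by simp
 then obtain M where M: "!!m n. m >= M ==> n >= M ==> N (r m - r n) < e * (\<eta> * \<eta>)" using assms(1) unfolding padic_cauchy_def by blast
 show "\<exists>M. \<forall>m\<ge>M. \<forall>n\<ge>M. N (1 / r m - 1 / r n) < e"
 proof (intro exI[of _ "max M K"] allI impI)
  fix m n assume mn: "m >= max M K" "n >= max M K"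
  have nz: "r m ~= 0" "r n ~= 0" using K[of m] K[of n] mn \<eta> by auto
  have "1 / r m - 1 / r n = (r n - r m) / (r m * r n)" using nz by (simp add: field_simps)
  then have "N (1 / r m - 1 / r n) = N (r n - r m) / (N (r m) * N (r n))" by (simp add: N_divide N_mult)
  also have "... <= N (r n - r m) / (\<eta> * \<eta>)"
   using K[of m] K[of n] mn \<eta> by (intro divide_left_mono mult_mono) auto
  also have "... < e" using M[of n m] mn \<eta> by (simp add: pos_divide_less_eq)
  finally show "N (1 / r m - 1 / r n) < e" .
 qed
qed

lemma cauchy_divide:
 assumes "padic_cauchy p s" "padic_cauchy p r" "~ padic_null p r"
 shows "padic_cauchy p (%n. s n / r n)"
 using cauchy_mult[OF assms(1) cauchy_inverse[OF assms(2,3)]] by simp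

subsection \<open>Normalised coordinates on the projective line\<close>

text \<open>On normalised coordinates \<open>N (cr v u)\<close> is the chordal distance of two
  points of the projective line.\<close>

definition cr :: "rat \<times> rat => rat \<times> rat => rat" where
 "cr v u = fst v * snd u - fst u * snd v"

definition vn :: "rat \<times> rat => real" where
 "vn v = max (N (fst v)) (N (snd v))"

text \<open>Homogeneous coordinates of norm 1, chosen separately for each term of the sequence. The
  chart may change with n, so these need not converge, but their cross products behave well.\<close>

definition can :: "(nat => rat) option => nat => rat \<times> rat" where
 "can P n = (case P of None => (1, 0) | Some s => if N (s n) <= 1 then (s n, 1) else (1, 1 / s n))"

lemma vn_can [simp]: "vn (can P n) = 1"
 by (auto simp: can_def vn_def N_divide split: option.split)

lemma can_Some:
 obtains k where "can (Some s) n = (s n / k, 1 / k)" "k ~= 0" "N k >= 1" "N k <= max 1 (N (s n))"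
proof (cases "N (s n) <= 1")
 case True
 then show thesis using that[of 1] by (simp add: can_def)
next
 case False
 then have "s n ~= 0" by auto
 then show thesis using that[of "s n"] False by (simp add: can_def)
qed

text \<open>The ultrametric inequality for the chordal distance. The identities express a coordinate
  of w times \<open>cr v u\<close> by the other two cross products, and some coordinate of w is a
  unit.\<close>

lemma cr_triangle:
 assumes "vn w = 1" "vn v <= 1" "vn u <= 1"
 shows "N (cr v u) <= max (N (cr v w)) (N (cr w u))"
proof -
 have id: "fst w * cr v u = fst v * cr w u + fst u * cr v w" "snd w * cr v u = snd v * cr w u + snd u * cr v w"
  by (simp_all add: cr_def algebra_simps)
 have b: "N (fst v) <= 1" "N (snd v) <= 1" "N (fst u) <= 1" "N (snd u) <= 1" using assms by (simp_all add: vn_def)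
 have r: "N (x * cr w u + y * cr v w) <= max (N (cr v w)) (N (cr w u))" if "N x <= 1" "N y <= 1" for x y
  by (rule N_add_le; rule N_mult_le[OF that(1)] N_mult_le[OF that(2)]) simp_all
 have "N (fst w) = 1 \<or> N (snd w) = 1" using assms(1) by (auto simp: vn_def max_def split: if_splits)
 then show ?thesis
 proof
  assume "N (fst w) = 1"
  then have "N (cr v u) = N (fst v * cr w u + fst u * cr v w)" by (simp flip: id add: N_mult)
  then show ?thesis using r[OF b(1,3)] by simp
 next
  assume "N (snd w) = 1"
  then have "N (cr v u) = N (snd v * cr w u + snd u * cr v w)" by (simp flip: id add: N_mult)
  then show ?thesis using r[OF b(2,4)] by simp
 qed
qed

lemma cr_commute: "N (cr v u) = N (cr u v)"
 unfolding cr_def by (subst N_minus_commute) simp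

text \<open>Cauchy sequences are bounded, so on finite points the chordal distance agrees with the
  affine one up to constants, and it stays away from 0 between a finite point and infinity.\<close>

lemma Qp_P1_eq_iff:
 assumes P: "Qp_P1 p P" and Q: "Qp_P1 p Q"
 shows "Qp_P1_eq p P Q \<longleftrightarrow> padic_null p (%n. cr (can P n) (can Q n))"
proof -
 have inf: "~ padic_null p (%n. cr (1, 0) (can (Some s) n))" if s: "padic_cauchy p s" for s
 proof
  assume null: "padic_null p (%n. cr (1, 0) (can (Some s) n))"
  obtain B where B: "B >= 1" "!!n. N (s n) <= B" using cauchy_bounded[OF s] by blast
  have "1 / B > 0" using B by simp
  then obtain n where n: "N (cr (1, 0) (can (Some s) n)) < 1 / B" using null unfolding padic_null_def by blast
  obtain k where k: "can (Some s) n = (s n / k, 1 / k)" "k ~= 0" "N k >= 1" "N k <= max 1 (N (s n))" by (rule can_Some)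
  have "N k <= B" using k(4) B(1) B(2)[of n] by simp
  then have "1 / B <= 1 / N k" using k(3) by (intro divide_left_mono) auto
  then show False using n by (simp add: k(1) cr_def N_divide)
 qed
 show ?thesis
 proof (cases P)
  case None
  then have cP: "can P = (%n. (1, 0))" by (simp add: can_def fun_eq_iff)
  show ?thesis
  proof (cases Q)
   case None
   then show ?thesis using \<open>P = None\<close> by (simp add: Qp_P1_eq_def can_def cr_def)
  next
   case (Some s)
   then show ?thesis using inf[of s] Q \<open>P = None\<close> unfolding cP by (simp add: Qp_P1_eq_def Qp_P1_def)
  qed
 next
  case (Some s)
  then have s: "padic_cauchy p s" using P by (simp add: Qp_P1_def)
  show ?thesis
  proof (cases Q)
   case None
   then have cQ: "can Q = (%n. (1, 0))" by (simp add: can_def fun_eq_iff)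
   have "~ padic_null p (%n. cr (can (Some s) n) (1, 0))"
    using inf[OF s] null_mono[of "%n. cr (can (Some s) n) (1, 0)" "%n. cr (1, 0) (can (Some s) n)"] cr_commute by (metis order_refl)
   then show ?thesis using None \<open>P = Some s\<close> unfolding cQ by (simp add: Qp_P1_eq_def)
  next
   case (Some r)
   then have r: "padic_cauchy p r" using Q by (simp add: Qp_P1_def)
   obtain B where B: "B >= 1" "!!n. N (s n) <= B" using cauchy_bounded[OF s] by blast
   obtain C where C: "C >= 1" "!!n. N (r n) <= C" using cauchy_bounded[OF r] by blast
   have bd: "N (cr (can (Some s) n) (can (Some r) n)) <= N (s n - r n)
     & N (s n - r n) <= (B * C) * N (cr (can (Some s) n) (can (Some r) n))" for n
   proof -
    obtain k where k: "can (Some s) n = (s n / k, 1 / k)" "k ~= 0" "N k >= 1" "N k <= max 1 (N (s n))" by (rule can_Some)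
    obtain j where j: "can (Some r) n = (r n / j, 1 / j)" "j ~= 0" "N j >= 1" "N j <= max 1 (N (r n))" by (rule can_Some)
    have e: "s n - r n = (k * j) * cr (can (Some s) n) (can (Some r) n)" using k(2) j(2) by (simp add: k(1) j(1) cr_def field_simps)
    have kj: "N k * N j >= 1" using mult_mono[of 1 "N k" 1 "N j"] k(3) j(3) by simp
    have "N k <= B" by (rule order_trans[OF k(4)]) (use B in simp)
    moreover have "N j <= C" by (rule order_trans[OF j(4)]) (use C in simp)
    ultimately have KB: "N k * N j <= B * C" using k j B C by (intro mult_mono) auto
    show ?thesis unfolding e N_mult
     using mult_right_mono[OF kj, of "N (cr (can (Some s) n) (can (Some r) n))"]
      mult_right_mono[OF KB, of "N (cr (can (Some s) n) (can (Some r) n))"] by simp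
   qed
   have "B * C > 0" using B C by simp
   then have "padic_null p (%n. s n - r n)" if "padic_null p (%n. cr (can (Some s) n) (can (Some r) n))"
    by (rule null_bounded[OF that]) (use bd in blast)
   moreover have "padic_null p (%n. cr (can (Some s) n) (can (Some r) n))" if "padic_null p (%n. s n - r n)"
    by (rule null_mono[OF that]) (use bd in blast)
   ultimately have "padic_null p (%n. s n - r n) \<longleftrightarrow> padic_null p (%n. cr (can (Some s) n) (can (Some r) n))" by blast
   then show ?thesis using Some \<open>P = Some s\<close> by (simp add: Qp_P1_eq_def)
  qed
 qed
qed

lemma cr_can_quotient:
 assumes "padic_cauchy p y" "~ padic_null p y"
 shows "padic_null p (%n. cr (can (Some (%n. x n / y n)) n) (x n / k n, y n / k n))"
proof -
 obtain e M where e: "e > 0" and M: "!!n. n >= M ==> N (y n) >= e" using cauchy_nonnull[OF assms] by blast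
 show ?thesis
 proof (rule null_eventually_mono[OF null_zero])
  fix n assume "n >= M"
  then have y: "y n ~= 0" using M[of n] e by auto
  obtain j where j: "can (Some (%n. x n / y n)) n = (x n / y n / j, 1 / j)" using can_Some[of "%n. x n / y n" n] by blast
  show "N (cr (can (Some (%n. x n / y n)) n) (x n / k n, y n / k n)) <= N 0"
   unfolding j cr_def using y by simp
 qed
qed

lemma exists_point:
 assumes X: "padic_cauchy p x" and Y: "padic_cauchy p y"
 obtains P where "Qp_P1 p P" "padic_null p (%n. cr (can P n) (x n, y n))"
proof (cases "padic_null p y")
 case True
 then show thesis using that[of None] by (simp add: Qp_P1_def can_def cr_def)
next
 case False
 then show thesis using that[of "Some (%n. x n / y n)"] cauchy_divide[OF X Y] cr_can_quotient[OF Y False, of x "%_. 1"]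
  by (simp add: Qp_P1_def)
qed

end

subsection \<open>Dynamics at a prime of good reduction\<close>

text \<open>Good reduction: the map and the coordinate change are p-integral, and the determinant
  and the constants of the normal form are units.\<close>

locale good_prime = quad_map f g + padic p for f g p +
 fixes a b c d l t :: rat
 assumes nf: "normal_form f g a b c d l t"
  and int_coeff: "!!i. N (cf f i) <= 1" "!!i. N (cf g i) <= 1"
  and int_T: "N a <= 1" "N b <= 1" "N c <= 1" "N d <= 1"
  and unit_T: "N (a * d - b * c) = 1" and unit_l: "N l = 1" and unit_t: "N t = 1"
begin

definition \<Phi> :: "rat \<times> rat => rat \<times> rat" where
 "\<Phi> v = (hq f (fst v) (snd v), hq g (fst v) (snd v))"

definition T :: "rat \<times> rat => rat \<times> rat" where
 "T v = (a * fst v + b * snd v, c * fst v + d * snd v)"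

lemma cr_T: "N (cr (T v) (T u)) = N (cr v u)"
proof -
 have "cr (T v) (T u) = (a * d - b * c) * cr v u" by (simp add: cr_def T_def algebra_simps)
 then show ?thesis by (simp add: N_mult unit_T)
qed

lemma vn_T: "vn (T v) = vn v"
proof -
 have 1: "vn (T v) <= vn v"
  using int_T by (auto simp: vn_def T_def intro!: N_add_le N_mult_le)
 have "(a * d - b * c) * fst v = d * fst (T v) - b * snd (T v)" "(a * d - b * c) * snd v = a * snd (T v) - c * fst (T v)"
  by (simp_all add: T_def algebra_simps)
 then have "N (fst v) = N (d * fst (T v) - b * snd (T v))" "N (snd v) = N (a * snd (T v) - c * fst (T v))"
  using N_mult[of "a * d - b * c"] unit_T by (metis mult_1)+
 then have "vn v <= vn (T v)" unfolding vn_def[of v]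
  using int_T by (auto simp: vn_def intro!: N_diff_le N_mult_le)
 then show ?thesis using 1 by simp
qed

lemma T_\<Phi>: "T (\<Phi> v) = (l * (t * (snd (T v))\<^sup>2), l * ((fst (T v))\<^sup>2 + fst (T v) * snd (T v)))"
 using normal_form_act[OF nf, of "fst v" "snd v"] by (simp add: T_def \<Phi>_def)

lemma vn_\<Phi>:
 assumes "vn v = 1"
 shows "vn (\<Phi> v) = 1"
proof -
 define U where "U = fst (T v)" define V where "V = snd (T v)"
 have m: "max (N U) (N V) = 1" using vn_T[of v] assms by (simp add: vn_def U_def V_def)
 have "max (N (V\<^sup>2)) (N (U\<^sup>2 + U * V)) = 1"
 proof (cases "N V = 1")
  case True
  then have "N U <= 1" using m by simp
  then have "N (U\<^sup>2 + U * V) <= 1" using True by (intro N_add_le) (simp_all add: N_power N_mult power_le_one)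
  then show ?thesis using True by (simp add: N_power)
 next
  case False
  then have UV: "N U = 1" "N V < 1" using m by (auto simp: max_def split: if_splits)
  then have "N (U\<^sup>2 + U * V) = 1" by (intro N_unit_add) (simp_all add: N_power N_mult)
  then show ?thesis using UV by (simp add: N_power power_le_one)
 qed
 then have "vn (T (\<Phi> v)) = 1" unfolding T_\<Phi> by (simp add: vn_def N_mult unit_l unit_t U_def V_def)
 then show ?thesis by (simp add: vn_T)
qed

lemma vn_\<Phi>_iter: "vn v = 1 ==> vn ((\<Phi> ^^ k) v) = 1"
 by (induction k) (simp_all add: vn_\<Phi>)

text \<open>The cross product of the images is that of the arguments times an integral cofactor, so
  the map does not increase chordal distances.\<close>

lemma cr_\<Phi>:
 assumes "vn v <= 1" "vn u <= 1"
 shows "N (cr (\<Phi> v) (\<Phi> u)) <= N (cr v u)"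
proof -
 let ?f = "cf f" and ?g = "cf g"
 define K where "K = (?f 2 * ?g 1 - ?f 1 * ?g 2) * (fst v * fst u) + (?f 2 * ?g 0 - ?f 0 * ?g 2) * (fst v * snd u + fst u * snd v)
   + (?f 1 * ?g 0 - ?f 0 * ?g 1) * (snd v * snd u)"
 have "cr (\<Phi> v) (\<Phi> u) = K * cr v u"
  by (simp add: K_def cr_def \<Phi>_def hq_def ring2)
 moreover have "N K <= 1" unfolding K_def using int_coeff assms by (intro N_int) (auto simp: vn_def)
 ultimately show ?thesis using N_mult_le[of K "cr v u"] by simp
qed

lemma rf_act_Qp_point:
 assumes "Qp_P1 p P"
 shows "Qp_P1 p (rf_act_Qp p f g P)" "padic_null p (%n. cr (can (rf_act_Qp p f g P) n) (\<Phi> (can P n)))"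
proof -
 have "Qp_P1 p (rf_act_Qp p f g P) & padic_null p (%n. cr (can (rf_act_Qp p f g P) n) (\<Phi> (can P n)))"
 proof (cases P)
  case None
  have cP: "\<Phi> (can P n) = (cf f 2, cf g 2)" for n
   using None by (simp add: can_def \<Phi>_def hq_def)
  show ?thesis
  proof (cases "degree g < degree f")
   case True
   then have "cf g 2 = 0" using degs(1) by (simp add: coeff_eq_0)
   then show ?thesis unfolding cP using True None by (simp add: rf_act_Qp_def Qp_P1_def can_def cr_def)
  next
   case False
   then have g2: "degree g = 2" using degs(1,2,3) deg by (simp add: rat_fun_deg_def)
   then have g0: "cf g 2 ~= 0" using degs(5) by (metis leading_coeff_0_iff)
   have r: "rf_act_Qp p f g P = Some (%n. cf f 2 / cf g 2)"
    using None False by (simp add: rf_act_Qp_def g2)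
   have "~ padic_null p (%_. cf g 2)" using N_pos[OF g0] by (auto simp: padic_null_def)
   then have "padic_null p (%n. cr (can (rf_act_Qp p f g P) n) (\<Phi> (can P n)))"
    unfolding cP r using cr_can_quotient[of "%_. cf g 2" "%_. cf f 2" "%_. 1"] by simp
   then show ?thesis unfolding r by (simp add: Qp_P1_def)
  qed
 next
  case (Some s)
  then have s: "padic_cauchy p s" using assms by (simp add: Qp_P1_def)
  have "\<exists>k. k ~= 0 & N k >= 1 & can P n = (s n / k, 1 / k)" for n
   unfolding Some using can_Some[of s n] by metis
  then obtain k where k: "!!n. k n ~= 0" "!!n. N (k n) >= 1" "!!n. can P n = (s n / k n, 1 / k n)" by metis
  have ev2: "poly h x = cf h 2 * (x * x) + cf h 1 * x + cf h 0" if "degree h <= 2" for h :: "rat poly" and x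
   using poly_degree_2[OF that, of x] by (simp add: power2_eq_square)
  have cF: "padic_cauchy p (%n. poly f (s n))" and cG: "padic_cauchy p (%n. poly g (s n))"
   unfolding ev2[OF degs(1)] ev2[OF degs(2)] by (intro cauchy_add cauchy_mult cauchy_const s)+
  have \<Phi>k: "\<Phi> (can P n) = (poly f (s n) / (k n * k n), poly g (s n) / (k n * k n))" for n
   unfolding ev2[OF degs(1)] ev2[OF degs(2)] using k(1)[of n] by (simp add: \<Phi>_def k(3) hq_def power2_eq_square add_divide_distrib)
  show ?thesis
  proof (cases "padic_null p (%n. poly g (s n))")
   case True
   then have r: "rf_act_Qp p f g P = None" using Some by (simp add: rf_act_Qp_def)
   have le: "N (cr (can None n) (\<Phi> (can P n))) <= N (poly g (s n))" for n
   proof -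
    have "N (k n) * N (k n) >= 1" using mult_mono[of 1 "N (k n)" 1 "N (k n)"] k(2)[of n] by simp
    moreover have "N (cr (can None n) (\<Phi> (can P n))) = N (poly g (s n)) / (N (k n) * N (k n))"
     unfolding \<Phi>k by (simp add: can_def cr_def N_divide N_mult)
    ultimately show ?thesis using divide_left_mono[of 1 "N (k n) * N (k n)" "N (poly g (s n))"] by simp
   qed
   have "padic_null p (%n. cr (can None n) (\<Phi> (can P n)))" by (rule null_mono[OF True le])
   then show ?thesis unfolding r by (simp add: Qp_P1_def)
  next
   case False
   then have r: "rf_act_Qp p f g P = Some (%n. poly f (s n) / poly g (s n))" using Some by (simp add: rf_act_Qp_def)
   show ?thesis unfolding r \<Phi>k
    using cauchy_divide[OF cF cG False] cr_can_quotient[OF cG False] by (simp add: Qp_P1_def)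
  qed
 qed
 then show "Qp_P1 p (rf_act_Qp p f g P)" "padic_null p (%n. cr (can (rf_act_Qp p f g P) n) (\<Phi> (can P n)))" by blast+
qed

text \<open>The action on sequences and \<open>\<Phi>\<close> on normalised coordinates differ by
  null sequences; since \<open>\<Phi>\<close> does not increase distances, these errors do not grow
  under iteration.\<close>

lemma rf_act_Qp_iter:
 assumes "Qp_P1 p P"
 shows "Qp_P1 p ((rf_act_Qp p f g ^^ k) P) & padic_null p (%n. cr (can ((rf_act_Qp p f g ^^ k) P) n) ((\<Phi> ^^ k) (can P n)))"
proof (induction k)
 case 0
 have "cr v v = 0" for v by (simp add: cr_def)
 then show ?case using assms by simp
next
 case (Suc k)
 let ?Q = "(rf_act_Qp p f g ^^ k) P"
 have Q: "Qp_P1 p ?Q" and nQ: "padic_null p (%n. cr (can ?Q n) ((\<Phi> ^^ k) (can P n)))" using Suc by auto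
 have "padic_null p (%n. cr (can (rf_act_Qp p f g ?Q) n) (\<Phi> ((\<Phi> ^^ k) (can P n))))"
 proof (rule null_max[OF rf_act_Qp_point(2)[OF Q] nQ])
  fix n
  have "N (cr (can (rf_act_Qp p f g ?Q) n) (\<Phi> ((\<Phi> ^^ k) (can P n))))
   <= max (N (cr (can (rf_act_Qp p f g ?Q) n) (\<Phi> (can ?Q n)))) (N (cr (\<Phi> (can ?Q n)) (\<Phi> ((\<Phi> ^^ k) (can P n)))))"
   by (intro cr_triangle) (simp_all add: vn_\<Phi> vn_\<Phi>_iter)
  moreover have "N (cr (\<Phi> (can ?Q n)) (\<Phi> ((\<Phi> ^^ k) (can P n)))) <= N (cr (can ?Q n) ((\<Phi> ^^ k) (can P n)))"
   by (intro cr_\<Phi>) (simp_all add: vn_\<Phi>_iter)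
  ultimately show "N (cr (can (rf_act_Qp p f g ?Q) n) (\<Phi> ((\<Phi> ^^ k) (can P n))))
   <= max (N (cr (can (rf_act_Qp p f g ?Q) n) (\<Phi> (can ?Q n)))) (N (cr (can ?Q n) ((\<Phi> ^^ k) (can P n))))" by linarith
 qed
 then show ?case using rf_act_Qp_point(1)[OF Q] by simp
qed

lemma iterate_eq_iff:
 assumes P: "Qp_P1 p P"
 shows "Qp_P1_eq p ((rf_act_Qp p f g ^^ k) P) P \<longleftrightarrow> padic_null p (%n. cr ((\<Phi> ^^ k) (can P n)) (can P n))"
proof -
 let ?Q = "(rf_act_Qp p f g ^^ k) P"
 have Q: "Qp_P1 p ?Q" and nQ: "padic_null p (%n. cr (can ?Q n) ((\<Phi> ^^ k) (can P n)))" using rf_act_Qp_iter[OF P] by auto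
 have nQ': "padic_null p (%n. cr ((\<Phi> ^^ k) (can P n)) (can ?Q n))"
  by (rule null_mono[OF nQ]) (simp add: cr_commute)
 show ?thesis unfolding Qp_P1_eq_iff[OF Q P]
 proof
  assume "padic_null p (%n. cr (can ?Q n) (can P n))"
  then show "padic_null p (%n. cr ((\<Phi> ^^ k) (can P n)) (can P n))"
   by (rule null_max[OF nQ']) (intro cr_triangle, simp_all add: vn_\<Phi>_iter)
 next
  assume "padic_null p (%n. cr ((\<Phi> ^^ k) (can P n)) (can P n))"
  then show "padic_null p (%n. cr (can ?Q n) (can P n))"
   by (rule null_max[OF nQ]) (intro cr_triangle, simp_all add: vn_\<Phi>_iter)
 qed
qed

lemma affine_step:
 assumes "N (snd (T v)) = 1" "N (snd (T (\<Phi> v))) = 1"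
 defines "x \<equiv> fst (T v) / snd (T v)"
 shows "(fst (T (\<Phi> v)) / snd (T (\<Phi> v))) * (x * x + x) = t"
proof -
 define U where "U = fst (T v)" define V where "V = snd (T v)"
 have V: "V ~= 0" using assms(1) by (auto simp: V_def)
 have st: "fst (T (\<Phi> v)) = l * (t * V\<^sup>2)" "snd (T (\<Phi> v)) = l * (U\<^sup>2 + U * V)" by (simp_all add: T_\<Phi> U_def V_def)
 have nz: "l * (U\<^sup>2 + U * V) ~= 0" using assms(2) unfolding st by auto
 have "x * x + x = (U\<^sup>2 + U * V) / V\<^sup>2" using V by (simp add: x_def U_def[symmetric] V_def[symmetric] field_simps power2_eq_square)
 then show ?thesis unfolding st using nz V by simp
qed

text \<open>Modulo p, infinity goes to 0 and 0 to infinity. Starting at one of them, three steps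
  lead to the other, so the orbit would not close up; an intermediate visit is excluded by following
  it to the third step.\<close>

lemma orbit_units:
 assumes v: "vn v = 1" and cyc: "N (cr ((\<Phi> ^^ 3) v) v) < 1"
 shows "k <= 3 ==> N (fst (T ((\<Phi> ^^ k) v))) = 1 & N (snd (T ((\<Phi> ^^ k) v))) = 1"
proof -
 define U where "U k = fst (T ((\<Phi> ^^ k) v))" for k
 define V where "V k = snd (T ((\<Phi> ^^ k) v))" for k
 have m: "N (U k) = 1 \<or> N (V k) = 1" "N (U k) <= 1" "N (V k) <= 1" for k
 proof -
  have "max (N (U k)) (N (V k)) = 1" using vn_T[of "(\<Phi> ^^ k) v"] vn_\<Phi>_iter[OF v, of k] by (simp add: vn_def U_def V_def)
  then show "N (U k) = 1 \<or> N (V k) = 1" "N (U k) <= 1" "N (V k) <= 1" by (auto simp: max_def split: if_splits)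
 qed
 have st: "U (Suc k) = l * (t * (V k)\<^sup>2)" "V (Suc k) = l * (U k * (U k + V k))" for k
  unfolding U_def V_def funpow.simps comp_def T_\<Phi> by (simp_all add: ring2)
 have NU: "N (U (Suc k)) = (N (V k))\<^sup>2" for k unfolding st by (simp add: N_mult N_power unit_l unit_t)
 have NV: "N (V (Suc k)) <= N (U k)" for k
  unfolding st using N_mult_le'[of "U k" "N (U k)" "U k + V k"] N_add_le[OF m(2) m(3), of k k] by (simp add: N_mult unit_l)
 have VU: "N (V k) < 1 ==> N (U (Suc k)) < 1" for k unfolding NU by (simp add: power_less_one_iff)
 have UV: "N (U k) < 1 ==> N (V (Suc k)) < 1" for k using NV[of k] by simp
 have cy: "N (U 3 * V 0 - U 0 * V 3) < 1"
  using cyc cr_T[of "(\<Phi> ^^ 3) v" v] by (simp add: cr_def U_def V_def)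
 have no: "~ (N (U 3 * V 0) = 1 & N (U 0 * V 3) < 1)" "~ (N (U 3 * V 0) < 1 & N (U 0 * V 3) = 1)"
 proof -
  show "~ (N (U 3 * V 0) = 1 & N (U 0 * V 3) < 1)"
  proof
   assume h: "N (U 3 * V 0) = 1 & N (U 0 * V 3) < 1"
   then have "N (U 3 * V 0 + - (U 0 * V 3)) = 1" by (intro N_unit_add) auto
   then show False using cy by simp
  qed
  show "~ (N (U 3 * V 0) < 1 & N (U 0 * V 3) = 1)"
  proof
   assume h: "N (U 3 * V 0) < 1 & N (U 0 * V 3) = 1"
   then have "N (- (U 0 * V 3) + U 3 * V 0) = 1" by (intro N_unit_add) auto
   then show False using cy by simp
  qed
 qed
 have s3: "U 3 = U (Suc (Suc (Suc 0)))" "V 3 = V (Suc (Suc (Suc 0)))" by (simp_all add: numeral_3_eq_3)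
 have one: "N x = 1 \<longleftrightarrow> ~ N x < 1" if "N x <= 1" for x using that by auto
 have V0: "N (V 0) = 1"
 proof (rule ccontr)
  assume "N (V 0) ~= 1"
  then have z: "N (V 0) < 1" using m(3)[of 0] by simp
  then have "N (U 3) < 1" unfolding s3 by (intro VU UV)
  then have "N (U 0) = 1" "N (V 3) = 1" using z m(1)[of 0] m(1)[of 3] by auto
  then show False using no(2) z m(2)[of 3] N_mult_less[of "U 3" "V 0" 1] by (simp add: N_mult)
 qed
 have U0: "N (U 0) = 1"
 proof (rule ccontr)
  assume "N (U 0) ~= 1"
  then have z: "N (U 0) < 1" using m(2)[of 0] by simp
  then have "N (V 3) < 1" unfolding s3 by (intro VU UV)
  then have "N (U 3) = 1" using m(1)[of 3] by auto
  then show False using no(1) V0 z m(3)[of 3] N_mult_less'[of "U 0" 1 "V 3"] by (simp add: N_mult)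
 qed
 have UV3: "N (U 3) = 1 & N (V 3) = 1"
 proof (rule ccontr)
  assume n: "~ ?thesis"
  then have "N (U 3) < 1 & N (V 3) = 1 \<or> N (U 3) = 1 & N (V 3) < 1" using m[of 3] by auto
  then show False using no U0 V0 by (auto simp: N_mult)
 qed
 have V2: "N (V (Suc (Suc 0))) = 1" using VU[of "Suc (Suc 0)"] UV3 m(3)[of "Suc (Suc 0)"] unfolding s3 by fastforce
 have U2: "N (U (Suc (Suc 0))) = 1" using UV[of "Suc (Suc 0)"] UV3 m(2)[of "Suc (Suc 0)"] unfolding s3 by fastforce
 have V1: "N (V (Suc 0)) = 1" using VU[of "Suc 0"] U2 m(3)[of "Suc 0"] by fastforce
 have U1: "N (U (Suc 0)) = 1" unfolding NU by (simp add: V0)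
 assume "k <= 3"
 then have "k = 0 \<or> k = Suc 0 \<or> k = Suc (Suc 0) \<or> k = 3" by auto
 then show ?thesis using U0 V0 U1 V1 U2 V2 UV3 unfolding U_def V_def by blast
qed

end

subsection \<open>Three-periodic points over the p-adic numbers\<close>

lemma jroots_nonemptyI:
 assumes p: "prime p" and w: "int p dvd w * w + w + 1" and r: "int p dvd r ^ 3 - ev w \<mu>"
 shows "jroots \<mu> p ~= {}"
proof -
 have p0: "int p > 0" using p prime_gt_0_nat by simp
 define u where "u = w mod int p"
 define s where "s = r mod int p"
 have u: "[u = w] (mod int p)" and s: "[s = r] (mod int p)" by (simp_all add: u_def s_def cong_def)
 have "[u * u + u + 1 = w * w + w + 1] (mod int p)" using u by (intro cong_add cong_mult cong_refl)
 then have 1: "int p dvd u * u + u + 1" using w cong_dvd_iff by blast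
 have "[s ^ 3 - ev u \<mu> = r ^ 3 - ev w \<mu>] (mod int p)" using s ev_cong[OF u] by (intro cong_diff cong_pow)
 then have 2: "int p dvd s ^ 3 - ev u \<mu>" using r cong_dvd_iff by blast
 have "(u, s) \<in> jroots \<mu> p" using 1 2 p0 by (simp add: jroots_def wroots_def u_def s_def)
 then show ?thesis by blast
qed

text \<open>The completed cube as an explicit combination of the three relations, with y = w x - 1
  and t = m / e cleared of denominators; it can therefore be reduced modulo any P.\<close>

lemma cube_root_of_cycle_mod:
 fixes w x y e m :: int
 assumes w: "P dvd w * w + w + 1" and y: "P dvd w * x - (y + 1)" and t: "P dvd e * (y * (x * x + x)) - m"
 shows "P dvd (e * (3 * x + 2 + w)) ^ 3 - ev w (kap m e)"
proof -
 have "(e * (3 * x + 2 + w)) ^ 3 - ev w (kap m e) =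
   (w * w + w + 1) * (e ^ 3 * (27 * (x * x * x) + 27 * (x * x) + 9 * x + w + 5))
   + (w * x - (y + 1)) * (e\<^sup>2 * (- 1 - w) * 27 * (e * (x * x + x))) + (e * (y * (x * x + x)) - m) * (e\<^sup>2 * (- 1 - w) * 27)"
  by (simp add: ev_def kap_sel ring23)
 then show ?thesis using dvd_add[OF dvd_add[OF dvd_mult2[OF w] dvd_mult2[OF y]] dvd_mult2[OF t]] by (simp only:)
qed

context padic
begin

lemma quotient_diff:
 assumes "N v = 1" "N v' = 1"
 shows "N (u / v - u' / v') = N (cr (u, v) (u', v'))"
proof -
 have "v ~= 0" "v' ~= 0" using assms by auto
 then have "u / v - u' / v' = cr (u, v) (u', v') / (v * v')" by (simp add: cr_def field_simps)
 then show ?thesis using assms by (simp add: N_divide N_mult)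
qed

text \<open>The relation w^2 + w + 1 = 0 for w = (z - y) / (y - x) survives up to the error made in closing the cycle.\<close>
lemma approximate_three_cycle:
 assumes units: "N x = 1" "N y = 1" "N z = 1" "N x' = 1"
  and cyc: "y * (x * x + x) = t" "z * (y * y + y) = t" "x' * (z * z + z) = t"
  and \<eta>: "\<eta> > 0" "N (y - x) >= \<eta>" "N (x' - x) < \<eta> * \<eta>"
 obtains w where "N w <= 1" "N (w * w + w + 1) < 1" "N (w * x - (y + 1)) < 1"
proof -
 have nz: "x ~= 0" "y ~= 0" "z ~= 0" "x' ~= 0" using units by auto
 have d0: "y - x ~= 0" using \<eta> by auto
 define E1 where "E1 = x * x + x - z * (y + 1)"
 define E2 where "E2 = y * y + y - x * (z + 1)"
 define E3 where "E3 = z * z + z - y * (x + 1)"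
 have "y * E1 = 0" using cyc(1,2) by (simp add: E1_def algebra_simps)
 then have E1: "E1 = 0" using nz by simp
 have "z * (E2 - (x' - x) * (z + 1)) = 0" using cyc(2,3) by (simp add: E2_def algebra_simps)
 then have E2: "E2 = (x' - x) * (z + 1)" using nz by simp
 have E3: "x * E3 = - ((x' - x) * (z * z + z))" using cyc(1,3) by (simp add: E3_def algebra_simps)
 have "N E2 <= N (x' - x)" unfolding E2 using units by (intro N_mult_le' N_add_le) auto
 moreover have "N E3 <= N (x' - x)"
 proof -
  have "N E3 = N (x * E3)" using units by (simp add: N_mult)
  also have "... <= N (x' - x)" unfolding E3 N_uminus using units by (intro N_mult_le' N_add_le) (auto simp: N_mult)
  finally show ?thesis .
 qed
 ultimately have small: "N (E1 + E2 + E3) < \<eta> * \<eta>" unfolding E1 using \<eta>(3) mult_pos_pos[OF \<eta>(1) \<eta>(1)] by (intro N_add_less) auto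
 define w where "w = (z - y) / (y - x)"
 have wz: "w * (y - x) = z - y" using d0 by (simp add: w_def)
 have "(w * w + w + 1) * ((y - x) * (y - x)) = (w * (y - x)) * (w * (y - x)) + (w * (y - x)) * (y - x) + (y - x) * (y - x)"
  by (simp add: algebra_simps)
 also have "... = E1 + E2 + E3" unfolding wz by (simp add: E1_def E2_def E3_def algebra_simps)
 \<comment> \<open>Dividing by (y - x)^2 costs two factors of size \<eta>; this is the reason for
   demanding a closing error below \<eta>^2.\<close>
 finally have "N (w * w + w + 1) * (N (y - x) * N (y - x)) < \<eta> * \<eta>" using small by (simp flip: N_mult)
 also have "\<eta> * \<eta> <= N (y - x) * N (y - x)" using \<eta> by (intro mult_mono) auto
 finally have "N (w * w + w + 1) * (N (y - x) * N (y - x)) < 1 * (N (y - x) * N (y - x))" by simp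
 then have W: "N (w * w + w + 1) < 1" by (rule mult_right_less_imp_less) simp
 \<comment> \<open>Integrality of an approximate root of a monic polynomial: for |w| > 1 the term
   w^2 would dominate.\<close>
 have w1: "N w <= 1"
 proof (rule ccontr)
  assume n: "~ N w <= 1"
  have "N ((w * w + w + 1) - (w + 1)) <= N w"
   by (rule N_diff_le) (use W n N_add_le[of w "N w" 1] in auto)
  moreover have "(w * w + w + 1) - (w + 1) = w * w" by simp
  ultimately have "N w * N w <= 1 * N w" by (simp only: N_mult mult_1)
  moreover have "1 * N w < N w * N w" using n by (intro mult_strict_right_mono) auto
  ultimately show False by linarith
 qed
 have "(y - x) * (x + (1 + w) * (y + 1)) = (y - x) * (x + y + 1) + (w * (y - x)) * (y + 1)" by (simp add: algebra_simps)
 also have "... = - E1" unfolding wz by (simp add: E1_def algebra_simps)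
 finally have q: "x + (1 + w) * (y + 1) = 0" using E1 d0 by simp
 have "w * x - (y + 1) = w * (x + (1 + w) * (y + 1)) - (w * w + w + 1) * (y + 1)" by (simp add: algebra_simps)
 then have "N (w * x - (y + 1)) = N ((w * w + w + 1) * (y + 1))" unfolding q by simp
 also have "... < 1" using W units by (intro N_mult_less' N_add_le) auto
 finally show thesis using that w1 W by blast
qed

lemma cauchy_int:
 assumes "!!n. [s (Suc n) = s n] (mod int p ^ Suc n)"
 shows "padic_cauchy p (%n. of_int (s n))"
proof -
 have st: "N (of_int (s (n + k)) - of_int (s n)) <= (1 / real p) ^ Suc n" for n k
 proof (induction k)
  case (Suc k)
  have "int p ^ Suc (n + k) dvd s (Suc (n + k)) - s (n + k)" using assms[of "n + k"] by (simp only: cong_iff_dvd_diff)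
  then have "N (of_int (s (Suc (n + k)) - s (n + k))) <= (1 / real p) ^ Suc (n + k)" by (rule N_of_int_power_dvd)
  also have "... <= (1 / real p) ^ Suc n" using p_gt_1 by (intro power_decreasing) auto
  finally have "N ((of_int (s (Suc (n + k))) - of_int (s (n + k))) + (of_int (s (n + k)) - of_int (s n))) <= (1 / real p) ^ Suc n"
   using Suc by (intro N_add_le) simp_all
  then show ?case by simp
 qed simp
 show ?thesis unfolding padic_cauchy_def
 proof (intro allI impI)
  fix e :: real assume e: "e > 0"
  obtain M where M: "(1 / real p) ^ M < e" using real_arch_pow_inv[of e "1 / real p"] e p_gt_1 by auto
  have S: "(1 / real p) ^ Suc M < e"
  proof -
   have "(1 / real p) ^ Suc M <= (1 / real p) ^ M" using p_gt_1 by (intro power_decreasing) auto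
   then show ?thesis using M by linarith
  qed
  have le: "N (of_int (s n) - of_int (s M)) < e" if "n >= M" for n
   using st[of M "n - M"] that S by simp
  show "\<exists>M. \<forall>m\<ge>M. \<forall>n\<ge>M. N (of_int (s m) - of_int (s n)) < e"
  proof (intro exI[of _ M] allI impI)
   fix m n assume "m >= M" "n >= M"
   then have "N ((of_int (s m) - of_int (s M)) - (of_int (s n) - of_int (s M))) < e" by (intro N_diff_less le)
   then show "N (of_int (s m) - of_int (s n)) < e" by simp
  qed
 qed
qed

end

text \<open>The pair is lifted by dependent choice, first w and then r, because the radicand
  \<open>ev w \<mu>\<close> moves with w.\<close>

lemma hensel_cube_roots:
 assumes p: "prime p" "p ~= 3" and \<mu>: "~ int p dvd enorm \<mu>" and j: "jroots \<mu> p ~= {}"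
 obtains w r :: "nat => int" where "!!n. int p ^ Suc n dvd w n * w n + w n + 1" "!!n. int p ^ Suc n dvd r n ^ 3 - ev (w n) \<mu>"
  "!!n. [w (Suc n) = w n] (mod int p ^ Suc n)" "!!n. [r (Suc n) = r n] (mod int p ^ Suc n)"
proof -
 define A where "A n s \<longleftrightarrow> int p ^ Suc n dvd fst s * fst s + fst s + 1 & int p ^ Suc n dvd snd s ^ 3 - ev (fst s) \<mu>" for n and s :: "int \<times> int"
 define B where "B n s s' \<longleftrightarrow> [fst s' = fst s] (mod int p ^ Suc n) & [snd s' = snd s] (mod int p ^ Suc n)" for n and s s' :: "int \<times> int"
 have "\<exists>s. \<forall>n. A n (s n) & B n (s n) (s (Suc n))"
 proof (rule dependent_nat_choice)
  obtain s where "s \<in> jroots \<mu> p" using j by blast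
  then have "A 0 s" by (auto simp: A_def jroots_def wroots_def)
  then show "\<exists>s. A 0 s" by blast
 next
  fix s n assume A: "A n s"
  obtain w r where s: "s = (w, r)" by (cases s)
  have w: "int p ^ Suc n dvd w * w + w + 1" and r: "int p ^ Suc n dvd r ^ 3 - ev w \<mu>" using A by (simp_all add: A_def s)
  obtain w' where w': "[w' = w] (mod int p ^ Suc n)" "int p ^ Suc (Suc n) dvd w' * w' + w' + 1"
   using cube_root_unity_lift[OF p _ w] by blast
  have "[r ^ 3 - ev w' \<mu> = r ^ 3 - ev w \<mu>] (mod int p ^ Suc n)" using ev_cong[OF w'(1)] by (intro cong_diff cong_refl)
  then have r1: "int p ^ Suc n dvd r ^ 3 - ev w' \<mu>" using r cong_dvd_iff by blast
  have "int p dvd w' * w' + w' + 1" by (rule dvd_trans[OF _ w'(2)]) simp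
  then have "~ int p dvd ev w' \<mu>" using ev_unit \<mu> by blast
  then obtain r' where "[r' = r] (mod int p ^ Suc n)" "int p ^ Suc (Suc n) dvd r' ^ 3 - ev w' \<mu>"
   using cube_root_lift[OF p _ r1] by blast
  then have "A (Suc n) (w', r') & B n s (w', r')" using w' by (simp add: A_def B_def s)
  then show "\<exists>s'. A (Suc n) s' & B n s s'" by blast
 qed
 then obtain s where "!!n. A n (s n)" "!!n. B n (s n) (s (Suc n))" by blast
 then show thesis using that[of "%n. fst (s n)" "%n. snd (s n)"] by (simp add: A_def B_def)
qed

context good_prime
begin

text \<open>Replacing the coordinates of P by any normalised sequence at null distance changes all
  closing distances by null sequences. This allows working with sequences that are not in canonical
  form.\<close>

lemma three_periodic_iff:
 assumes P: "Qp_P1 p P" and v: "!!n. vn (v n) = 1" and Pv: "padic_null p (%n. cr (can P n) (v n))"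
 shows "periodic_pt (Qp_P1_eq p) (rf_act_Qp p f g) 3 P \<longleftrightarrow> padic_null p (%n. cr ((\<Phi> ^^ 3) (v n)) (v n))
   & ~ padic_null p (%n. cr (\<Phi> (v n)) (v n)) & ~ padic_null p (%n. cr ((\<Phi> ^^ 2) (v n)) (v n))"
proof -
 have cr_iter: "N (cr ((\<Phi> ^^ k) x) ((\<Phi> ^^ k) y)) <= N (cr x y)" if "vn x = 1" "vn y = 1" for k x y
 proof (induction k)
  case (Suc k)
  have "N (cr (\<Phi> ((\<Phi> ^^ k) x)) (\<Phi> ((\<Phi> ^^ k) y))) <= N (cr ((\<Phi> ^^ k) x) ((\<Phi> ^^ k) y))"
   by (intro cr_\<Phi>) (simp_all add: vn_\<Phi>_iter that)
  then show ?case using Suc by simp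
 qed simp
 have transfer: "padic_null p (%n. cr ((\<Phi> ^^ k) (y n)) (y n))"
  if x: "!!n. vn (x n) = 1" and y: "!!n. vn (y n) = 1" and xy: "padic_null p (%n. cr (x n) (y n))"
   and null: "padic_null p (%n. cr ((\<Phi> ^^ k) (x n)) (x n))" for x y :: "nat => rat \<times> rat" and k
 proof (rule null_max[OF xy null])
  fix n
  have "N (cr ((\<Phi> ^^ k) (y n)) (y n)) <= max (N (cr ((\<Phi> ^^ k) (y n)) (x n))) (N (cr (x n) (y n)))"
   by (intro cr_triangle) (simp_all add: vn_\<Phi>_iter x y)
  moreover have "N (cr ((\<Phi> ^^ k) (y n)) (x n)) <= max (N (cr ((\<Phi> ^^ k) (y n)) ((\<Phi> ^^ k) (x n)))) (N (cr ((\<Phi> ^^ k) (x n)) (x n)))"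
   by (intro cr_triangle) (simp_all add: vn_\<Phi>_iter x y)
  moreover have "N (cr ((\<Phi> ^^ k) (y n)) ((\<Phi> ^^ k) (x n))) <= N (cr (x n) (y n))"
   using cr_iter[OF y x, of k n n] by (simp add: cr_commute)
  ultimately show "N (cr ((\<Phi> ^^ k) (y n)) (y n)) <= max (N (cr (x n) (y n))) (N (cr ((\<Phi> ^^ k) (x n)) (x n)))" by linarith
 qed
 have vP: "padic_null p (%n. cr (v n) (can P n))" by (rule null_mono[OF Pv]) (simp add: cr_commute)
 have eq: "Qp_P1_eq p ((rf_act_Qp p f g ^^ k) P) P \<longleftrightarrow> padic_null p (%n. cr ((\<Phi> ^^ k) (v n)) (v n))" for k
  unfolding iterate_eq_iff[OF P]
 proof
  assume "padic_null p (%n. cr ((\<Phi> ^^ k) (can P n)) (can P n))"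
  then show "padic_null p (%n. cr ((\<Phi> ^^ k) (v n)) (v n))" by (rule transfer[OF vn_can v Pv])
 next
  assume "padic_null p (%n. cr ((\<Phi> ^^ k) (v n)) (v n))"
  then show "padic_null p (%n. cr ((\<Phi> ^^ k) (can P n)) (can P n))" by (rule transfer[OF v vn_can vP])
 qed
 have "(\<forall>k. 0 < k & k < 3 --> ~ Q k) \<longleftrightarrow> ~ Q 1 & ~ Q 2" for Q :: "nat => bool"
 proof -
  have "0 < k & k < 3 \<longleftrightarrow> k = 1 \<or> k = 2" for k :: nat by auto
  then show ?thesis by auto
 qed
 then show ?thesis unfolding periodic_pt_def eq by simp
qed

text \<open>A single late index is enough: the point is at distance at least \<eta> from its image
  while the orbit closes up to less than \<eta>^2. The ratio w is formed before reduction, since x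
  and y may agree modulo p; then w, x and y are replaced by integers modulo p.\<close>

lemma jroots_of_periodic:
 assumes tme: "t = of_int m / of_int e" and e: "e ~= 0"
  and P: "Qp_P1 p P" "periodic_pt (Qp_P1_eq p) (rf_act_Qp p f g) 3 P"
 shows "jroots (kap m e) p ~= {}"
proof -
 have cc: "padic_null p (%n. cr (can P n) (can P n))" by (simp add: cr_def)
 have c3: "padic_null p (%n. cr ((\<Phi> ^^ 3) (can P n)) (can P n))" and c1: "~ padic_null p (%n. cr (\<Phi> (can P n)) (can P n))"
  using P(2) unfolding three_periodic_iff[OF P(1) vn_can cc] by auto
 obtain h where h: "h > 0" "!!M. \<exists>n\<ge>M. ~ N (cr (\<Phi> (can P n)) (can P n)) < h" using c1 unfolding padic_null_def by blast
 define \<eta> where "\<eta> = min h 1"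
 have \<eta>: "\<eta> > 0" "\<eta> <= h" "\<eta> * \<eta> <= 1" using h(1) mult_mono[of \<eta> 1 \<eta> 1] by (simp_all add: \<eta>_def)
 obtain M where M: "!!n. n >= M ==> N (cr ((\<Phi> ^^ 3) (can P n)) (can P n)) < \<eta> * \<eta>"
  using c3 \<eta>(1) unfolding padic_null_def by (metis mult_pos_pos)
 obtain n where n: "n >= M" "~ N (cr (\<Phi> (can P n)) (can P n)) < h" using h(2) by blast
 define v where "v = can P n"
 have v: "vn v = 1" by (simp add: v_def)
 have v3: "N (cr ((\<Phi> ^^ 3) v) v) < \<eta> * \<eta>" and v1: "N (cr (\<Phi> v) v) >= \<eta>" using M[OF n(1)] n(2) \<eta>(2) by (simp_all add: v_def)
 have "N (cr ((\<Phi> ^^ 3) v) v) < 1" using v3 \<eta>(3) by linarith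
 note u = orbit_units[OF v this]
 define X where "X k = fst (T ((\<Phi> ^^ k) v)) / snd (T ((\<Phi> ^^ k) v))" for k
 have NX: "N (X k) = 1" if "k <= 3" for k using u[OF that] by (simp add: X_def N_divide)
 have step: "X (Suc k) * (X k * X k + X k) = t" if "k < 3" for k
  using affine_step[of "(\<Phi> ^^ k) v"] u[of k] u[of "Suc k"] that by (simp add: X_def)
 have dX: "N (X k - X 0) = N (cr ((\<Phi> ^^ k) v) v)" if "k <= 3" for k
  using quotient_diff[of "snd (T ((\<Phi> ^^ k) v))" "snd (T v)" "fst (T ((\<Phi> ^^ k) v))" "fst (T v)"] u[OF that] u[of 0] cr_T[of "(\<Phi> ^^ k) v" v]
  by (simp add: X_def)
 define x y where "x = X 0" and "y = X (Suc 0)"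
 have s2: "X 3 = X (Suc (Suc (Suc 0)))" by (simp add: numeral_3_eq_3)
 have xy: "N x = 1" "N y = 1" "y * (x * x + x) = t" using NX step[of 0] by (simp_all add: x_def y_def)
 obtain w where w: "N w <= 1" "N (w * w + w + 1) < 1" "N (w * x - (y + 1)) < 1"
 proof (rule approximate_three_cycle)
  show "N x = 1" "N y = 1" "N (X (Suc (Suc 0))) = 1" "N (X 3) = 1" using NX by (simp_all add: x_def y_def)
  show "y * (x * x + x) = t" "X (Suc (Suc 0)) * (y * y + y) = t" "X 3 * (X (Suc (Suc 0)) * X (Suc (Suc 0)) + X (Suc (Suc 0))) = t"
   unfolding s2 x_def y_def by (rule step, simp)+
  show "\<eta> > 0" "N (y - x) >= \<eta>" "N (X 3 - x) < \<eta> * \<eta>"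
   using \<eta>(1) v1 v3 dX[of "Suc 0"] dX[of 3] by (simp_all add: x_def y_def)
 qed
 have xy1: "N x <= 1" "N y <= 1" using xy by simp_all
 obtain w' where w': "N (w - of_int w') < 1" using integral_approx[OF w(1)] by blast
 obtain x' where x': "N (x - of_int x') < 1" using integral_approx[OF xy1(1)] by blast
 obtain y' where y': "N (y - of_int y') < 1" using integral_approx[OF xy1(2)] by blast
 have "of_int (w' * w' + w' + 1) = (w * w + w + 1) - (w - of_int w') * (w + of_int w' + 1)" by (simp add: algebra_simps)
 also have "N ... < 1" by (rule N_diff_less[OF w(2) N_mult_less'[OF w']]) (use w(1) in \<open>auto intro!: N_add_le N_of_int_le\<close>)
 finally have 1: "int p dvd w' * w' + w' + 1" unfolding N_of_int_less_1_iff .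
 have "of_int (w' * x' - (y' + 1)) = (w * x - (y + 1)) - w * (x - of_int x') - of_int x' * (w - of_int w') + (y - of_int y')" by (simp add: algebra_simps)
 also have "N ... < 1" by (rule N_add_less[OF N_diff_less[OF N_diff_less[OF w(3) N_mult_less[OF w(1) x']] N_mult_less[OF N_of_int_le w']] y'])
 finally have 2: "int p dvd w' * x' - (y' + 1)" unfolding N_of_int_less_1_iff .
 have mt: "of_int m = of_int e * (y * (x * x + x))" using tme e xy(3) by simp
 have "of_int (e * (y' * (x' * x' + x')) - m) = - (of_int e * ((y - of_int y') * (x * x + x) + of_int y' * ((x - of_int x') * (x + of_int x' + 1))))"
  unfolding of_int_diff mt by (simp add: algebra_simps)
 also have "N ... < 1"
 proof -
  have 1: "N (x * x + x) <= 1" using xy1 by (intro N_add_le N_mult_le)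
  have 2: "N (x + of_int x' + 1) <= 1" using xy1 by (auto intro!: N_add_le N_of_int_le)
  show ?thesis unfolding N_uminus
   by (rule N_mult_less[OF N_of_int_le N_add_less[OF N_mult_less'[OF y' 1] N_mult_less[OF N_of_int_le N_mult_less'[OF x' 2]]]])
 qed
 finally have 3: "int p dvd e * (y' * (x' * x' + x')) - m" unfolding N_of_int_less_1_iff .
 show ?thesis by (rule jroots_nonemptyI[OF prime_p 1 cube_root_of_cycle_mod[OF 1 2 3]])
qed

text \<open>The inverse construction: x is read off from the lifted cube root, and the cycle is x, s
  x, s (s x) with s u = w u - 1, where s has order 3 up to multiples of w^2 + w + 1. All equations
  hold up to \<open>eps n\<close>, which tends to 0.\<close>

lemma periodic_of_jroots:
 assumes p3: "p ~= 3" and tme: "t = of_int m / of_int e" and pe: "~ int p dvd e" and k: "~ int p dvd enorm (kap m e)"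
  and j: "jroots (kap m e) p ~= {}"
 shows "\<exists>P. Qp_P1 p P & periodic_pt (Qp_P1_eq p) (rf_act_Qp p f g) 3 P"
proof -
 obtain ws rs where ws: "!!n. int p ^ Suc n dvd ws n * ws n + ws n + 1" and rs: "!!n. int p ^ Suc n dvd rs n ^ 3 - ev (ws n) (kap m e)"
  and cw: "!!n. [ws (Suc n) = ws n] (mod int p ^ Suc n)" and cr': "!!n. [rs (Suc n) = rs n] (mod int p ^ Suc n)"
  using hensel_cube_roots[OF prime_p p3 k j] by metis
 define E where "E = (of_int e :: rat)"
 have NE: "N E = 1" unfolding E_def by (rule N_of_int_eq_1[OF pe])
 then have E0: "E ~= 0" by auto
 have N3: "N 3 = 1" using N_of_int_eq_1[OF prime_not_dvd_3[OF prime_p p3]] by simp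
 define w where "w n = (of_int (ws n) :: rat)" for n
 define R where "R n = (of_int (rs n) :: rat)" for n
 define W where "W n = w n * w n + w n + 1" for n
 \<comment> \<open>The solution of R = E (3 x + 2 + w), which is the completed cube with -w^2
   replaced by 1 + w.\<close>
 define x where "x n = (1 / 3) * ((1 / E) * R n + - 1 * w n + - 2)" for n
 define s where "s n u = w n * u - 1" for n u
 define eps where "eps n = (1 / real p) ^ Suc n" for n
 \<comment> \<open>The adjugate of T applied to (u, 1): coordinates of the point whose image under T
   is u, up to the unit determinant.\<close>
 define A where "A u = (d * u + - b, (- c) * u + a)" for u
 have eps: "eps n < 1" for n
 proof -
  have "(1 / real p) ^ Suc n <= (1 / real p) ^ 1" using p_gt_1 by (intro power_decreasing) auto
  also have "... < 1" using p_gt_1 by simp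
  finally show ?thesis by (simp add: eps_def)
 qed
 have Nw: "N (w n) <= 1" and NR: "N (R n) <= 1" for n unfolding w_def R_def by (rule N_of_int_le)+
 have NW: "N (W n) <= eps n" for n
  using N_of_int_power_dvd[OF ws[of n]] by (simp add: W_def w_def eps_def)
 have Nx: "N (x n) <= 1" for n
 proof -
  have "N ((1 / E) * R n + - 1 * w n + - 2) <= 1" using NE Nw[of n] NR[of n] by (intro N_add_le) (simp_all add: N_mult N_divide)
  then show ?thesis unfolding x_def using N3 by (simp add: N_mult N_divide)
 qed
 have Ns: "N (s n u) <= 1" if "N u <= 1" for n u unfolding s_def using Nw[of n] that by (intro N_int) auto
 have wW: "w n * (1 + w n) = W n + - 1" "(w n - 1) * (w n + 2) = W n + - 3" for n by (simp_all add: W_def algebra_simps)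
 have unit_prod: "N u = 1" if "N (u * u') = 1" "N u <= 1" "N u' <= 1" for u u'
 proof (rule ccontr)
  assume "N u ~= 1"
  then have "N (u * u') < 1" using that by (intro N_mult_less') auto
  then show False using that by simp
 qed
 have unit_add': "N (h + k) = 1" if "N h <= eps n" "N k = 1" for h k n
  using N_unit_add[of k h] that eps[of n] by (simp add: add.commute)
 have N1w: "N (1 + w n) = 1" for n
 proof (rule unit_prod)
  show "N ((1 + w n) * w n) = 1" using unit_add'[OF NW, of "- 1" n] wW(1)[of n] by (simp add: mult.commute)
 qed (use Nw[of n] in \<open>auto intro: N_add_le\<close>)
 have Nw1: "N (w n - 1) = 1" for n
 proof (rule unit_prod)
  show "N ((w n - 1) * (w n + 2)) = 1" unfolding wW using unit_add'[OF NW, of "- 3" n] N3 by simp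
 qed (use Nw[of n] in \<open>auto intro: N_add_le N_diff_le\<close>)
 have NR1: "N (R n) = 1" for n
 proof -
  have pp: "int p dvd int p ^ Suc n" by simp
  have "int p dvd ws n * ws n + ws n + 1" by (rule dvd_trans[OF pp ws])
  then have ne: "~ int p dvd ev (ws n) (kap m e)" using ev_unit k by blast
  have d: "int p dvd rs n ^ 3 - ev (ws n) (kap m e)" by (rule dvd_trans[OF pp rs])
  have "~ int p dvd rs n"
  proof
   assume "int p dvd rs n"
   then have "int p dvd rs n ^ 3" by (simp add: power3_eq_cube)
   then have "int p dvd rs n ^ 3 - (rs n ^ 3 - ev (ws n) (kap m e))" using d by (rule dvd_diff)
   then show False using ne by simp
  qed
  then show ?thesis unfolding R_def by (rule N_of_int_eq_1)
 qed
 have xR: "3 * x n = R n / E - w n - 2" for n by (simp add: x_def)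
 text \<open>The cycle equations for x, s x, s (s x) hold up to multiples of W and of the defect of the cube root.\<close>
 have t1: "N (t - s n (x n) * (x n * x n + x n)) <= eps n" for n
 proof -
  have mE: "of_int m = t * E" using tme E0 by (simp add: E_def)
  have RE: "R n = E * (3 * x n + 2 + w n)" unfolding xR using E0 by (simp add: field_simps)
  have evk: "of_int (rs n ^ 3 - ev (ws n) (kap m e)) = R n ^ 3 - (E * E * (3 * E - 27 * (t * E)) + E * E * (6 * E - 27 * (t * E)) * w n)"
   unfolding mE[symmetric] by (simp add: ev_def kap_sel R_def w_def E_def power2_eq_square)
  \<comment> \<open>The factor in front is a unit, so it suffices to bound the right side. It
    consists of the defect of the cube root and a multiple of w^2 + w + 1, both divisible by p^(n +
    1).\<close>
  have "27 * (E * E * E) * ((1 + w n) * (t - s n (x n) * (x n * x n + x n))) =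
    (R n ^ 3 - (E * E * (3 * E - 27 * (t * E)) + E * E * (6 * E - 27 * (t * E)) * w n))
    - W n * (E * E * E * (27 * (x n * x n * x n) + 27 * (x n * x n) + 9 * x n + w n + 5))"
   unfolding RE s_def W_def by (simp add: ring3)
  also have "N ... <= eps n"
  proof (rule N_diff_le)
   show "N (R n ^ 3 - (E * E * (3 * E - 27 * (t * E)) + E * E * (6 * E - 27 * (t * E)) * w n)) <= eps n"
    unfolding evk[symmetric] eps_def by (rule N_of_int_power_dvd[OF rs])
   have "N E <= 1" using NE by simp
   then show "N (W n * (E * E * E * (27 * (x n * x n * x n) + 27 * (x n * x n) + 9 * x n + w n + 5))) <= eps n"
    using NW[of n] Nx[of n] Nw[of n] by (intro N_mult_le' N_int) auto
  qed
  finally have "N (27 * (E * E * E) * ((1 + w n) * (t - s n (x n) * (x n * x n + x n)))) <= eps n" .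
  moreover have "N 27 = 1"
  proof -
   have "(27 :: rat) = 3 * (3 * 3)" by simp
   then show ?thesis using N3 by (simp only: N_mult)
  qed
  ultimately show ?thesis using NE N1w[of n] by (simp add: N_mult)
 qed
 have t2: "N (t - s n (s n u) * (s n u * s n u + s n u)) <= eps n"
  if "N (t - s n u * (u * u + u)) <= eps n" "N u <= 1" for n u
 proof -
  have "t - s n (s n u) * (s n u * s n u + s n u) = (t - s n u * (u * u + u)) - W n * ((w n - 1) * (u * u + u) * s n u - w n * u * s n u)"
   by (simp add: s_def W_def algebra_simps)
  also have "N ... <= eps n" using that NW[of n] Nw[of n] Ns[OF that(2), of n] by (intro N_diff_le[OF that(1)] N_mult_le' N_int) auto
  finally show ?thesis .
 qed
 have TA: "T (A u) = ((a * d - b * c) * u, a * d - b * c)" for u by (simp add: T_def A_def algebra_simps)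
 have vA: "vn (A u) = 1" if "N u <= 1" for u
  using that unfolding vn_T[symmetric, of "A u"] TA by (simp add: vn_def N_mult unit_T)
 have crA: "N (cr (A u) (A u')) = N (u - u')" for u u'
 proof -
  have "N (cr (A u) (A u')) = N (cr (T (A u)) (T (A u')))" by (simp only: cr_T)
  also have "cr (T (A u)) (T (A u')) = (a * d - b * c) * ((a * d - b * c) * (u - u'))"
   unfolding TA cr_def by (simp add: algebra_simps)
  also have "N ... = N (u - u')" by (simp only: N_mult unit_T mult_1)
  finally show ?thesis .
 qed
 have cr\<Phi>A: "N (cr (\<Phi> (A u)) (A u')) = N (t - u' * (u * u + u))" for u u'
 proof -
  let ?D = "a * d - b * c"
  have "N (cr (\<Phi> (A u)) (A u')) = N (cr (T (\<Phi> (A u))) (T (A u')))" by (simp only: cr_T)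
  also have "cr (T (\<Phi> (A u))) (T (A u')) = l * (?D * (?D * (?D * (t - u' * (u * u + u)))))"
   unfolding T_\<Phi> TA cr_def by (simp add: ring2)
  also have "N ... = N (t - u' * (u * u + u))" by (simp only: N_mult unit_T unit_l mult_1)
  finally show ?thesis .
 qed
 define v where "v n = A (x n)" for n
 have vv: "vn (v n) = 1" for n unfolding v_def by (rule vA[OF Nx])
 have cx: "padic_cauchy p x"
  unfolding x_def[abs_def] R_def w_def by (intro cauchy_add cauchy_mult cauchy_const cauchy_int cw cr')
 obtain P where P: "Qp_P1 p P" and Pv: "padic_null p (%n. cr (can P n) (v n))"
 proof (rule exists_point)
  show "padic_cauchy p (%n. d * x n + - b)" "padic_cauchy p (%n. - c * x n + a)"
   by (intro cauchy_add cauchy_mult cauchy_const cx)+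
 qed (auto simp: v_def A_def intro: that)
 define y z where "y n = s n (x n)" and "z n = s n (s n (x n))" for n
 have Ny: "N (y n) <= 1" and Nz: "N (z n) <= 1" for n unfolding y_def z_def by (intro Ns Nx)+
 have c1: "N (cr (\<Phi> (v n)) (A (y n))) <= eps n" for n unfolding v_def cr\<Phi>A y_def by (rule t1)
 have \<Phi>v: "vn ((\<Phi> ^^ i) (v n)) = 1" for i n by (rule vn_\<Phi>_iter[OF vv])
 have c2: "N (cr ((\<Phi> ^^ 2) (v n)) (A (z n))) <= eps n" for n
 proof -
  have "N (cr (\<Phi> (\<Phi> (v n))) (A (z n))) <= max (N (cr (\<Phi> (\<Phi> (v n))) (\<Phi> (A (y n))))) (N (cr (\<Phi> (A (y n))) (A (z n))))"
   by (intro cr_triangle) (simp_all add: vn_\<Phi> vv vA Ny Nz)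
  moreover have "N (cr (\<Phi> (\<Phi> (v n))) (\<Phi> (A (y n)))) <= N (cr (\<Phi> (v n)) (A (y n)))"
   by (intro cr_\<Phi>) (simp_all add: vn_\<Phi> vv vA Ny)
  moreover have "N (cr (\<Phi> (A (y n))) (A (z n))) <= eps n" unfolding cr\<Phi>A y_def z_def by (rule t2[OF t1 Nx])
  ultimately show ?thesis using c1[of n] by (simp add: numeral_2_eq_2)
 qed
 have c3: "N (cr ((\<Phi> ^^ 3) (v n)) (v n)) <= eps n" for n
 proof -
  have "N (cr (\<Phi> ((\<Phi> ^^ 2) (v n))) (A (s n (z n)))) <= max (N (cr (\<Phi> ((\<Phi> ^^ 2) (v n))) (\<Phi> (A (z n))))) (N (cr (\<Phi> (A (z n))) (A (s n (z n)))))"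
   by (intro cr_triangle) (simp_all add: vn_\<Phi> \<Phi>v vA Nz Ns)
  moreover have "N (cr (\<Phi> ((\<Phi> ^^ 2) (v n))) (\<Phi> (A (z n)))) <= N (cr ((\<Phi> ^^ 2) (v n)) (A (z n)))"
   by (intro cr_\<Phi>) (simp_all add: \<Phi>v vA Nz)
  moreover have "N (cr (\<Phi> (A (z n))) (A (s n (z n)))) <= eps n" unfolding cr\<Phi>A z_def by (intro t2 t1 Nx Ns)
  ultimately have 1: "N (cr ((\<Phi> ^^ 3) (v n)) (A (s n (z n)))) <= eps n" using c2[of n] by (simp add: numeral_3_eq_3 numeral_2_eq_2)
  have "s n (z n) - x n = W n * ((w n - 1) * x n - 1)" by (simp add: z_def s_def W_def algebra_simps)
  also have "N ... <= eps n" using NW[of n] Nw[of n] Nx[of n] by (intro N_mult_le' N_int) auto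
  finally have 2: "N (cr (A (s n (z n))) (v n)) <= eps n" unfolding v_def crA .
  have "N (cr ((\<Phi> ^^ 3) (v n)) (v n)) <= max (N (cr ((\<Phi> ^^ 3) (v n)) (A (s n (z n))))) (N (cr (A (s n (z n))) (v n)))"
   by (intro cr_triangle) (simp_all add: \<Phi>v vv vA Nz Ns)
  then show ?thesis using 1 2 by simp
 qed
 \<comment> \<open>Up to a multiple of W the difference is (w - 1) R / (3 E), a unit. So the three
   points stay distinct modulo p, which excludes the shorter periods.\<close>
 have yx: "N (y n - x n) = 1" for n
 proof -
  have "3 * (y n - x n) = (w n - 1) * (3 * x n) - 3" by (simp add: y_def s_def algebra_simps)
  also have "... = - W n + (w n - 1) * (R n / E)" unfolding xR by (simp add: W_def algebra_simps)
  finally have "N (3 * (y n - x n)) = N (- W n + (w n - 1) * (R n / E))" by simp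
  also have "... = 1" by (rule unit_add'[of _ n]) (use NW[of n] Nw1[of n] NR1[of n] NE in \<open>simp_all add: N_mult N_divide\<close>)
  finally show ?thesis by (simp only: N_mult N3 mult_1)
 qed
 have zx: "N (z n - x n) = 1" for n
 proof -
  have "z n - x n = (1 + w n) * (y n - x n)" by (simp add: z_def y_def s_def algebra_simps)
  then show ?thesis by (simp only: N_mult N1w yx mult_1)
 qed
 have far: "~ padic_null p (%n. cr ((\<Phi> ^^ i) (v n)) (v n))"
  if near: "!!n. N (cr ((\<Phi> ^^ i) (v n)) (A (u n))) <= eps n" and u: "!!n. N (u n) <= 1" "!!n. N (u n - x n) = 1" for i u
 proof
  assume "padic_null p (%n. cr ((\<Phi> ^^ i) (v n)) (v n))"
  then obtain n where n: "N (cr ((\<Phi> ^^ i) (v n)) (v n)) < 1" unfolding padic_null_def by (meson le_refl zero_less_one)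
  have "N (cr (A (u n)) (v n)) <= max (N (cr (A (u n)) ((\<Phi> ^^ i) (v n)))) (N (cr ((\<Phi> ^^ i) (v n)) (v n)))"
   by (intro cr_triangle) (simp_all add: \<Phi>v vv vA u)
  moreover have "N (cr (A (u n)) ((\<Phi> ^^ i) (v n))) < 1" using near[of n] eps[of n] cr_commute by simp
  ultimately have "N (cr (A (u n)) (v n)) < 1" using n by simp
  then show False unfolding v_def crA using u by simp
 qed
 have "padic_null p (%n. cr ((\<Phi> ^^ 3) (v n)) (v n))" by (rule null_power[OF c3[unfolded eps_def]])
 moreover have "~ padic_null p (%n. cr (\<Phi> (v n)) (v n))" using far[of "Suc 0" y, OF _ Ny yx] c1 by simp
 moreover have "~ padic_null p (%n. cr ((\<Phi> ^^ 2) (v n)) (v n))" by (rule far[OF c2 Nz zx])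
 ultimately have "periodic_pt (Qp_P1_eq p) (rf_act_Qp p f g) 3 P"
  unfolding three_periodic_iff[OF P vv Pv] by blast
 then show ?thesis using P by blast
qed

end

lemma finite_nonunit_primes:
 assumes "q ~= 0"
 shows "finite {p. prime p & padic_abs p q ~= 1}"
proof -
 obtain a b where ab: "quotient_of q = (a, b)" by (cases "quotient_of q")
 have b: "b > 0" and q: "q = of_int a / of_int b" using quotient_of_denom_pos[OF ab] quotient_of_div[OF ab] by auto
 have a: "a ~= 0" using assms q by auto
 have pos: "nat \<bar>a * b\<bar> > 0" using a b by simp
 have "{p. prime p & padic_abs p q ~= 1} \<subseteq> {p. p dvd nat \<bar>a * b\<bar>}"
 proof
  fix p assume "p \<in> {p. prime p & padic_abs p q ~= 1}"
  then have p: "prime p" "padic_abs p q ~= 1" by auto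
  interpret padic p by standard (rule p(1))
  have "int p dvd a \<or> int p dvd b"
  proof (rule ccontr)
   assume "~ ?thesis"
   then have "N (of_int a) = 1" "N (of_int b) = 1" using N_of_int_eq_1 by blast+
   then show False using p(2) unfolding q N_divide by simp
  qed
  then have "int p dvd a * b" by auto
  then have "int p dvd \<bar>a * b\<bar>" by simp
  then have "int p dvd int (nat \<bar>a * b\<bar>)" by simp
  then show "p \<in> {p. p dvd nat \<bar>a * b\<bar>}" unfolding of_nat_dvd_iff by simp
 qed
 then show ?thesis using finite_subset finite_divisors_nat[OF pos] by blast
qed

theorem (in quad_map) density_three_periodic:
 assumes nf: "normal_form f g a b c d l t"
 shows "\<exists>\<delta>>0.72. has_dirichlet_density {p. prime p & ~ (\<exists>P. Qp_P1 p P & periodic_pt (Qp_P1_eq p) (rf_act_Qp p f g) 3 P)} \<delta>"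
proof -
 have det: "a * d - b * c ~= 0" and l0: "l ~= 0" and t0: "t ~= 0" using nf by (simp_all add: normal_form_def)
 obtain m e where me: "quotient_of t = (m, e)" by (cases "quotient_of t")
 have e0: "e > 0" and tme: "t = of_int m / of_int e" using quotient_of_denom_pos[OF me] quotient_of_div[OF me] by auto
 have m0: "m ~= 0" using t0 tme by auto
 have e1: "e ~= 0" using e0 by simp
 have nc: "x ^ 3 ~= kap m e * y ^ 3" if "y ~= 0" for x y using kap_not_cube[OF m0 e1 that] by blast
 have k0: "kap m e ~= 0" using nc[of 1 0] by auto
 \<comment> \<open>All rational data attached to the map. Outside finitely many primes each is 0 or
   a unit, which is good reduction together with the unit conditions on the denominator of t and the
   norm of the Kummer generator.\<close>
 define C where "C = {a, b, c, d, a * d - b * c, l, t, of_int e, of_int (enorm (kap m e)), cf f 0, cf f 1,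
   cf f 2, cf g 0, cf g 1, cf g 2} - {0}"
 define F where "F = insert 3 (\<Union>q\<in>C. {p. prime p & padic_abs p q ~= 1})"
 have "finite F" unfolding F_def C_def by (intro finite.insertI finite_UN_I finite_nonunit_primes) auto
 show ?thesis
 proof (rule density_without_cube_root[OF nc \<open>finite F\<close>])
  fix p assume p: "prime p" and pF: "p \<notin> F"
  have p3: "p ~= 3" using pF by (simp add: F_def)
  have u: "padic_abs p q = 1" if "q \<in> C" for q using pF p that by (auto simp: F_def)
  interpret padic p by standard (rule p)
  have le: "N q <= 1" if "q \<in> insert 0 C" for q using u that by auto
  have cf: "cf h i \<in> {0, cf h 0, cf h 1, cf h 2}" if "degree h <= 2" for h :: "rat poly" and i
  proof (cases "i <= 2")
   case True
   then have "i = 0 \<or> i = 1 \<or> i = 2" by auto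
   then show ?thesis by auto
  next
   case False
   then show ?thesis using that by (simp add: coeff_eq_0)
  qed
  interpret good_prime f g p a b c d l t
  proof
   show "normal_form f g a b c d l t" by (rule nf)
   show "N (cf f i) <= 1" "N (cf g i) <= 1" for i
    using cf[OF degs(1), of i] cf[OF degs(2), of i] by (auto intro!: le simp: C_def)
   show "N a <= 1" "N b <= 1" "N c <= 1" "N d <= 1" by (auto intro!: le simp: C_def)
   show "N (a * d - b * c) = 1" "N l = 1" "N t = 1" using det l0 t0 by (auto intro!: u simp: C_def)
  qed
  have "N (of_int e) = 1" using e1 by (intro u) (simp add: C_def)
  then have pe: "~ int p dvd e" using N_of_int_less_1_iff[of e] by simp
  have "N (of_int (enorm (kap m e))) = 1" using k0 by (intro u) (simp add: C_def)
  then have pk: "~ int p dvd enorm (kap m e)" using N_of_int_less_1_iff[of "enorm (kap m e)"] by simp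
  show "p \<in> {p. prime p & ~ (\<exists>P. Qp_P1 p P & periodic_pt (Qp_P1_eq p) (rf_act_Qp p f g) 3 P)} \<longleftrightarrow> jroots (kap m e) p = {}"
   using p jroots_of_periodic[OF tme e1] periodic_of_jroots[OF p3 tme pe pk] by blast
 qed
qed

theorem theorem1p3:
  fixes f g :: "rat poly"
  assumes phi: "is_rat_fun f g"
    and deg2: "rat_fun_deg f g = 2"
    and crit2: "\<exists>P. alg_point P \<and> critical_pt f g P \<and> periodic_pt (=) (rf_act f g) 2 P"
    and aut: "trivial_Aut f g"
  shows "(\<forall>P. alg_point P \<and> periodic_pt (=) (rf_act f g) 3 P \<longrightarrow> field_of_def_degree P = 6)
       \<and> (\<exists>\<delta>. \<delta> > 0.72 \<and> has_dirichlet_density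
              {p. prime p \<and> \<not> (\<exists>P. Qp_P1 p P \<and> periodic_pt (Qp_P1_eq p) (rf_act_Qp p f g) 3 P)} \<delta>)"
proof -
  interpret quad_map f g by standard (use phi deg2 in auto)
  obtain a b c d l t where nf: "normal_form f g a b c d l t" using normal_form_exists[OF crit2 aut] by blast
  show ?thesis using degree_three_periodic[OF nf] density_three_periodic[OF nf] by blast
qed

end
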